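(* Let $I\subseteq\mathbb{R}$ be an open interval and let $P_a(t)(Z)=Z^n+\sum_{j=1}^n a_j(t)Z^{n-j}$, $t\in I$, be a $C^{p-1,1}$-curve of hyperbolic polynomials of degree $n$, where $p$ is the maximal multiplicity of the roots of $P_a$. Then any continuous root of $P_a$ is locally Lipschitz on $I$. Moreover, if $p=n$, then for any pair of open intervals $I_0\Subset I_1\Subset I$ and any continuous root $\lambda$ of $P_a$, $$\operatorname{Lip}_{I_0}(\lambda)\le C(n,I_0,I_1)\,\max_{1\le i\le n}\|a_i\|^{1/i}_{C^{n-1,1}(\overline I_1)}\le \tilde C(n,I_0,I_1)\,\Big(1+\max_{1\le i\le n}\|a_i\|_{C^{n-1,1}(\overline I_1)}\Big),$$ where $C(n,I_0,I_1)$ and $\tilde C(n,I_0,I_1)$ depend only on $n$, $I_0$, $I_1$. More precisely (case $p=n\ge 2$), any continuous root $\lambda$ of the Tschirnhausen form $P_{\tilde a}$ satisfies $$\operatorname{Lip}_{I_0}(\lambda)\le C(n)\max\Big\{\delta^{-1}\|\tilde a_2\|^{1/2}_{L^\infty(I_1)},\ (\operatorname{Lip}_{I_1}(\tilde a_2'))^{1/2},\ \max_{2\le i\le n}\big(M_i\|\tilde a_2\|_{L^\infty(I_1)}^{(n-i)/2}\big)^{1/n}\Big\},$$ where $M_i=\operatorname{Lip}_{I_1}(\tilde a_i^{(n-1)})$ and $C(n)$ depends only on $n$. If $2\le p<n$, then for any pair of open intervals $I_0\Subset I_1\Subset I$ and any continuous root $\lambda$ of the Tschirnhausen form $P_{\tilde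 a}$, $$\operatorname{Lip}_{I_0}(\lambda)\le C(n)\,\alpha_{I_1}^{\frac{n-p}{p}}\max\Big\{\delta^{-1}\|\tilde a_2\|^{1/2}_{L^\infty(I_1)},\ (\operatorname{Lip}_{I_1}(\tilde a_2'))^{1/2},\ \max_{2\le i\le p}\big(M_i\|\tilde a_2\|_{L^\infty(I_1)}^{(p-i)/2}\big)^{1/p},\ \max_{p<i\le n}\big(M_i\,m_2^{(p-i)/2}\big)^{1/p}\Big\}$$ $$\le C(n,I_0,I_1)\,\alpha_{I_1}^{\frac{n-p}{p}}\,\big(1+m_2^{\frac{p-n}{2p}}\big)\Big(1+\max_{2\le i\le n}\|\tilde a_i\|_{C^{p-1,1}(\overline I_1)}\Big),$$ where now $M_i=\operatorname{Lip}_{I_1}(\tilde a_i^{(p-1)})$, $m_2=\min_{t\in\overline I_0}|\tilde a_2(t)|$, $C(n)$ depends only on $n$, and $C(n,I_0,I_1)$ depends only on $n,I_0,I_1$.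
   Context: A monic real polynomial is hyperbolic if all its roots are real. $P_a(t)$, $t\in I$, is a $C^{p-1,1}$-curve of hyperbolic polynomials if $a_1,\dots,a_n\in C^{p-1,1}(I,\mathbb{R})$ and $P_a(t)$ is hyperbolic for each $t\in I$. The maximal multiplicity of the roots of $P_a$ is the maximum over $t\in I$ of the multiplicities of the roots of $P_a(t)$. A continuous root of $P_a$ is a continuous function $\lambda:I\to\mathbb{R}$ with $P_a(t)(\lambda(t))=0$ for all $t\in I$. $C^{p-1,1}(I)$ is the space of $f\in C^{p-1}(I)$ whose derivative $f^{(p-1)}$ is locally Lipschitz. $\operatorname{Lip}_K(f)=\sup_{x,y\in K,\,x\neq y}|f(x)-f(y)|/|x-y|$, and $\|f\|_{C^{p-1,1}(K)}=\|f\|_{C^{p-1}(K)}+\operatorname{Lip}_K(f^{(p-1)})$. $V\Subset W$ means that the closure $\overline V$ is compact and contained in $W$. The Tschirnhausen form of $P_a$ is $P_{\tilde a}(t)(Z)=P_a(t)\big(Z-\tfrac{a_1(t)}{n}\big)=Z^n+\sum_{j=2}^n\tilde a_j(t)Z^{n-j}$; its roots are those of $P_a(t)$ shifted by $a_1(t)/n$. $\delta$ denotes the distance between the endpoints of $I_0$ and those of $I_1$. With $\lambda_1(t)\le\cdots\le\lambda_n(t)$ the increasingly ordered roots of $P_{\tilde a}(t)$, and $p<n$, set $$\alpha(t)=\frac{|\lambda_n(t)-\lambda_1(t)|}{\min_{i=1,\dots,n-p}|\lambda_{i+p}(t)-\lambda_i(t)|},\qquad \alpha_{I_1}=\sup_{t\in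 I_1}\alpha(t).$$ *)

theory Defs
  imports "HOL-Analysis.Analysis" "HOL-Computational_Algebra.Computational_Algebra"
begin

subsection \<open>Intervals\<close>

text \<open>Open intervals may be unbounded; they are nonempty.\<close>

definition open_interval :: "real set \<Rightarrow> bool" where
  "open_interval J \<longleftrightarrow> open J \<and> is_interval J \<and> J \<noteq> {}"

definition compactly_contained :: "real set \<Rightarrow> real set \<Rightarrow> bool"  (infix "\<Subset>" 50) where
  "V \<Subset> W \<longleftrightarrow> compact (closure V) \<and> closure V \<subseteq> W"

text \<open>Only meaningful for bounded intervals, as \<open>Inf\<close> and \<open>Sup\<close> are real-valued.\<close>

definition endpoint_dist :: "real set \<Rightarrow> real set \<Rightarrow> real" where
  "endpoint_dist J K = setdist {Inf J, Sup J} {Inf K, Sup K}"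


subsection \<open>The spaces \<open>C\<^sup>m\<^sup>,\<^sup>1\<close>\<close>

text \<open>The library's \<open>local_lipschitz\<close> is about families of functions indexed by a parameter;
  here the family is constant.\<close>

definition locally_lipschitz_on :: "real set \<Rightarrow> (real \<Rightarrow> real) \<Rightarrow> bool" where
  "locally_lipschitz_on X f \<longleftrightarrow> local_lipschitz {0::real} X (\<lambda>_. f)"

text \<open>The \<open>k\<close>-th derivative is \<open>(deriv ^^ k) f\<close>. As \<open>deriv\<close> at a point depends only on the germ
  of \<open>f\<close> there, values of \<open>f\<close> outside an open set \<open>J\<close> do not matter on \<open>J\<close>.\<close>

definition CLip_on :: "nat \<Rightarrow> real set \<Rightarrow> (real \<Rightarrow> real) \<Rightarrow> bool" where
  "CLip_on m J f \<longleftrightarrow>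
     (\<forall>k<m. \<forall>x\<in>J. (deriv ^^ k) f field_differentiable at x) \<and>
     continuous_on J ((deriv ^^ m) f) \<and>
     locally_lipschitz_on J ((deriv ^^ m) f)"

text \<open>The following suprema are real-valued, hence unspecified when the set is unbounded above.\<close>

definition Lip :: "real set \<Rightarrow> (real \<Rightarrow> real) \<Rightarrow> real" where
  "Lip K f = (SUP (x, y)\<in>{(x, y). x \<in> K \<and> y \<in> K \<and> x \<noteq> y}. \<bar>f x - f y\<bar> / \<bar>x - y\<bar>)"

text \<open>For continuous \<open>f\<close> and open \<open>K\<close> this is the \<open>L\<^sup>\<infinity>\<close> norm.\<close>

definition sup_norm :: "real set \<Rightarrow> (real \<Rightarrow> real) \<Rightarrow> real" where
  "sup_norm K f = (SUP x\<in>K. \<bar>f x\<bar>)"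

definition C_norm :: "nat \<Rightarrow> real set \<Rightarrow> (real \<Rightarrow> real) \<Rightarrow> real" where
  "C_norm m K f = (MAX k\<in>{..m}. sup_norm K ((deriv ^^ k) f))"

definition CLip_norm :: "nat \<Rightarrow> real set \<Rightarrow> (real \<Rightarrow> real) \<Rightarrow> real" where
  "CLip_norm m K f = C_norm m K f + Lip K ((deriv ^^ m) f)"


subsection \<open>Curves of hyperbolic polynomials\<close>

definition hyperbolic :: "real poly \<Rightarrow> bool" where
  "hyperbolic q \<longleftrightarrow> lead_coeff q = 1 \<and>
     (\<forall>z::complex. poly (map_poly complex_of_real q) z = 0 \<longrightarrow> z \<in> \<real>)"

text \<open>Coefficient functions are indexed from \<open>1\<close> to \<open>n\<close>; other indices are ignored.\<close>

definition poly_curve :: "nat \<Rightarrow> (nat \<Rightarrow> real \<Rightarrow> real) \<Rightarrow> real \<Rightarrow> real poly" where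
  "poly_curve n a t = monom 1 n + (\<Sum>j=1..n. monom (a j t) (n - j))"

definition hyperbolic_curve :: "nat \<Rightarrow> nat \<Rightarrow> real set \<Rightarrow> (nat \<Rightarrow> real \<Rightarrow> real) \<Rightarrow> bool" where
  "hyperbolic_curve m n J a \<longleftrightarrow>
     (\<forall>j\<in>{1..n}. CLip_on m J (a j)) \<and> (\<forall>t\<in>J. hyperbolic (poly_curve n a t))"

definition max_multiplicity :: "real set \<Rightarrow> (real \<Rightarrow> real poly) \<Rightarrow> nat" where
  "max_multiplicity J Q = Max {order x (Q t) | t x. t \<in> J \<and> poly (Q t) x = 0}"

definition continuous_root :: "real set \<Rightarrow> (real \<Rightarrow> real poly) \<Rightarrow> (real \<Rightarrow> real) \<Rightarrow> bool" where
  "continuous_root J Q lam \<longleftrightarrow> continuous_on J lam \<and> (\<forall>t\<in>J. poly (Q t) (lam t) = 0)"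

definition tschirnhausen :: "nat \<Rightarrow> (nat \<Rightarrow> real \<Rightarrow> real) \<Rightarrow> real \<Rightarrow> real poly" where
  "tschirnhausen n a t = pcompose (poly_curve n a t) [:- (a 1 t / real n), 1:]"

definition tcoeff :: "nat \<Rightarrow> (nat \<Rightarrow> real \<Rightarrow> real) \<Rightarrow> nat \<Rightarrow> real \<Rightarrow> real" where
  "tcoeff n a j t = coeff (tschirnhausen n a t) (n - j)"

text \<open>The \<open>i\<close>-th root, \<open>i = 1, 2, \<dots>\<close>, in increasing order and counted with multiplicity.\<close>

definition ordered_root :: "real poly \<Rightarrow> nat \<Rightarrow> real" where
  "ordered_root q i = sorted_list_of_multiset (proots q) ! (i - 1)"

definition alpha :: "nat \<Rightarrow> nat \<Rightarrow> (nat \<Rightarrow> real \<Rightarrow> real) \<Rightarrow> real \<Rightarrow> real" where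
  "alpha n p a t =
     (let lam = ordered_root (tschirnhausen n a t)
      in \<bar>lam n - lam 1\<bar> / (MIN i\<in>{1..n - p}. \<bar>lam (i + p) - lam i\<bar>))"

definition alpha_sup :: "nat \<Rightarrow> nat \<Rightarrow> (nat \<Rightarrow> real \<Rightarrow> real) \<Rightarrow> real set \<Rightarrow> real" where
  "alpha_sup n p a J = (SUP t\<in>J. alpha n p a t)"


subsection \<open>The bounds for the roots of the Tschirnhausen form\<close>

text \<open>The bounds with the constant stripped off. Powers with exponent \<open>(n - i) / 2\<close> or
  \<open>(p - i) / 2\<close> that is nonnegative are written \<open>sqrt _ ^ (n - i)\<close> and \<open>sqrt _ ^ (p - i)\<close>, so that
  \<open>0\<close> to the power \<open>0\<close> is \<open>1\<close> (for \<open>powr\<close> it is \<open>0\<close>). The number \<open>m\<^sub>2\<close> is positive when \<open>p < n\<close> is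
  the maximal multiplicity, because \<open>tcoeff n a 2 t = 0\<close> forces a root of multiplicity \<open>n\<close>.\<close>

definition bound_full :: "nat \<Rightarrow> (nat \<Rightarrow> real \<Rightarrow> real) \<Rightarrow> real set \<Rightarrow> real set \<Rightarrow> real" where
  "bound_full n a I0 I1 =
     (let b = tcoeff n a;
          A = sup_norm I1 (b 2);
          M = (\<lambda>i. Lip I1 ((deriv ^^ (n - 1)) (b i)))
      in Max {sqrt A / endpoint_dist I0 I1,
              sqrt (Lip I1 (deriv (b 2))),
              MAX i\<in>{2..n}. root n (M i * sqrt A ^ (n - i))})"

definition m2 :: "nat \<Rightarrow> (nat \<Rightarrow> real \<Rightarrow> real) \<Rightarrow> real set \<Rightarrow> real" where
  "m2 n a I0 = (INF t\<in>closure I0. \<bar>tcoeff n a 2 t\<bar>)"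

definition bound_partial :: "nat \<Rightarrow> nat \<Rightarrow> (nat \<Rightarrow> real \<Rightarrow> real) \<Rightarrow> real set \<Rightarrow> real set \<Rightarrow> real" where
  "bound_partial n p a I0 I1 =
     (let b = tcoeff n a;
          A = sup_norm I1 (b 2);
          M = (\<lambda>i. Lip I1 ((deriv ^^ (p - 1)) (b i)))
      in Max {sqrt A / endpoint_dist I0 I1,
              sqrt (Lip I1 (deriv (b 2))),
              MAX i\<in>{2..p}. root p (M i * sqrt A ^ (p - i)),
              MAX i\<in>{p<..n}. root p (M i * m2 n a I0 powr ((real p - real i) / 2))})"

end

(*
Fix a base point t0 and a root z0 of P(t0), and expand P(t)(z0 + Z) = sum_j h_j(t) Z^j. Sort the
distances of z0 to the roots of P(t0) as 0 = x_0 <= x_1 <= ..., and let N(r) be the product of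
the numbers max(r, x_i). For a speed c that is large compared with the data we show, by
descending through the scales r, that |h_j(t)| r^j <= C N(r) for |t - t0| <= r / (C c).

For the largest scale this is the trivial bound for the roots. If it holds at R = x_d, and the d
nearest roots have distance at most r << R, then interpolation bounds the first derivative and
the Lipschitz constant of the derivative of every h_j at scale R. This settles h_(d-1) at scale
r. By comparing coefficients in P(z0 + Z) P(z0 - Z) the number h_(d-1)^2 - 2 h_d h_(d-2) is
nonnegative and controls all h_j with j < d, because all roots are real. Nonnegativity gives a
one-sided bound for h_(d-2), which Glaeser's argument turns into a two-sided one, and hence the
bound for all h_j at scale r. No factorization of P is needed.

As r tends to 0 this gives |lam(t) - lam(t0)| <= C c |t - t0| near t0 for a continuous root, and
therefore the Lipschitz bound.
*)

theory Submission
  imports Defs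
begin

subsection \<open>Coefficients of polynomials with real roots\<close>

text \<open>The maximal multiplicity p enters through N(r). If p + 1 consecutive roots always span
  at least \<gamma>, at most p roots are closer than \<gamma>/2 to z0, so N(r) is at least r^p
  (\<gamma>/2)^(n-p). A Taylor remainder of order r^p, coming from p - 1 derivatives with Lipschitz
  top derivative, is then controlled by c^p N(r) at all scales at once. Since c^p has to make up for
  n - p factors of the gap, the ratio of spread and gap appears with the exponent (n-p)/p. The
  constants must not depend on the curve. Hence each step is normalised: time in units of R/c, roots
  in units of R, coefficients divided by N(R); and every auxiliary estimate fixes its constant
  before the functions are named. At most n descents occur, so the constants are multiplied
  boundedly often. The estimate at t0 holds on a neighbourhood of uncontrolled size, but with a
  controlled constant, and on an interval this is enough. Two situations are treated directly:
  points where all roots coincide, which offer no root scale to normalise by, and p = 1, where the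
  coefficients have no derivative to interpolate.\<close>

definition lin_prod :: "real list \<Rightarrow> real poly" where
  "lin_prod ys = (\<Prod>y\<leftarrow>ys. [:- y, 1:])"

lemma lin_prod_simps [simp]:
  "lin_prod [] = 1" "lin_prod (y # ys) = [:- y, 1:] * lin_prod ys"
  by (simp_all add: lin_prod_def)

lemma coeff_linear_times:
  fixes q :: "real poly"
  shows "coeff ([:- y, 1:] * q) j = (if j = 0 then 0 else coeff q (j - 1)) - y * coeff q j"
  by (cases j) (auto simp: coeff_pCons)

lemma lin_prod_nonzero [simp]: "lin_prod ys \<noteq> 0"
  by (induction ys) (simp_all del: mult_pCons_left)

lemma degree_lin_prod [simp]: "degree (lin_prod ys) = length ys"
  by (induction ys) (simp_all add: degree_mult_eq del: mult_pCons_left)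

lemma lead_coeff_lin_prod [simp]: "coeff (lin_prod ys) (length ys) = 1"
proof (induction ys)
  case (Cons y ys)
  have "coeff (lin_prod ys) (Suc (length ys)) = 0"
    by (simp add: coeff_eq_0)
  then show ?case using Cons by (simp add: coeff_pCons)
qed auto

lemma coeff_lin_prod_gt: "j > length ys \<Longrightarrow> coeff (lin_prod ys) j = 0"
  by (simp add: coeff_eq_0)

lemma poly_lin_prod: "poly (lin_prod ys) z = (\<Prod>y\<leftarrow>ys. z - y)"
  by (induction ys) (auto simp: algebra_simps)

text \<open>Up to sign the coefficient is an elementary symmetric polynomial of degree
  \<open>length ys - j\<close>. It has at most \<open>2 ^ length ys\<close> terms, and the sorting
  makes the product of the last entries the largest of them.\<close>

lemma coeff_lin_prod_bound:
  assumes "sorted (map abs ys)"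
  shows "\<bar>coeff (lin_prod ys) j\<bar> \<le> 2 ^ length ys * prod_list (map abs (drop j ys))"
  using assms
proof (induction ys arbitrary: j)
  case Nil
  then show ?case by (simp add: coeff_1)
next
  case (Cons y ys)
  have IH: "\<bar>coeff (lin_prod ys) j\<bar> \<le> 2 ^ length ys * prod_list (map abs (drop j ys))" for j
    using Cons by auto
  have nn: "prod_list (map abs (drop j ys)) \<ge> 0" for j :: nat
    by (rule prod_list_nonneg) auto
  \<comment> \<open>The new \<open>y\<close> has the smallest absolute value, so it may be exchanged
    for the entry that \<open>drop j ys\<close> lacks compared with
    \<open>drop (j - 1) ys\<close>.\<close>
  have b: "\<bar>y\<bar> * \<bar>coeff (lin_prod ys) j\<bar> \<le> 2 ^ length ys * prod_list (map abs (drop j (y # ys)))"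
  proof (cases j)
    case 0
    then show ?thesis using IH[of 0] mult_left_mono[OF IH[of 0], of "\<bar>y\<bar>"] by (simp add: algebra_simps)
  next
    case (Suc i)
    show ?thesis
    proof (cases "i < length ys")
      case True
      then have d: "drop i ys = ys ! i # drop j ys"
        using Suc by (simp add: Cons_nth_drop_Suc)
      have le: "\<bar>y\<bar> \<le> \<bar>ys ! i\<bar>"
        using Cons.prems True by auto
      have "\<bar>y\<bar> * \<bar>coeff (lin_prod ys) j\<bar> \<le> \<bar>ys ! i\<bar> * (2 ^ length ys * prod_list (map abs (drop j ys)))"
        using le IH[of j] by (intro mult_mono) auto
      then show ?thesis using Suc d by (simp add: algebra_simps)
    next
      case False
      then have "coeff (lin_prod ys) j = 0"
        using Suc by (simp add: coeff_lin_prod_gt)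
      then show ?thesis using Suc nn by (simp)
    qed
  qed
  have a: "\<bar>if j = 0 then 0 else coeff (lin_prod ys) (j - 1)\<bar>
      \<le> 2 ^ length ys * prod_list (map abs (drop j (y # ys)))"
  proof (cases j)
    case 0
    then show ?thesis using nn[of 0] by simp
  next
    case (Suc i)
    then show ?thesis using IH[of i] by simp
  qed
  have "\<bar>coeff (lin_prod (y # ys)) j\<bar> \<le> \<bar>if j = 0 then 0 else coeff (lin_prod ys) (j - 1)\<bar> + \<bar>y\<bar> * \<bar>coeff (lin_prod ys) j\<bar>"
    unfolding lin_prod_simps coeff_linear_times
    by (metis abs_mult abs_triangle_ineq4)
  also have "\<dots> \<le> 2 ^ length (y # ys) * prod_list (map abs (drop j (y # ys)))"
    using a b by (simp del: drop_Cons')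
  finally show ?case .
qed

lemma coeff_lin_prod_uminus:
  "coeff (lin_prod (map uminus ys)) j = (-1) ^ (length ys + j) * coeff (lin_prod ys) j"
proof (induction ys arbitrary: j)
  case Nil
  then show ?case by (cases j) (auto simp: coeff_1)
next
  case (Cons y ys)
  show ?case
    unfolding list.map lin_prod_simps coeff_linear_times Cons.IH
    by (cases j) (auto simp: algebra_simps)
qed

section \<open>Coefficients of products of the factors Z^2 - y^2\<close>

lemma coeff_even_prod_nonneg:
  fixes ys :: "real list"
  shows "0 \<le> (-1) ^ (length ys + k) * coeff (\<Prod>y\<leftarrow>ys. [:- (y\<^sup>2), 0, 1:]) (2 * k)"
proof (induction ys arbitrary: k)
  case Nil
  then show ?case by (auto simp: coeff_1)
next
  case (Cons y ys)
  have "0 \<le> y\<^sup>2 * ((-1) ^ (length ys + k) * coeff (\<Prod>y\<leftarrow>ys. [:- (y\<^sup>2), 0, 1:]) (2 * k))"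
    by (intro mult_nonneg_nonneg zero_le_power2 Cons.IH)
  then show ?case using Cons.IH[of "k - 1"]
    by (cases k) (auto simp: coeff_pCons algebra_simps)
qed

text \<open>The signed coefficient is an elementary symmetric polynomial in the squares. All its
  terms are nonnegative, so any single one is a lower bound; the one kept consists of the entries
  from \<open>k\<close> on.\<close>

lemma coeff_even_prod_ge:
  fixes ys :: "real list"
  assumes "k \<le> length ys"
  shows "prod_list (map power2 (drop k ys)) \<le>
    (-1) ^ (length ys + k) * coeff (\<Prod>y\<leftarrow>ys. [:- (y\<^sup>2), 0, 1:]) (2 * k)"
  using assms
proof (induction ys arbitrary: k)
  case Nil
  then show ?case by simp
next
  case (Cons y ys)
  let ?q = "\<Prod>y\<leftarrow>ys. [:- (y\<^sup>2), 0, 1:]"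
  show ?case
  proof (cases k)
    case 0
    then show ?thesis using mult_left_mono[OF Cons.IH[of 0], of "y\<^sup>2"]
      by (simp add: algebra_simps)
  next
    case (Suc i)
    have "0 \<le> y\<^sup>2 * ((-1) ^ (length ys + k) * coeff ?q (2 * k))"
      by (intro mult_nonneg_nonneg zero_le_power2 coeff_even_prod_nonneg)
    moreover have "coeff (\<Prod>y\<leftarrow>y # ys. [:- (y\<^sup>2), 0, 1:]) (2 * k) = coeff ?q (2 * i) - y\<^sup>2 * coeff ?q (2 * k)"
      using Suc by (simp add: coeff_pCons)
    ultimately show ?thesis using Cons.IH[of i] Cons.prems Suc
      by (simp add: algebra_simps)
  qed
qed

text \<open>Compares coefficients in \<open>q(Z) q(-Z) = l\<^sup>2 (\<Prod>i. y\<^sub>i\<^sup>2 - Z\<^sup>2)\<close>.\<close>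

lemma coeff_square_identity:
  assumes h: "\<And>j. h j = coeff (smult l (lin_prod ys)) j"
    and "k \<le> length ys"
  shows "l\<^sup>2 * prod_list (map power2 (drop k ys)) \<le> (\<Sum>i\<le>2 * k. (-1) ^ (k + i) * h i * h (2 * k - i))"
proof -
  \<comment> \<open>The second factor is q(-Z) up to the sign (-1)^n, where q is the first
    one.\<close>
  have 1: "lin_prod ys * lin_prod (map uminus ys) = (\<Prod>y\<leftarrow>ys. [:- (y\<^sup>2), 0, 1:])"
  proof (induction ys)
    case (Cons y ys)
    have "[:- y, 1:] * [:y, 1:] = [:- (y\<^sup>2), 0, 1:]" by (simp add: power2_eq_square)
    then show ?case using Cons
      by (simp del: mult_pCons_left mult_pCons_right) (metis (no_types, lifting) mult.assoc mult.left_commute)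
  qed auto
  have "(\<Sum>i\<le>2 * k. (-1) ^ (k + i) * h i * h (2 * k - i))
      = l\<^sup>2 * ((-1) ^ (length ys + k) * (\<Sum>i\<le>2 * k. coeff (lin_prod ys) i * coeff (lin_prod (map uminus ys)) (2 * k - i)))"
    unfolding sum_distrib_left h coeff_lin_prod_uminus
  proof (rule sum.cong)
    fix i assume "i \<in> {..2 * k}"
    then obtain e where e: "2 * k = i + e" using le_Suc_ex by auto
    have "(-1::real) ^ (length ys + k) * (-1) ^ (length ys + e) = (-1) ^ (2 * length ys + (k + e))"
      by (simp flip: power_add add: ac_simps mult_2_right)
    also have "\<dots> = (-1) ^ (k + e)" by (simp add: power_add)
    also have "\<dots> = (-1) ^ (k + i)"
    proof -
      have "even (k + e) \<longleftrightarrow> even (k + i)" using e by presburger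
      then show ?thesis by (simp add: minus_one_power_iff)
    qed
    finally have "(-1::real) ^ (k + i) = (-1) ^ (length ys + k) * (-1) ^ (length ys + e)" ..
    then show "(-1) ^ (k + i) * coeff (smult l (lin_prod ys)) i * coeff (smult l (lin_prod ys)) (2 * k - i) =
         l\<^sup>2 * ((-1) ^ (length ys + k) *
           (coeff (lin_prod ys) i * ((- 1) ^ (length ys + (2 * k - i)) * coeff (lin_prod ys) (2 * k - i))))"
      using e by (simp add: power2_eq_square)
  qed auto
  also have "\<dots> = l\<^sup>2 * ((-1) ^ (length ys + k) * coeff (\<Prod>y\<leftarrow>ys. [:- (y\<^sup>2), 0, 1:]) (2 * k))"
    by (simp add: coeff_mult flip: 1)
  finally show ?thesis
    using coeff_even_prod_ge[OF assms(2)] by (simp add: mult_left_mono)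
qed

section \<open>Small low-order coefficients and clusters of small roots\<close>

lemma prod_list_drop_le:
  fixes ys :: "real list"
  assumes "j \<le> d" "d \<le> length ys" "\<And>i. i < d \<Longrightarrow> \<bar>ys ! i\<bar> \<le> Y"
  shows "prod_list (map abs (drop j ys)) \<le> Y ^ (d - j) * prod_list (map abs (drop d ys))"
  using assms(1)
proof (induction rule: inc_induct)
  case base
  show ?case by simp
next
  case (step j)
  have "0 \<le> Y" using assms(3)[of j] step by (smt (verit) abs_ge_zero)
  have "drop j ys = ys ! j # drop (Suc j) ys"
    using step assms(2) by (simp add: Cons_nth_drop_Suc)
  then have "prod_list (map abs (drop j ys)) = \<bar>ys ! j\<bar> * prod_list (map abs (drop (Suc j) ys))"
    by simp
  also have "\<dots> \<le> Y * (Y ^ (d - Suc j) * prod_list (map abs (drop d ys)))"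
    using step assms(3)[of j] \<open>0 \<le> Y\<close> by (intro mult_mono prod_list_nonneg) auto
  also have "\<dots> = Y ^ (d - j) * prod_list (map abs (drop d ys))"
    using Suc_diff_Suc[OF \<open>j < d\<close>, symmetric] by simp
  finally show ?case .
qed

lemma prod_list_power2_abs:
  fixes ys :: "real list"
  shows "prod_list (map power2 ys) = (prod_list (map abs ys))\<^sup>2"
  by (induction ys) (auto simp: power_mult_distrib)

text \<open>The square identity at index d - 1 is used twice, with G and Y as in the proof. Crude
  estimates of its terms first show that Y is small. Then all terms but the three central ones can
  be absorbed, and the sum of these three is h_(d-1)^2 - 2 h_d h_(d-2). So this number bounds (G
  Y)^2, and G Y in turn bounds all coefficients below d.\<close>

lemma coeff_cluster_bound:
  fixes n d :: nat and C :: real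
  assumes d: "2 \<le> d" "d \<le> n" and C: "C \<ge> 1"
  shows "\<exists>\<eta>>0. \<exists>C'>0. \<forall>l ys h. length ys = n \<and> sorted (map abs ys) \<and>
    (\<forall>j. h j = coeff (smult l (lin_prod ys)) j) \<and> (\<forall>j. \<bar>h j\<bar> \<le> C) \<and> \<bar>h d\<bar> \<ge> 1/2 \<and> (\<forall>j<d. \<bar>h j\<bar> \<le> \<eta>)
    \<longrightarrow> (h (d - 1))\<^sup>2 - 2 * h d * h (d - 2) \<ge> 0 \<and>
       (\<forall>j<d. \<bar>h j\<bar> \<le> C' * sqrt ((h (d - 1))\<^sup>2 - 2 * h d * h (d - 2)) ^ (d - j))"
proof -
  define B :: real where "B = 2 ^ n"
  \<comment> \<open>The first use of the identity gives \<open>Y\<^sup>2 \<le> D * \<eta>\<close>,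
    the second leaves a remainder of at most \<open>D * Y / 2\<close> times G^2 Y^2. For
    \<open>Y \<le> 1 / D\<close> this is at most half of the left-hand side.\<close>
  define D where "D = 8 * real n * C * B\<^sup>2"
  define y0 where "y0 = 1 / D"
  define \<eta> where "\<eta> = y0\<^sup>2 / D"
  have B1: "B \<ge> 1" by (simp add: B_def)
  have D1: "D \<ge> 1"
  proof -
    have "1 * 1 * 1 \<le> (8 * real n) * C * B\<^sup>2"
      using d C B1 by (intro mult_mono) auto
    then show ?thesis by (simp add: D_def)
  qed
  have y0: "0 < y0" "y0 \<le> 1" using D1 by (auto simp: y0_def)
  have \<eta>: "0 < \<eta>" using y0 D1 by (auto simp: \<eta>_def)
  define C' where "C' = B * ((2 * B) ^ n * 2 ^ n)"
  have C': "C' > 0" using B1 by (simp add: C'_def)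
  have main: "(h (d - 1))\<^sup>2 - 2 * h d * h (d - 2) \<ge> 0 \<and>
       (\<forall>j<d. \<bar>h j\<bar> \<le> C' * sqrt ((h (d - 1))\<^sup>2 - 2 * h d * h (d - 2)) ^ (d - j))"
    if H: "length ys = n \<and> sorted (map abs ys) \<and>
    (\<forall>j. h j = coeff (smult l (lin_prod ys)) j) \<and> (\<forall>j. \<bar>h j\<bar> \<le> C) \<and> \<bar>h d\<bar> \<ge> 1/2 \<and> (\<forall>j<d. \<bar>h j\<bar> \<le> \<eta>)"
    for l ys h
  proof -
    \<comment> \<open>G is the size of h_d that the far roots predict, and Y the size of the d
      nearest roots.\<close>
    define G where "G = \<bar>l\<bar> * prod_list (map abs (drop d ys))"
    define Y where "Y = \<bar>ys ! (d - 1)\<bar>"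
    define W where "W = (h (d - 1))\<^sup>2 - 2 * h d * h (d - 2)"
    have len: "length ys = n" and srt: "sorted (map abs ys)"
      and h: "\<And>j. h j = coeff (smult l (lin_prod ys)) j"
      and hC: "\<And>j. \<bar>h j\<bar> \<le> C" and hd: "\<bar>h d\<bar> \<ge> 1/2" and h\<eta>: "\<And>j. j < d \<Longrightarrow> \<bar>h j\<bar> \<le> \<eta>"
      using H by auto
    have Ynn: "Y \<ge> 0" and Gnn: "G \<ge> 0"
      by (auto simp: Y_def G_def intro!: mult_nonneg_nonneg prod_list_nonneg)
    have leY: "\<bar>ys ! i\<bar> \<le> Y" if "i < d" for i
    proof -
      have "map abs ys ! i \<le> map abs ys ! (d - 1)"
        using srt that d len by (intro sorted_nth_mono) auto
      then show ?thesis using that d len by (simp add: Y_def)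
    qed
    have f1: "\<bar>h j\<bar> \<le> B * G * Y ^ (d - j)" if "j \<le> d" for j
    proof -
      have "\<bar>h j\<bar> \<le> \<bar>l\<bar> * (B * prod_list (map abs (drop j ys)))"
        using coeff_lin_prod_bound[OF srt, of j] by (simp add: h abs_mult B_def len mult_left_mono)
      also have "\<dots> \<le> \<bar>l\<bar> * (B * (Y ^ (d - j) * prod_list (map abs (drop d ys))))"
        using that d len leY B1 by (intro mult_left_mono prod_list_drop_le) auto
      finally show ?thesis by (simp add: G_def mult_ac)
    qed
    have BG: "1 \<le> 2 * B * G" using f1[of d] hd by simp
    have f3: "G\<^sup>2 * Y\<^sup>2 \<le> (\<Sum>i\<le>2 * (d - 1). (-1) ^ (d - 1 + i) * h i * h (2 * (d - 1) - i))"
    proof -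
      have "drop (d - 1) ys = ys ! (d - 1) # drop d ys"
        using Cons_nth_drop_Suc[of "d - 1" ys] d len by simp
      then have "G\<^sup>2 * Y\<^sup>2 = l\<^sup>2 * prod_list (map power2 (drop (d - 1) ys))"
        by (simp add: prod_list_power2_abs G_def Y_def power_mult_distrib)
      then show ?thesis
        using coeff_square_identity[of h l ys "d - 1", OF h] d len by simp
    qed
    \<comment> \<open>The two indices of each term add up to 2 (d - 1), so one of them is below d
      and its coefficient is at most \<eta>.\<close>
    have f4: "G\<^sup>2 * Y\<^sup>2 \<le> 2 * real n * C * \<eta>"
    proof -
      have "G\<^sup>2 * Y\<^sup>2 \<le> (\<Sum>i\<le>2 * (d - 1). C * \<eta>)"
      proof (rule order_trans[OF f3 sum_mono])
        fix i assume i: "i \<in> {..2 * (d - 1)}"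
        have "\<bar>h i\<bar> * \<bar>h (2 * (d - 1) - i)\<bar> \<le> C * \<eta>"
        proof (cases "i < d")
          case True
          then have "\<bar>h i\<bar> * \<bar>h (2 * (d - 1) - i)\<bar> \<le> \<eta> * C"
            using h\<eta> hC \<eta> C by (intro mult_mono) auto
          then show ?thesis by (simp add: mult.commute)
        next
          case False
          then show ?thesis using h\<eta>[of "2 * (d - 1) - i"] hC[of i] \<eta> C d
            by (intro mult_mono) auto
        qed
        then have "\<bar>(-1) ^ (d - 1 + i) * h i * h (2 * (d - 1) - i)\<bar> \<le> C * \<eta>"
          by (simp add: abs_mult power_abs)
        then show "(-1) ^ (d - 1 + i) * h i * h (2 * (d - 1) - i) \<le> C * \<eta>" by linarith
      qed
      also have "\<dots> \<le> real (2 * n) * (C * \<eta>)"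
      proof -
        have "2 * (d - 1) + 1 \<le> 2 * n" using d by linarith
        then have "real (2 * (d - 1) + 1) \<le> real (2 * n)" using of_nat_le_iff by blast
        then have "real (2 * (d - 1) + 1) * (C * \<eta>) \<le> real (2 * n) * (C * \<eta>)"
          using C \<eta> by (intro mult_right_mono) auto
        then show ?thesis by simp
      qed
      finally show ?thesis by simp
    qed
    have Y0: "Y \<le> y0"
    proof -
      have "Y\<^sup>2 = 1\<^sup>2 * Y\<^sup>2" by simp
      also have "\<dots> \<le> (2 * B * G)\<^sup>2 * Y\<^sup>2" using BG by (intro mult_right_mono power_mono) auto
      also have "\<dots> = 4 * B\<^sup>2 * (G\<^sup>2 * Y\<^sup>2)" by (simp add: power_mult_distrib)
      also have "\<dots> \<le> 4 * B\<^sup>2 * (2 * real n * C * \<eta>)" using f4 by (intro mult_left_mono) auto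
      also have "\<dots> = D * \<eta>" by (simp add: D_def)
      also have "\<dots> = y0\<^sup>2" using D1 by (simp add: \<eta>_def)
      finally show ?thesis using y0 by (simp add: power2_le_iff_abs_le)
    qed
    \<comment> \<open>Apart from the indices d - 2, d - 1, d every term has a factor of index below
      d - 2, which is of order G Y^3. Only one G occurs there; \<open>1 \<le> 2 * B * G\<close>
      supplies the second.\<close>
    have f5: "G\<^sup>2 * Y\<^sup>2 \<le> W + G\<^sup>2 * Y\<^sup>2 / 2"
    proof -
      define k where "k = d - 2"
      have dk: "d = k + 2" using d by (simp add: k_def)
      let ?c = "\<lambda>i. (-1) ^ (d - 1 + i) * h i * h (2 * (d - 1) - i)"
      let ?S = "{..2 * (d - 1)} - {k, k + 1, k + 2}"
      have "(\<Sum>i\<le>2 * (d - 1). ?c i) = (\<Sum>i\<in>{k, k + 1, k + 2}. ?c i) + (\<Sum>i\<in>?S. ?c i)"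
        by (subst add.commute, rule sum.subset_diff) (auto simp: dk)
      also have "(\<Sum>i\<in>{k, k + 1, k + 2}. ?c i) = W"
        by (simp add: W_def dk power2_eq_square)
      also have "(\<Sum>i\<in>?S. ?c i) \<le> (\<Sum>i\<in>?S. C * (B * G * Y ^ 3))"
      proof (rule sum_mono)
        fix i assume i: "i \<in> ?S"
        have small: "\<bar>h j\<bar> \<le> B * G * Y ^ 3" if "j < k" for j
        proof -
          have "\<bar>h j\<bar> \<le> B * G * Y ^ (d - j)" using f1 that dk by auto
          also have "\<dots> \<le> B * G * Y ^ 3"
            using that dk Ynn Y0 y0 B1 Gnn by (intro mult_left_mono power_decreasing) auto
          finally show ?thesis .
        qed
        have nn: "0 \<le> B * G * Y ^ 3" using B1 Gnn Ynn by simp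
        have "\<bar>h i\<bar> * \<bar>h (2 * (d - 1) - i)\<bar> \<le> C * (B * G * Y ^ 3)"
        proof (cases "i < k")
          case True
          then have "\<bar>h i\<bar> * \<bar>h (2 * (d - 1) - i)\<bar> \<le> (B * G * Y ^ 3) * C"
            using small hC C nn by (intro mult_mono) auto
          then show ?thesis by (simp add: mult.commute)
        next
          case False
          then show ?thesis using i small[of "2 * (d - 1) - i"] hC[of i] C nn dk
            by (intro mult_mono) auto
        qed
        then have "\<bar>?c i\<bar> \<le> C * (B * G * Y ^ 3)"
          by (simp add: abs_mult power_abs)
        then show "?c i \<le> C * (B * G * Y ^ 3)" by linarith
      qed
      also have "\<dots> = real (card ?S) * (C * (B * G * Y ^ 3))" by simp
      also have "\<dots> \<le> real (2 * n) * (C * (B * G * Y ^ 3))"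
      proof -
        have "card ?S \<le> card {..2 * (d - 1)}" by (intro card_mono) auto
        also have "\<dots> \<le> 2 * n" using d by simp
        finally have "real (card ?S) \<le> real (2 * n)" using of_nat_le_iff by blast
        then show ?thesis using C B1 Gnn Ynn by (intro mult_right_mono) auto
      qed
      also have "\<dots> \<le> (2 * B * G) * (real (2 * n) * (C * (B * G * Y ^ 3)))"
        using mult_right_mono[OF BG, of "real (2 * n) * (C * (B * G * Y ^ 3))"] C B1 Gnn Ynn by simp
      also have "\<dots> = (D * Y / 2) * (G\<^sup>2 * Y\<^sup>2)"
        by (simp add: D_def power2_eq_square power3_eq_cube)
      also have "\<dots> \<le> (1 / 2) * (G\<^sup>2 * Y\<^sup>2)"
      proof (rule mult_right_mono)
        have "D * Y \<le> D * y0" using Y0 D1 by (intro mult_left_mono) auto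
        then show "D * Y / 2 \<le> 1 / 2" using D1 by (simp add: y0_def)
      qed auto
      finally show ?thesis using f3 by simp
    qed
    then have f6: "(G * Y)\<^sup>2 \<le> 2 * W" by (simp add: power_mult_distrib)
    then have W: "W \<ge> 0" by (smt (verit) zero_le_power2)
    have f7: "G * Y \<le> 2 * sqrt W"
    proof (rule power2_le_imp_le)
      show "(G * Y)\<^sup>2 \<le> (2 * sqrt W)\<^sup>2" using f6 W by (simp add: power_mult_distrib)
    qed (use W in auto)
    have "\<bar>h j\<bar> \<le> C' * sqrt W ^ (d - j)" if j: "j < d" for j
    proof -
      \<comment> \<open>\<open>f1\<close> has a single factor G, but a power of G Y is wanted; the
        missing factors come again from \<open>1 \<le> 2 * B * G\<close>.\<close>
      obtain e where e: "d - j = Suc e" using j by (metis Suc_diff_Suc)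
      have en: "e \<le> n" "Suc e \<le> n" using e d by auto
      have "\<bar>h j\<bar> \<le> B * (G * Y ^ Suc e)" using f1[of j] j e by (simp add: mult.assoc)
      also have "\<dots> \<le> B * ((2 * B * G) ^ e * (G * Y ^ Suc e))"
      proof -
        have "1 * (G * Y ^ Suc e) \<le> (2 * B * G) ^ e * (G * Y ^ Suc e)"
          using BG Gnn Ynn by (intro mult_right_mono one_le_power) auto
        then show ?thesis using B1 by (simp add: mult_left_mono)
      qed
      also have "\<dots> = B * ((2 * B) ^ e * (G * Y) ^ Suc e)"
        by (simp add: power_mult_distrib)
      also have "\<dots> \<le> B * ((2 * B) ^ e * (2 * sqrt W) ^ Suc e)"
        using f7 B1 Gnn Ynn by (intro mult_left_mono power_mono) auto
      also have "\<dots> = B * ((2 * B) ^ e * (2 ^ Suc e * sqrt W ^ Suc e))"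
        by (simp only: power_mult_distrib)
      also have "\<dots> \<le> B * ((2 * B) ^ n * (2 ^ n * sqrt W ^ Suc e))"
      proof -
        have "(2 * B) ^ e \<le> (2 * B) ^ n" using B1 en by (intro power_increasing) auto
        moreover have "(2::real) ^ Suc e \<le> 2 ^ n" using en by (intro power_increasing) auto
        ultimately show ?thesis using B1 W
          by (intro mult_left_mono mult_mono mult_right_mono) auto
      qed
      finally show ?thesis using e by (simp add: C'_def mult_ac)
    qed
    then show ?thesis using W by (simp add: W_def)
  qed
  show ?thesis
    by (rule exI[of _ \<eta>], rule conjI[OF \<eta>], rule exI[of _ C'], rule conjI[OF C'])
      (intro allI impI main)
qed

subsection \<open>Interpolation of derivatives\<close>

text \<open>The derivatives are an explicit chain \<open>D\<close>, taken within \<open>S\<close>.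
  So closed intervals with one-sided derivatives at the ends are allowed, and the class is stable
  under rescaling and translation without reference to values outside \<open>S\<close>.\<close>

definition lip_deriv :: "nat \<Rightarrow> real set \<Rightarrow> real \<Rightarrow> (real \<Rightarrow> real) \<Rightarrow> bool" where
  "lip_deriv m S L f \<longleftrightarrow> (\<exists>D. D 0 = f \<and>
     (\<forall>k<m. \<forall>t\<in>S. (D k has_real_derivative D (Suc k) t) (at t within S)) \<and>
     L-lipschitz_on S (D m))"

text \<open>Iterated mean value theorem: the k-th derivative is small somewhere in each outer third,
  and between these two points the next derivative equals their difference quotient. The constant
  depends on \<open>k\<close> and \<open>l\<close> alone.\<close>

lemma deriv_small_somewhere:
  "\<forall>l>0. \<exists>B\<ge>0. \<forall>D a C.
     (\<forall>i<k. \<forall>t\<in>{a..a+l}. (D i has_real_derivative D (Suc i) t) (at t within {a..a+l})) \<and>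
     (\<forall>t\<in>{a..a+l}. \<bar>D 0 t\<bar> \<le> C) \<longrightarrow> (\<exists>\<xi>\<in>{a..a+l}. \<bar>D k \<xi>\<bar> \<le> B * C)"
proof (induction k)
  case 0
  show ?case by (intro allI impI exI[of _ 1]) force
next
  case (Suc k)
  show ?case
  proof (intro allI impI)
    fix l :: real assume l: "l > 0"
    obtain B where B: "B \<ge> 0" and IH: "\<And>D a C. (\<And>i t. i < k \<Longrightarrow> t \<in> {a..a+l/3} \<Longrightarrow> (D i has_real_derivative D (Suc i) t) (at t within {a..a+l/3}))
       \<Longrightarrow> (\<And>t. t \<in> {a..a+l/3} \<Longrightarrow> \<bar>D 0 t\<bar> \<le> C) \<Longrightarrow> (\<exists>\<xi>\<in>{a..a+l/3}. \<bar>D k \<xi>\<bar> \<le> B * C)"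
      using Suc.IH[rule_format, of "l/3"] l by auto
    show "\<exists>B\<ge>0. \<forall>D a C.
     (\<forall>i<Suc k. \<forall>t\<in>{a..a+l}. (D i has_real_derivative D (Suc i) t) (at t within {a..a+l})) \<and>
     (\<forall>t\<in>{a..a+l}. \<bar>D 0 t\<bar> \<le> C) \<longrightarrow> (\<exists>\<xi>\<in>{a..a+l}. \<bar>D (Suc k) \<xi>\<bar> \<le> B * C)"
    \<comment> \<open>The values differ by at most 2 B C over a distance of at least l/3.\<close>
    proof (rule exI[of _ "6 * B / l"], intro conjI allI impI; (elim conjE)?)
      fix D :: "nat \<Rightarrow> real \<Rightarrow> real" and a C :: real
      assume D: "\<forall>i<Suc k. \<forall>t\<in>{a..a+l}. (D i has_real_derivative D (Suc i) t) (at t within {a..a+l})"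
        and C: "\<forall>t\<in>{a..a+l}. \<bar>D 0 t\<bar> \<le> C"
      have D': "(D i has_real_derivative D (Suc i) t) (at t within T)"
        if "i < Suc k" "t \<in> T" "T \<subseteq> {a..a+l}" for i t T
        using D that by (meson DERIV_subset subsetD)
      have "\<exists>\<xi>\<in>{a..a+l/3}. \<bar>D k \<xi>\<bar> \<le> B * C"
        using C l by (intro IH D') auto
      then obtain x where x: "x \<in> {a..a+l/3}" "\<bar>D k x\<bar> \<le> B * C" by auto
      have "\<exists>\<xi>\<in>{a+2*l/3..a+2*l/3+l/3}. \<bar>D k \<xi>\<bar> \<le> B * C"
        using C l by (intro IH D') auto
      then obtain y where y: "y \<in> {a+2*l/3..a+2*l/3+l/3}" "\<bar>D k y\<bar> \<le> B * C" by auto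
      have xy: "y - x \<ge> l / 3" using x y l by (auto simp: field_simps)
      have "\<exists>z\<in>{x<..<y}. D k y - D k x = D (Suc k) z * (y - x)"
        using xy l x y by (intro mvt_simple) (auto intro!: has_field_derivative_imp_has_derivative D')
      then obtain z where z: "z \<in> {x<..<y}" "D k y - D k x = D (Suc k) z * (y - x)" by auto
      have "\<bar>D (Suc k) z\<bar> * (l / 3) \<le> \<bar>D (Suc k) z\<bar> * (y - x)"
        using xy by (intro mult_left_mono) auto
      also have "\<dots> = \<bar>D k y - D k x\<bar>" using z xy l by (simp add: abs_mult)
      also have "\<dots> \<le> 2 * (B * C)" using x y by linarith
      finally have "\<bar>D (Suc k) z\<bar> \<le> 6 * B / l * C" using l by (simp add: field_simps)
      moreover have "z \<in> {a..a+l}" using z x y l by auto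
      ultimately show "\<exists>\<xi>\<in>{a..a+l}. \<bar>D (Suc k) \<xi>\<bar> \<le> 6 * B / l * C" by blast
    qed (use B l in auto)
  qed
qed

text \<open>A derivative that is small at one point and has a bounded next derivative is bounded
  everywhere. This starts at the top, where the Lipschitz constant replaces the next derivative, and
  descends to order one. \<open>B\<close> comes before \<open>f\<close>, so the bound is
  uniform.\<close>

lemma lip_deriv_interpolation:
  fixes \<kappa> C L :: real
  assumes m: "m \<ge> 1" and \<kappa>: "\<kappa> > 0"
  shows "\<exists>B. \<forall>f. lip_deriv m {-\<kappa>..\<kappa>} L f \<and> (\<forall>t\<in>{-\<kappa>..\<kappa>}. \<bar>f t\<bar> \<le> C) \<longrightarrow>
    (\<exists>g. (\<forall>t\<in>{-\<kappa>..\<kappa>}. (f has_real_derivative g t) (at t within {-\<kappa>..\<kappa>}) \<and> \<bar>g t\<bar> \<le> B) \<and>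
      B-lipschitz_on {-\<kappa>..\<kappa>} g)"
proof -
  let ?S = "{-\<kappa>..\<kappa>}"
  define P where "P D \<longleftrightarrow> (\<forall>k<m. \<forall>t\<in>?S. (D k has_real_derivative D (Suc k) t) (at t within ?S)) \<and>
     L-lipschitz_on ?S (D m) \<and> (\<forall>t\<in>?S. \<bar>D 0 t\<bar> \<le> C)" for D :: "nat \<Rightarrow> real \<Rightarrow> real"
  have point: "\<exists>B\<ge>0. \<forall>D. P D \<longrightarrow> (\<exists>\<xi>\<in>?S. \<bar>D k \<xi>\<bar> \<le> B)" if "k \<le> m" for k
  proof -
    obtain B where B: "B \<ge> 0" and *: "\<And>D a C.
     (\<And>i t. i < k \<Longrightarrow> t \<in> {a..a+2*\<kappa>} \<Longrightarrow> (D i has_real_derivative D (Suc i) t) (at t within {a..a+2*\<kappa>})) \<Longrightarrow>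
     (\<And>t. t \<in> {a..a+2*\<kappa>} \<Longrightarrow> \<bar>D 0 t\<bar> \<le> C) \<Longrightarrow> (\<exists>\<xi>\<in>{a..a+2*\<kappa>}. \<bar>D k \<xi>\<bar> \<le> B * C)"
      using deriv_small_somewhere[of k, rule_format, of "2*\<kappa>"] \<kappa> by auto
    have "\<exists>\<xi>\<in>?S. \<bar>D k \<xi>\<bar> \<le> B * \<bar>C\<bar>" if "P D" for D
    proof -
      have "\<exists>\<xi>\<in>{-\<kappa>..-\<kappa>+2*\<kappa>}. \<bar>D k \<xi>\<bar> \<le> B * C"
        using that \<open>k \<le> m\<close> by (intro *) (auto simp: P_def)
      moreover have "B * C \<le> B * \<bar>C\<bar>" using B by (intro mult_left_mono) auto
      ultimately show ?thesis by (auto intro: order_trans)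
    qed
    then show ?thesis using B by (intro exI[of _ "B * \<bar>C\<bar>"]) auto
  qed
  have bnd: "\<exists>B\<ge>0. \<forall>D. P D \<longrightarrow> (\<forall>t\<in>?S. \<bar>D k t\<bar> \<le> B)" if "k \<le> m" for k
    using that
  proof (induction rule: inc_induct)
    case base
    obtain B where B: "B \<ge> 0" "\<And>D. P D \<Longrightarrow> \<exists>\<xi>\<in>?S. \<bar>D m \<xi>\<bar> \<le> B" using point[of m] by auto
    have "\<bar>D m t\<bar> \<le> B + \<bar>L\<bar> * (2 * \<kappa>)" if "P D" "t \<in> ?S" for D t
    proof -
      obtain \<xi> where \<xi>: "\<xi> \<in> ?S" "\<bar>D m \<xi>\<bar> \<le> B" using B(2)[OF \<open>P D\<close>] by auto
      have "\<bar>D m t - D m \<xi>\<bar> \<le> L * \<bar>t - \<xi>\<bar>"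
        using that \<xi> lipschitz_onD[of L ?S "D m" t \<xi>] by (auto simp: P_def dist_real_def)
      also have "\<dots> \<le> \<bar>L\<bar> * (2 * \<kappa>)" using that \<xi> by (intro mult_mono) auto
      finally show ?thesis using \<xi> by linarith
    qed
    then show ?case using B \<kappa> by (intro exI[of _ "B + \<bar>L\<bar> * (2 * \<kappa>)"]) auto
  next
    case (step k)
    obtain B where B: "B \<ge> 0" "\<And>D. P D \<Longrightarrow> \<exists>\<xi>\<in>?S. \<bar>D k \<xi>\<bar> \<le> B"
      using point[of k] step by auto
    obtain B' where B': "B' \<ge> 0" "\<And>D t. P D \<Longrightarrow> t \<in> ?S \<Longrightarrow> \<bar>D (Suc k) t\<bar> \<le> B'" using step by auto
    have "\<bar>D k t\<bar> \<le> B + B' * (2 * \<kappa>)" if "P D" "t \<in> ?S" for D t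
    proof -
      obtain \<xi> where \<xi>: "\<xi> \<in> ?S" "\<bar>D k \<xi>\<bar> \<le> B" using B(2)[OF \<open>P D\<close>] by auto
      have "norm (D k t - D k \<xi>) \<le> B' * norm (t - \<xi>)"
        using that \<xi> step B' by (intro field_differentiable_bound[of ?S _ "D (Suc k)"]) (auto simp: P_def)
      also have "\<dots> \<le> B' * (2 * \<kappa>)" using that \<xi> B' by (intro mult_mono) auto
      finally show ?thesis using \<xi> by simp
    qed
    then show ?case using B B' \<kappa> by (intro exI[of _ "B + B' * (2 * \<kappa>)"]) auto
  qed
  obtain B1 where B1: "B1 \<ge> 0" "\<And>D t. P D \<Longrightarrow> t \<in> ?S \<Longrightarrow> \<bar>D 1 t\<bar> \<le> B1" using bnd[of 1] m by auto
  have "\<exists>B2. \<forall>D. P D \<longrightarrow> B2-lipschitz_on ?S (D 1)"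
  \<comment> \<open>For m = 1 the Lipschitz constant of the first derivative is the given one;
    otherwise the bound for the second derivative provides it.\<close>
  proof (cases "m = 1")
    case True
    then show ?thesis by (intro exI[of _ L]) (auto simp: P_def)
  next
    case False
    then have m2: "m \<ge> 2" using m by auto
    obtain B where B: "B \<ge> 0" "\<And>D t. P D \<Longrightarrow> t \<in> ?S \<Longrightarrow> \<bar>D 2 t\<bar> \<le> B" using bnd[of 2] m2 by auto
    have "B-lipschitz_on ?S (D 1)" if "P D" for D
    proof (rule lipschitz_onI)
      fix x y assume "x \<in> ?S" "y \<in> ?S"
      then have "norm (D 1 x - D 1 y) \<le> B * norm (x - y)"
        using that B m2 by (intro field_differentiable_bound[of ?S _ "D 2"]) (auto simp: P_def numeral_2_eq_2)
      then show "dist (D 1 x) (D 1 y) \<le> B * dist x y" by (simp add: dist_real_def)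
    qed (use B in auto)
    then show ?thesis by blast
  qed
  then obtain B2 where B2: "\<And>D. P D \<Longrightarrow> B2-lipschitz_on ?S (D 1)" by auto
  define B where "B = max B1 B2"
  have "\<exists>g. (\<forall>t\<in>?S. (f has_real_derivative g t) (at t within ?S) \<and> \<bar>g t\<bar> \<le> B) \<and> B-lipschitz_on ?S g"
    if "lip_deriv m ?S L f \<and> (\<forall>t\<in>?S. \<bar>f t\<bar> \<le> C)" for f
  proof -
    from that obtain D where D: "D 0 = f" "P D" unfolding lip_deriv_def P_def by auto
    have "\<bar>D 1 t\<bar> \<le> B" if "t \<in> ?S" for t using B1(2)[OF D(2) that] by (simp add: B_def)
    moreover have "B-lipschitz_on ?S (D 1)" using B2[OF D(2)] by (rule lipschitz_on_le) (simp add: B_def)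
    moreover have "(f has_real_derivative D 1 t) (at t within ?S)" if "t \<in> ?S" for t
      using D m that by (auto simp: P_def)
    ultimately show ?thesis by blast
  qed
  then show ?thesis by blast
qed

lemma taylor_lipschitz_deriv:
  fixes f :: "real \<Rightarrow> real"
  assumes f: "\<And>x. x \<in> {-\<kappa>..\<kappa>} \<Longrightarrow> (f has_real_derivative g x) (at x within {-\<kappa>..\<kappa>})"
    and g: "C-lipschitz_on {-\<kappa>..\<kappa>} g" and t: "\<bar>t\<bar> \<le> \<kappa>"
  shows "\<bar>f t - f 0 - g 0 * t\<bar> \<le> C * t\<^sup>2"
proof -
  let ?T = "{-\<bar>t\<bar>..\<bar>t\<bar>}"
  have "norm ((f t - g 0 * t) - (f 0 - g 0 * 0)) \<le> (C * \<bar>t\<bar>) * norm (t - 0)"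
  proof (rule field_differentiable_bound[of ?T _ "\<lambda>x. g x - g 0"])
    fix x assume x: "x \<in> ?T"
    have "(f has_real_derivative g x) (at x within ?T)"
      using f[of x] x t by (meson DERIV_subset atLeastatMost_subset_iff atLeastAtMost_iff neg_le_iff_le order_trans)
    then show "((\<lambda>z. f z - g 0 * z) has_real_derivative (g x - g 0)) (at x within ?T)"
      by (auto intro!: derivative_eq_intros)
    have "\<bar>g x - g 0\<bar> \<le> C * \<bar>x\<bar>"
      using lipschitz_onD[OF g, of x 0] x t by (auto simp: dist_real_def)
    also have "\<dots> \<le> C * \<bar>t\<bar>"
      using x lipschitz_on_nonneg[OF g] by (intro mult_left_mono) auto
    finally show "norm (g x - g 0) \<le> C * \<bar>t\<bar>" by simp
  qed auto
  then show ?thesis by (simp add: power2_eq_square mult.assoc)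
qed

text \<open>Bounded derivatives carry h_(d-1), of size \<rho>, over a time of order \<rho>. For
  h_(d-2), of size \<rho>^2, this is too weak. There the inequality 2 h_d h_(d-2) \<le> h_(d-1)^2
  bounds one sign of h_(d-2) by a multiple of \<rho>^2 on the whole window, and a function with
  Lipschitz derivative and such a bound cannot have a slope beyond order \<rho> at the centre. The
  two coefficients together control all lower ones by \<open>coeff_cluster_bound\<close>.\<close>

lemma cluster_stage:
  fixes n d :: nat and C \<kappa> :: real
  assumes d: "1 \<le> d" "d \<le> n" and C: "C \<ge> 1" and \<kappa>: "\<kappa> > 0"
  shows "\<exists>\<epsilon>>0. \<exists>C'>0. \<exists>\<kappa>'>0. \<epsilon> \<le> 1 \<and> \<kappa>' \<le> \<kappa> \<and> (\<forall>\<rho> h. 0 < \<rho> \<and> \<rho> \<le> \<epsilon> \<and>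
     (\<forall>\<tau>\<in>{-\<kappa>..\<kappa>}. \<exists>l ys. length ys = n \<and> sorted (map abs ys) \<and> (\<forall>j. h j \<tau> = coeff (smult l (lin_prod ys)) j)) \<and>
     (\<forall>j. \<exists>g. (\<forall>\<tau>\<in>{-\<kappa>..\<kappa>}. (h j has_real_derivative g \<tau>) (at \<tau> within {-\<kappa>..\<kappa>}) \<and> \<bar>g \<tau>\<bar> \<le> C) \<and> C-lipschitz_on {-\<kappa>..\<kappa>} g) \<and>
     (\<forall>j. \<forall>\<tau>\<in>{-\<kappa>..\<kappa>}. \<bar>h j \<tau>\<bar> \<le> C) \<and> (\<forall>j<d. \<bar>h j 0\<bar> \<le> C * \<rho> ^ (d - j)) \<and> \<bar>h d 0\<bar> \<ge> 3/4
     \<longrightarrow> (\<forall>\<tau>. \<bar>\<tau>\<bar> \<le> \<kappa>' * \<rho> \<longrightarrow> (\<forall>j<d. \<bar>h j \<tau>\<bar> \<le> C' * \<rho> ^ (d - j))))"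
proof -
  have lip0: "\<bar>h j \<tau> - h j 0\<bar> \<le> C * \<bar>\<tau>\<bar>"
    if g: "\<And>j. \<exists>g. (\<forall>\<tau>\<in>{-\<kappa>..\<kappa>}. (h j has_real_derivative g \<tau>) (at \<tau> within {-\<kappa>..\<kappa>}) \<and> \<bar>g \<tau>\<bar> \<le> C) \<and> C-lipschitz_on {-\<kappa>..\<kappa>} g"
      and \<tau>: "\<bar>\<tau>\<bar> \<le> \<kappa>" for h :: "nat \<Rightarrow> real \<Rightarrow> real" and j \<tau>
  proof -
    obtain g' where g': "\<forall>\<tau>\<in>{-\<kappa>..\<kappa>}. (h j has_real_derivative g' \<tau>) (at \<tau> within {-\<kappa>..\<kappa>}) \<and> \<bar>g' \<tau>\<bar> \<le> C"
      using g[of j] by auto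
    have "norm (h j \<tau> - h j 0) \<le> C * norm (\<tau> - 0)"
      using g' \<tau> \<kappa> by (intro field_differentiable_bound[of "{-\<kappa>..\<kappa>}" _ g']) auto
    then show ?thesis by simp
  qed
  show ?thesis
  proof (cases "d = 1")
    case True
    \<comment> \<open>For d = 1 only h_0 is concerned, and the mean value estimate suffices.\<close>
    have "\<bar>h 0 \<tau>\<bar> \<le> (2 * C) * \<rho>"
      if "0 < \<rho>" "\<rho> \<le> 1"
      "\<And>j. \<exists>g. (\<forall>\<tau>\<in>{-\<kappa>..\<kappa>}. (h j has_real_derivative g \<tau>) (at \<tau> within {-\<kappa>..\<kappa>}) \<and> \<bar>g \<tau>\<bar> \<le> C) \<and> C-lipschitz_on {-\<kappa>..\<kappa>} g"
      "\<forall>j<d. \<bar>h j 0\<bar> \<le> C * \<rho> ^ (d - j)" "\<bar>\<tau>\<bar> \<le> min \<kappa> 1 * \<rho>"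
    for \<rho> \<tau> :: real and h :: "nat \<Rightarrow> real \<Rightarrow> real"
    proof -
      have "min \<kappa> 1 * \<rho> \<le> \<kappa> * 1" "min \<kappa> 1 * \<rho> \<le> 1 * \<rho>"
        using \<kappa> that by (intro mult_mono; simp)+
      then have 1: "min \<kappa> 1 * \<rho> \<le> \<kappa>" "min \<kappa> 1 * \<rho> \<le> \<rho>" by simp_all
      have "\<bar>h 0 \<tau> - h 0 0\<bar> \<le> C * \<bar>\<tau>\<bar>"
        using order_trans[OF that(5) 1(1)] by (intro lip0 that(3))
      also have "\<dots> \<le> C * \<rho>" using order_trans[OF that(5) 1(2)] C by (intro mult_left_mono) auto
      finally show ?thesis using that(4) True by auto
    qed
    then show ?thesis using C \<kappa> True
      by (intro exI[of _ "1::real"] conjI exI[of _ "2 * C"] exI[of _ "min \<kappa> 1"]) auto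
  next
    case False
    then have d2: "2 \<le> d" using d by auto
    obtain \<eta> C1 where \<eta>: "\<eta> > 0" and C1: "C1 > 0" and main:
      "\<And>l ys h. length ys = n \<Longrightarrow> sorted (map abs ys) \<Longrightarrow>
    (\<And>j. h j = coeff (smult l (lin_prod ys)) j) \<Longrightarrow> (\<And>j. \<bar>h j\<bar> \<le> C) \<Longrightarrow> \<bar>h d\<bar> \<ge> 1/2 \<Longrightarrow> (\<And>j. j<d \<Longrightarrow> \<bar>h j\<bar> \<le> \<eta>)
    \<Longrightarrow> (h (d - 1))\<^sup>2 - 2 * h d * h (d - 2) \<ge> 0 \<and>
       (\<forall>j<d. \<bar>h j\<bar> \<le> C1 * sqrt ((h (d - 1))\<^sup>2 - 2 * h d * h (d - 2)) ^ (d - j))"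
      using coeff_cluster_bound[OF d2 d(2) C] by metis
    \<comment> \<open>The threshold \<eta> is split in two: \<open>C * \<epsilon>\<close> bounds the
      initial value of a low coefficient, \<open>C * k\<close> its change in time. In addition
      \<open>k\<close> keeps h_d within 1/4 of its initial value.\<close>
    define \<epsilon> where "\<epsilon> = min 1 (\<eta> / (2 * C))"
    define k where "k = min (min \<kappa> 1) (min (1 / (4 * C)) (\<eta> / (2 * C)))"
    define C' where "C' = C1 * (5 * C\<^sup>2) ^ n"
    have \<epsilon>: "0 < \<epsilon>" "\<epsilon> \<le> 1" "C * \<epsilon> \<le> \<eta> / 2"
      using \<eta> C by (auto simp: \<epsilon>_def min_def field_simps)
    have k: "0 < k" "k \<le> \<kappa>" "k \<le> 1" using \<eta> C \<kappa> by (auto simp: k_def)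
    have "k \<le> 1 / (4 * C)" "k \<le> \<eta> / (2 * C)" by (auto simp: k_def)
    then have k': "C * k \<le> 1/4" "C * k \<le> \<eta> / 2" using C by (simp_all add: field_simps)
    have "\<bar>h j \<tau>\<bar> \<le> C' * \<rho> ^ (d - j)"
      if \<rho>: "0 < \<rho>" "\<rho> \<le> \<epsilon>"
       and hyp: "\<And>\<tau>. \<tau>\<in>{-\<kappa>..\<kappa>} \<Longrightarrow> \<exists>l ys. length ys = n \<and> sorted (map abs ys) \<and> (\<forall>j. h j \<tau> = coeff (smult l (lin_prod ys)) j)"
       and g: "\<And>j. \<exists>g. (\<forall>\<tau>\<in>{-\<kappa>..\<kappa>}. (h j has_real_derivative g \<tau>) (at \<tau> within {-\<kappa>..\<kappa>}) \<and> \<bar>g \<tau>\<bar> \<le> C) \<and> C-lipschitz_on {-\<kappa>..\<kappa>} g"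
       and hC: "\<And>j \<tau>. \<tau>\<in>{-\<kappa>..\<kappa>} \<Longrightarrow> \<bar>h j \<tau>\<bar> \<le> C" and h0: "\<And>j. j<d \<Longrightarrow> \<bar>h j 0\<bar> \<le> C * \<rho> ^ (d - j)"
       and hd: "\<bar>h d 0\<bar> \<ge> 3/4" and \<tau>: "\<bar>\<tau>\<bar> \<le> k * \<rho>" and j: "j < d"
      for \<rho> h \<tau> j
    proof -
      have \<rho>1: "\<rho> \<le> 1" using \<rho> \<epsilon> by auto
      have k\<rho>: "k * \<rho> \<le> k" "k * \<rho> \<le> \<rho>" using k \<rho> \<rho>1 by (auto simp: mult_left_le mult_left_le_one_le)
      let ?W = "\<lambda>x. (h (d - 1) x)\<^sup>2 - 2 * h d x * h (d - 2) x"
      have Ck: "C * \<bar>x\<bar> \<le> C * k" "C * \<bar>x\<bar> \<le> C * \<rho>" "\<bar>x\<bar> \<le> \<kappa>" if "\<bar>x\<bar> \<le> k * \<rho>" for x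
      proof -
        have "\<bar>x\<bar> \<le> k" "\<bar>x\<bar> \<le> \<rho>" "\<bar>x\<bar> \<le> \<kappa>" using that k k\<rho> by linarith+
        then show "C * \<bar>x\<bar> \<le> C * k" "C * \<bar>x\<bar> \<le> C * \<rho>" "\<bar>x\<bar> \<le> \<kappa>"
          using C by (auto intro!: mult_left_mono)
      qed
      have hdx: "\<bar>h d x - h d 0\<bar> \<le> 1/4" if "\<bar>x\<bar> \<le> k * \<rho>" for x
        using lip0[of h x d, OF g] Ck[OF that] k' by auto
      have M: "?W x \<ge> 0 \<and> (\<forall>j<d. \<bar>h j x\<bar> \<le> C1 * sqrt (?W x) ^ (d - j))" if x: "\<bar>x\<bar> \<le> k * \<rho>" for x
      proof -
        have xk: "x \<in> {-\<kappa>..\<kappa>}" using Ck(3)[OF x] unfolding atLeastAtMost_iff by linarith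
        obtain l ys where "length ys = n" "sorted (map abs ys)" "\<And>j. h j x = coeff (smult l (lin_prod ys)) j"
          using hyp[OF xk] by auto
        moreover have "\<bar>h d x\<bar> \<ge> 1/2" using hdx[OF x] hd by linarith
        moreover have "\<bar>h j x\<bar> \<le> \<eta>" if "j < d" for j
        proof -
          have "\<rho> ^ (d - j) \<le> \<rho>" using that \<rho> \<rho>1 power_decreasing[of 1 "d - j" \<rho>] by auto
          then have "C * \<rho> ^ (d - j) \<le> C * \<epsilon>" using \<rho> C by (intro mult_left_mono) auto
          then show ?thesis using h0[OF that] \<epsilon> lip0[of h x j, OF g] Ck[OF x] k' by linarith
        qed
        ultimately show ?thesis using hC[OF xk] by (intro main[where h="\<lambda>j. h j x"]) auto
      qed
      have d1: "\<bar>h (d - 1) x\<bar> \<le> 2 * C * \<rho>" if "\<bar>x\<bar> \<le> k * \<rho>" for x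
      proof -
        have "\<bar>h (d - 1) 0\<bar> \<le> C * \<rho>" using h0[of "d - 1"] d2 by simp
        then show ?thesis using lip0[of h x "d - 1", OF g] Ck[OF that] by linarith
      qed
      \<comment> \<open>Multiplying by the sign of h_d makes the one-sided bound an upper bound for
        \<sigma> h_(d-2).\<close>
      define \<sigma> where "\<sigma> = sgn (h d 0)"
      have \<sigma>: "\<bar>\<sigma>\<bar> = 1" "\<sigma> * \<sigma> = 1" "\<sigma> * h d 0 = \<bar>h d 0\<bar>" using hd by (auto simp: \<sigma>_def sgn_if)
      have \<sigma>d: "\<sigma> * h d x \<ge> 1/2" if "\<bar>x\<bar> \<le> k * \<rho>" for x
      proof -
        have "\<bar>\<sigma> * h d x - \<sigma> * h d 0\<bar> = \<bar>h d x - h d 0\<bar>"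
          unfolding right_diff_distrib[symmetric] abs_mult using \<sigma>(1) by simp
        then show ?thesis using hdx[OF that] hd \<sigma> by linarith
      qed
      have up: "\<sigma> * h (d - 2) x \<le> 4 * C\<^sup>2 * \<rho>\<^sup>2" if x: "\<bar>x\<bar> \<le> k * \<rho>" for x
      proof (cases "\<sigma> * h (d - 2) x \<le> 0")
        case True
        have "0 \<le> 4 * C\<^sup>2 * \<rho>\<^sup>2" by simp
        then show ?thesis using True by linarith
      next
        case False
        then have "1 * (\<sigma> * h (d - 2) x) \<le> (2 * (\<sigma> * h d x)) * (\<sigma> * h (d - 2) x)"
          using \<sigma>d[OF x] by (intro mult_right_mono) auto
        also have "\<dots> = (\<sigma> * \<sigma>) * (2 * h d x * h (d - 2) x)" by (simp only: mult_ac)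
        also have "\<dots> \<le> (h (d - 1) x)\<^sup>2" using M[OF x] \<sigma> by simp
        also have "\<dots> \<le> (2 * C * \<rho>)\<^sup>2" using d1[OF x] by (metis abs_ge_zero power2_abs power_mono)
        finally show ?thesis by (simp add: power_mult_distrib)
      qed
      obtain g' where g'd: "\<And>\<tau>. \<tau> \<in> {-\<kappa>..\<kappa>} \<Longrightarrow> (h (d - 2) has_real_derivative g' \<tau>) (at \<tau> within {-\<kappa>..\<kappa>})"
        and g'l: "C-lipschitz_on {-\<kappa>..\<kappa>} g'" using g[of "d - 2"] by blast
      have T: "\<bar>h (d - 2) x - h (d - 2) 0 - g' 0 * x\<bar> \<le> C * \<rho>\<^sup>2" if "\<bar>x\<bar> \<le> k * \<rho>" for x
      proof -
        have "\<bar>h (d - 2) x - h (d - 2) 0 - g' 0 * x\<bar> \<le> C * x\<^sup>2"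
          using Ck[OF that] by (intro taylor_lipschitz_deriv[OF g'd g'l]) auto
        also have "\<dots> \<le> C * \<rho>\<^sup>2"
        proof (rule mult_left_mono)
          have "\<bar>x\<bar> \<le> \<rho>" using that k\<rho> by linarith
          then show "x\<^sup>2 \<le> \<rho>\<^sup>2" by (metis abs_ge_zero power2_abs power_mono)
        qed (use C in auto)
        finally show ?thesis .
      qed
      have h20: "\<bar>h (d - 2) 0\<bar> \<le> C * \<rho>\<^sup>2" using h0[of "d - 2"] d2 by auto
      have C2: "C * \<rho>\<^sup>2 \<le> C\<^sup>2 * \<rho>\<^sup>2" using C by (intro mult_right_mono) (auto simp: power2_eq_square)
      have g0: "\<bar>g' 0\<bar> * (k * \<rho>) \<le> 6 * (C\<^sup>2 * \<rho>\<^sup>2)"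
      proof -
        \<comment> \<open>The end of the window at which the linear term is positive, so that the
          upper bound limits the slope.\<close>
        define x where "x = (if \<sigma> * g' 0 \<ge> 0 then k * \<rho> else - (k * \<rho>))"
        have x: "\<bar>x\<bar> \<le> k * \<rho>" using k \<rho> by (auto simp: x_def)
        have "\<bar>g' 0\<bar> = \<bar>\<sigma> * g' 0\<bar>" using \<sigma> by (simp add: abs_mult)
        then have "\<bar>g' 0\<bar> * (k * \<rho>) = \<sigma> * (g' 0 * x)" by (auto simp: x_def)
        moreover have "\<bar>\<sigma> * (h (d - 2) x - h (d - 2) 0 - g' 0 * x)\<bar> \<le> C * \<rho>\<^sup>2"
          using T[OF x] \<sigma> by (simp add: abs_mult)
        then have "\<sigma> * (g' 0 * x) \<le> C * \<rho>\<^sup>2 + \<sigma> * h (d - 2) x - \<sigma> * h (d - 2) 0"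
          by (simp add: algebra_simps)
        moreover have "\<bar>\<sigma> * h (d - 2) 0\<bar> \<le> C * \<rho>\<^sup>2" using h20 \<sigma> by (simp add: abs_mult)
        ultimately show ?thesis using up[OF x] C2 by linarith
      qed
      have h2: "\<bar>h (d - 2) \<tau>\<bar> \<le> 8 * (C\<^sup>2 * \<rho>\<^sup>2)"
      proof -
        have "\<bar>g' 0 * \<tau>\<bar> \<le> \<bar>g' 0\<bar> * (k * \<rho>)" using \<tau> by (simp add: abs_mult mult_left_mono)
        then show ?thesis using T[OF \<tau>] h20 g0 C2 by linarith
      qed
      have "\<bar>2 * h d \<tau> * h (d - 2) \<tau>\<bar> \<le> 2 * C * (8 * (C\<^sup>2 * \<rho>\<^sup>2))"
      proof -
        have "\<tau> \<in> {-\<kappa>..\<kappa>}" using Ck(3)[OF \<tau>] unfolding atLeastAtMost_iff by linarith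
        then show ?thesis unfolding abs_mult using h2 hC[of \<tau> d] C by (intro mult_mono) auto
      qed
      moreover have "(h (d - 1) \<tau>)\<^sup>2 \<le> (2 * C * \<rho>)\<^sup>2" using d1[OF \<tau>] by (metis abs_ge_zero power2_abs power_mono)
      ultimately have "?W \<tau> \<le> 4 * C\<^sup>2 * \<rho>\<^sup>2 + 16 * C^3 * \<rho>\<^sup>2"
        unfolding power_mult_distrib power2_eq_square power3_eq_cube by (simp add: mult_ac)
      also have "\<dots> \<le> 4 * C^4 * \<rho>\<^sup>2 + 16 * C^4 * \<rho>\<^sup>2"
        using C by (intro add_mono mult_right_mono mult_left_mono power_increasing) auto
      also have "\<dots> \<le> 25 * C^4 * \<rho>\<^sup>2" by simp
      also have "\<dots> = (5 * C\<^sup>2 * \<rho>)\<^sup>2" by (simp add: power_mult_distrib flip: power_mult)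
      finally have sW: "sqrt (?W \<tau>) \<le> 5 * C\<^sup>2 * \<rho>"
        using \<rho> C by (intro real_le_lsqrt) auto
      have "\<bar>h j \<tau>\<bar> \<le> C1 * sqrt (?W \<tau>) ^ (d - j)" using M[OF \<tau>] j by auto
      also have "\<dots> \<le> C1 * (5 * C\<^sup>2 * \<rho>) ^ (d - j)"
        using sW M[OF \<tau>] C1 by (intro mult_left_mono power_mono) auto
      also have "\<dots> = C1 * ((5 * C\<^sup>2) ^ (d - j) * \<rho> ^ (d - j))" by (simp only: power_mult_distrib)
      also have "\<dots> \<le> C1 * ((5 * C\<^sup>2) ^ n * \<rho> ^ (d - j))"
      proof -
        have "1 * 1 \<le> 5 * C\<^sup>2" using C by (intro mult_mono) auto
        then have "(5 * C\<^sup>2) ^ (d - j) \<le> (5 * C\<^sup>2) ^ n" using d by (intro power_increasing) auto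
        then show ?thesis using C1 \<rho> by (intro mult_left_mono mult_right_mono) auto
      qed
      finally show ?thesis by (simp add: C'_def mult_ac)
    qed note res = this
    have C': "C' > 0" using C1 C by (simp add: C'_def)
    show ?thesis
      by (rule exI[of _ \<epsilon>], rule conjI[OF \<epsilon>(1)], rule exI[of _ C'], rule conjI[OF C'],
          rule exI[of _ k], rule conjI[OF k(1)], rule conjI[OF \<epsilon>(2)], rule conjI[OF k(2)])
        (intro allI impI; elim conjE; rule res; blast)
  qed
qed

subsection \<open>Clusters of roots at all scales\<close>

lemma lip_deriv_mono: "lip_deriv m S L f \<Longrightarrow> L \<le> L' \<Longrightarrow> lip_deriv m S L' f"
  unfolding lip_deriv_def using lipschitz_on_le by blast

text \<open>The m-th derivative gains the factor w^m from the chain rule, and its Lipschitz constant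
  one factor more.\<close>

lemma lip_deriv_rescale:
  assumes f: "lip_deriv m S L f" and S: "(\<lambda>\<tau>. w * \<tau>) ` T \<subseteq> S"
  shows "lip_deriv m T (\<bar>u\<bar> * \<bar>w\<bar> ^ Suc m * L) (\<lambda>\<tau>. u * f (w * \<tau>))"
proof -
  obtain D where D: "D 0 = f"
    "\<And>k t. k < m \<Longrightarrow> t \<in> S \<Longrightarrow> (D k has_real_derivative D (Suc k) t) (at t within S)"
    "L-lipschitz_on S (D m)" using f by (auto simp: lip_deriv_def)
  define D' where "D' k = (\<lambda>\<tau>. u * w ^ k * D k (w * \<tau>))" for k
  have "(D' k has_real_derivative D' (Suc k) t) (at t within T)" if "k < m" "t \<in> T" for k t
  proof -
    have "(D k has_real_derivative D (Suc k) (w * t)) (at (w * t) within (\<lambda>\<tau>. w * \<tau>) ` T)"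
      using D(2)[OF that(1), of "w * t"] that S by (meson DERIV_subset image_subset_iff)
    moreover have "((\<lambda>\<tau>. w * \<tau>) has_real_derivative w) (at t within T)"
      by (auto intro!: derivative_eq_intros)
    ultimately have "((D k \<circ> (\<lambda>\<tau>. w * \<tau>)) has_real_derivative D (Suc k) (w * t) * w) (at t within T)"
      by (rule DERIV_image_chain)
    then have "((\<lambda>\<tau>. u * w ^ k * D k (w * \<tau>)) has_real_derivative u * w ^ k * (D (Suc k) (w * t) * w)) (at t within T)"
      unfolding comp_def by (rule DERIV_cmult)
    then show ?thesis by (simp add: D'_def mult_ac)
  qed
  moreover have "(\<bar>u\<bar> * \<bar>w\<bar> ^ Suc m * L)-lipschitz_on T (D' m)"
  proof (rule lipschitz_onI)
    show "0 \<le> \<bar>u\<bar> * \<bar>w\<bar> ^ Suc m * L" using lipschitz_on_nonneg[OF D(3)] by simp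
    fix x y assume xy: "x \<in> T" "y \<in> T"
    have "\<bar>D m (w * x) - D m (w * y)\<bar> \<le> L * \<bar>w * x - w * y\<bar>"
      using lipschitz_onD[OF D(3), of "w * x" "w * y"] S xy by (auto simp: dist_real_def)
    then have "\<bar>u\<bar> * \<bar>w\<bar> ^ m * \<bar>D m (w * x) - D m (w * y)\<bar> \<le> \<bar>u\<bar> * \<bar>w\<bar> ^ m * (L * \<bar>w * x - w * y\<bar>)"
      by (intro mult_left_mono) auto
    then show "dist (D' m x) (D' m y) \<le> \<bar>u\<bar> * \<bar>w\<bar> ^ Suc m * L * dist x y"
      by (simp add: D'_def dist_real_def abs_mult power_abs mult_ac flip: right_diff_distrib)
  qed
  moreover have "D' 0 = (\<lambda>\<tau>. u * f (w * \<tau>))" by (auto simp: D'_def D(1))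
  ultimately show ?thesis unfolding lip_deriv_def by blast
qed

text \<open>Homogeneity: substituting R Z for Z divides the roots by R and produces the factor
  R^n.\<close>

lemma coeff_lin_prod_scale:
  assumes "R \<noteq> 0"
  shows "coeff (lin_prod ys) j * R ^ j = R ^ length ys * coeff (lin_prod (map (\<lambda>y. y / R) ys)) j"
proof (induction ys arbitrary: j)
  case Nil
  then show ?case by (cases j) (auto simp: coeff_1)
next
  case (Cons y ys)
  have "coeff (lin_prod (y # ys)) j * R ^ j
     = R * (if j = 0 then 0 else coeff (lin_prod ys) (j - 1) * R ^ (j - 1)) - y * (coeff (lin_prod ys) j * R ^ j)"
    unfolding lin_prod_simps coeff_linear_times by (cases j) (auto simp: algebra_simps)
  also have "\<dots> = R ^ length (y # ys) * coeff (lin_prod (map (\<lambda>y. y / R) (y # ys))) j"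
    unfolding lin_prod_simps coeff_linear_times list.map Cons.IH using assms
    by (cases j) (auto simp: algebra_simps)
  finally show ?case .
qed

lemma prod_list_abs_scale:
  fixes ys :: "real list"
  assumes "R > 0"
  shows "prod_list (map abs (map (\<lambda>y. y / R) ys)) * R ^ length ys = prod_list (map abs ys)"
  using assms by (induction ys) (auto simp: field_simps)

lemma lin_prod_mset: "mset ys = mset zs \<Longrightarrow> lin_prod ys = lin_prod zs"
  unfolding lin_prod_def by (metis mset_map prod_mset_prod_list)

lemma lin_prod_sorted:
  obtains zs where "mset zs = mset ys" "length zs = length ys" "sorted (map abs zs)" "lin_prod zs = lin_prod ys"
  using that[of "sort_key abs ys"] by (simp add: lin_prod_mset[of "sort_key abs ys" ys])

text \<open>The far roots predict size 1 for h_d, but cancellation has to be excluded. In the square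
  identity at index d the central term is h_d^2, and each other term has one index below d, hence a
  factor \<open>C * \<rho>\<close>.\<close>

lemma cluster_lead_coeff:
  fixes h :: "nat \<Rightarrow> real"
  assumes len: "length ys = n" and d: "d \<le> n" and h: "\<And>j. h j = coeff (smult l (lin_prod ys)) j"
    and G: "\<bar>l\<bar> * prod_list (map abs (drop d ys)) = 1"
    and hC: "\<And>j. \<bar>h j\<bar> \<le> C" and h\<rho>: "\<And>j. j < d \<Longrightarrow> \<bar>h j\<bar> \<le> C * \<rho>" and \<rho>: "2 * real n * C\<^sup>2 * \<rho> \<le> 1/4"
    and \<rho>0: "\<rho> \<ge> 0"
  shows "\<bar>h d\<bar> \<ge> 3/4"
proof -
  have C0: "C \<ge> 0" using hC[of 0] by linarith
  have "1 = (\<bar>l\<bar> * prod_list (map abs (drop d ys)))\<^sup>2" using G by simp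
  also have "\<dots> = l\<^sup>2 * prod_list (map power2 (drop d ys))"
    by (simp add: prod_list_power2_abs power_mult_distrib)
  also have "\<dots> \<le> (\<Sum>i\<le>2 * d. (-1) ^ (d + i) * h i * h (2 * d - i))"
    using coeff_square_identity[of h l ys d, OF h] len d by simp
  also have "\<dots> = (-1) ^ (d + d) * h d * h (2 * d - d) + (\<Sum>i\<in>{..2 * d} - {d}. (-1) ^ (d + i) * h i * h (2 * d - i))"
    by (rule sum.remove) auto
  also have "(\<Sum>i\<in>{..2 * d} - {d}. (-1) ^ (d + i) * h i * h (2 * d - i)) \<le> (\<Sum>i\<in>{..2 * d} - {d}. C\<^sup>2 * \<rho>)"
  proof (rule sum_mono)
    fix i assume i: "i \<in> {..2 * d} - {d}"
    have "\<bar>h i\<bar> * \<bar>h (2 * d - i)\<bar> \<le> C\<^sup>2 * \<rho>"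
    proof (cases "i < d")
      case True
      then have "\<bar>h i\<bar> * \<bar>h (2 * d - i)\<bar> \<le> (C * \<rho>) * C"
        using h\<rho> hC C0 \<rho>0 by (intro mult_mono) auto
      then show ?thesis by (simp add: power2_eq_square mult_ac)
    next
      case False
      then have "\<bar>h i\<bar> * \<bar>h (2 * d - i)\<bar> \<le> C * (C * \<rho>)"
        using h\<rho>[of "2 * d - i"] hC[of i] C0 i by (intro mult_mono) auto
      then show ?thesis by (simp add: power2_eq_square mult_ac)
    qed
    then have "\<bar>(-1) ^ (d + i) * h i * h (2 * d - i)\<bar> \<le> C\<^sup>2 * \<rho>"
      by (simp add: abs_mult power_abs)
    then show "(-1) ^ (d + i) * h i * h (2 * d - i) \<le> C\<^sup>2 * \<rho>" by linarith
  qed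
  also have "\<dots> = real (2 * d) * (C\<^sup>2 * \<rho>)" by simp
  also have "\<dots> \<le> real (2 * n) * (C\<^sup>2 * \<rho>)" using d \<rho>0 by (intro mult_right_mono) auto
  also have "\<dots> \<le> 1/4" using \<rho> by (simp add: mult_ac)
  finally have "1 \<le> (h d)\<^sup>2 + 1/4" by (simp add: power2_eq_square flip: mult_2)
  then have "(3/4)\<^sup>2 \<le> \<bar>h d\<bar>\<^sup>2" by (simp add: power2_eq_square)
  then show ?thesis by (rule power2_le_imp_le) auto
qed

section \<open>The product N(r) and coefficient bounds at one scale\<close>

definition scale_prod :: "real list \<Rightarrow> real \<Rightarrow> real" where
  "scale_prod ys r = prod_list (map (\<lambda>y. max r \<bar>y\<bar>) ys)"

lemma scale_prod_pos: "r > 0 \<Longrightarrow> scale_prod ys r > 0"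
  unfolding scale_prod_def by (induction ys) (auto simp: less_max_iff_disj)

lemma scale_prod_cluster:
  assumes "d \<le> length ys" "\<And>i. i < d \<Longrightarrow> \<bar>ys ! i\<bar> \<le> r"
    "\<And>i. d \<le> i \<Longrightarrow> i < length ys \<Longrightarrow> r \<le> \<bar>ys ! i\<bar>"
  shows "scale_prod ys r = r ^ d * prod_list (map abs (drop d ys))"
proof -
  have "scale_prod ys r = prod_list (map (\<lambda>y. max r \<bar>y\<bar>) (take d ys @ drop d ys))"
    by (simp add: scale_prod_def)
  also have "\<dots> = prod_list (map (\<lambda>y. max r \<bar>y\<bar>) (take d ys)) * prod_list (map (\<lambda>y. max r \<bar>y\<bar>) (drop d ys))"
    by (simp only: map_append prod_list.append)
  also have "map (\<lambda>y. max r \<bar>y\<bar>) (take d ys) = replicate d r"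
    using assms by (intro nth_equalityI) auto
  also have "map (\<lambda>y. max r \<bar>y\<bar>) (drop d ys) = map abs (drop d ys)"
    using assms by (intro nth_equalityI) auto
  finally show ?thesis by simp
qed

text \<open>Each ratio max(r, |y|) / r is nonincreasing in r. Hence comparable scales have
  comparable values of N.\<close>

lemma scale_prod_compare:
  assumes "0 < r" "r \<le> R"
  shows "scale_prod ys R * r ^ length ys \<le> R ^ length ys * scale_prod ys r"
proof (induction ys)
  case (Cons y ys)
  have "max R \<bar>y\<bar> * r \<le> R * max r \<bar>y\<bar>"
  proof (cases "\<bar>y\<bar> \<le> R")
    case True
    then have "max R \<bar>y\<bar> * r = R * r" by simp
    also have "\<dots> \<le> R * max r \<bar>y\<bar>" using assms by (intro mult_left_mono) auto
    finally show ?thesis .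
  next
    case False
    then have "max R \<bar>y\<bar> * r = \<bar>y\<bar> * r" by simp
    also have "\<dots> \<le> \<bar>y\<bar> * R" using assms by (intro mult_left_mono) auto
    also have "\<dots> \<le> R * max r \<bar>y\<bar>" using assms by (simp add: mult.commute mult_left_mono)
    finally show ?thesis .
  qed
  then have "(max R \<bar>y\<bar> * r) * (scale_prod ys R * r ^ length ys) \<le> (R * max r \<bar>y\<bar>) * (R ^ length ys * scale_prod ys r)"
    by (rule mult_mono[OF _ Cons]) (use assms scale_prod_pos[of r ys] scale_prod_pos[of R ys] in auto)
  then show ?case by (simp add: scale_prod_def mult_ac)
qed (simp add: scale_prod_def)

text \<open>A curve of polynomials \<open>\<Sum>j. h j t * Z ^ j\<close> for \<open>\<bar>t\<bar> \<le> s / c\<close> whose roots for \<open>t = 0\<close> are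
  the \<open>ys\<close>; \<open>s\<close> is a length scale for the roots and \<open>c\<close> a speed. The last condition says that
  the remainders of the Taylor expansions of order \<open>m\<close> are under control at all scales \<open>r \<le> s\<close>.\<close>

definition root_curve ::
  "nat \<Rightarrow> nat \<Rightarrow> real \<Rightarrow> (nat \<Rightarrow> real \<Rightarrow> real) \<Rightarrow> real \<Rightarrow> real \<Rightarrow> real list \<Rightarrow> real \<Rightarrow> bool" where
  "root_curve n m K h c s ys Q \<longleftrightarrow> c > 0 \<and> s > 0 \<and> Q \<ge> 0 \<and>
     length ys = n \<and> sorted (map abs ys) \<and> (\<forall>y\<in>set ys. \<bar>y\<bar> \<le> s) \<and> (\<forall>j. h j 0 = coeff (lin_prod ys) j) \<and>
     (\<forall>t\<in>{-(s/c)..s/c}. \<exists>zs. length zs = n \<and> (\<forall>j. h j t = coeff (lin_prod zs) j)) \<and>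
     (\<forall>t\<in>{-(s/c)..s/c}. \<forall>j. \<bar>h j t\<bar> * s ^ j \<le> K * s ^ n) \<and>
     (\<forall>j. lip_deriv m {-(s/c)..s/c} (Q / s ^ j) (h j)) \<and>
     (\<forall>r. 0 < r \<and> r \<le> s \<longrightarrow> Q * r ^ Suc m \<le> c ^ Suc m * scale_prod ys r)"

text \<open>At t = 0 such a bound holds with the constant 2^n. The condition says that up to time
  \<kappa> r / c the coefficients keep the size expected when the roots move by no more than a
  multiple of r.\<close>

definition scale_bound :: "real \<Rightarrow> real \<Rightarrow> (nat \<Rightarrow> real \<Rightarrow> real) \<Rightarrow> real \<Rightarrow> real list \<Rightarrow> real \<Rightarrow> bool" where
  "scale_bound C \<kappa> h c ys r \<longleftrightarrow> (\<forall>t j. \<bar>t\<bar> \<le> \<kappa> * r / c \<longrightarrow> \<bar>h j t\<bar> * r ^ j \<le> C * scale_prod ys r)"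

lemma scale_bound_shrink:
  assumes b: "scale_bound C \<kappa> h c ys R" and r: "\<epsilon> * R \<le> r" "r \<le> R" "0 < r" and \<epsilon>: "\<epsilon> > 0" and c: "c > 0"
    and C: "C \<ge> 0" and k: "0 \<le> \<kappa>'" "\<kappa>' \<le> \<kappa>"
  shows "scale_bound (C / \<epsilon> ^ length ys) \<kappa>' h c ys r"
  unfolding scale_bound_def
proof (intro allI impI)
  fix t j assume t: "\<bar>t\<bar> \<le> \<kappa>' * r / c"
  also have "\<dots> \<le> \<kappa> * R / c" using k r c by (intro divide_right_mono mult_mono) auto
  finally have t': "\<bar>h j t\<bar> * R ^ j \<le> C * scale_prod ys R" using b by (simp add: scale_bound_def)
  have "\<bar>h j t\<bar> * r ^ j \<le> \<bar>h j t\<bar> * R ^ j" using r by (intro mult_left_mono power_mono) auto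
  also note t'
  also have "scale_prod ys R \<le> scale_prod ys r / \<epsilon> ^ length ys"
  proof -
    have "scale_prod ys R * (\<epsilon> * R) ^ length ys \<le> scale_prod ys R * r ^ length ys"
      using r \<epsilon> scale_prod_pos[of R ys] by (intro mult_left_mono power_mono) auto
    also have "\<dots> \<le> R ^ length ys * scale_prod ys r"
      using r by (intro scale_prod_compare) auto
    finally show ?thesis using \<epsilon> r by (simp add: field_simps power_mult_distrib)
  qed
  finally show "\<bar>h j t\<bar> * r ^ j \<le> C / \<epsilon> ^ length ys * scale_prod ys r"
    using C by (simp add: mult_left_mono)
qed

lemma scale_bound_mono:
  assumes "scale_bound C \<kappa> h c ys r" "C \<le> C'" "\<kappa>' \<le> \<kappa>" "r > 0" "c > 0"
  shows "scale_bound C' \<kappa>' h c ys r"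
  unfolding scale_bound_def
proof (intro allI impI)
  fix t j assume "\<bar>t\<bar> \<le> \<kappa>' * r / c"
  also have "\<dots> \<le> \<kappa> * r / c" using assms by (intro divide_right_mono mult_right_mono) auto
  finally have "\<bar>h j t\<bar> * r ^ j \<le> C * scale_prod ys r" using assms by (auto simp: scale_bound_def)
  also have "\<dots> \<le> C' * scale_prod ys r" using assms scale_prod_pos[of r ys] by (intro mult_right_mono) auto
  finally show "\<bar>h j t\<bar> * r ^ j \<le> C' * scale_prod ys r" .
qed

text \<open>No root distance lies strictly between r and R, so the \<open>Suc d\<close> nearest
  roots form a cluster. After division by N(R) and rescaling, the coefficients satisfy the
  hypotheses of \<open>cluster_stage\<close> with \<rho> = r / R. All constants depend on n, m, C,
  \<kappa> and d only.\<close>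

lemma multiscale_step:
  fixes n m d :: nat and K C \<kappa> :: real
  assumes m: "m \<ge> 1" and d: "Suc d \<le> n" and C: "C \<ge> 1" and \<kappa>: "0 < \<kappa>" "\<kappa> \<le> 1"
  shows "\<exists>C'\<ge>1. \<exists>\<kappa>'>0. \<kappa>' \<le> 1 \<and> (\<forall>h c s ys Q R r. root_curve n m K h c s ys Q \<longrightarrow>
    scale_bound C \<kappa> h c ys R \<longrightarrow> (\<forall>i<Suc d. \<bar>ys ! i\<bar> \<le> r) \<longrightarrow> (\<forall>i<n. Suc d \<le> i \<longrightarrow> R \<le> \<bar>ys ! i\<bar>) \<longrightarrow>
    0 < r \<longrightarrow> r \<le> R \<longrightarrow> R \<le> s \<longrightarrow> scale_bound C' \<kappa>' h c ys r)"
proof -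
  define e where "e = Suc d"
  obtain B where B: "\<And>f. lip_deriv m {-\<kappa>..\<kappa>} 1 f \<Longrightarrow> (\<And>t. t \<in> {-\<kappa>..\<kappa>} \<Longrightarrow> \<bar>f t\<bar> \<le> C) \<Longrightarrow>
    (\<exists>g. (\<forall>t\<in>{-\<kappa>..\<kappa>}. (f has_real_derivative g t) (at t within {-\<kappa>..\<kappa>}) \<and> \<bar>g t\<bar> \<le> B) \<and>
      B-lipschitz_on {-\<kappa>..\<kappa>} g)"
    using lip_deriv_interpolation[OF m \<kappa>(1), of 1 C] by metis
  \<comment> \<open>C bounds the normalised coefficients, B their derivatives by interpolation, and
    2^n comes from \<open>coeff_lin_prod_bound\<close> at time 0.\<close>
  define C1 where "C1 = max (max C B) (2 ^ n)"
  have C1: "C1 \<ge> 1" "C1 \<ge> C" "C1 \<ge> B" "C1 \<ge> 2 ^ n" using C by (auto simp: C1_def)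
  obtain \<epsilon> C2 k where \<epsilon>: "\<epsilon> > 0" "\<epsilon> \<le> 1" and C2: "C2 > 0" and k: "k > 0" "k \<le> \<kappa>"
    and stage: "\<And>\<rho> h \<tau> j. 0 < \<rho> \<Longrightarrow> \<rho> \<le> \<epsilon> \<Longrightarrow>
     (\<And>\<tau>. \<tau>\<in>{-\<kappa>..\<kappa>} \<Longrightarrow> \<exists>l ys. length ys = n \<and> sorted (map abs ys) \<and> (\<forall>j. h j \<tau> = coeff (smult l (lin_prod ys)) j)) \<Longrightarrow>
     (\<And>j. \<exists>g. (\<forall>\<tau>\<in>{-\<kappa>..\<kappa>}. (h j has_real_derivative g \<tau>) (at \<tau> within {-\<kappa>..\<kappa>}) \<and> \<bar>g \<tau>\<bar> \<le> C1) \<and> C1-lipschitz_on {-\<kappa>..\<kappa>} g) \<Longrightarrow>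
     (\<And>j \<tau>. \<tau>\<in>{-\<kappa>..\<kappa>} \<Longrightarrow> \<bar>h j \<tau>\<bar> \<le> C1) \<Longrightarrow> (\<And>j. j<e \<Longrightarrow> \<bar>h j 0\<bar> \<le> C1 * \<rho> ^ (e - j)) \<Longrightarrow> \<bar>h e 0\<bar> \<ge> 3/4
     \<Longrightarrow> \<bar>\<tau>\<bar> \<le> k * \<rho> \<Longrightarrow> j<e \<Longrightarrow> \<bar>h j \<tau>\<bar> \<le> C2 * \<rho> ^ (e - j)"
    using cluster_stage[of e n C1 \<kappa>] C1(1) \<kappa>(1) d unfolding e_def by (elim exE conjE meta_impE; force)
  \<comment> \<open>The second entry is the smallness of \<rho> that
    \<open>cluster_lead_coeff\<close> asks for.\<close>
  define \<epsilon>' where "\<epsilon>' = min \<epsilon> (1 / (8 * real n * C1\<^sup>2))"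
  have n1: "real n \<ge> 1" using d by simp
  have nC: "8 * real n * C1\<^sup>2 \<ge> 1"
  proof -
    have "1 * 1 \<le> (8 * real n) * C1\<^sup>2" using n1 C1 by (intro mult_mono) auto
    then show ?thesis by simp
  qed
  have \<epsilon>': "0 < \<epsilon>'" "\<epsilon>' \<le> \<epsilon>" "2 * real n * C1\<^sup>2 * \<epsilon>' \<le> 1/4"
  proof -
    show "0 < \<epsilon>'" using nC \<epsilon> by (auto simp: \<epsilon>'_def)
    show "\<epsilon>' \<le> \<epsilon>" by (auto simp: \<epsilon>'_def)
    have "(2 * real n * C1\<^sup>2) * \<epsilon>' \<le> (2 * real n * C1\<^sup>2) * (1 / (8 * real n * C1\<^sup>2))"
      by (intro mult_left_mono) (auto simp: \<epsilon>'_def)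
    also have "\<dots> = 1/4" using n1 C1 by (simp add: field_simps)
    finally show "2 * real n * C1\<^sup>2 * \<epsilon>' \<le> 1/4" .
  qed
  define C' where "C' = max (C / \<epsilon>' ^ n) (max C C2)"
  have C': "C' \<ge> 1" "C' \<ge> C / \<epsilon>' ^ n" "C' \<ge> C" "C' \<ge> C2" using C by (auto simp: C'_def)
  have main: "scale_bound C' k h c ys r"
    if rc: "root_curve n m K h c s ys Q" and sb: "scale_bound C \<kappa> h c ys R"
      and near: "\<And>i. i < e \<Longrightarrow> \<bar>ys ! i\<bar> \<le> r" and far: "\<And>i. i < n \<Longrightarrow> e \<le> i \<Longrightarrow> R \<le> \<bar>ys ! i\<bar>"
      and r: "0 < r" "r \<le> R" and Rs: "R \<le> s" for h c s ys Q R r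
  proof -
    have c: "c > 0" and s: "s > 0" and len: "length ys = n" and srt: "sorted (map abs ys)"
      and h0: "\<And>j. h j 0 = coeff (lin_prod ys) j"
      and hyp: "\<And>t. t\<in>{-(s/c)..s/c} \<Longrightarrow> \<exists>zs. length zs = n \<and> (\<forall>j. h j t = coeff (lin_prod zs) j)"
      and lip: "\<And>j. lip_deriv m {-(s/c)..s/c} (Q / s ^ j) (h j)"
      and Q: "Q \<ge> 0" "\<And>r. 0 < r \<Longrightarrow> r \<le> s \<Longrightarrow> Q * r ^ Suc m \<le> c ^ Suc m * scale_prod ys r"
      using rc unfolding root_curve_def by auto
    show ?thesis
    proof (cases "\<epsilon>' * R \<le> r")
      \<comment> \<open>For r comparable with R only the constant changes.\<close>
      case True
      then have "scale_bound (C / \<epsilon>' ^ length ys) k h c ys r"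
        using r \<epsilon>' c C k by (intro scale_bound_shrink[OF sb]) auto
      then show ?thesis using C' len r c by (auto elim!: scale_bound_mono)
    next
      case False
      have R: "R > 0" using r by linarith
      define E where "E = prod_list (map abs (drop e ys))"
      define \<rho> where "\<rho> = r / R"
      have \<rho>: "0 < \<rho>" "\<rho> \<le> \<epsilon>'" "\<rho> \<le> 1" using r R False \<epsilon>' \<epsilon> by (auto simp: \<rho>_def field_simps)
      have r\<rho>: "r = \<rho> * R" using R by (simp add: \<rho>_def)
      have NR: "scale_prod ys R = R ^ e * E"
        unfolding E_def using near far r d len by (intro scale_prod_cluster) (force simp: e_def)+
      have Nr: "scale_prod ys r = r ^ e * E"
        unfolding E_def using near far r d len by (intro scale_prod_cluster) (force simp: e_def)+
      have E: "E > 0" using NR scale_prod_pos[of R ys] R by (simp add: zero_less_mult_iff)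
      \<comment> \<open>The denominator is N(R) by \<open>NR\<close>, so the given bound at scale R
        becomes |H_j| \<le> C.\<close>
      define u where "u j = R ^ j / (R ^ e * E)" for j
      have u: "u j > 0" for j using R E by (simp add: u_def)
      define H where "H j \<tau> = u j * h j (R / c * \<tau>)" for j \<tau>
      have win: "R / c * \<tau> \<in> {-(s/c)..s/c}" "\<bar>R / c * \<tau>\<bar> \<le> \<kappa> * R / c" if "\<tau> \<in> {-\<kappa>..\<kappa>}" for \<tau>
      proof -
        have "\<bar>R / c * \<tau>\<bar> = \<bar>\<tau>\<bar> * R / c" using R c by (simp add: abs_mult)
        also have "\<dots> \<le> \<kappa> * R / c" using that R c by (intro divide_right_mono mult_right_mono) auto
        finally show 1: "\<bar>R / c * \<tau>\<bar> \<le> \<kappa> * R / c" .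
        have "\<kappa> * R / c \<le> 1 * s / c" using \<kappa> Rs R c by (intro divide_right_mono mult_mono) auto
        then show "R / c * \<tau> \<in> {-(s/c)..s/c}" using 1 unfolding atLeastAtMost_iff by linarith
      qed
      have HC: "\<bar>H j \<tau>\<bar> \<le> C" if "\<tau> \<in> {-\<kappa>..\<kappa>}" for j \<tau>
      proof -
        have "\<bar>h j (R / c * \<tau>)\<bar> * R ^ j \<le> C * (R ^ e * E)"
          using sb win(2)[OF that] unfolding scale_bound_def NR by blast
        then show ?thesis using R E by (simp add: H_def u_def abs_mult field_simps)
      qed
      \<comment> \<open>The remainder condition in \<open>root_curve\<close>, taken at r = R, says
        exactly that the rescaled Lipschitz constant is at most 1; \<open>R \<le> s\<close> allows
        to replace s^j by R^j.\<close>
      have HL: "lip_deriv m {-\<kappa>..\<kappa>} 1 (H j)" for j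
      proof -
        have "lip_deriv m {-\<kappa>..\<kappa>} (\<bar>u j\<bar> * \<bar>R / c\<bar> ^ Suc m * (Q / s ^ j)) (H j)"
          unfolding H_def using win(1) by (intro lip_deriv_rescale[OF lip]) blast
        moreover have "\<bar>u j\<bar> * \<bar>R / c\<bar> ^ Suc m * (Q / s ^ j) \<le> 1"
        proof -
          have "\<bar>u j\<bar> * \<bar>R / c\<bar> ^ Suc m * (Q / s ^ j) \<le> \<bar>u j\<bar> * \<bar>R / c\<bar> ^ Suc m * (Q / R ^ j)"
            using Q Rs R by (intro mult_left_mono divide_left_mono power_mono mult_pos_pos) auto
          also have "\<dots> = (Q * R ^ Suc m) / (c ^ Suc m * (R ^ e * E))"
            using R c E by (simp add: u_def power_divide mult_ac)
          also have "\<dots> \<le> 1" using Q(2)[of R] R Rs c E NR by (simp add: field_simps)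
          finally show ?thesis .
        qed
        ultimately show ?thesis by (rule lip_deriv_mono)
      qed
      have hypH: "\<exists>l ys. length ys = n \<and> sorted (map abs ys) \<and> (\<forall>j. H j \<tau> = coeff (smult l (lin_prod ys)) j)"
        if \<tau>: "\<tau> \<in> {-\<kappa>..\<kappa>}" for \<tau>
      proof -
        obtain zs0 where zs0: "length zs0 = n" "\<And>j. h j (R / c * \<tau>) = coeff (lin_prod zs0) j"
          using hyp[OF win(1)[OF \<tau>]] by auto
        obtain zs where zs: "length zs = n" "sorted (map abs zs)" "lin_prod zs = lin_prod zs0"
          using lin_prod_sorted[of zs0] zs0 by metis
        have "sorted (map abs (map (\<lambda>y. y / R) zs))"
          using zs R by (auto simp: sorted_iff_nth_mono divide_right_mono)
        moreover have "H j \<tau> = coeff (smult (R ^ n / (R ^ e * E)) (lin_prod (map (\<lambda>y. y / R) zs))) j" for j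
          using coeff_lin_prod_scale[of R zs j] R zs zs0(2)[of j] by (simp add: H_def u_def field_simps)
        ultimately show ?thesis using zs by (metis length_map)
      qed
      have h0b: "\<bar>H j 0\<bar> \<le> C1 * \<rho> ^ (e - j)" if "j < e" for j
      proof -
        have "\<bar>h j 0\<bar> \<le> 2 ^ n * prod_list (map abs (drop j ys))"
          using coeff_lin_prod_bound[OF srt, of j] by (simp add: h0 len)
        also have "\<dots> \<le> 2 ^ n * (r ^ (e - j) * E)"
          unfolding E_def using near that d len by (intro mult_left_mono prod_list_drop_le) (auto simp: e_def)
        finally have "u j * \<bar>h j 0\<bar> \<le> u j * (2 ^ n * (r ^ (e - j) * E))"
          using u[of j] by (intro mult_left_mono) auto
        also have "\<dots> = 2 ^ n * \<rho> ^ (e - j)"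
        proof -
          have "R ^ e = R ^ j * R ^ (e - j)" using that by (simp flip: power_add)
          then show ?thesis using R E by (simp add: u_def r\<rho> power_mult_distrib)
        qed
        also have "\<dots> \<le> C1 * \<rho> ^ (e - j)" using C1 \<rho> by (intro mult_right_mono) auto
        finally show ?thesis using u[of j] by (simp add: H_def abs_mult)
      qed
      have he: "\<bar>H e 0\<bar> \<ge> 3/4"
      proof (rule cluster_lead_coeff[where h="\<lambda>j. H j 0" and C=C1 and \<rho>=\<rho> and n=n and ys="map (\<lambda>y. y / R) ys" and l="R ^ n / (R ^ e * E)"])
        show "H j 0 = coeff (smult (R ^ n / (R ^ e * E)) (lin_prod (map (\<lambda>y. y / R) ys))) j" for j
          using coeff_lin_prod_scale[of R ys j] R len by (simp add: H_def u_def h0 field_simps)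
        have "R ^ n = R ^ e * R ^ length (drop e ys)" using d len by (simp add: e_def flip: power_add power_Suc)
        moreover have "prod_list (map abs (drop e (map (\<lambda>y. y / R) ys))) * R ^ length (drop e ys) = E"
          unfolding E_def drop_map by (rule prod_list_abs_scale[OF R])
        ultimately show "\<bar>R ^ n / (R ^ e * E)\<bar> * prod_list (map abs (drop e (map (\<lambda>y. y / R) ys))) = 1"
          using R E by (simp add: field_simps)
        show "\<bar>H j 0\<bar> \<le> C1" for j using HC[of 0 j] \<kappa> C1 by auto
        show "\<bar>H j 0\<bar> \<le> C1 * \<rho>" if "j < e" for j
        proof -
          have "\<rho> ^ (e - j) \<le> \<rho>" using that \<rho> power_decreasing[of 1 "e - j" \<rho>] by auto
          then show ?thesis using h0b[OF that] C1 by (meson mult_left_mono order_trans zero_le_one)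
        qed
        have "2 * real n * C1\<^sup>2 * \<rho> \<le> 2 * real n * C1\<^sup>2 * \<epsilon>'" using \<rho> by (intro mult_left_mono) auto
        then show "2 * real n * C1\<^sup>2 * \<rho> \<le> 1/4" using \<epsilon>' by linarith
      qed (use len d \<rho> in \<open>auto simp: e_def\<close>)
      have st: "\<bar>H j \<tau>\<bar> \<le> C2 * \<rho> ^ (e - j)" if "\<bar>\<tau>\<bar> \<le> k * \<rho>" "j < e" for j \<tau>
      proof (rule stage[OF _ _ _ _ _ _ _ that])
        show "\<exists>g. (\<forall>\<tau>\<in>{-\<kappa>..\<kappa>}. (H j has_real_derivative g \<tau>) (at \<tau> within {-\<kappa>..\<kappa>}) \<and> \<bar>g \<tau>\<bar> \<le> C1) \<and> C1-lipschitz_on {-\<kappa>..\<kappa>} g" for j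
        proof -
          obtain g where g: "\<forall>t\<in>{-\<kappa>..\<kappa>}. (H j has_real_derivative g t) (at t within {-\<kappa>..\<kappa>}) \<and> \<bar>g t\<bar> \<le> B"
             "B-lipschitz_on {-\<kappa>..\<kappa>} g" using B[OF HL HC] by blast
          have "C1-lipschitz_on {-\<kappa>..\<kappa>} g" using g(2) C1(3) by (rule lipschitz_on_le)
          moreover have "\<forall>t\<in>{-\<kappa>..\<kappa>}. (H j has_real_derivative g t) (at t within {-\<kappa>..\<kappa>}) \<and> \<bar>g t\<bar> \<le> C1"
            using g(1) C1(3) by force
          ultimately show ?thesis by blast
        qed
        show "\<bar>H j \<tau>\<bar> \<le> C1" if "\<tau> \<in> {-\<kappa>..\<kappa>}" for j \<tau> using HC[OF that, of j] C1 by linarith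
      qed (use \<rho> \<epsilon>' hypH h0b he in auto)
      show ?thesis unfolding scale_bound_def
      proof (intro allI impI)
        fix t j assume t: "\<bar>t\<bar> \<le> k * r / c"
        define \<tau> where "\<tau> = t * c / R"
        have \<tau>: "\<bar>\<tau>\<bar> \<le> k * \<rho>" using t R c by (simp add: \<tau>_def \<rho>_def abs_mult field_simps)
        have t\<tau>: "t = R / c * \<tau>" using R c by (simp add: \<tau>_def)
        \<comment> \<open>From index e on the old bound is sufficient, because \<rho>^j is at most
          \<rho>^e there. Only the indices below e need the cluster estimate.\<close>
        have "\<bar>H j \<tau>\<bar> * \<rho> ^ j \<le> C' * \<rho> ^ e"
        proof (cases "j < e")
          case True
          have "\<bar>H j \<tau>\<bar> * \<rho> ^ j \<le> (C2 * \<rho> ^ (e - j)) * \<rho> ^ j"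
            using st[OF \<tau> True] \<rho> by (intro mult_right_mono) auto
          also have "\<dots> = C2 * \<rho> ^ e" using True by (simp flip: power_add)
          also have "\<dots> \<le> C' * \<rho> ^ e" using C' \<rho> by (intro mult_right_mono) auto
          finally show ?thesis .
        next
          case False
          have "k * \<rho> \<le> \<kappa> * 1" using k \<kappa> \<rho> by (intro mult_mono) auto
          then have "\<tau> \<in> {-\<kappa>..\<kappa>}" using \<tau> unfolding atLeastAtMost_iff by linarith
          then have "\<bar>H j \<tau>\<bar> \<le> C'" using HC[of \<tau> j] C' by linarith
          moreover have "\<rho> ^ j \<le> \<rho> ^ e" using False \<rho> by (intro power_decreasing) auto
          ultimately show ?thesis using C' \<rho> by (intro mult_mono) auto
        qed
        moreover have "\<bar>h j t\<bar> * r ^ j = (R ^ e * E) * (\<bar>H j \<tau>\<bar> * \<rho> ^ j)"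
          using R E by (simp add: H_def u_def t\<tau> r\<rho> abs_mult power_mult_distrib)
        ultimately have "\<bar>h j t\<bar> * r ^ j \<le> (R ^ e * E) * (C' * \<rho> ^ e)"
          using R E by (simp add: mult_left_mono)
        then show "\<bar>h j t\<bar> * r ^ j \<le> C' * scale_prod ys r"
          unfolding Nr by (simp add: r\<rho> power_mult_distrib mult_ac)
      qed
    qed
  qed
  show ?thesis
    by (rule exI[of _ C'], rule conjI[OF C'(1)], rule exI[of _ k], rule conjI[OF k(1)],
        rule conjI[OF order_trans[OF k(2) \<kappa>(2)]])
      (intro allI impI, rule main, assumption, assumption, auto simp: e_def)
qed

text \<open>Downward induction over the sorted root distances. The case n is the scale s itself, the
  case d covers all scales from the distance of index d upwards, and the case 0 is the
  claim.\<close>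

lemma multiscale:
  fixes n m :: nat and K :: real
  assumes m: "m \<ge> 1" and n: "n \<ge> 1"
  shows "\<exists>C\<ge>1. \<exists>\<kappa>>0. \<kappa> \<le> 1 \<and> (\<forall>h c s ys Q r. root_curve n m K h c s ys Q \<longrightarrow> 0 < r \<longrightarrow> r \<le> s \<longrightarrow>
    \<bar>ys ! 0\<bar> \<le> r \<longrightarrow> scale_bound C \<kappa> h c ys r)"
proof -
  define P where "P d \<longleftrightarrow> (\<exists>C\<ge>1. \<exists>\<kappa>>0. \<kappa> \<le> 1 \<and> (\<forall>h c s ys Q r. root_curve n m K h c s ys Q \<longrightarrow> 0 < r \<longrightarrow> r \<le> s \<longrightarrow>
    (d < n \<longrightarrow> \<bar>ys ! d\<bar> \<le> r) \<longrightarrow> (d = n \<longrightarrow> r = s) \<longrightarrow> scale_bound C \<kappa> h c ys r))" for d :: nat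
  have "P d" if "d \<le> n" for d
    using that
  proof (induction rule: inc_induct)
    case base
    \<comment> \<open>All roots are within s, so N(s) = s^n and the bound with K in
      \<open>root_curve\<close> is what is needed.\<close>
    have "scale_bound (max 1 K) 1 h c ys s" if rc: "root_curve n m K h c s ys Q" for h c s ys Q
    proof -
      have "scale_prod ys s = s ^ n * prod_list (map abs (drop n ys))"
        using rc by (intro scale_prod_cluster) (auto simp: root_curve_def)
      then have N: "scale_prod ys s = s ^ n" using rc by (simp add: root_curve_def)
      have s: "s > 0" using rc by (simp add: root_curve_def)
      have "\<bar>h j t\<bar> * s ^ j \<le> max 1 K * s ^ n" if "\<bar>t\<bar> \<le> s / c" for t j
      proof -
        have "t \<in> {-(s/c)..s/c}" using that unfolding atLeastAtMost_iff by linarith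
        then have "\<bar>h j t\<bar> * s ^ j \<le> K * s ^ n" using rc unfolding root_curve_def by blast
        also have "\<dots> \<le> max 1 K * s ^ n" using s by (intro mult_right_mono) auto
        finally show ?thesis .
      qed
      then show ?thesis by (simp add: scale_bound_def N)
    qed
    then show ?case unfolding P_def
      by (intro exI[of _ "max 1 K"] conjI exI[of _ "1::real"]) auto
  next
    case (step d)
    obtain C \<kappa> where C: "C \<ge> 1" "\<kappa> > 0" "\<kappa> \<le> 1" and IH:
      "\<And>h c s ys Q r. root_curve n m K h c s ys Q \<Longrightarrow> 0 < r \<Longrightarrow> r \<le> s \<Longrightarrow>
        (Suc d < n \<Longrightarrow> \<bar>ys ! Suc d\<bar> \<le> r) \<Longrightarrow> (Suc d = n \<Longrightarrow> r = s) \<Longrightarrow> scale_bound C \<kappa> h c ys r"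
      using step.IH unfolding P_def by blast
    have "Suc d \<le> n" using step by simp
    from multiscale_step[OF m this C, of K]
    obtain C' \<kappa>' where C': "C' \<ge> 1" "\<kappa>' > 0" "\<kappa>' \<le> 1" and st:
      "\<And>h c s ys Q R r. root_curve n m K h c s ys Q \<Longrightarrow>
    scale_bound C \<kappa> h c ys R \<Longrightarrow> (\<And>i. i<Suc d \<Longrightarrow> \<bar>ys ! i\<bar> \<le> r) \<Longrightarrow> (\<And>i. i<n \<Longrightarrow> Suc d \<le> i \<Longrightarrow> R \<le> \<bar>ys ! i\<bar>) \<Longrightarrow>
    0 < r \<Longrightarrow> r \<le> R \<Longrightarrow> R \<le> s \<Longrightarrow> scale_bound C' \<kappa>' h c ys r"
      by metis
    have "scale_bound (max C C') (min \<kappa> \<kappa>') h c ys r"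
      if rc: "root_curve n m K h c s ys Q" and r: "0 < r" "r \<le> s" and d: "\<bar>ys ! d\<bar> \<le> r" for h c s ys Q r
    proof -
      have c: "c > 0" and len: "length ys = n" and srt: "sorted (map abs ys)"
        and s: "\<And>y. y \<in> set ys \<Longrightarrow> \<bar>y\<bar> \<le> s" using rc by (auto simp: root_curve_def)
      \<comment> \<open>R is the next root distance, or s if there is none: the smallest scale that
        the induction hypothesis reaches.\<close>
      define R where "R = (if Suc d < n then \<bar>ys ! Suc d\<bar> else s)"
      have R: "R \<le> s" using s len by (auto simp: R_def)
      show ?thesis
      proof (cases "R \<le> r")
        case True
        then have "scale_bound C \<kappa> h c ys r"
          using r step.hyps by (intro IH[OF rc]) (auto simp: R_def split: if_splits)
        then show ?thesis using r c by (auto elim!: scale_bound_mono)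
      next
        case False
        have mono: "\<bar>ys ! i\<bar> \<le> \<bar>ys ! i'\<bar>" if "i \<le> i'" "i' < n" for i i'
          using srt that len sorted_nth_mono[of "map abs ys" i i'] by auto
        have "scale_bound C \<kappa> h c ys R"
          using r False R by (intro IH[OF rc]) (auto simp: R_def)
        then have "scale_bound C' \<kappa>' h c ys r"
        proof (rule st[OF rc])
          show "\<bar>ys ! i\<bar> \<le> r" if "i < Suc d" for i
            using mono[of i d] that step.hyps d by linarith
          show "R \<le> \<bar>ys ! i\<bar>" if "i < n" "Suc d \<le> i" for i
            using mono[of "Suc d" i] that by (auto simp: R_def)
        qed (use r False R in auto)
        then show ?thesis using r c by (auto elim!: scale_bound_mono)
      qed
    qed
    then show ?case using C C' step.hyps unfolding P_def
      by (intro exI[of _ "max C C'"] conjI exI[of _ "min \<kappa> \<kappa>'"]) auto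
  qed
  from this[of 0] show ?thesis using n unfolding P_def by simp
qed

text \<open>A scaled form of Cauchy's bound for roots. Let 0 be a root of multiplicity d at time 0.
  At time t the scale r = c |t| / \<kappa> controls h_j for j < d, a fixed scale R controls h_j for
  j > d, and h_d stays away from 0. A small root much larger than r would let the term of index d
  dominate the others. The neighbourhood depends on the curve, the constant does not.\<close>

lemma root_curve_speed:
  fixes n m :: nat and K :: real
  assumes m: "m \<ge> 1" and n: "n \<ge> 1"
  shows "\<exists>C>0. \<forall>h c s ys Q y. root_curve n m K h c s ys Q \<longrightarrow> isCont y 0 \<longrightarrow> y 0 = 0 \<longrightarrow>
    (\<forall>t. \<bar>t\<bar> \<le> s / c \<longrightarrow> (\<Sum>j\<le>n. h j t * y t ^ j) = 0) \<longrightarrow>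
    (\<forall>\<^sub>F t in nhds 0. \<bar>y t\<bar> \<le> C * c * \<bar>t\<bar>)"
proof -
  obtain C \<kappa> where C: "C \<ge> 1" and \<kappa>: "\<kappa> > 0" "\<kappa> \<le> 1" and ms:
    "\<And>h c s ys Q r. root_curve n m K h c s ys Q \<Longrightarrow> 0 < r \<Longrightarrow> r \<le> s \<Longrightarrow>
    \<bar>ys ! 0\<bar> \<le> r \<Longrightarrow> scale_bound C \<kappa> h c ys r"
    using multiscale[OF m n, of K] by metis
  \<comment> \<open>The root is shown to be at most 4 C n r; the factor 1 / \<kappa> comes from
    r.\<close>
  define C' where "C' = 4 * C * real n / \<kappa>"
  have n1: "real n \<ge> 1" using n by simp
  have Cn: "4 * C * real n \<ge> 1"
  proof -
    have "1 * 1 \<le> (4 * C) * real n" using C n1 by (intro mult_mono) auto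
    then show ?thesis by simp
  qed
  have C': "C' > 0" using Cn \<kappa> by (simp add: C'_def)
  have main: "\<forall>\<^sub>F t in nhds 0. \<bar>y t\<bar> \<le> C' * c * \<bar>t\<bar>"
    if rc: "root_curve n m K h c s ys Q" and y: "isCont y 0" "y 0 = 0"
      and root: "\<And>t. \<bar>t\<bar> \<le> s / c \<Longrightarrow> (\<Sum>j\<le>n. h j t * y t ^ j) = 0" for h c s ys Q y
  proof -
    have c: "c > 0" and s: "s > 0" and len: "length ys = n" and srt: "sorted (map abs ys)"
      and h0: "\<And>j. h j 0 = coeff (lin_prod ys) j"
      and lip: "\<And>j. lip_deriv m {-(s/c)..s/c} (Q / s ^ j) (h j)"
      and ys: "\<And>y. y \<in> set ys \<Longrightarrow> \<bar>y\<bar> \<le> s"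
      using rc unfolding root_curve_def by auto
    have mono: "\<bar>ys ! i\<bar> \<le> \<bar>ys ! i'\<bar>" if "i \<le> i'" "i' < n" for i i'
      using srt that len sorted_nth_mono[of "map abs ys" i i'] by auto
    have "h 0 0 = 0"
    proof -
      have "(\<Sum>j\<le>n. h j 0 * y 0 ^ j) = h 0 0"
        using y by (subst sum.remove[of _ 0]) auto
      then show ?thesis using root[of 0] s c by simp
    qed
    then have "poly (lin_prod ys) 0 = 0" by (simp add: h0 poly_0_coeff_0)
    then have "0 \<in> set ys" by (auto simp: poly_lin_prod prod_list_zero_iff)
    then obtain i where "i < n" "ys ! i = 0" using len by (auto simp: in_set_conv_nth)
    then have y0: "ys ! 0 = 0" using mono[of 0 i] by auto
    \<comment> \<open>The multiplicity of the root 0 at time 0, as the entries are sorted by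
      absolute value.\<close>
    define d where "d = (LEAST i. i = n \<or> ys ! i \<noteq> 0)"
    have d: "d = n \<or> ys ! d \<noteq> 0" unfolding d_def by (rule LeastI[of _ n]) auto
    have dn: "d \<le> n" unfolding d_def by (rule Least_le) auto
    have near: "ys ! i = 0" if "i < d" for i
      using not_less_Least[of i "\<lambda>i. i = n \<or> ys ! i \<noteq> 0"] that unfolding d_def by auto
    have "d \<noteq> 0" using d y0 n by (metis not_one_le_zero)
    define R where "R = (if d < n then \<bar>ys ! d\<bar> else s)"
    have R: "0 < R" "R \<le> s" using d dn s ys len by (auto simp: R_def)
    have far: "R \<le> \<bar>ys ! i\<bar>" if "d \<le> i" "i < n" for i using mono[OF that] that by (auto simp: R_def)
    define E where "E = prod_list (map abs (drop d ys))"
    have Nr: "scale_prod ys r = r ^ d * E" if "0 < r" "r \<le> R" for r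
      unfolding E_def using that near far dn len by (intro scale_prod_cluster) force+
    have E: "E > 0" using Nr[OF R(1)] scale_prod_pos[OF R(1), of ys] R by (simp add: zero_less_mult_iff)
    have sb: "\<bar>h j t\<bar> * r ^ j \<le> C * (r ^ d * E)" if "0 < r" "r \<le> R" "\<bar>t\<bar> \<le> \<kappa> * r / c" for r t j
    proof -
      have "scale_bound C \<kappa> h c ys r" using that R y0 by (intro ms[OF rc]) auto
      then show ?thesis using that by (auto simp: scale_bound_def Nr)
    qed
    have hd0: "\<bar>h d 0\<bar> \<ge> 3/4 * E"
    proof -
      have "\<bar>h d 0 / E\<bar> \<ge> 3/4"
      \<comment> \<open>The coefficients below d vanish, so \<rho> = 0 is possible. Then
        \<open>C\<close> may depend on the curve, since the resulting bound 3/4 does not contain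
        it.\<close>
      proof (rule cluster_lead_coeff[where h="\<lambda>j. h j 0 / E" and l="1 / E" and \<rho>=0 and C="\<Sum>j\<le>n. \<bar>h j 0 / E\<bar>" and n=n and ys=ys])
        show "\<bar>1 / E\<bar> * prod_list (map abs (drop d ys)) = 1" using E by (simp add: E_def)
        show "\<bar>h j 0 / E\<bar> \<le> (\<Sum>j\<le>n. \<bar>h j 0 / E\<bar>)" for j
        proof (cases "j \<le> n")
          case True
          then show ?thesis by (intro member_le_sum) auto
        next
          case False
          then show ?thesis using len by (simp add: h0 coeff_lin_prod_gt sum_nonneg)
        qed
        show "\<bar>h j 0 / E\<bar> \<le> (\<Sum>j\<le>n. \<bar>h j 0 / E\<bar>) * 0" if "j < d" for j
        proof -
          have "\<bar>h j 0\<bar> \<le> 2 ^ n * prod_list (map abs (drop j ys))"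
            using coeff_lin_prod_bound[OF srt, of j] by (simp add: h0 len)
          also have "\<dots> \<le> 2 ^ n * (0 ^ (d - j) * E)"
            unfolding E_def using near that dn len by (intro mult_left_mono prod_list_drop_le) auto
          finally have "\<bar>h j 0\<bar> \<le> 2 ^ n * (0 ^ (d - j) * E)" .
          moreover have "(0::real) ^ (d - j) = 0" using that by simp
          ultimately show ?thesis by simp
        qed
      qed (use len dn h0 in auto)
      then show ?thesis using E by (simp add: field_simps)
    qed
    have sc: "s / c > 0" using s c by simp
    have cont: "isCont (h d) 0"
    proof -
      obtain D where "(h d has_real_derivative D) (at 0 within {-(s/c)..s/c})"
        using lip[of d] m sc unfolding lip_deriv_def by (metis atLeastAtMost_iff less_eq_real_def less_le_trans neg_less_0_iff_less zero_less_one One_nat_def Suc_le_lessD)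
      then have "continuous (at 0 within {-(s/c)..s/c}) (h d)" by (rule DERIV_continuous)
      moreover have "0 \<in> interior {-(s/c)..s/c}" using sc by simp
      ultimately show ?thesis using at_within_interior by metis
    qed
    then have "((\<lambda>t. \<bar>h d t\<bar>) \<longlongrightarrow> \<bar>h d 0\<bar>) (nhds 0)"
      by (intro tendsto_rabs) (simp add: isCont_def tendsto_at_iff_tendsto_nhds)
    moreover have "E / 2 < \<bar>h d 0\<bar>" using hd0 E by linarith
    ultimately have ev1: "\<forall>\<^sub>F t in nhds 0. E / 2 < \<bar>h d t\<bar>" by (rule order_tendstoD)
    have "((\<lambda>t. \<bar>y t\<bar>) \<longlongrightarrow> \<bar>y 0\<bar>) (nhds 0)"
      using y(1) by (intro tendsto_rabs) (simp add: isCont_def tendsto_at_iff_tendsto_nhds)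
    moreover have "\<bar>y 0\<bar> < R / (4 * C * real n)" using y R Cn by simp
    ultimately have ev2: "\<forall>\<^sub>F t in nhds 0. \<bar>y t\<bar> < R / (4 * C * real n)" by (rule order_tendstoD)
    have ev3: "\<forall>\<^sub>F t in nhds 0. \<bar>t\<bar> < \<kappa> * R / c"
    proof -
      have "((\<lambda>t::real. \<bar>t\<bar>) \<longlongrightarrow> \<bar>0\<bar>) (nhds 0)" by (intro tendsto_rabs filterlim_ident)
      moreover have "\<bar>0\<bar> < \<kappa> * R / c" using \<kappa> R c by simp
      ultimately show ?thesis by (rule order_tendstoD)
    qed
    show ?thesis
      using ev1 ev2 ev3
    proof eventually_elim
      case (elim t)
      show ?case
      proof (cases "t = 0")
        case True
        then show ?thesis using y by simp
      next
        case False
        \<comment> \<open>The smallest scale whose time window still contains t.\<close>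
        define r where "r = c * \<bar>t\<bar> / \<kappa>"
        have r: "0 < r" "r \<le> R" "\<bar>t\<bar> \<le> \<kappa> * r / c"
          using elim(3) False c \<kappa> by (auto simp: r_def field_simps)
        have tR: "\<bar>t\<bar> \<le> \<kappa> * R / c" using elim(3) by simp
        have "\<kappa> * R / c \<le> 1 * s / c" using \<kappa> R c by (intro divide_right_mono mult_mono) auto
        then have ts: "\<bar>t\<bar> \<le> s / c" using tR by linarith
        define Y where "Y = \<bar>y t\<bar>"
        have Y: "0 \<le> Y" "Y * (4 * C * real n) \<le> R" using elim(2) Cn by (auto simp: Y_def field_simps)
        have YR: "Y \<le> R"
        proof -
          have "Y * 1 \<le> Y * (4 * C * real n)" using Cn Y by (intro mult_left_mono) auto
          then show ?thesis using Y(2) by linarith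
        qed
        have "Y \<le> 4 * C * real n * r"
        proof (cases "Y \<le> r")
          case True
          have "1 * r \<le> 4 * C * real n * r" using Cn r by (intro mult_right_mono) auto
          then show ?thesis using True by linarith
        next
          case Yr: False
          have pw: "x ^ j = x * x ^ i * x ^ (j - Suc i)" if "i < j" for x :: real and i j
          proof -
            have "x ^ j = x ^ Suc (i + (j - Suc i))" using that by simp
            then show ?thesis by (simp only: power_Suc power_add mult.assoc)
          qed
          \<comment> \<open>The neighbourhood was chosen so that Y \<le> R / (4 C n). Thus each term
            above d is at most a share 1 / (4 n) of E Y^d, and together they take at most a
            quarter.\<close>
          have jgt: "\<bar>h j t * y t ^ j\<bar> \<le> E * Y ^ d / (4 * real n)" if "d < j" for j
          proof -
            have "\<bar>h j t * y t ^ j\<bar> * R ^ j = (\<bar>h j t\<bar> * R ^ j) * Y ^ j" by (simp add: Y_def abs_mult power_abs)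
            also have "\<dots> \<le> (C * (R ^ d * E)) * Y ^ j" using sb[OF R(1) _ tR, of j] Y by (intro mult_right_mono) auto
            also have "Y ^ j = Y ^ d * Y * Y ^ (j - Suc d)" using pw[OF that] by (simp add: mult.commute)
            also have "(C * (R ^ d * E)) * (Y ^ d * Y * Y ^ (j - Suc d)) \<le> (C * (R ^ d * E)) * (Y ^ d * Y * R ^ (j - Suc d))"
              using Y YR R C E by (intro mult_left_mono power_mono) auto
            also have "\<dots> = C * Y * (E * Y ^ d) * R ^ d * R ^ (j - Suc d)" by (simp add: mult_ac)
            also have "\<dots> \<le> R / (4 * real n) * (E * Y ^ d) * R ^ d * R ^ (j - Suc d)"
            proof -
              have "C * Y \<le> R / (4 * real n)" using Y n1 by (simp add: field_simps)
              then show ?thesis using E Y R by (intro mult_right_mono) auto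
            qed
            also have "R / (4 * real n) * (E * Y ^ d) * R ^ d * R ^ (j - Suc d) = E * Y ^ d / (4 * real n) * (R * R ^ d * R ^ (j - Suc d))"
              by simp
            also have "R * R ^ d * R ^ (j - Suc d) = R ^ j" using pw[OF that] by simp
            finally show ?thesis by (rule mult_right_le_imp_le) (use R in simp)
          qed
          \<comment> \<open>Because Y > r, the estimate for j = d - 1 is the worst.\<close>
          have jlt: "\<bar>h j t * y t ^ j\<bar> \<le> C * E * (r * Y ^ (d - 1))" if "j < d" for j
          proof -
            have "\<bar>h j t * y t ^ j\<bar> * r ^ j = (\<bar>h j t\<bar> * r ^ j) * Y ^ j" by (simp add: Y_def abs_mult power_abs)
            also have "\<dots> \<le> (C * (r ^ d * E)) * Y ^ j" using sb[OF r, of j] Y by (intro mult_right_mono) auto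
            also have "r ^ d = r * r ^ (d - Suc j) * r ^ j" using pw[OF that] by (simp add: mult_ac)
            also have "(C * (r * r ^ (d - Suc j) * r ^ j * E)) * Y ^ j = (C * E * r * r ^ j) * (r ^ (d - Suc j) * Y ^ j)"
              by (simp add: mult_ac)
            also have "\<dots> \<le> (C * E * r * r ^ j) * (Y ^ (d - Suc j) * Y ^ j)"
              using r Yr Y C E by (intro mult_left_mono mult_right_mono power_mono) auto
            also have "Y ^ (d - Suc j) * Y ^ j = Y ^ (d - 1)" using that by (simp flip: power_add)
            finally have "\<bar>h j t * y t ^ j\<bar> * r ^ j \<le> C * E * (r * Y ^ (d - 1)) * r ^ j" by (simp add: mult_ac)
            then show ?thesis by (rule mult_right_le_imp_le) (use r in simp)
          qed
          let ?f = "\<lambda>j. h j t * y t ^ j"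
          have "(\<Sum>j\<le>n. ?f j) = ?f d + (\<Sum>j\<in>{..n} - {d}. ?f j)"
            using dn by (intro sum.remove) auto
          then have "\<bar>?f d\<bar> = \<bar>\<Sum>j\<in>{..n} - {d}. ?f j\<bar>" using root[OF ts] by simp
          also have "\<dots> \<le> (\<Sum>j\<in>{..n} - {d}. \<bar>?f j\<bar>)" by (rule sum_abs)
          also have "\<dots> \<le> (\<Sum>j\<in>{..n} - {d}. E * Y ^ d / (4 * real n) + C * E * (r * Y ^ (d - 1)))"
          proof (rule sum_mono)
            fix j assume j: "j \<in> {..n} - {d}"
            have "0 \<le> E * Y ^ d / (4 * real n)" "0 \<le> C * E * (r * Y ^ (d - 1))" using E Y C r by auto
            then show "\<bar>?f j\<bar> \<le> E * Y ^ d / (4 * real n) + C * E * (r * Y ^ (d - 1))"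
              using j jlt[of j] jgt[of j] by (cases "j < d") auto
          qed
          also have "\<dots> = real n * (E * Y ^ d / (4 * real n) + C * E * (r * Y ^ (d - 1)))"
            using dn by (simp add: card_Diff_singleton)
          also have "\<dots> = E * Y ^ d / 4 + real n * C * E * r * Y ^ (d - 1)"
            using n1 by (simp add: field_simps)
          finally have "\<bar>h d t\<bar> * Y ^ d \<le> E * Y ^ d / 4 + real n * C * E * r * Y ^ (d - 1)"
            by (simp add: Y_def abs_mult power_abs)
          moreover have "E / 2 * Y ^ d \<le> \<bar>h d t\<bar> * Y ^ d" using elim(1) Y by (intro mult_right_mono) auto
          ultimately have "E * Y ^ d / 4 \<le> real n * C * E * r * Y ^ (d - 1)" by simp
          moreover have "Y ^ d = Y * Y ^ (d - 1)" using \<open>d \<noteq> 0\<close> by (cases d) auto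
          ultimately have "(E * Y ^ (d - 1)) * Y \<le> (E * Y ^ (d - 1)) * (4 * C * real n * r)" by (simp add: mult_ac)
          moreover have "E * Y ^ (d - 1) > 0" using E Yr r by simp
          ultimately show ?thesis by (simp only: mult_le_cancel_left_pos)
        qed
        then show ?thesis using \<kappa> by (simp add: Y_def r_def C'_def)
      qed
    qed
  qed
  show ?thesis by (rule exI[of _ C'], rule conjI[OF C']) (intro allI impI, rule main, auto)
qed

subsection \<open>Centered curves of polynomials\<close>

lemma lip_deriv_cmult: "lip_deriv m S L f \<Longrightarrow> lip_deriv m S (\<bar>u\<bar> * L) (\<lambda>t. u * f t)"
  using lip_deriv_rescale[of m S L f 1 S u] by simp

lemma lip_deriv_const: "lip_deriv m S 0 (\<lambda>t. a)"
  unfolding lip_deriv_def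
  by (rule exI[of _ "\<lambda>k t. if k = 0 then a else 0"]) (auto simp: lipschitz_on_def)

lemma lip_deriv_add:
  assumes "lip_deriv m S L f" "lip_deriv m S L' f'"
  shows "lip_deriv m S (L + L') (\<lambda>t. f t + f' t)"
proof -
  obtain D where D: "D 0 = f"
    "\<And>k t. k < m \<Longrightarrow> t \<in> S \<Longrightarrow> (D k has_real_derivative D (Suc k) t) (at t within S)"
    "L-lipschitz_on S (D m)" using assms(1) by (auto simp: lip_deriv_def)
  obtain D' where D': "D' 0 = f'"
    "\<And>k t. k < m \<Longrightarrow> t \<in> S \<Longrightarrow> (D' k has_real_derivative D' (Suc k) t) (at t within S)"
    "L'-lipschitz_on S (D' m)" using assms(2) by (auto simp: lip_deriv_def)
  show ?thesis unfolding lip_deriv_def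
    using D D' by (intro exI[of _ "\<lambda>k t. D k t + D' k t"]) (auto intro!: lipschitz_on_add DERIV_add)
qed

lemma lip_deriv_sum:
  assumes "finite A" "\<And>i. i \<in> A \<Longrightarrow> lip_deriv m S (L i) (f i)"
  shows "lip_deriv m S (\<Sum>i\<in>A. L i) (\<lambda>t. \<Sum>i\<in>A. f i t)"
  using assms by (induction A) (auto intro: lip_deriv_add lip_deriv_const)

lemma lip_deriv_cong:
  assumes f: "lip_deriv m S L f" and eq: "\<And>t. t \<in> S \<Longrightarrow> f t = f' t"
  shows "lip_deriv m S L f'"
proof -
  obtain D where D: "D 0 = f"
    "\<And>k t. k < m \<Longrightarrow> t \<in> S \<Longrightarrow> (D k has_real_derivative D (Suc k) t) (at t within S)"
    "L-lipschitz_on S (D m)" using f by (auto simp: lip_deriv_def)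
  define D' where "D' k = (if k = 0 then f' else D k)" for k
  have E: "D' k t = D k t" if "t \<in> S" for k t using eq[OF that] D(1) by (simp add: D'_def)
  have "(D' k has_real_derivative D' (Suc k) t) (at t within S)" if "k < m" "t \<in> S" for k t
  proof -
    have "(D k has_real_derivative D' (Suc k) t) (at t within S)" using D(2)[OF that] by (simp add: D'_def)
    then show ?thesis by (rule has_field_derivative_transform_within[of _ _ _ _ 1]) (use that E in auto)
  qed
  moreover have "L-lipschitz_on S (D' m)"
    using D(3) by (rule lipschitz_on_transform) (simp add: E)
  moreover have "D' 0 = f'" by (simp add: D'_def)
  ultimately show ?thesis unfolding lip_deriv_def by blast
qed

lemma lip_deriv_translate:
  assumes f: "lip_deriv m S L f" and S: "(\<lambda>\<tau>. a + \<tau>) ` T \<subseteq> S"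
  shows "lip_deriv m T L (\<lambda>\<tau>. f (a + \<tau>))"
proof -
  obtain D where D: "D 0 = f"
    "\<And>k t. k < m \<Longrightarrow> t \<in> S \<Longrightarrow> (D k has_real_derivative D (Suc k) t) (at t within S)"
    "L-lipschitz_on S (D m)" using f by (auto simp: lip_deriv_def)
  have "((\<lambda>\<tau>. D k (a + \<tau>)) has_real_derivative D (Suc k) (a + t)) (at t within T)" if "k < m" "t \<in> T" for k t
  proof -
    have "(D k has_real_derivative D (Suc k) (a + t)) (at (a + t) within (\<lambda>\<tau>. a + \<tau>) ` T)"
      using D(2)[OF that(1), of "a + t"] that S by (meson DERIV_subset image_subset_iff)
    moreover have "((\<lambda>\<tau>. a + \<tau>) has_real_derivative 1) (at t within T)"
      by (auto intro!: derivative_eq_intros)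
    ultimately have "((D k \<circ> (\<lambda>\<tau>. a + \<tau>)) has_real_derivative D (Suc k) (a + t) * 1) (at t within T)"
      by (rule DERIV_image_chain)
    then show ?thesis by (simp add: comp_def)
  qed
  moreover have "L-lipschitz_on T (\<lambda>\<tau>. D m (a + \<tau>))"
  proof (rule lipschitz_onI)
    fix x y assume "x \<in> T" "y \<in> T"
    then show "dist (D m (a + x)) (D m (a + y)) \<le> L * dist x y"
      using lipschitz_onD[OF D(3), of "a + x" "a + y"] S by auto
  qed (rule lipschitz_on_nonneg[OF D(3)])
  ultimately show ?thesis unfolding lip_deriv_def
    using D(1) by (intro exI[of _ "\<lambda>k \<tau>. D k (a + \<tau>)"]) auto
qed

section \<open>Translated polynomials and the size of their roots\<close>

lemma pcompose_lin_prod: "pcompose (lin_prod ys) [:u, 1:] = lin_prod (map (\<lambda>y. y - u) ys)"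
proof (induction ys)
  case (Cons y ys)
  have "pcompose [:- y, 1:] [:u, 1:] = [:- (y - u), 1:]" by (simp add: pcompose_pCons)
  then show ?case unfolding list.map lin_prod_simps pcompose_mult Cons.IH by (rule arg_cong)
qed (simp add: pcompose_1)

lemma coeff_pcompose_translate:
  fixes q :: "real poly"
  assumes "degree q \<le> n"
  shows "coeff (pcompose q [:u, 1:]) j = (\<Sum>k\<le>n. coeff q k * (real (k choose j) * u ^ (k - j)))"
proof -
  have 0: "pcompose q [:u, 1:] = (\<Sum>k\<le>n. pcompose (monom (coeff q k) k) [:u, 1:])"
    unfolding pcompose_sum[symmetric] poly_as_sum_of_monoms'[OF assms] ..
  have m: "pcompose (monom a k) [:u, 1:] = smult a ([:u, 1:] ^ k)" for a :: real and k
  proof (induction k)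
    case (Suc k)
    have "pcompose (monom a (Suc k)) [:u, 1:] = [:u, 1:] * pcompose (monom a k) [:u, 1:]"
      unfolding monom_Suc pcompose_pCons by simp
    then show ?case unfolding Suc by simp
  qed (simp add: monom_0)
  have 1: "pcompose q [:u, 1:] = (\<Sum>k\<le>n. smult (coeff q k) ([:u, 1:] ^ k))"
    unfolding 0 m ..
  have 2: "coeff ([:u, 1:] ^ k) j = real (k choose j) * u ^ (k - j)" for k
  proof (cases "j \<le> k")
    case True
    then show ?thesis unfolding coeff_linear_poly_power[OF True] by simp
  next
    case False
    then have "coeff ([:u, 1:] ^ k) j = 0" by (intro coeff_eq_0) (simp add: degree_linear_power)
    then show ?thesis using False by (simp only: binomial_eq_0 not_le)
  qed
  show ?thesis unfolding 1 coeff_sum coeff_smult 2 ..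
qed

lemma coeff_lin_prod_sum:
  assumes "ys \<noteq> []"
  shows "coeff (lin_prod ys) (length ys - 1) = - sum_list ys"
  using assms
proof (induction ys)
  case (Cons y ys)
  show ?case
  proof (cases "ys = []")
    case False
    then have "coeff (lin_prod (y # ys)) (length ys) = coeff (lin_prod ys) (length ys - 1) - y * coeff (lin_prod ys) (length ys)"
      unfolding lin_prod_simps coeff_linear_times by simp
    then show ?thesis using Cons False by simp
  qed simp
qed simp

text \<open>If the roots have sum 0, the sum of their squares is -2 times the coefficient of
  Z^(n-2), and it dominates every single square. The square identity at index n - 1 gives this for
  the largest root, with three nonzero terms left.\<close>

lemma root_square_le:
  assumes len: "length ys = n" and n: "n \<ge> 2" and z: "coeff (lin_prod ys) (n - 1) = 0" and y: "y \<in> set ys"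
  shows "y\<^sup>2 \<le> - (2 * coeff (lin_prod ys) (n - 2))"
proof -
  obtain zs where zs: "mset zs = mset ys" "length zs = length ys" "sorted (map abs zs)" "lin_prod zs = lin_prod ys"
    by (rule lin_prod_sorted)
  define h where "h j = coeff (lin_prod zs) j" for j
  have h: "h n = 1" "h (n - 1) = 0" "\<And>j. j > n \<Longrightarrow> h j = 0"
    using zs z len lead_coeff_lin_prod[of zs] by (auto simp: h_def coeff_lin_prod_gt)
  obtain k where k: "n = k + 2" using n by (metis add.commute le_Suc_ex)
  have "y \<in> set zs" using y zs(1) by (metis set_mset_mset)
  then obtain i where i: "i < n" "zs ! i = y" using zs(2) len by (auto simp: in_set_conv_nth)
  have "\<bar>zs ! i\<bar> \<le> \<bar>zs ! (n - 1)\<bar>"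
    using zs(2,3) i len sorted_nth_mono[of "map abs zs" i "n - 1"] by auto
  then have "y\<^sup>2 \<le> (zs ! (n - 1))\<^sup>2" using i by (metis abs_le_square_iff)
  also have "\<dots> = 1\<^sup>2 * prod_list (map power2 (drop (n - 1) zs))"
    using Cons_nth_drop_Suc[of "n - 1" zs] zs(2) len n by (auto simp flip: Cons_nth_drop_Suc)
  also have "\<dots> \<le> (\<Sum>i\<le>2 * (n - 1). (-1) ^ (n - 1 + i) * h i * h (2 * (n - 1) - i))"
    by (rule coeff_square_identity) (use zs(2) len in \<open>auto simp: h_def\<close>)
  also have "\<dots> = (\<Sum>i\<in>{k, k + 1, k + 2}. (-1) ^ (n - 1 + i) * h i * h (2 * (n - 1) - i))"
  proof (intro sum.mono_neutral_right ballI)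
    fix i assume i: "i \<in> {..2 * (n - 1)} - {k, k + 1, k + 2}"
    have "n < i \<or> n < 2 * (n - 1) - i" using i k by auto
    then show "(-1) ^ (n - 1 + i) * h i * h (2 * (n - 1) - i) = 0" using h(3) by auto
  qed (use k in auto)
  also have "\<dots> = - (2 * h k)" using h k by simp
  finally show ?thesis using zs k by (simp add: h_def)
qed

text \<open>A converse to \<open>root_square_le\<close>: the coefficient is a sum of products of two
  roots.\<close>

lemma abs_coeff_le_root_square:
  assumes len: "length ys = n" and n: "n \<ge> 2" and y: "\<And>y. y \<in> set ys \<Longrightarrow> \<bar>y\<bar> \<le> Y"
  shows "\<bar>coeff (lin_prod ys) (n - 2)\<bar> \<le> 2 ^ n * Y\<^sup>2"
proof -
  obtain zs where zs: "mset zs = mset ys" "length zs = length ys" "sorted (map abs zs)" "lin_prod zs = lin_prod ys"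
    by (rule lin_prod_sorted)
  have "set zs = set ys" using zs(1) by (metis set_mset_mset)
  then have "\<bar>zs ! i\<bar> \<le> Y" if "i < n" for i using y[of "zs ! i"] nth_mem[of i zs] that zs(2) len by simp
  then have "prod_list (map abs (drop (n - 2) zs)) \<le> Y ^ (n - (n - 2)) * prod_list (map abs (drop n zs))"
    using zs(2) len n by (intro prod_list_drop_le) auto
  also have "\<dots> = Y\<^sup>2" using zs(2) len n by simp
  finally have "2 ^ n * prod_list (map abs (drop (n - 2) zs)) \<le> 2 ^ n * Y\<^sup>2"
    by (intro mult_left_mono) auto
  moreover have "\<bar>coeff (lin_prod ys) (n - 2)\<bar> \<le> 2 ^ n * prod_list (map abs (drop (n - 2) zs))"
    using coeff_lin_prod_bound[OF zs(3), of "n - 2"] zs(2,4) len by simp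
  ultimately show ?thesis by linarith
qed

text \<open>Glaeser's inequality: a nonnegative function whose derivative is c^2-Lipschitz has slope
  at most a multiple of c times the root of its value, so it stays comparable over times of order s
  / c. It is applied to minus the coefficient of Z^(n-2), which measures the squared size of the
  roots.\<close>

lemma glaeser:
  fixes f g :: "real \<Rightarrow> real"
  assumes f: "\<And>x. x \<in> {-w..w} \<Longrightarrow> (f has_real_derivative g x) (at x within {-w..w})"
    and g: "(c\<^sup>2)-lipschitz_on {-w..w} g" and nn: "\<And>x. x \<in> {-w..w} \<Longrightarrow> f x \<ge> 0"
    and f0: "f 0 = s\<^sup>2" and s: "0 < s" "s \<le> c * w" and c: "c > 0" and x: "\<bar>x\<bar> \<le> s / (2 * c)"
  shows "f x \<le> 4 * s\<^sup>2"
proof -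
  define r where "r = s / (2 * c)"
  have r: "r > 0" "r \<le> w"
  proof -
    show "r > 0" using s c by (simp add: r_def)
    have "s / (2 * c) \<le> s / c" using s c by (intro divide_left_mono) auto
    also have "\<dots> \<le> w" using s c by (simp add: field_simps)
    finally show "r \<le> w" by (simp add: r_def)
  qed
  have T: "\<bar>f y - f 0 - g 0 * y\<bar> \<le> s\<^sup>2 / 4" if "\<bar>y\<bar> \<le> r" for y
  proof -
    have "\<bar>f y - f 0 - g 0 * y\<bar> \<le> c\<^sup>2 * y\<^sup>2"
      using that r by (intro taylor_lipschitz_deriv[OF f g]) auto
    also have "\<dots> \<le> c\<^sup>2 * r\<^sup>2"
      using that r by (intro mult_left_mono) (auto simp: abs_le_square_iff[symmetric])
    also have "\<dots> = s\<^sup>2 / 4" using c by (simp add: r_def power_divide power_mult_distrib)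
    finally show ?thesis .
  qed
  have g0: "\<bar>g 0\<bar> * r \<le> 5/4 * s\<^sup>2"
  proof -
    \<comment> \<open>Nonnegativity is tested where the linear term is negative; this bounds the
      slope.\<close>
    define y where "y = (if g 0 \<ge> 0 then - r else r)"
    have y: "\<bar>y\<bar> \<le> r" "y \<in> {-w..w}" using r by (auto simp: y_def)
    have "g 0 * y = - (\<bar>g 0\<bar> * r)" by (auto simp: y_def)
    then show ?thesis using T[OF y(1)] nn[OF y(2)] f0 by linarith
  qed
  have "\<bar>g 0 * x\<bar> \<le> \<bar>g 0\<bar> * r"
    using mult_left_mono[OF x, of "\<bar>g 0\<bar>"] by (simp add: abs_mult r_def)
  then show ?thesis using T[of x] x g0 f0 zero_le_power2[of s] unfolding r_def[symmetric] by linarith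
qed

text \<open>Each of the first p factors is at least r, each later one at least g. This turns a gap
  condition at one time into the remainder condition at all scales.\<close>

lemma scale_prod_ge:
  assumes "p \<le> length ys" "0 < r" "0 < g" "\<And>i. p \<le> i \<Longrightarrow> i < length ys \<Longrightarrow> g \<le> \<bar>ys ! i\<bar>"
  shows "r ^ p * g ^ (length ys - p) \<le> scale_prod ys r"
proof -
  have ge: "a ^ length zs \<le> prod_list (map (\<lambda>y. max r \<bar>y\<bar>) zs)" if "0 < a" "\<And>z. z \<in> set zs \<Longrightarrow> a \<le> max r \<bar>z\<bar>" for zs a
    using that(2)
  proof (induction zs)
    case (Cons z zs)
    then show ?case using that(1) by (auto intro!: mult_mono)
  qed auto
  have "r ^ p * g ^ (length ys - p) = r ^ length (take p ys) * g ^ length (drop p ys)" using assms by simp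
  also have "\<dots> \<le> prod_list (map (\<lambda>y. max r \<bar>y\<bar>) (take p ys)) * prod_list (map (\<lambda>y. max r \<bar>y\<bar>) (drop p ys))"
  proof (intro mult_mono ge)
    show "g \<le> max r \<bar>z\<bar>" if z: "z \<in> set (drop p ys)" for z
    proof -
      obtain i where "i < length (drop p ys)" "z = drop p ys ! i"
        using z by (metis in_set_conv_nth)
      moreover from this have "p + i < length ys" by simp
      ultimately show ?thesis using assms(4)[of "p + i"] by (auto simp: le_max_iff_disj)
    qed
    show "0 \<le> prod_list (map (\<lambda>y. max r \<bar>y\<bar>) (take p ys))"
      using assms(2) by (intro prod_list_nonneg) auto
  qed (use assms in auto)
  also have "\<dots> = scale_prod ys r"
    unfolding prod_list.append[symmetric] map_append[symmetric] append_take_drop_id scale_prod_def ..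
  finally show ?thesis .
qed

text \<open>Pigeonhole: an interval of length below \<gamma> contains at most p consecutive roots.
  With distances counted from 0, those of index p and more are therefore at least
  \<gamma>/2.\<close>

lemma far_roots:
  fixes zs ys :: "real list"
  assumes zs: "sorted zs" "length zs = n" and gap: "\<And>i. i + p < n \<Longrightarrow> \<gamma> \<le> zs ! (i + p) - zs ! i"
    and ys: "mset ys = mset (map (\<lambda>y. y - z) zs)" "sorted (map abs ys)" and i: "p \<le> i" "i < n"
  shows "\<gamma> / 2 \<le> \<bar>ys ! i\<bar>"
proof (rule ccontr)
  assume neg: "\<not> \<gamma> / 2 \<le> \<bar>ys ! i\<bar>"
  have len: "length ys = n" using ys(1) zs(2) by (metis length_map mset_eq_length)
  let ?P = "\<lambda>y. \<bar>y\<bar> < \<gamma> / 2"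
  define S where "S = {j. j < n \<and> ?P (zs ! j - z)}"
  have "{..i} \<subseteq> {j. j < length ys \<and> ?P (ys ! j)}"
  proof
    fix j assume "j \<in> {..i}"
    then have "\<bar>ys ! j\<bar> \<le> \<bar>ys ! i\<bar>" using ys(2) i len sorted_nth_mono[of "map abs ys" j i] by auto
    then show "j \<in> {j. j < length ys \<and> ?P (ys ! j)}" using neg \<open>j \<in> {..i}\<close> i len by auto
  qed
  then have "Suc i \<le> card {j. j < length ys \<and> ?P (ys ! j)}"
    using card_mono[of "{j. j < length ys \<and> ?P (ys ! j)}" "{..i}"] by auto
  also have "\<dots> = length (filter ?P ys)" by (simp add: length_filter_conv_card)
  also have "\<dots> = length (filter ?P (map (\<lambda>y. y - z) zs))"
    unfolding size_mset[symmetric] mset_filter ys(1) ..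
  also have "\<dots> = card S"
    using zs(2) by (simp add: length_filter_conv_card S_def cong: conj_cong)
  finally have cS: "Suc i \<le> card S" .
  have "card S > 0" using cS by simp
  then have S: "finite S" "S \<noteq> {}" by (auto simp: card_gt_0_iff)
  define a b where "a = Min S" and "b = Max S"
  have ab: "a \<in> S" "b \<in> S" using S by (auto simp: a_def b_def)
  have "S \<subseteq> {a..b}" using S by (auto simp: a_def b_def)
  then have "card S \<le> Suc b - a" using card_mono[of "{a..b}" S] by simp
  then have "a + p \<le> b" using cS i by linarith
  then have 1: "zs ! (a + p) \<le> zs ! b" using ab zs by (intro sorted_nth_mono) (auto simp: S_def)
  have "a + p < n" using \<open>a + p \<le> b\<close> ab by (auto simp: S_def)
  then have "\<gamma> \<le> zs ! (a + p) - zs ! a" by (rule gap)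
  moreover have "\<bar>zs ! a - z\<bar> < \<gamma> / 2" "\<bar>zs ! b - z\<bar> < \<gamma> / 2" using ab by (auto simp: S_def)
  ultimately show False using 1 by linarith
qed

text \<open>The share of the coefficient k in the coefficient j after a shift by z0, measured in
  powers of the length 4 s0. The factor 8^n is 2^n for the binomial coefficient times 4^n for the
  change of length from s0 to 4 s0.\<close>

lemma translation_weight:
  fixes z0 s0 M X :: real
  assumes z0: "\<bar>z0\<bar> \<le> 2 * s0" and s0: "s0 > 0" and k: "k \<le> n" and j: "j \<le> k" and M: "0 \<le> M" "M * s0 ^ k \<le> X"
  shows "\<bar>real (k choose j) * z0 ^ (k - j)\<bar> * M * (4 * s0) ^ j \<le> 8 ^ n * X"
proof -
  have a: "real (k choose j) \<le> 2 ^ n"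
  proof -
    have "k choose j \<le> 2 ^ k" by (rule binomial_le_pow2)
    also have "\<dots> \<le> 2 ^ n" using k by (intro power_increasing) auto
    finally have "real (k choose j) \<le> real (2 ^ n)" by (rule of_nat_mono)
    then show ?thesis by simp
  qed
  have b: "\<bar>z0\<bar> ^ (k - j) \<le> (4 * s0) ^ (k - j)" using z0 s0 by (intro power_mono) auto
  have d: "(4 * s0) ^ (k - j) * (4 * s0) ^ j = 4 ^ k * s0 ^ k"
  proof -
    have "(4 * s0) ^ (k - j) * (4 * s0) ^ j = (4 * s0) ^ k"
      using j by (simp only: power_add[symmetric] le_add_diff_inverse2)
    then show ?thesis by (simp only: power_mult_distrib)
  qed
  have e: "(2::real) ^ n * 4 ^ n = 8 ^ n"
  proof -
    have "(8::real) = 2 * 4" by simp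
    then show ?thesis by (simp only: power_mult_distrib)
  qed
  have "\<bar>real (k choose j) * z0 ^ (k - j)\<bar> * M * (4 * s0) ^ j = real (k choose j) * \<bar>z0\<bar> ^ (k - j) * M * (4 * s0) ^ j"
    by (simp add: abs_mult power_abs)
  also have "\<dots> \<le> 2 ^ n * (4 * s0) ^ (k - j) * M * (4 * s0) ^ j"
    using a b M s0 by (intro mult_right_mono mult_mono) auto
  also have "\<dots> = 2 ^ n * M * ((4 * s0) ^ (k - j) * (4 * s0) ^ j)" by (simp only: mult_ac)
  also have "\<dots> = 2 ^ n * 4 ^ k * (M * s0 ^ k)" unfolding d by (simp only: mult_ac)
  also have "\<dots> \<le> 2 ^ n * 4 ^ n * X"
  proof (rule mult_mono)
    show "(2::real) ^ n * 4 ^ k \<le> 2 ^ n * 4 ^ n"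
      using k by (intro mult_left_mono power_increasing) auto
  qed (use M s0 in auto)
  finally show ?thesis unfolding e .
qed

text \<open>A curve \<open>T\<close> of polynomials with vanishing second coefficient and a continuous root \<open>lam\<close>, on
  \<open>[t0 - w, t0 + w]\<close>. The length \<open>s0\<close> measures the size of the roots at \<open>t0\<close>, any \<open>m + 2\<close>
  consecutive roots at \<open>t0\<close> span an interval of length at least \<open>\<gamma>\<close>, and \<open>c\<close> is a speed.\<close>

definition centered_curve :: "nat \<Rightarrow> nat \<Rightarrow> (real \<Rightarrow> real poly) \<Rightarrow> (real \<Rightarrow> real) \<Rightarrow> real \<Rightarrow> real \<Rightarrow> real \<Rightarrow> real \<Rightarrow> real \<Rightarrow> bool" where
  "centered_curve n m T lam t0 w c \<gamma> s0 \<longleftrightarrow>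
    w > 0 \<and> c > 0 \<and> \<gamma> > 0 \<and> s0 > 0 \<and>
    (\<forall>t\<in>{t0-w..t0+w}. \<exists>zs. length zs = n \<and> T t = lin_prod zs) \<and>
    (\<forall>t\<in>{t0-w..t0+w}. coeff (T t) (n - 1) = 0) \<and>
    (\<exists>g. (\<forall>t\<in>{t0-w..t0+w}. ((\<lambda>t. coeff (T t) (n - 2)) has_real_derivative g t) (at t within {t0-w..t0+w})) \<and>
       (c\<^sup>2)-lipschitz_on {t0-w..t0+w} g) \<and>
    s0\<^sup>2 = \<bar>coeff (T t0) (n - 2)\<bar> \<and> s0 \<le> c * w \<and>
    (\<forall>k\<le>n - 2. \<exists>M\<ge>0. lip_deriv m {t0-w..t0+w} M (\<lambda>t. coeff (T t) k) \<and>
       M * s0 ^ k \<le> c ^ Suc m * \<gamma> ^ (n - Suc m)) \<and>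
    (\<exists>zs. T t0 = lin_prod zs \<and> length zs = n \<and> sorted zs \<and>
       (\<forall>i. i + Suc m < n \<longrightarrow> \<gamma> \<le> zs ! (i + Suc m) - zs ! i)) \<and>
    isCont lam t0 \<and> (\<forall>t\<in>{t0-w..t0+w}. poly (T t) (lam t) = 0)"

text \<open>Expansion about z0 = lam t0 gives a \<open>root_curve\<close>. Glaeser's inequality for
  the second coefficient bounds all roots on a time window, and the gaps give the remainder
  condition.\<close>

lemma speed_estimate:
  fixes n m :: nat
  assumes m: "m \<ge> 1" and mn: "Suc m \<le> n"
  shows "\<exists>C>0. \<forall>T lam t0 w c \<gamma> s0. centered_curve n m T lam t0 w c \<gamma> s0 \<longrightarrow>
    (\<forall>\<^sub>F t in nhds t0. \<bar>lam t - lam t0\<bar> \<le> C * c * \<bar>t - t0\<bar>)"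
proof -
  have n2: "n \<ge> 2" and n1: "n \<ge> 1" using m mn by auto
  \<comment> \<open>One factor 2^n is the bound for coefficients by roots, the other comes from
    shifted roots of size up to 2 s.\<close>
  define K :: real where "K = 4 ^ n"
  obtain C where C: "C > 0" and core: "\<forall>h c s ys Q y. root_curve n m K h c s ys Q \<longrightarrow> isCont y 0 \<longrightarrow> y 0 = 0 \<longrightarrow>
    (\<forall>t. \<bar>t\<bar> \<le> s / c \<longrightarrow> (\<Sum>j\<le>n. h j t * y t ^ j) = 0) \<longrightarrow>
    (\<forall>\<^sub>F t in nhds 0. \<bar>y t\<bar> \<le> C * c * \<bar>t\<bar>)"
    using root_curve_speed[OF m n1, of K] by (elim exE conjE) (rule that)
  have p16: "(8::real) ^ n * 2 ^ n = 16 ^ n"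
  proof -
    have "(16::real) = 8 * 2" by simp
    then show ?thesis by (simp only: power_mult_distrib)
  qed
  \<comment> \<open>A absorbs the factor n 8^n of the translation and the powers of 2 from the
    halved gaps. Being at least 8 it also shortens the window to s0 / (2 c), where
    \<open>glaeser\<close> applies.\<close>
  define A :: real where "A = real n * 16 ^ n"
  have A: "A \<ge> 8"
  proof -
    have "1 * 16 ^ 1 \<le> real n * 16 ^ n" using n1 by (intro mult_mono power_increasing) auto
    then show ?thesis by (simp add: A_def)
  qed
  have main: "\<forall>\<^sub>F t in nhds t0. \<bar>lam t - lam t0\<bar> \<le> (C * A) * c * \<bar>t - t0\<bar>"
    if cc: "centered_curve n m T lam t0 w c \<gamma> s0"
    for T lam t0 w c \<gamma> s0
  proof -
    have w: "w > 0" and c: "c > 0" and \<gamma>: "\<gamma> > 0" and s0: "s0 > 0"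
      and s0b: "s0\<^sup>2 = \<bar>coeff (T t0) (n - 2)\<bar>" and s0w: "s0 \<le> c * w"
      and lam: "isCont lam t0" "\<And>t. t\<in>{t0-w..t0+w} \<Longrightarrow> poly (T t) (lam t) = 0"
      and hyp: "\<And>t. t \<in> {t0-w..t0+w} \<Longrightarrow> \<exists>zs. length zs = n \<and> T t = lin_prod zs"
      and tsch: "\<And>t. t\<in>{t0-w..t0+w} \<Longrightarrow> coeff (T t) (n - 1) = 0"
      using cc unfolding centered_curve_def by blast+
    obtain g where g: "\<And>t. t\<in>{t0-w..t0+w} \<Longrightarrow> ((\<lambda>t. coeff (T t) (n - 2)) has_real_derivative g t) (at t within {t0-w..t0+w})"
      and gl: "(c\<^sup>2)-lipschitz_on {t0-w..t0+w} g"
      using cc unfolding centered_curve_def by blast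
    obtain zs where zs: "T t0 = lin_prod zs" "length zs = n" "sorted zs"
      and gap: "\<And>i. i + Suc m < n \<Longrightarrow> \<gamma> \<le> zs ! (i + Suc m) - zs ! i"
      using cc unfolding centered_curve_def by blast
    have "\<forall>k\<in>{..n-2}. \<exists>M\<ge>0. lip_deriv m {t0-w..t0+w} M (\<lambda>t. coeff (T t) k) \<and>
       M * s0 ^ k \<le> c ^ Suc m * \<gamma> ^ (n - Suc m)"
      using cc unfolding centered_curve_def by blast
    then obtain M where M': "\<forall>k\<in>{..n-2}. M k \<ge> 0 \<and> lip_deriv m {t0-w..t0+w} (M k) (\<lambda>t. coeff (T t) k) \<and>
       M k * s0 ^ k \<le> c ^ Suc m * \<gamma> ^ (n - Suc m)"
      by (subst (asm) bchoice_iff) blast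
    then have lip: "\<And>k. k\<le>n - 2 \<Longrightarrow> lip_deriv m {t0-w..t0+w} (M k) (\<lambda>t. coeff (T t) k)"
      and M: "\<And>k. k\<le>n - 2 \<Longrightarrow> 0 \<le> M k \<and> M k * s0 ^ k \<le> c ^ Suc m * \<gamma> ^ (n - Suc m)"
      by auto
    define z0 where "z0 = lam t0"
    \<comment> \<open>The roots at t0 are at most 2 s0 in absolute value, so they are within 4 s0 of
      z0.\<close>
    define s where "s = 4 * s0"
    define c1 where "c1 = A * c"
    have s: "s > 0" and c1: "c1 > 0" using s0 A c by (auto simp: s_def c1_def)
    have scw: "s / c1 \<le> s0 / (2 * c)" "s / c1 \<le> w" "s / c1 > 0"
    proof -
      have "s / c1 = 4 * s0 / (A * c)" by (simp add: s_def c1_def)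
      also have "\<dots> \<le> 4 * s0 / (8 * c)" using A c s0 by (intro divide_left_mono mult_right_mono) auto
      finally show 1: "s / c1 \<le> s0 / (2 * c)" by simp
      also have "\<dots> \<le> s0 / c" using s0 c by (intro divide_left_mono) auto
      also have "\<dots> \<le> w" using s0w c by (simp add: field_simps)
      finally show "s / c1 \<le> w" .
      show "s / c1 > 0" using s c1 by simp
    qed
    let ?W = "{-(s/c1)..s/c1}"
    have inW: "t0 + \<tau> \<in> {t0-w..t0+w}" if "\<tau> \<in> ?W" for \<tau> using that scw(2) by auto
    have t0W: "t0 \<in> {t0-w..t0+w}" using w by auto
    have sq: "z\<^sup>2 \<le> - (2 * coeff (T t) (n - 2))" if tz: "t \<in> {t0-w..t0+w}" "poly (T t) z = 0" for t z
    proof -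
      obtain us where us: "length us = n" "T t = lin_prod us" using hyp[OF tz(1)] by auto
      have "z \<in> set us" using tz(2) us by (auto simp: poly_lin_prod prod_list_zero_iff)
      then show ?thesis using root_square_le[OF us(1) n2, of z] tsch[OF tz(1)] us by auto
    qed
    define f where "f \<tau> = - coeff (T (t0 + \<tau>)) (n - 2)" for \<tau>
    have fnn: "f \<tau> \<ge> 0" if "\<tau> \<in> {-w..w}" for \<tau>
    proof -
      have t: "t0 + \<tau> \<in> {t0-w..t0+w}" using that by auto
      show ?thesis using sq[OF t lam(2)[OF t]] zero_le_power2[of "lam (t0 + \<tau>)"] unfolding f_def by linarith
    qed
    have f0: "f 0 = s0\<^sup>2" using fnn[of 0] w s0b by (simp add: f_def)
    have fle: "f \<tau> \<le> 4 * s0\<^sup>2" if "\<tau> \<in> ?W" for \<tau>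
    proof (rule glaeser[where f=f and w=w and s=s0 and c=c and g="\<lambda>\<tau>. - g (t0 + \<tau>)", OF _ _ _ f0 s0 s0w c])
      show "f x \<ge> 0" if "x \<in> {-w..w}" for x using that by (rule fnn)
    next
      show "\<bar>\<tau>\<bar> \<le> s0 / (2 * c)" using that scw(1) unfolding atLeastAtMost_iff by linarith
      show "(c\<^sup>2)-lipschitz_on {-w..w} (\<lambda>\<tau>. - g (t0 + \<tau>))"
      proof (rule lipschitz_onI)
        fix x y assume "x \<in> {-w..w}" "y \<in> {-w..w}"
        then show "dist (- g (t0 + x)) (- g (t0 + y)) \<le> c\<^sup>2 * dist x y"
          using lipschitz_onD[OF gl, of "t0 + x" "t0 + y"] by (auto simp: dist_real_def)
      qed simp
      fix x assume x: "x \<in> {-w..w}"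
      have "((\<lambda>t. coeff (T t) (n - 2)) has_real_derivative g (t0 + x)) (at (t0 + x) within (\<lambda>\<tau>. t0 + \<tau>) ` {-w..w})"
      proof (rule DERIV_subset[OF g])
        show "(\<lambda>\<tau>. t0 + \<tau>) ` {-w..w} \<subseteq> {t0-w..t0+w}" by auto
      qed (use x in auto)
      moreover have "((\<lambda>\<tau>. t0 + \<tau>) has_real_derivative 1) (at x within {-w..w})"
        by (auto intro!: derivative_eq_intros)
      ultimately have "(((\<lambda>t. coeff (T t) (n - 2)) \<circ> (\<lambda>\<tau>. t0 + \<tau>)) has_real_derivative g (t0 + x) * 1) (at x within {-w..w})"
        by (rule DERIV_image_chain)
      then show "(f has_real_derivative - g (t0 + x)) (at x within {-w..w})"
        unfolding f_def comp_def by (auto intro!: DERIV_minus)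
    qed
    have rootle: "\<bar>z\<bar> \<le> 3 * s0" if "\<tau> \<in> ?W" "poly (T (t0 + \<tau>)) z = 0" for \<tau> z
    proof -
      have "z\<^sup>2 \<le> 2 * f \<tau>" using sq[OF inW[OF that(1)] that(2)] by (simp add: f_def)
      also have "\<dots> \<le> 9 * s0\<^sup>2" using fle[OF that(1)] zero_le_power2[of s0] by linarith
      also have "\<dots> = (3 * s0)\<^sup>2" by (simp add: power_mult_distrib)
      finally have "\<bar>z\<bar>\<^sup>2 \<le> (3 * s0)\<^sup>2" by simp
      then show ?thesis by (rule power2_le_imp_le) (use s0 in auto)
    qed
    have z0: "\<bar>z0\<bar> \<le> 2 * s0" and rt0: "\<And>z. poly (T t0) z = 0 \<Longrightarrow> \<bar>z\<bar> \<le> 2 * s0"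
    proof -
      have *: "\<bar>z\<bar> \<le> 2 * s0" if "poly (T t0) z = 0" for z
      proof -
        have "z\<^sup>2 \<le> 2 * f 0" using sq[OF t0W that] by (simp add: f_def)
        also have "\<dots> \<le> (2 * s0)\<^sup>2" using f0 by (simp add: power_mult_distrib)
        finally have "\<bar>z\<bar>\<^sup>2 \<le> (2 * s0)\<^sup>2" by simp
        then show ?thesis by (rule power2_le_imp_le) (use s0 in auto)
      qed
      show "\<bar>z0\<bar> \<le> 2 * s0" using *[OF lam(2)[OF t0W]] by (simp add: z0_def)
      show "\<And>z. poly (T t0) z = 0 \<Longrightarrow> \<bar>z\<bar> \<le> 2 * s0" by (rule *)
    qed
    define h where "h j \<tau> = coeff (pcompose (T (t0 + \<tau>)) [:z0, 1:]) j" for j \<tau>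
    have shift: "h j \<tau> = coeff (lin_prod (map (\<lambda>y. y - z0) us)) j" if "T (t0 + \<tau>) = lin_prod us" for j \<tau> us
      unfolding h_def that pcompose_lin_prod ..
    obtain ys where ys: "mset ys = mset (map (\<lambda>y. y - z0) zs)" "length ys = length (map (\<lambda>y. y - z0) zs)"
       "sorted (map abs ys)" "lin_prod ys = lin_prod (map (\<lambda>y. y - z0) zs)"
      by (rule lin_prod_sorted)
    have len: "length ys = n" using ys zs by simp
    \<comment> \<open>At most n terms of the binomial expansion vary in time, each with the weight
      of \<open>translation_weight\<close>.\<close>
    define Q where "Q = real n * 8 ^ n * (c ^ Suc m * \<gamma> ^ (n - Suc m))"
    have Q: "Q \<ge> 0" using c \<gamma> by (simp add: Q_def)
    have rc: "root_curve n m K h c1 s ys Q"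
      unfolding root_curve_def
    proof (intro conjI ballI allI impI)
      show "\<bar>y\<bar> \<le> s" if y: "y \<in> set ys" for y
      proof -
        have "set ys = (\<lambda>y. y - z0) ` set zs" using ys(1) by (metis set_map set_mset_mset)
        then obtain z where z: "z \<in> set zs" "y = z - z0" using y by auto
        then have "poly (T t0) z = 0" using zs by (auto simp: poly_lin_prod prod_list_zero_iff)
        then show ?thesis using rt0 z z0 by (fastforce simp: s_def)
      qed
      show "h j 0 = coeff (lin_prod ys) j" for j using shift[of 0 zs j] zs ys by simp
      show "\<exists>zs. length zs = n \<and> (\<forall>j. h j t = coeff (lin_prod zs) j)" if t: "t \<in> ?W" for t
      proof -
        obtain us where us: "length us = n" "T (t0 + t) = lin_prod us" using hyp[OF inW[OF t]] by auto
        then show ?thesis using shift[OF us(2)] by (intro exI[of _ "map (\<lambda>y. y - z0) us"]) auto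
      qed
      show "\<bar>h j t\<bar> * s ^ j \<le> K * s ^ n" if t: "t \<in> ?W" for t j
      proof -
        obtain us where us: "length us = n" "T (t0 + t) = lin_prod us" using hyp[OF inW[OF t]] by auto
        obtain vs where vs: "mset vs = mset (map (\<lambda>y. y - z0) us)" "length vs = length (map (\<lambda>y. y - z0) us)"
           "sorted (map abs vs)" "lin_prod vs = lin_prod (map (\<lambda>y. y - z0) us)"
          by (rule lin_prod_sorted)
        have hv: "h j t = coeff (lin_prod vs) j" using shift[OF us(2)] vs by simp
        have lenv: "length vs = n" using vs us by simp
        show ?thesis
        proof (cases "j \<le> n")
          case True
          have small: "\<bar>vs ! i\<bar> \<le> 2 * s" if "i < n" for i
          proof -
            have "vs ! i \<in> set vs" using that lenv by simp
            moreover have "set vs = (\<lambda>y. y - z0) ` set us" using vs(1) by (metis set_map set_mset_mset)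
            ultimately obtain z where z: "z \<in> set us" "vs ! i = z - z0" by auto
            then have "poly (T (t0 + t)) z = 0" using us by (auto simp: poly_lin_prod prod_list_zero_iff)
            then show ?thesis using rootle[OF t] z z0 s0 by (fastforce simp: s_def)
          qed
          have "\<bar>h j t\<bar> \<le> 2 ^ n * prod_list (map abs (drop j vs))"
            using coeff_lin_prod_bound[OF vs(3), of j] by (simp add: hv lenv)
          also have "\<dots> \<le> 2 ^ n * ((2 * s) ^ (n - j) * prod_list (map abs (drop n vs)))"
            using small lenv True by (intro mult_left_mono prod_list_drop_le) auto
          also have "\<dots> = 2 ^ n * (2 ^ (n - j) * s ^ (n - j))" using lenv by (simp add: power_mult_distrib)
          also have "\<dots> \<le> 2 ^ n * (2 ^ n * s ^ (n - j))"
            using s by (intro mult_left_mono mult_right_mono power_increasing) auto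
          also have "\<dots> = K * s ^ (n - j)" by (simp add: K_def flip: power_mult_distrib mult.assoc)
          finally have "\<bar>h j t\<bar> * s ^ j \<le> K * s ^ (n - j) * s ^ j" using s by (intro mult_right_mono) auto
          also have "\<dots> = K * s ^ n" using True by (simp add: mult.assoc flip: power_add)
          finally show ?thesis .
        next
          case False
          then show ?thesis using s lenv by (simp add: hv coeff_lin_prod_gt K_def)
        qed
      qed
      show "lip_deriv m ?W (Q / s ^ j) (h j)" for j
      proof -
        define L where "L k = (if k \<le> n - 2 then \<bar>real (k choose j) * z0 ^ (k - j)\<bar> * M k else 0)" for k
        have deg: "degree (T (t0 + \<tau>)) \<le> n" if "\<tau> \<in> ?W" for \<tau>
          using hyp[OF inW[OF that]] by auto
        \<comment> \<open>The coefficients of index n and n - 1 are the constants 1 and 0 and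
          contribute nothing to the Lipschitz constant.\<close>
        have "lip_deriv m ?W (\<Sum>k\<le>n. L k) (\<lambda>\<tau>. \<Sum>k\<le>n. (if k \<le> n - 2 then real (k choose j) * z0 ^ (k - j) * coeff (T (t0 + \<tau>)) k
            else if k = n then real (k choose j) * z0 ^ (k - j) else 0))"
        proof (rule lip_deriv_sum)
          fix k
          have "lip_deriv m ?W (\<bar>real (k choose j) * z0 ^ (k - j)\<bar> * M k) (\<lambda>\<tau>. real (k choose j) * z0 ^ (k - j) * coeff (T (t0 + \<tau>)) k)"
            if "k \<le> n - 2"
            using inW by (intro lip_deriv_cmult lip_deriv_translate[OF lip[OF that]]) blast
          then show "lip_deriv m ?W (L k) (\<lambda>\<tau>. if k \<le> n - 2 then real (k choose j) * z0 ^ (k - j) * coeff (T (t0 + \<tau>)) k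
            else if k = n then real (k choose j) * z0 ^ (k - j) else 0)"
            by (auto simp: L_def intro: lip_deriv_const)
        qed simp
        moreover have "(\<Sum>k\<le>n. (if k \<le> n - 2 then real (k choose j) * z0 ^ (k - j) * coeff (T (t0 + \<tau>)) k
            else if k = n then real (k choose j) * z0 ^ (k - j) else 0)) = h j \<tau>" if "\<tau> \<in> ?W" for \<tau>
          unfolding h_def coeff_pcompose_translate[OF deg[OF that]]
        proof (rule sum.cong)
          fix k assume k: "k \<in> {..n}"
          obtain us where us: "length us = n" "T (t0 + \<tau>) = lin_prod us" using hyp[OF inW[OF \<open>\<tau> \<in> ?W\<close>]] by auto
          have "k = n - 1" if "\<not> k \<le> n - 2" "k \<noteq> n" using that k by auto
          moreover have "n - 1 \<noteq> n" using n1 by auto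
          ultimately show "(if k \<le> n - 2 then real (k choose j) * z0 ^ (k - j) * coeff (T (t0 + \<tau>)) k
            else if k = n then real (k choose j) * z0 ^ (k - j) else 0) = coeff (T (t0 + \<tau>)) k * (real (k choose j) * z0 ^ (k - j))"
            using us tsch[OF inW[OF \<open>\<tau> \<in> ?W\<close>]] lead_coeff_lin_prod[of us] by auto
        qed simp
        ultimately have 1: "lip_deriv m ?W (\<Sum>k\<le>n. L k) (h j)" by (rule lip_deriv_cong)
        have "L k * s ^ j \<le> 8 ^ n * (c ^ Suc m * \<gamma> ^ (n - Suc m))" if k: "k \<le> n" for k
        proof (cases "k \<le> n - 2 \<and> j \<le> k")
          case True
          have "\<bar>real (k choose j) * z0 ^ (k - j)\<bar> * M k * (4 * s0) ^ j \<le> 8 ^ n * (c ^ Suc m * \<gamma> ^ (n - Suc m))"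
            using M[of k] True by (intro translation_weight z0 s0 k) auto
          then show ?thesis using True unfolding L_def s_def by simp
        next
          case False
          then have "L k = 0" unfolding L_def by (auto intro: binomial_eq_0)
          then show ?thesis using c \<gamma> by simp
        qed
        moreover have "L n = 0" using n1 by (auto simp: L_def)
        ultimately have "(\<Sum>k<n. L k * s ^ j) \<le> (\<Sum>k<n. 8 ^ n * (c ^ Suc m * \<gamma> ^ (n - Suc m)))"
          by (intro sum_mono) auto
        also have "\<dots> = Q" by (simp add: Q_def)
        finally have "(\<Sum>k<n. L k) * s ^ j \<le> Q" by (simp add: sum_distrib_right)
        moreover have "(\<Sum>k\<le>n. L k) = (\<Sum>k<n. L k)"
          using \<open>L n = 0\<close> by (simp flip: lessThan_Suc_atMost)
        ultimately have "(\<Sum>k\<le>n. L k) \<le> Q / s ^ j" using s by (simp add: pos_le_divide_eq)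
        then show ?thesis by (rule lip_deriv_mono[OF 1])
      qed
      show "Q * r ^ Suc m \<le> c1 ^ Suc m * scale_prod ys r" if "0 < r \<and> r \<le> s" for r
      proof -
        have "r ^ Suc m * (\<gamma> / 2) ^ (n - Suc m) \<le> scale_prod ys r"
        proof -
          have "\<gamma> / 2 \<le> \<bar>ys ! i\<bar>" if "Suc m \<le> i" "i < n" for i
            by (rule far_roots[OF zs(3) zs(2) gap ys(1) ys(3) that])
          then show ?thesis
            using scale_prod_ge[of "Suc m" ys r "\<gamma> / 2"] len mn that \<gamma> by auto
        qed
        then have "c1 ^ Suc m * (r ^ Suc m * (\<gamma> / 2) ^ (n - Suc m)) \<le> c1 ^ Suc m * scale_prod ys r"
          using c1 by (intro mult_left_mono) auto
        moreover have "Q * r ^ Suc m \<le> c1 ^ Suc m * (r ^ Suc m * (\<gamma> / 2) ^ (n - Suc m))"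
        proof -
          have "real n * 8 ^ n * 2 ^ (n - Suc m) \<le> real n * 8 ^ n * 2 ^ n"
            by (intro mult_left_mono power_increasing) auto
          also have "\<dots> = A ^ 1" by (simp only: A_def mult.assoc p16 power_one_right)
          also have "\<dots> \<le> A ^ Suc m" using A by (intro power_increasing) auto
          finally have "real n * 8 ^ n \<le> A ^ Suc m / 2 ^ (n - Suc m)" by (simp add: field_simps)
          then have "real n * 8 ^ n * (c ^ Suc m * \<gamma> ^ (n - Suc m) * r ^ Suc m) \<le> A ^ Suc m / 2 ^ (n - Suc m) * (c ^ Suc m * \<gamma> ^ (n - Suc m) * r ^ Suc m)"
            using c \<gamma> \<open>0 < r \<and> r \<le> s\<close> by (intro mult_right_mono) auto
          then show ?thesis unfolding Q_def c1_def power_mult_distrib power_divide by (simp only: mult_ac times_divide_eq_right times_divide_eq_left)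
        qed
        ultimately show ?thesis by linarith
      qed
    qed (use c1 s Q len ys in auto)
    have "\<forall>\<^sub>F \<tau> in nhds 0. \<bar>lam (t0 + \<tau>) - z0\<bar> \<le> C * c1 * \<bar>\<tau>\<bar>"
    proof (rule core[rule_format, OF rc])
      show "isCont (\<lambda>\<tau>. lam (t0 + \<tau>) - z0) 0"
      proof -
        have "isCont (\<lambda>\<tau>. t0 + \<tau>) 0" by (intro continuous_intros)
        then have "isCont (\<lambda>\<tau>. lam (t0 + \<tau>)) 0"
          by (rule isCont_o2) (use lam(1) in simp)
        then show ?thesis by (intro continuous_diff continuous_const)
      qed
      show "(\<Sum>j\<le>n. h j \<tau> * (lam (t0 + \<tau>) - z0) ^ j) = 0" if "\<bar>\<tau>\<bar> \<le> s / c1" for \<tau>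
      proof -
        have t: "t0 + \<tau> \<in> {t0-w..t0+w}" using that by (intro inW) auto
        obtain us where us: "length us = n" "T (t0 + \<tau>) = lin_prod us" using hyp[OF t] by auto
        have "degree (pcompose (T (t0 + \<tau>)) [:z0, 1:]) = n"
          unfolding us(2) pcompose_lin_prod using us(1) by simp
        then have "(\<Sum>j\<le>n. h j \<tau> * (lam (t0 + \<tau>) - z0) ^ j) = poly (pcompose (T (t0 + \<tau>)) [:z0, 1:]) (lam (t0 + \<tau>) - z0)"
          unfolding poly_altdef h_def by simp
        also have "\<dots> = poly (T (t0 + \<tau>)) (lam (t0 + \<tau>))" by (simp add: poly_pcompose)
        finally show ?thesis using lam(2)[OF t] by simp
      qed
    qed (simp add: z0_def)
    moreover have "filterlim (\<lambda>t. t - t0) (nhds 0) (nhds t0)"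
      using tendsto_diff[OF filterlim_ident[of "nhds t0"] tendsto_const[of t0]] by simp
    ultimately have "\<forall>\<^sub>F t in nhds t0. \<bar>lam (t0 + (t - t0)) - z0\<bar> \<le> C * c1 * \<bar>t - t0\<bar>"
      by (rule eventually_compose_filterlim)
    then show ?thesis by (simp add: z0_def c1_def mult.assoc)
  qed
  have CA: "C * A > 0" using C A by simp
  show ?thesis
    by (rule exI[of _ "C * A"], rule conjI[OF CA]) (intro allI impI, rule main, assumption)
qed

subsection \<open>Differentiability classes\<close>

text \<open>The recursion through the first derivative makes the sum and product rules plain
  inductions. \<open>U\<close> is an open set of differentiability, which gives \<open>deriv\<close>
  a meaning, and \<open>K\<close> the set where one constant bounds all orders and the last
  Lipschitz quotient.\<close>

primrec smooth_bound :: "nat \<Rightarrow> real \<Rightarrow> real set \<Rightarrow> real set \<Rightarrow> (real \<Rightarrow> real) \<Rightarrow> bool" where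
  "smooth_bound 0 L U K f \<longleftrightarrow> (\<forall>x\<in>K. \<bar>f x\<bar> \<le> L) \<and> L-lipschitz_on K f"
| "smooth_bound (Suc m) L U K f \<longleftrightarrow> (\<forall>x\<in>K. \<bar>f x\<bar> \<le> L) \<and> (\<forall>x\<in>U. f field_differentiable at x) \<and>
     smooth_bound m L U K (deriv f)"

lemma smooth_bound_iff:
  "smooth_bound m L U K f \<longleftrightarrow> (\<forall>k\<le>m. \<forall>x\<in>K. \<bar>(deriv ^^ k) f x\<bar> \<le> L) \<and>
     (\<forall>k<m. \<forall>x\<in>U. (deriv ^^ k) f field_differentiable at x) \<and> L-lipschitz_on K ((deriv ^^ m) f)"
proof (induction m arbitrary: f)
  case (Suc m)
  have 1: "(\<forall>k\<le>Suc m. P k) \<longleftrightarrow> P 0 \<and> (\<forall>k\<le>m. P (Suc k))" for P :: "nat \<Rightarrow> bool"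
    unfolding less_Suc_eq_le[symmetric] All_less_Suc2 ..
  have 2: "(\<forall>k<Suc m. P k) \<longleftrightarrow> P 0 \<and> (\<forall>k<m. P (Suc k))" for P :: "nat \<Rightarrow> bool"
    by (rule All_less_Suc2)
  show ?case
    unfolding smooth_bound.simps Suc.IH 1 2 funpow_Suc_right comp_apply funpow.simps(1) id_apply
    by (rule iffI; elim conjE; intro conjI; assumption)
qed simp

lemma smooth_bound_le: "smooth_bound m L U K f \<Longrightarrow> x \<in> K \<Longrightarrow> \<bar>f x\<bar> \<le> L"
  by (cases m) auto

lemma smooth_bound_mono: "smooth_bound m L U K f \<Longrightarrow> L \<le> L' \<Longrightarrow> smooth_bound m L' U K f"
  by (induction m arbitrary: f) (auto intro: order_trans lipschitz_on_le)

text \<open>Agreement on the open set \<open>U\<close> is agreement of germs there, so it passes to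
  \<open>deriv\<close> at each order.\<close>

lemma smooth_bound_cong:
  assumes "open U" "K \<subseteq> U" "\<And>x. x \<in> U \<Longrightarrow> f x = g x" "smooth_bound m L U K f"
  shows "smooth_bound m L U K g"
  using assms(3,4)
proof (induction m arbitrary: f g)
  case 0
  have eq: "g x = f x" if "x \<in> K" for x using 0(1)[of x] that assms(2) by (simp add: subset_iff)
  have "L-lipschitz_on K g" by (rule lipschitz_on_transform[of L K f]) (use 0(2) eq in simp_all)
  then show ?case using 0(2) eq by simp
next
  case (Suc m)
  have ev: "\<forall>\<^sub>F y in nhds x. f y = g y" if "x \<in> U" for x
    using eventually_nhds_in_open[OF assms(1) that] by eventually_elim (rule Suc.prems(1))
  have "g field_differentiable at x" if x: "x \<in> U" for x
  proof -
    obtain D where "(f has_field_derivative D) (at x)"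
      using Suc.prems(2) x by (auto simp: field_differentiable_def)
    then have "(g has_field_derivative D) (at x)"
      using DERIV_cong_ev[OF refl ev[OF x] refl] by simp
    then show ?thesis by (auto simp: field_differentiable_def)
  qed
  moreover have "smooth_bound m L U K (deriv g)"
  proof (rule Suc.IH)
    show "deriv f x = deriv g x" if "x \<in> U" for x by (rule deriv_cong_ev[OF ev[OF that] refl])
    show "smooth_bound m L U K (deriv f)" using Suc.prems(2) by simp
  qed
  moreover have "g x = f x" if "x \<in> K" for x using Suc.prems(1)[of x] that assms(2) by (simp add: subset_iff)
  ultimately show ?case using Suc.prems(2) by simp
qed

lemma smooth_bound_Suc_imp:
  assumes "convex K" "K \<subseteq> U" "smooth_bound (Suc m) L U K f" "L \<ge> 0"
  shows "smooth_bound m L U K f"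
  using assms(3)
proof (induction m arbitrary: f)
  case 0
  have "L-lipschitz_on K f"
  proof (rule lipschitz_onI)
    fix x y assume xy: "x \<in> K" "y \<in> K"
    have "norm (f x - f y) \<le> L * norm (x - y)"
    proof (rule field_differentiable_bound[OF assms(1), of f "deriv f"])
      show "(f has_field_derivative deriv f z) (at z within K)" if "z \<in> K" for z
      proof -
        have "f field_differentiable at z" using 0 that assms(2) by auto
        then show ?thesis using field_differentiable_derivI has_field_derivative_at_within by blast
      qed
      show "norm (deriv f z) \<le> L" if "z \<in> K" for z using 0 that by simp
    qed (use xy in auto)
    then show "dist (f x) (f y) \<le> L * dist x y" by (simp add: dist_norm)
  qed (rule assms(4))
  then show ?case using 0 by simp
next
  case (Suc m)
  then show ?case by simp
qed

lemma smooth_bound_const: "smooth_bound m \<bar>a\<bar> U K (\<lambda>x. a)"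
proof (induction m arbitrary: a)
  case (Suc m)
  have "smooth_bound m \<bar>a\<bar> U K (\<lambda>x. 0)"
    by (rule smooth_bound_mono[OF Suc]) simp
  moreover have "deriv (\<lambda>x. a) = (\<lambda>x. 0)" by (rule ext) simp
  ultimately show ?case by simp
qed (auto simp: lipschitz_on_def)

lemma smooth_bound_add:
  assumes U: "open U" "K \<subseteq> U" and f: "smooth_bound m L U K f" and g: "smooth_bound m L' U K g"
  shows "smooth_bound m (L + L') U K (\<lambda>x. f x + g x)"
  using f g
proof (induction m arbitrary: f g)
  case 0
  have "\<bar>f x + g x\<bar> \<le> L + L'" if "x \<in> K" for x
    using 0 that by (intro order_trans[OF abs_triangle_ineq] add_mono) auto
  then show ?case using 0 by (auto intro: lipschitz_on_add)
next
  case (Suc m)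
  have "\<bar>f x + g x\<bar> \<le> L + L'" if "x \<in> K" for x
    using Suc.prems that by (intro order_trans[OF abs_triangle_ineq] add_mono) auto
  moreover have "smooth_bound m (L + L') U K (deriv (\<lambda>x. f x + g x))"
  proof (rule smooth_bound_cong[OF U])
    show "smooth_bound m (L + L') U K (\<lambda>x. deriv f x + deriv g x)" using Suc by auto
    show "deriv f x + deriv g x = deriv (\<lambda>x. f x + g x) x" if "x \<in> U" for x
      using Suc.prems that by (subst deriv_add) auto
  qed
  ultimately show ?case using Suc.prems by (auto intro: field_differentiable_add)
qed

text \<open>Each differentiation by the product rule produces two terms of the same form, and so
  does the Lipschitz estimate at the end; this gives the power of 2.\<close>

lemma smooth_bound_mult:
  assumes U: "open U" "K \<subseteq> U" "convex K" and L: "L \<ge> 0" "L' \<ge> 0"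
    and f: "smooth_bound m L U K f" and g: "smooth_bound m L' U K g"
  shows "smooth_bound m (2 ^ Suc m * (L * L')) U K (\<lambda>x. f x * g x)"
  using f g
proof (induction m arbitrary: f g)
  case 0
  have *: "\<bar>f x * g y\<bar> \<le> L * L'" if "x \<in> K" "y \<in> K" for x y
    unfolding abs_mult using 0 that L by (intro mult_mono) auto
  have "(2 * (L * L'))-lipschitz_on K (\<lambda>x. f x * g x)"
  proof (rule lipschitz_onI)
    fix x y assume xy: "x \<in> K" "y \<in> K"
    have "\<bar>f x - f y\<bar> \<le> L * \<bar>x - y\<bar>" "\<bar>g x - g y\<bar> \<le> L' * \<bar>x - y\<bar>"
      using 0 xy lipschitz_onD[of L K f x y] lipschitz_onD[of L' K g x y] by (auto simp: dist_real_def)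
    moreover have "\<bar>f x\<bar> \<le> L" "\<bar>g y\<bar> \<le> L'" using 0 xy by auto
    ultimately have "\<bar>f x\<bar> * \<bar>g x - g y\<bar> \<le> L * (L' * \<bar>x - y\<bar>)" "\<bar>g y\<bar> * \<bar>f x - f y\<bar> \<le> L' * (L * \<bar>x - y\<bar>)"
      using L by (auto intro!: mult_mono)
    moreover have "f x * g x - f y * g y = f x * (g x - g y) + g y * (f x - f y)" by (simp add: algebra_simps)
    then have "\<bar>f x * g x - f y * g y\<bar> \<le> \<bar>f x\<bar> * \<bar>g x - g y\<bar> + \<bar>g y\<bar> * \<bar>f x - f y\<bar>"
      using abs_triangle_ineq[of "f x * (g x - g y)" "g y * (f x - f y)"] by (simp add: abs_mult)
    ultimately show "dist (f x * g x) (f y * g y) \<le> 2 * (L * L') * dist x y"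
      by (simp add: dist_real_def algebra_simps)
  qed (use L in auto)
  moreover have "\<bar>f x * g x\<bar> \<le> 2 * (L * L')" if "x \<in> K" for x
  proof -
    have "0 \<le> L * L'" using L by simp
    then show ?thesis using *[OF that that] by linarith
  qed
  ultimately show ?case by simp
next
  case (Suc m)
  have LL: "0 \<le> L * L'" using L by simp
  have "\<bar>f x * g x\<bar> \<le> 2 ^ Suc (Suc m) * (L * L')" if "x \<in> K" for x
  proof -
    have "\<bar>f x * g x\<bar> \<le> 1 * (L * L')"
      unfolding abs_mult using Suc.prems that L by (auto intro!: mult_mono)
    also have "\<dots> \<le> 2 ^ Suc (Suc m) * (L * L')" by (intro mult_right_mono LL one_le_power) simp
    finally show ?thesis .
  qed
  moreover have "smooth_bound m (2 ^ Suc (Suc m) * (L * L')) U K (deriv (\<lambda>x. f x * g x))"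
  proof (rule smooth_bound_cong[OF U(1,2)])
    have "smooth_bound m L U K f" "smooth_bound m L' U K g"
      using smooth_bound_Suc_imp[OF U(3,2)] Suc.prems L by auto
    moreover have "smooth_bound m L U K (deriv f)" "smooth_bound m L' U K (deriv g)" using Suc.prems by auto
    ultimately have "smooth_bound m (2 ^ Suc m * (L * L') + 2 ^ Suc m * (L * L')) U K (\<lambda>x. f x * deriv g x + deriv f x * g x)"
      by (intro smooth_bound_add[OF U(1,2)] Suc.IH)
    then show "smooth_bound m (2 ^ Suc (Suc m) * (L * L')) U K (\<lambda>x. f x * deriv g x + deriv f x * g x)"
      by (rule smooth_bound_mono) simp
    show "f x * deriv g x + deriv f x * g x = deriv (\<lambda>x. f x * g x) x" if "x \<in> U" for x
      using Suc.prems that by (subst deriv_mult) auto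
  qed
  ultimately show ?case using Suc.prems by (auto intro: field_differentiable_mult)
qed

lemma smooth_bound_power:
  assumes U: "open U" "K \<subseteq> U" "convex K" and L: "L \<ge> 0" and f: "smooth_bound m L U K f"
  shows "smooth_bound m ((2 ^ Suc m) ^ k * L ^ k) U K (\<lambda>x. f x ^ k)"
proof (induction k)
  case 0
  then show ?case using smooth_bound_const[of m 1 U K] by simp
next
  case (Suc k)
  have "smooth_bound m (2 ^ Suc m * (L * ((2 ^ Suc m) ^ k * L ^ k))) U K (\<lambda>x. f x * f x ^ k)"
    using L by (intro smooth_bound_mult U f Suc) auto
  then show ?case by (simp add: mult_ac)
qed

lemma smooth_bound_sum:
  assumes "open U" "K \<subseteq> U" "finite A" "\<And>i. i \<in> A \<Longrightarrow> smooth_bound m (L i) U K (f i)"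
  shows "smooth_bound m (\<Sum>i\<in>A. L i) U K (\<lambda>x. \<Sum>i\<in>A. f i x)"
  using assms(3,4)
proof (induction A)
  case empty
  then show ?case using smooth_bound_const[of m 0 U K] by simp
next
  case (insert i A)
  then show ?case by (simp add: smooth_bound_add[OF assms(1,2)])
qed

section \<open>Finiteness of the suprema in \<open>Lip\<close>, \<open>sup_norm\<close> and
  \<open>CLip_norm\<close>\<close>

lemma Lip_bdd:
  fixes f :: "real \<Rightarrow> real"
  assumes "L-lipschitz_on K f"
  shows "bdd_above ((\<lambda>(x, y). \<bar>f x - f y\<bar> / \<bar>x - y\<bar>) ` {(x, y). x \<in> K \<and> y \<in> K \<and> x \<noteq> y})"
proof (rule bdd_aboveI2)
  fix z assume "z \<in> {(x, y). x \<in> K \<and> y \<in> K \<and> x \<noteq> y}"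
  then show "(case z of (x, y) \<Rightarrow> \<bar>f x - f y\<bar> / \<bar>x - y\<bar>) \<le> L"
    using lipschitz_onD[OF assms] by (auto simp: dist_real_def divide_le_eq)
qed

text \<open>\<open>Lip\<close> is a real supremum, so some Lipschitz constant must be known before
  it can be used as one. Two distinct points make it nonnegative.\<close>

lemma Lip_lipschitz:
  assumes "L-lipschitz_on K f" "x0 \<in> K" "y0 \<in> K" "x0 \<noteq> y0"
  shows "(Lip K f)-lipschitz_on K f"
proof -
  have le: "\<bar>f x - f y\<bar> / \<bar>x - y\<bar> \<le> Lip K f" if "x \<in> K" "y \<in> K" "x \<noteq> y" for x y
    unfolding Lip_def using that cSUP_upper[OF _ Lip_bdd[OF assms(1)], of "(x, y)"] by auto
  show ?thesis
  proof (rule lipschitz_onI)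
    fix x y assume "x \<in> K" "y \<in> K"
    then show "dist (f x) (f y) \<le> Lip K f * dist x y"
      using le[of x y] by (cases "x = y") (auto simp: dist_real_def pos_divide_le_eq)
  next
    have "0 \<le> \<bar>f x0 - f y0\<bar> / \<bar>x0 - y0\<bar>" by simp
    then show "0 \<le> Lip K f" using le[OF assms(2-4)] by linarith
  qed
qed

lemma Lip_le:
  fixes f :: "real \<Rightarrow> real"
  assumes "L-lipschitz_on K f" "x0 \<in> K" "y0 \<in> K" "x0 \<noteq> y0"
  shows "Lip K f \<le> L"
  unfolding Lip_def
proof (rule cSUP_least)
  show "{(x, y). x \<in> K \<and> y \<in> K \<and> x \<noteq> y} \<noteq> {}" using assms by auto
  fix z assume "z \<in> {(x, y). x \<in> K \<and> y \<in> K \<and> x \<noteq> y}"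
  then show "(case z of (x, y) \<Rightarrow> \<bar>f x - f y\<bar> / \<bar>x - y\<bar>) \<le> L"
    using lipschitz_onD[OF assms(1)] by (auto simp: dist_real_def divide_le_eq)
qed

lemma sup_norm_upper:
  assumes "\<And>x. x \<in> K \<Longrightarrow> \<bar>f x\<bar> \<le> B" "x \<in> K"
  shows "\<bar>f x\<bar> \<le> sup_norm K f"
  unfolding sup_norm_def using assms by (intro cSUP_upper bdd_aboveI2[of K _ B]) auto

lemma CLip_on_deriv_continuous:
  assumes "CLip_on m J f" "k \<le> m"
  shows "continuous_on J ((deriv ^^ k) f)"
proof (cases "k = m")
  case True
  then show ?thesis using assms by (simp add: CLip_on_def)
next
  case False
  then have "\<forall>x\<in>J. isCont ((deriv ^^ k) f) x"
    using assms by (intro ballI field_differentiable_imp_continuous_at) (simp add: CLip_on_def)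
  then show ?thesis by (simp add: continuous_at_imp_continuous_on)
qed

lemma CLip_on_lipschitz_compact:
  assumes "CLip_on m J f" "compact K" "K \<subseteq> J"
  obtains L where "L-lipschitz_on K ((deriv ^^ m) f)"
proof -
  let ?g = "(deriv ^^ m) f"
  have "local_lipschitz {0::real} K (\<lambda>_. ?g)"
    using assms by (auto simp: CLip_on_def locally_lipschitz_on_def intro: local_lipschitz_subset)
  then obtain L where "\<And>t. t \<in> {0::real} \<Longrightarrow> L-lipschitz_on K ?g"
    by (rule local_lipschitz_compact_implies_lipschitz[OF _ assms(2)]) auto
  then show ?thesis using that by auto
qed

text \<open>On a compact set continuity bounds the derivatives, and local Lipschitz continuity
  becomes global. Once some bound exists, \<open>smooth_bound_CLip_norm\<close> replaces it by the
  norm.\<close>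

lemma CLip_on_smooth_bound:
  assumes f: "CLip_on m J f" and K: "compact K" "K \<subseteq> J"
  shows "\<exists>L. smooth_bound m L J K f"
proof -
  obtain L where L: "L-lipschitz_on K ((deriv ^^ m) f)" by (rule CLip_on_lipschitz_compact[OF f K])
  have "\<forall>k\<in>{..m}. \<exists>B. \<forall>x\<in>K. \<bar>(deriv ^^ k) f x\<bar> \<le> B"
  proof
    fix k assume "k \<in> {..m}"
    then have "k \<le> m" by simp
    then have "continuous_on K ((deriv ^^ k) f)"
      by (rule continuous_on_subset[OF CLip_on_deriv_continuous[OF f] K(2)])
    then have "bounded ((deriv ^^ k) f ` K)" using K(1) compact_continuous_image compact_imp_bounded by blast
    then show "\<exists>B. \<forall>x\<in>K. \<bar>(deriv ^^ k) f x\<bar> \<le> B" by (auto simp: bounded_iff)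
  qed
  then obtain B where B: "\<forall>k\<in>{..m}. \<forall>x\<in>K. \<bar>(deriv ^^ k) f x\<bar> \<le> B k" by (subst (asm) bchoice_iff) blast
  define M where "M = \<bar>L\<bar> + (\<Sum>k\<le>m. \<bar>B k\<bar>)"
  have b: "\<bar>(deriv ^^ k) f x\<bar> \<le> M" if k: "k \<le> m" and x: "x \<in> K" for k x
  proof -
    have "\<bar>(deriv ^^ k) f x\<bar> \<le> B k" using B k x by auto
    moreover have "\<bar>B k\<bar> \<le> (\<Sum>k\<le>m. \<bar>B k\<bar>)" using k by (intro member_le_sum) auto
    ultimately show ?thesis unfolding M_def by linarith
  qed
  have l: "M-lipschitz_on K ((deriv ^^ m) f)"
  proof (rule lipschitz_on_le[OF L])
    have "0 \<le> (\<Sum>k\<le>m. \<bar>B k\<bar>)" by (rule sum_nonneg) simp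
    then show "L \<le> M" unfolding M_def by linarith
  qed
  have "smooth_bound m M J K f"
    unfolding smooth_bound_iff by (intro conjI allI impI ballI b l) (use f in \<open>auto simp: CLip_on_def\<close>)
  then show ?thesis ..
qed

lemma smooth_bound_CLip_norm:
  assumes f: "smooth_bound m L U K f" and xy: "x0 \<in> K" "y0 \<in> K" "x0 \<noteq> y0"
  shows "smooth_bound m (CLip_norm m K f) U K f" "0 \<le> CLip_norm m K f"
proof -
  have LL: "(Lip K ((deriv ^^ m) f))-lipschitz_on K ((deriv ^^ m) f)"
    by (rule Lip_lipschitz[OF _ xy]) (use f in \<open>unfold smooth_bound_iff, elim conjE\<close>)
  have L0: "0 \<le> Lip K ((deriv ^^ m) f)" by (rule lipschitz_on_nonneg[OF LL])
  have sup: "\<bar>(deriv ^^ k) f x\<bar> \<le> sup_norm K ((deriv ^^ k) f)" if "k \<le> m" "x \<in> K" for k x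
  proof (rule sup_norm_upper[OF _ that(2)])
    show "\<bar>(deriv ^^ k) f y\<bar> \<le> L" if "y \<in> K" for y
      using f that \<open>k \<le> m\<close> unfolding smooth_bound_iff by auto
  qed
  have Ck: "sup_norm K ((deriv ^^ k) f) \<le> C_norm m K f" if "k \<le> m" for k
    unfolding C_norm_def using that by (intro Max_ge) auto
  have C0: "0 \<le> C_norm m K f" using Ck[of 0] sup[of 0 x0] xy by force
  have 3: "\<bar>(deriv ^^ k) f x\<bar> \<le> CLip_norm m K f" if "k \<le> m" "x \<in> K" for k x
    using sup[OF that] Ck[OF that(1)] L0 unfolding CLip_norm_def by linarith
  have 5: "Lip K ((deriv ^^ m) f) \<le> CLip_norm m K f" using C0 by (simp add: CLip_norm_def)
  show "0 \<le> CLip_norm m K f" using C0 L0 by (simp add: CLip_norm_def)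
  show "smooth_bound m (CLip_norm m K f) U K f"
    unfolding smooth_bound_iff by (intro conjI allI impI ballI 3 lipschitz_on_le[OF LL 5])
      (use f in \<open>auto simp: smooth_bound_iff\<close>)
qed

lemma smooth_bound_lip_deriv:
  assumes f: "smooth_bound m L U K f" and S: "S \<subseteq> U" and g: "L'-lipschitz_on S ((deriv ^^ m) f)"
  shows "lip_deriv m S L' f"
  unfolding lip_deriv_def
proof (rule exI[of _ "\<lambda>k. (deriv ^^ k) f"], intro conjI allI impI ballI g)
  fix k t assume "k < m" "t \<in> S"
  then have "(deriv ^^ k) f field_differentiable at t" using f S unfolding smooth_bound_iff by blast
  then have "((deriv ^^ k) f has_real_derivative deriv ((deriv ^^ k) f) t) (at t)"
    by (simp add: field_differentiable_derivI)
  then show "((deriv ^^ k) f has_real_derivative (deriv ^^ Suc k) f t) (at t within S)"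
    by (simp add: has_field_derivative_at_within)
qed simp

subsection \<open>Hyperbolic polynomials and the Tschirnhausen form\<close>

lemma map_poly_of_real_mult:
  "map_poly complex_of_real (p * q) = map_poly complex_of_real p * map_poly complex_of_real q"
  by (rule poly_eqI) (simp add: coeff_map_poly coeff_mult)

lemma poly_map_poly_of_real:
  "poly (map_poly complex_of_real p) (complex_of_real x) = complex_of_real (poly p x)"
  by (induction p) (simp_all add: map_poly_pCons)

text \<open>The fundamental theorem of algebra gives a complex root, hyperbolicity makes it real,
  and the cofactor is again monic and hyperbolic.\<close>

lemma hyperbolic_lin_prod:
  assumes "hyperbolic q"
  shows "\<exists>ys. length ys = degree q \<and> q = lin_prod ys"
  using assms
proof (induction "degree q" arbitrary: q)
  case 0
  obtain a where "q = [:a:]" using degree_0_id[OF 0(1)[symmetric]] by metis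
  then have "q = 1" using 0(2) by (simp add: hyperbolic_def)
  then show ?case by (intro exI[of _ "[]"]) simp
next
  case (Suc n)
  have "degree (map_poly complex_of_real q) = degree q" by (rule degree_map_poly) simp
  then have "\<not> constant (poly (map_poly complex_of_real q))"
    using Suc.hyps(2) by (simp add: constant_degree)
  then obtain z where z: "poly (map_poly complex_of_real q) z = 0"
    using fundamental_theorem_of_algebra by blast
  then have "z \<in> \<real>" using Suc.prems by (simp add: hyperbolic_def)
  then obtain x where x: "z = complex_of_real x" by (rule Reals_cases)
  have "poly q x = 0" using z unfolding x poly_map_poly_of_real by simp
  then obtain r where r: "q = [:- x, 1:] * r" by (auto simp: poly_eq_0_iff_dvd elim: dvdE)
  have q0: "q \<noteq> 0" using Suc.hyps(2) by auto
  then have r0: "r \<noteq> 0" using r by auto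
  have "degree q = Suc (degree r)" unfolding r using r0 by (subst degree_mult_eq) auto
  then have dr: "n = degree r" using Suc.hyps(2) by simp
  have "lead_coeff q = lead_coeff r" unfolding r lead_coeff_mult by simp
  then have "hyperbolic r"
    using Suc.prems unfolding hyperbolic_def r map_poly_of_real_mult poly_mult by auto
  then obtain ys where "length ys = degree r" "r = lin_prod ys" using Suc.hyps(1)[OF dr] by blast
  then show ?case using r \<open>degree q = Suc (degree r)\<close> by (intro exI[of _ "x # ys"]) simp
qed

section \<open>Roots, multiplicities and coefficients of the curve and its Tschirnhausen
  form\<close>

lemma proots_lin_prod: "proots (lin_prod ys) = mset ys"
  by (induction ys) (simp_all add: proots_mult del: mult_pCons_left)

lemma order_lin_prod: "order x (lin_prod ys) = count (mset ys) x"
  by (simp flip: count_proots proots_lin_prod)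

lemma count_mset_map_add:
  fixes ys :: "real list"
  shows "count (mset (map (\<lambda>y. y + u) ys)) (x + u) = count (mset ys) x"
  by (induction ys) auto

lemma coeff_poly_curve:
  "coeff (poly_curve n a t) k = (if k = n then 1 else if k < n then a (n - k) t else 0)"
proof -
  have "(\<Sum>j=1..n. coeff (monom (a j t) (n - j)) k) = (\<Sum>j=1..n. if j = n - k then (if k < n then a j t else 0) else 0)"
    by (intro sum.cong) auto
  also have "\<dots> = (if k < n then a (n - k) t else 0)" by (cases "k < n") (auto simp: sum.delta)
  finally show ?thesis by (simp add: poly_curve_def coeff_sum)
qed

lemma degree_poly_curve: "degree (poly_curve n a t) = n"
proof (rule antisym)
  show "degree (poly_curve n a t) \<le> n" by (rule degree_le) (simp add: coeff_poly_curve)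
  show "n \<le> degree (poly_curve n a t)" by (rule le_degree) (simp add: coeff_poly_curve)
qed

lemma tcoeff_eq:
  "tcoeff n a j t = (\<Sum>k\<le>n. (if k = n then 1 else a (n - k) t) * (real (k choose (n - j)) * (- (a 1 t / real n)) ^ (k - (n - j))))"
  unfolding tcoeff_def tschirnhausen_def
  by (subst coeff_pcompose_translate[of _ n]) (auto simp: degree_poly_curve coeff_poly_curve intro!: sum.cong)

lemma poly_curve_roots:
  assumes "hyperbolic (poly_curve n a t)"
  obtains ys where "length ys = n" "sorted ys" "poly_curve n a t = lin_prod ys"
proof -
  obtain ys where "length ys = n" "poly_curve n a t = lin_prod ys"
    using hyperbolic_lin_prod[OF assms] by (auto simp: degree_poly_curve)
  then show ?thesis by (intro that[of "sort ys"]) (auto simp: lin_prod_mset[of "sort ys" ys])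
qed

text \<open>The roots of the curve add up to -a_1. Shifting each of the n roots by a_1 / n makes the
  sum, and with it the coefficient of Z^(n-1), vanish.\<close>

lemma tschirnhausen_roots:
  assumes n: "n \<ge> 1" and hyp: "hyperbolic (poly_curve n a t)"
  obtains zs where "length zs = n" "sorted zs" "tschirnhausen n a t = lin_prod zs"
    "\<And>x. count (mset zs) (x + a 1 t / real n) = order x (poly_curve n a t)"
    "coeff (tschirnhausen n a t) (n - 1) = 0"
proof -
  obtain ys where ys: "length ys = n" "sorted ys" "poly_curve n a t = lin_prod ys"
    by (rule poly_curve_roots[OF hyp])
  define u where "u = a 1 t / real n"
  define zs where "zs = map (\<lambda>y. y + u) ys"
  have T: "tschirnhausen n a t = lin_prod zs"
    unfolding tschirnhausen_def ys(3) pcompose_lin_prod zs_def u_def by (simp add: diff_minus_eq_add)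
  have "count (mset zs) (x + u) = order x (poly_curve n a t)" for x
    unfolding zs_def ys(3) order_lin_prod count_mset_map_add ..
  moreover have "coeff (tschirnhausen n a t) (n - 1) = 0"
  proof -
    have ne: "ys \<noteq> []" "zs \<noteq> []" using ys n by (auto simp: zs_def)
    have "coeff (poly_curve n a t) (n - 1) = a 1 t" using n by (simp add: coeff_poly_curve)
    then have "a 1 t = - sum_list ys" using coeff_lin_prod_sum[OF ne(1)] ys by simp
    moreover have "sum_list zs = sum_list ys + real n * u"
      unfolding zs_def sum_list_addf by (simp add: ys(1) sum_list_triv)
    ultimately have "sum_list zs = 0" using n by (simp add: u_def)
    then show ?thesis using coeff_lin_prod_sum[OF ne(2)] ys(1) T by (simp add: zs_def)
  qed
  moreover have "sorted zs" using ys(2) by (simp add: zs_def sorted_map sorted_wrt_mono_rel)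
  ultimately show ?thesis using that[of zs] ys(1) T by (simp add: zs_def u_def)
qed

text \<open>The maximum in \<open>max_multiplicity\<close> is meaningful: orders are at most n, and
  a hyperbolic polynomial of positive degree has a root.\<close>

lemma order_le_max_multiplicity:
  assumes n: "n \<ge> 1" and hyp: "\<And>t. t \<in> J \<Longrightarrow> hyperbolic (poly_curve n a t)" and t: "t \<in> J"
  shows "order x (poly_curve n a t) \<le> max_multiplicity J (poly_curve n a)"
    "1 \<le> max_multiplicity J (poly_curve n a)" "max_multiplicity J (poly_curve n a) \<le> n"
proof -
  let ?S = "{order x (poly_curve n a t) | t x. t \<in> J \<and> poly (poly_curve n a t) x = 0}"
  have nz: "poly_curve n a t \<noteq> 0" for t using degree_poly_curve[of n a t] n by auto
  have S: "?S \<subseteq> {..n}" using order_degree[OF nz] by (auto simp: degree_poly_curve)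
  then have fin: "finite ?S" using finite_subset by blast
  obtain ys where ys: "length ys = n" "poly_curve n a t = lin_prod ys"
    by (rule poly_curve_roots[OF hyp[OF t]])
  have rt: "poly (poly_curve n a t) (ys ! 0) = 0"
    using ys n by (auto simp: poly_lin_prod prod_list_zero_iff)
  then have in_S: "order (ys ! 0) (poly_curve n a t) \<in> ?S" using t by blast
  have "order (ys ! 0) (poly_curve n a t) \<noteq> 0" using rt nz order_root by blast
  then have "1 \<le> order (ys ! 0) (poly_curve n a t)" by simp
  also have "\<dots> \<le> Max ?S" by (rule Max_ge[OF fin in_S])
  finally show p1: "1 \<le> max_multiplicity J (poly_curve n a)" by (simp add: max_multiplicity_def)
  have "?S \<noteq> {}" using in_S by blast
  then have "Max ?S \<in> ?S" using Max_in fin by blast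
  then show "max_multiplicity J (poly_curve n a) \<le> n" using S unfolding max_multiplicity_def by blast
  show "order x (poly_curve n a t) \<le> max_multiplicity J (poly_curve n a)"
  proof (cases "poly (poly_curve n a t) x = 0")
    case True
    then show ?thesis unfolding max_multiplicity_def using t by (intro Max_ge[OF fin]) blast
  next
    case False
    then have "order x (poly_curve n a t) = 0" using order_root by blast
    then show ?thesis by simp
  qed
qed

text \<open>A pointwise bound with one constant suffices, however small the neighbourhoods are.
  Short intervals are split at the point x they contain, and the inequality is additive over
  adjacent intervals, so bisection applies.\<close>

lemma lipschitz_on_pointwise:
  fixes f :: "real \<Rightarrow> real"
  assumes S: "is_interval S" and C: "C \<ge> 0"
    and loc: "\<And>x. x \<in> S \<Longrightarrow> \<exists>d>0. \<forall>y\<in>S. \<bar>y - x\<bar> < d \<longrightarrow> \<bar>f y - f x\<bar> \<le> C * \<bar>y - x\<bar>"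
  shows "C-lipschitz_on S f"
proof -
  have main: "\<bar>f b - f a\<bar> \<le> C * (b - a)" if "a \<le> b" "a \<in> S" "b \<in> S" for a b
  proof -
    have sub: "{a..b} \<subseteq> S" using S that by (meson atLeastAtMost_iff is_interval_1 subsetI)
    have "a \<in> {a..b} \<and> b \<in> {a..b} \<longrightarrow> \<bar>f b - f a\<bar> \<le> C * (b - a)"
      using \<open>a \<le> b\<close>
    proof (rule Bolzano[where P="\<lambda>x y. x \<in> {a..b} \<and> y \<in> {a..b} \<longrightarrow> \<bar>f y - f x\<bar> \<le> C * (y - x)"])
      show "x \<in> {a..b} \<and> z \<in> {a..b} \<longrightarrow> \<bar>f z - f x\<bar> \<le> C * (z - x)"
        if 1: "x \<in> {a..b} \<and> y \<in> {a..b} \<longrightarrow> \<bar>f y - f x\<bar> \<le> C * (y - x)"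
           and 2: "y \<in> {a..b} \<and> z \<in> {a..b} \<longrightarrow> \<bar>f z - f y\<bar> \<le> C * (z - y)" and 3: "x \<le> y" "y \<le> z" for x y z
      proof
        assume "x \<in> {a..b} \<and> z \<in> {a..b}"
        then have "\<bar>f y - f x\<bar> \<le> C * (y - x)" "\<bar>f z - f y\<bar> \<le> C * (z - y)" using 1 2 3 by auto
        moreover have "C * (z - x) = C * (y - x) + C * (z - y)" by (simp add: algebra_simps)
        ultimately show "\<bar>f z - f x\<bar> \<le> C * (z - x)" by linarith
      qed
      fix x assume x: "a \<le> x" "x \<le> b"
      then have "x \<in> S" using sub by auto
      from loc[OF this] obtain d where d: "d > 0" "\<forall>y\<in>S. \<bar>y - x\<bar> < d \<longrightarrow> \<bar>f y - f x\<bar> \<le> C * \<bar>y - x\<bar>"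
        by blast
      show "\<exists>d>0. \<forall>u v. u \<le> x \<and> x \<le> v \<and> v - u < d \<longrightarrow> (u \<in> {a..b} \<and> v \<in> {a..b} \<longrightarrow> \<bar>f v - f u\<bar> \<le> C * (v - u))"
      proof (intro exI[of _ d] conjI d(1) allI impI)
        fix u v assume uv: "u \<le> x \<and> x \<le> v \<and> v - u < d" "u \<in> {a..b} \<and> v \<in> {a..b}"
        then have "u \<in> S" "v \<in> S" using sub by auto
        moreover have "\<bar>u - x\<bar> < d" "\<bar>v - x\<bar> < d" "\<bar>u - x\<bar> = x - u" "\<bar>v - x\<bar> = v - x" using uv by auto
        ultimately have "\<bar>f u - f x\<bar> \<le> C * (x - u)" "\<bar>f v - f x\<bar> \<le> C * (v - x)" using d(2) by metis+
        moreover have "C * (v - u) = C * (x - u) + C * (v - x)" by (simp add: algebra_simps)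
        ultimately show "\<bar>f v - f u\<bar> \<le> C * (v - u)" by linarith
      qed
    qed
    then show ?thesis using that(1) by simp
  qed
  show ?thesis
  proof (rule lipschitz_onI)
    fix x y assume "x \<in> S" "y \<in> S"
    then show "dist (f x) (f y) \<le> C * dist x y"
      using main[of x y] main[of y x] by (cases "x \<le> y") (auto simp: dist_real_def abs_minus_commute)
  qed (rule C)
qed

text \<open>If no root has multiplicity above \<open>p\<close>, then at each point \<open>z\<close> one of the first \<open>p + 1\<close>
  Taylor coefficients is nonzero. By compactness they are not simultaneously small, which keeps
  \<open>p + 1\<close> roots from clustering.\<close>

lemma root_gaps_bounded_below:
  fixes T :: "real \<Rightarrow> real poly" and zs :: "real \<Rightarrow> real list"
  assumes K: "compact K" and pn: "p < n"
    and zs: "\<And>t. t \<in> K \<Longrightarrow> length (zs t) = n \<and> sorted (zs t) \<and> T t = lin_prod (zs t)"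
    and mult: "\<And>t x. t \<in> K \<Longrightarrow> count (mset (zs t)) x \<le> p"
    and bnd: "\<And>t y. t \<in> K \<Longrightarrow> y \<in> set (zs t) \<Longrightarrow> \<bar>y\<bar> \<le> \<rho>"
    and cont: "\<And>k. continuous_on K (\<lambda>t. coeff (T t) k)"
  shows "\<exists>\<gamma>>0. \<forall>t\<in>K. \<forall>i. i + p < n \<longrightarrow> \<gamma> \<le> zs t ! (i + p) - zs t ! i"
proof (cases "K = {}")
  case True
  then show ?thesis by (intro exI[of _ 1]) auto
next
  case False
  then obtain t1 where t1: "t1 \<in> K" by auto
  have "zs t1 ! 0 \<in> set (zs t1)" using zs[OF t1] pn by (intro nth_mem) auto
  then have \<rho>: "\<rho> \<ge> 0" using bnd[OF t1] by fastforce
  \<comment> \<open>The absolute values of the Taylor coefficients of order 0 to p at z, summed up.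
    The binomial form shows joint continuity in (t, z).\<close>
  define F where "F x = (\<Sum>j\<le>p. \<bar>\<Sum>k\<le>n. coeff (T (fst x)) k * (real (k choose j) * snd x ^ (k - j))\<bar>)" for x
  have F: "F (t, z) = (\<Sum>j\<le>p. \<bar>coeff (pcompose (T t) [:z, 1:]) j\<bar>)" if "t \<in> K" for t z
    unfolding F_def using zs[OF that] by (intro sum.cong) (auto simp: coeff_pcompose_translate[of _ n])
  have pos: "F (t, z) > 0" if t: "t \<in> K" for t z
  proof (rule ccontr)
    assume "\<not> F (t, z) > 0"
    moreover have "F (t, z) \<ge> 0" unfolding F_def by (intro sum_nonneg) auto
    ultimately have "F (t, z) = 0" by linarith
    then have "(\<Sum>j\<le>p. \<bar>coeff (pcompose (T t) [:z, 1:]) j\<bar>) = 0" using F[OF t, of z] by simp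
    then have "\<forall>k<Suc p. coeff (pcompose (T t) [:z, 1:]) k = 0"
      by (subst (asm) sum_nonneg_eq_0_iff) (auto simp: less_Suc_eq_le)
    then have "monom 1 (Suc p) dvd pcompose (T t) [:z, 1:]" unfolding monom_1_dvd_iff' .
    then have "[:- 0, 1:] ^ Suc p dvd pcompose (T t) [:z, 1:]" by (simp add: monom_altdef)
    moreover have e: "pcompose (T t) [:z, 1:] = lin_prod (map (\<lambda>y. y - z) (zs t))"
      using zs[OF t] by (simp add: pcompose_lin_prod)
    ultimately have "Suc p \<le> order 0 (lin_prod (map (\<lambda>y. y - z) (zs t)))"
      unfolding order_divides by (metis lin_prod_nonzero)
    also have "\<dots> = count (mset (map (\<lambda>y. y + (- z)) (zs t))) (z + (- z))" by (simp add: order_lin_prod)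
    also have "\<dots> = count (mset (zs t)) z" by (rule count_mset_map_add)
    finally show False using mult[OF t, of z] by simp
  qed
  have comp: "compact (K \<times> {-\<rho>..\<rho>})" using K by (intro compact_Times) auto
  have ne: "K \<times> {-\<rho>..\<rho>} \<noteq> {}" using t1 \<rho> by auto
  have contF: "continuous_on (K \<times> {-\<rho>..\<rho>}) F"
    unfolding F_def
    by (intro continuous_intros continuous_on_compose2[OF cont continuous_on_fst[OF continuous_on_id]]) auto
  obtain x0 where x0: "x0 \<in> K \<times> {-\<rho>..\<rho>}" "\<And>x. x \<in> K \<times> {-\<rho>..\<rho>} \<Longrightarrow> F x0 \<le> F x"
    using continuous_attains_inf[OF comp ne contF] by blast
  have F0: "F x0 > 0" using pos x0(1) by (cases x0) auto
  \<comment> \<open>If p + 1 roots lie within g \<le> 1 of z, each of these p + 1 coefficients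
    contains a factor g. This gives F \<le> B g, against the positive minimum of F.\<close>
  define B where "B = real (Suc p) * (2 ^ n * (1 + 2 * \<rho>) ^ n)"
  have B: "B > 0" using \<rho> by (simp add: B_def)
  define \<gamma> where "\<gamma> = min 1 (F x0 / B)"
  have \<gamma>: "\<gamma> > 0" using F0 B by (simp add: \<gamma>_def)
  have "\<gamma> \<le> zs t ! (i + p) - zs t ! i" if t: "t \<in> K" and i: "i + p < n" for t i
  proof (rule ccontr)
    assume neg: "\<not> \<gamma> \<le> zs t ! (i + p) - zs t ! i"
    define z where "z = zs t ! i"
    define g where "g = zs t ! (i + p) - z"
    have len: "length (zs t) = n" and srt: "sorted (zs t)" and T: "T t = lin_prod (zs t)" using zs[OF t] by auto
    have g: "0 \<le> g" "g < \<gamma>" using neg srt len i by (auto simp: g_def z_def sorted_nth_mono)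
    have g1: "g \<le> 1" using g(2) by (simp add: \<gamma>_def)
    obtain ys where ys: "mset ys = mset (map (\<lambda>y. y - z) (zs t))" "length ys = length (map (\<lambda>y. y - z) (zs t))"
       "sorted (map abs ys)" "lin_prod ys = lin_prod (map (\<lambda>y. y - z) (zs t))"
      by (rule lin_prod_sorted)
    have leny: "length ys = n" using ys len by simp
    let ?P = "\<lambda>y. \<bar>y\<bar> \<le> g"
    \<comment> \<open>The roots of index i to i + p are within g of z. Counting them shows that the
      p + 1 smallest distances are at most g.\<close>
    have near: "\<bar>ys ! j\<bar> \<le> g" if "j < Suc p" for j
    proof (rule ccontr)
      assume "\<not> \<bar>ys ! j\<bar> \<le> g"
      then have far: "\<not> \<bar>ys ! j'\<bar> \<le> g" if "j \<le> j'" "j' < n" for j'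
        using ys(3) leny that sorted_nth_mono[of "map abs ys" j j'] by auto
      have "{j'. j' < length ys \<and> ?P (ys ! j')} \<subseteq> {..<j}" using far leny not_le by auto
      then have "card {j'. j' < length ys \<and> ?P (ys ! j')} \<le> j"
        using card_mono[of "{..<j}"] by force
      moreover have "card {j'. j' < length ys \<and> ?P (ys ! j')} = length (filter ?P ys)"
        by (simp add: length_filter_conv_card)
      moreover have "length (filter ?P ys) = length (filter ?P (map (\<lambda>y. y - z) (zs t)))"
        unfolding size_mset[symmetric] mset_filter ys(1) ..
      moreover have "\<dots> = card {j'. j' < n \<and> ?P (zs t ! j' - z)}"
        using len by (simp add: length_filter_conv_card cong: conj_cong)
      moreover have "{i..i + p} \<subseteq> {j'. j' < n \<and> ?P (zs t ! j' - z)}"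
      proof
        fix j' assume j': "j' \<in> {i..i + p}"
        then have "zs t ! i \<le> zs t ! j'" "zs t ! j' \<le> zs t ! (i + p)"
          using srt len i by (auto intro!: sorted_nth_mono)
        then show "j' \<in> {j'. j' < n \<and> ?P (zs t ! j' - z)}" using j' i by (auto simp: g_def z_def)
      qed
      then have "card {i..i + p} \<le> card {j'. j' < n \<and> ?P (zs t ! j' - z)}" by (intro card_mono) auto
      ultimately show False using \<open>j < Suc p\<close> by simp
    qed
    have zK: "\<bar>z\<bar> \<le> \<rho>" using bnd[OF t, of z] len i by (simp add: z_def)
    have all: "\<bar>ys ! j\<bar> \<le> 1 + 2 * \<rho>" if "j < n" for j
    proof -
      have "set ys = (\<lambda>y. y - z) ` set (zs t)" using ys(1) by (metis set_map set_mset_mset)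
      moreover have "ys ! j \<in> set ys" using that leny by simp
      ultimately obtain y where y: "y \<in> set (zs t)" "ys ! j = y - z" by auto
      show ?thesis using bnd[OF t y(1)] zK y(2) by linarith
    qed
    have "\<bar>coeff (lin_prod ys) j\<bar> \<le> 2 ^ n * (1 + 2 * \<rho>) ^ n * g" if "j \<le> p" for j
    proof -
      have "prod_list (map abs (drop (Suc p) ys)) \<le> (1 + 2 * \<rho>) ^ (n - Suc p) * prod_list (map abs (drop n ys))"
        using all leny pn by (intro prod_list_drop_le) auto
      also have "\<dots> = (1 + 2 * \<rho>) ^ (n - Suc p)" using leny by simp
      also have "\<dots> \<le> (1 + 2 * \<rho>) ^ n" using \<rho> by (intro power_increasing) auto
      finally have 1: "prod_list (map abs (drop (Suc p) ys)) \<le> (1 + 2 * \<rho>) ^ n" .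
      have "prod_list (map abs (drop j ys)) \<le> g ^ (Suc p - j) * prod_list (map abs (drop (Suc p) ys))"
        using near leny pn that by (intro prod_list_drop_le) auto
      also have "\<dots> \<le> g * (1 + 2 * \<rho>) ^ n"
      proof (rule mult_mono[OF _ 1])
        show "g ^ (Suc p - j) \<le> g" using power_decreasing[of 1 "Suc p - j" g] g g1 that by auto
      qed (use g in \<open>auto intro!: prod_list_nonneg\<close>)
      finally have "2 ^ n * prod_list (map abs (drop j ys)) \<le> 2 ^ n * (g * (1 + 2 * \<rho>) ^ n)"
        by (intro mult_left_mono) auto
      moreover have "\<bar>coeff (lin_prod ys) j\<bar> \<le> 2 ^ n * prod_list (map abs (drop j ys))"
        using coeff_lin_prod_bound[OF ys(3), of j] leny by simp
      moreover have "2 ^ n * (g * (1 + 2 * \<rho>) ^ n) = 2 ^ n * (1 + 2 * \<rho>) ^ n * g" by (simp only: mult_ac)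
      ultimately show ?thesis by linarith
    qed
    then have "(\<Sum>j\<le>p. \<bar>coeff (lin_prod ys) j\<bar>) \<le> (\<Sum>j\<le>p. 2 ^ n * (1 + 2 * \<rho>) ^ n * g)"
      by (intro sum_mono) auto
    also have "\<dots> = B * g" by (simp add: B_def)
    also have "(\<Sum>j\<le>p. \<bar>coeff (lin_prod ys) j\<bar>) = F (t, z)"
      using F[OF t] T ys(4) by (simp add: pcompose_lin_prod)
    finally have "F (t, z) \<le> B * g" .
    moreover have "(t, z) \<in> K \<times> {-\<rho>..\<rho>}" using t zK by (auto simp: abs_le_iff)
    then have "F x0 \<le> F (t, z)" by (rule x0(2))
    moreover have "B * g < B * (F x0 / B)" using g B by (intro mult_strict_left_mono) (auto simp: \<gamma>_def)
    ultimately show False using B by simp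
  qed
  then show ?thesis using \<gamma> by blast
qed

text \<open>Weighted homogeneity: with weight i for a_i, the j-th Tschirnhausen coefficient is
  homogeneous of weight j.\<close>

lemma tcoeff_smooth_bound:
  fixes n m :: nat
  assumes n: "n \<ge> 1"
  shows "\<exists>C\<ge>1. \<forall>\<Theta> a U K. 0 \<le> \<Theta> \<longrightarrow> open U \<longrightarrow> K \<subseteq> U \<longrightarrow> convex K \<longrightarrow>
    (\<forall>i\<in>{1..n}. smooth_bound m (\<Theta> ^ i) U K (a i)) \<longrightarrow>
    (\<forall>j\<le>n. smooth_bound m (C * \<Theta> ^ j) U K (tcoeff n a j))"
proof -
  define D :: real where "D = 2 ^ Suc m"
  \<comment> \<open>One D for each of the two products, 2^n for the binomial coefficient, and D D
    per factor a_1 / n in the power: one D for its own bound and one for the multiplication.\<close>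
  define E :: real where "E = D * D * 2 ^ n * (D * D) ^ n"
  define C where "C = real (Suc n) * E"
  have D: "D \<ge> 1" unfolding D_def by (rule one_le_power) simp
  have DD: "D * D \<ge> 1" using mult_mono[of 1 D 1 D] D by simp
  have E: "E \<ge> 1"
  proof -
    have "1 * 1 * 1 \<le> D * D * 2 ^ n * (D * D) ^ n" using DD by (intro mult_mono one_le_power) auto
    then show ?thesis by (simp add: E_def)
  qed
  have C: "C \<ge> 1"
  proof -
    have "1 * 1 \<le> real (Suc n) * E" using E by (intro mult_mono) auto
    then show ?thesis by (simp add: C_def)
  qed
  have main: "smooth_bound m (C * \<Theta> ^ j) U K (tcoeff n a j)"
    if \<Theta>: "0 \<le> \<Theta>" and U: "open U" "K \<subseteq> U" "convex K"
      and a: "\<And>i. i \<in> {1..n} \<Longrightarrow> smooth_bound m (\<Theta> ^ i) U K (a i)" and j: "j \<le> n" for \<Theta> a U K j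
  proof -
    have one: "smooth_bound m 1 U K (\<lambda>t. 1)" using smooth_bound_const[of m 1 U K] by simp
    have a1: "smooth_bound m (D * \<Theta>) U K (\<lambda>t. - (a 1 t / real n))"
    proof -
      have "smooth_bound m (2 ^ Suc m * (\<bar>- 1 / real n\<bar> * \<Theta> ^ 1)) U K (\<lambda>t. (- 1 / real n) * a 1 t)"
        using \<Theta> n by (intro smooth_bound_mult U smooth_bound_const a) auto
      then have "smooth_bound m (2 ^ Suc m * (\<bar>- 1 / real n\<bar> * \<Theta> ^ 1)) U K (\<lambda>t. - (a 1 t / real n))" by simp
      moreover have "2 ^ Suc m * (\<bar>- 1 / real n\<bar> * \<Theta> ^ 1) \<le> D * \<Theta>"
      proof -
        have "\<bar>- 1 / real n\<bar> * \<Theta> \<le> 1 * \<Theta>" using n \<Theta> by (intro mult_right_mono) auto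
        then show ?thesis unfolding D_def by (intro mult_left_mono) auto
      qed
      ultimately show ?thesis by (rule smooth_bound_mono)
    qed
    have "smooth_bound m (E * \<Theta> ^ j) U K
        (\<lambda>t. (if k = n then 1 else a (n - k) t) * (real (k choose (n - j)) * (- (a 1 t / real n)) ^ (k - (n - j))))"
      if k: "k \<le> n" for k
    proof (cases "n - j \<le> k")
      case False
      then have ch: "k choose (n - j) = 0" by (intro binomial_eq_0) simp
      have "smooth_bound m (E * \<Theta> ^ j) U K (\<lambda>t. 0)"
        by (rule smooth_bound_mono[OF smooth_bound_const[of m 0]]) (use E \<Theta> in auto)
      then show ?thesis unfolding ch of_nat_0 mult_zero_left mult_zero_right .
    next
      case True
      define e where "e = k - (n - j)"
      \<comment> \<open>This is the count of weights: n - k from the coefficient and e from the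
        power of a_1.\<close>
      have e: "e \<le> n" "n - k + e = j" using True k j by (auto simp: e_def)
      have "smooth_bound m ((2 ^ Suc m) ^ e * (D * \<Theta>) ^ e) U K (\<lambda>t. (- (a 1 t / real n)) ^ e)"
        using D \<Theta> by (intro smooth_bound_power U a1) auto
      then have pw: "smooth_bound m ((D * D) ^ n * \<Theta> ^ e) U K (\<lambda>t. (- (a 1 t / real n)) ^ e)"
      proof (rule smooth_bound_mono)
        have "(2 ^ Suc m) ^ e * (D * \<Theta>) ^ e = (D * D) ^ e * \<Theta> ^ e"
          unfolding D_def power_mult_distrib by (simp only: mult_ac)
        also have "\<dots> \<le> (D * D) ^ n * \<Theta> ^ e" using DD e \<Theta> by (intro mult_right_mono power_increasing) auto
        finally show "(2 ^ Suc m) ^ e * (D * \<Theta>) ^ e \<le> (D * D) ^ n * \<Theta> ^ e" .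
      qed
      have bin: "smooth_bound m (2 ^ n) U K (\<lambda>t. real (k choose (n - j)))"
      proof (rule smooth_bound_mono[OF smooth_bound_const])
        have "k choose (n - j) \<le> 2 ^ k" by (rule binomial_le_pow2)
        also have "\<dots> \<le> 2 ^ n" using k by (intro power_increasing) auto
        finally have "real (k choose (n - j)) \<le> real (2 ^ n)" by (rule of_nat_mono)
        then show "\<bar>real (k choose (n - j))\<bar> \<le> 2 ^ n" by simp
      qed
      have Ak: "smooth_bound m (\<Theta> ^ (n - k)) U K (\<lambda>t. if k = n then 1 else a (n - k) t)"
      proof (cases "k = n")
        case True
        then show ?thesis using one by simp
      next
        case False
        then have "smooth_bound m (\<Theta> ^ (n - k)) U K (a (n - k))" using k by (intro a) auto
        then show ?thesis using False by simp
      qed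
      have q: "smooth_bound m (D * (2 ^ n * ((D * D) ^ n * \<Theta> ^ e))) U K (\<lambda>t. real (k choose (n - j)) * (- (a 1 t / real n)) ^ e)"
        unfolding D_def[symmetric] using \<Theta> D bin pw unfolding D_def by (intro smooth_bound_mult U) auto
      have "smooth_bound m (2 ^ Suc m * (\<Theta> ^ (n - k) * (D * (2 ^ n * ((D * D) ^ n * \<Theta> ^ e))))) U K
        (\<lambda>t. (if k = n then 1 else a (n - k) t) * (real (k choose (n - j)) * (- (a 1 t / real n)) ^ e))"
        using \<Theta> D by (intro smooth_bound_mult U Ak q) auto
      moreover have "2 ^ Suc m * (\<Theta> ^ (n - k) * (D * (2 ^ n * ((D * D) ^ n * \<Theta> ^ e)))) = E * \<Theta> ^ j"
      proof -
        have "\<Theta> ^ j = \<Theta> ^ (n - k) * \<Theta> ^ e" unfolding power_add[symmetric] e(2) ..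
        then show ?thesis unfolding E_def D_def[symmetric] by (simp only: mult_ac)
      qed
      ultimately show ?thesis unfolding e_def by simp
    qed
    then have "smooth_bound m (\<Sum>k\<le>n. E * \<Theta> ^ j) U K (\<lambda>t. \<Sum>k\<le>n.
        (if k = n then 1 else a (n - k) t) * (real (k choose (n - j)) * (- (a 1 t / real n)) ^ (k - (n - j))))"
      by (intro smooth_bound_sum U) auto
    moreover have "(\<Sum>k\<le>n. E * \<Theta> ^ j) = C * \<Theta> ^ j" by (simp add: C_def)
    moreover have "tcoeff n a j = (\<lambda>t. \<Sum>k\<le>n.
        (if k = n then 1 else a (n - k) t) * (real (k choose (n - j)) * (- (a 1 t / real n)) ^ (k - (n - j))))"
      by (rule ext) (rule tcoeff_eq)
    ultimately show ?thesis by (simp only:)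
  qed
  show ?thesis
    by (rule exI[of _ C], rule conjI[OF C]) (intro allI impI, rule main, auto)
qed

lemma smooth_bound_order_mono:
  assumes "convex K" "K \<subseteq> U" "L \<ge> 0" "smooth_bound m L U K f" "m' \<le> m"
  shows "smooth_bound m' L U K f"
  using assms(5,4)
proof (induction rule: inc_induct)
  case (step k)
  then show ?case using smooth_bound_Suc_imp[OF assms(1,2) _ assms(3)] by blast
qed

lemma open_interval_two_points:
  assumes "open_interval J"
  obtains x y where "x \<in> J" "y \<in> J" "x \<noteq> y"
proof -
  obtain x where x: "x \<in> J" using assms by (auto simp: open_interval_def)
  obtain e where e: "e > 0" "ball x e \<subseteq> J" using assms x by (auto simp: open_interval_def open_contains_ball)
  have "x + e / 2 \<in> ball x e" using e by (simp add: dist_real_def)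
  then show ?thesis using that[of x "x + e / 2"] x e by auto
qed

lemma compactly_contained_interval:
  assumes "open_interval V" "V \<Subset> W"
  shows "compact (closure V)" "closure V \<subseteq> W" "convex (closure V)" "V \<subseteq> closure V" "V \<subseteq> W"
  using assms closure_subset[of V]
  by (auto simp: compactly_contained_def open_interval_def is_interval_convex_1 intro!: convex_closure)

text \<open>A qualitative bound whose size does not matter. It makes the suprema for the
  Tschirnhausen coefficients finite and justifies their derivatives.\<close>

lemma tcoeff_regular:
  assumes n: "n \<ge> 1" and I: "open_interval I" and hc: "hyperbolic_curve m n I a"
    and I1: "open_interval I1" "I1 \<Subset> I"
  obtains L where "L \<ge> 0" "\<And>j. j \<le> n \<Longrightarrow> smooth_bound m L I (closure I1) (tcoeff n a j)"
proof -
  let ?K = "closure I1"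
  note K = compactly_contained_interval[OF I1]
  obtain x0 y0 where xy: "x0 \<in> I1" "y0 \<in> I1" "x0 \<noteq> y0" by (rule open_interval_two_points[OF I1(1)])
  then have xyK: "x0 \<in> ?K" "y0 \<in> ?K" using K(4) by auto
  obtain C where C: "C \<ge> 1" and tc: "\<And>\<Theta> a U K j. 0 \<le> \<Theta> \<Longrightarrow> open U \<Longrightarrow> K \<subseteq> U \<Longrightarrow> convex K \<Longrightarrow>
    (\<And>i. i\<in>{1..n} \<Longrightarrow> smooth_bound m (\<Theta> ^ i) U K (a i)) \<Longrightarrow> j \<le> n \<Longrightarrow>
    smooth_bound m (C * \<Theta> ^ j) U K (tcoeff n a j)"
    using tcoeff_smooth_bound[OF n, of m] by (elim exE conjE) (rule that, assumption, blast)
  have ai: "smooth_bound m (CLip_norm m ?K (a i)) I ?K (a i)" "0 \<le> CLip_norm m ?K (a i)" if "i \<in> {1..n}" for i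
  proof -
    have "CLip_on m I (a i)" using hc that by (auto simp: hyperbolic_curve_def)
    then obtain L where "smooth_bound m L I ?K (a i)" using CLip_on_smooth_bound K(1,2) by blast
    from smooth_bound_CLip_norm[OF this xyK xy(3)]
    show "smooth_bound m (CLip_norm m ?K (a i)) I ?K (a i)" "0 \<le> CLip_norm m ?K (a i)" .
  qed
  \<comment> \<open>Being at least 1, this \<Theta> lies below its own powers, so it bounds each
    norm in the form \<Theta>^i.\<close>
  define \<Theta> where "\<Theta> = 1 + (\<Sum>i\<in>{1..n}. CLip_norm m ?K (a i))"
  have "0 \<le> (\<Sum>i\<in>{1..n}. CLip_norm m ?K (a i))" using ai(2) by (rule sum_nonneg)
  then have \<Theta>: "\<Theta> \<ge> 1" unfolding \<Theta>_def by simp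
  have "smooth_bound m (C * \<Theta> ^ n) I ?K (tcoeff n a j)" if j: "j \<le> n" for j
  proof (rule smooth_bound_mono)
    show "smooth_bound m (C * \<Theta> ^ j) I ?K (tcoeff n a j)"
    proof (rule tc[OF _ _ K(2,3) _ j])
      show "smooth_bound m (\<Theta> ^ i) I ?K (a i)" if i: "i \<in> {1..n}" for i
      proof (rule smooth_bound_mono[OF ai(1)[OF i]])
        have "CLip_norm m ?K (a i) \<le> (\<Sum>i\<in>{1..n}. CLip_norm m ?K (a i))"
          using i ai(2) by (intro member_le_sum) auto
        then have "CLip_norm m ?K (a i) \<le> \<Theta> ^ 1" by (simp add: \<Theta>_def)
        also have "\<dots> \<le> \<Theta> ^ i" using \<Theta> i by (intro power_increasing) auto
        finally show "CLip_norm m ?K (a i) \<le> \<Theta> ^ i" .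
      qed
    qed (use \<Theta> I in \<open>auto simp: open_interval_def\<close>)
    show "C * \<Theta> ^ j \<le> C * \<Theta> ^ n" using C \<Theta> j by (intro mult_left_mono power_increasing) auto
  qed
  then show ?thesis using that[of "C * \<Theta> ^ n"] C \<Theta> by simp
qed

text \<open>\<open>speed_estimate\<close> in terms of the quantities of the theorem. The speed c has
  to dominate three things: the root size over the length of the window, the second derivative of
  the second coefficient in the Lipschitz sense, and the weighted top derivatives relative to the
  gap.\<close>

lemma tschirnhausen_speed:
  fixes n p :: nat
  assumes p: "2 \<le> p" "p \<le> n"
  shows "\<exists>C>0. \<forall>I I1 a lam t0 \<delta> c \<gamma> zs.
    open_interval I \<and> open_interval I1 \<and> I1 \<Subset> I \<and> hyperbolic_curve (p - 1) n I a \<and>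
    continuous_root I (tschirnhausen n a) lam \<and> {t0 - \<delta><..<t0 + \<delta>} \<subseteq> I1 \<and>
    \<delta> > 0 \<and> c > 0 \<and> \<gamma> > 0 \<and> tcoeff n a 2 t0 \<noteq> 0 \<and> sqrt \<bar>tcoeff n a 2 t0\<bar> \<le> c * \<delta> \<and>
    Lip I1 (deriv (tcoeff n a 2)) \<le> c\<^sup>2 \<and>
    (\<forall>i\<in>{2..n}. Lip I1 ((deriv ^^ (p - 1)) (tcoeff n a i)) * sqrt \<bar>tcoeff n a 2 t0\<bar> ^ (n - i) \<le> c ^ p * \<gamma> ^ (n - p)) \<and>
    tschirnhausen n a t0 = lin_prod zs \<and> length zs = n \<and> sorted zs \<and>
    (\<forall>i. i + p < n \<longrightarrow> \<gamma> \<le> zs ! (i + p) - zs ! i)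
    \<longrightarrow> (\<forall>\<^sub>F t in nhds t0. \<bar>lam t - lam t0\<bar> \<le> C * c * \<bar>t - t0\<bar>)"
proof -
  define m where "m = p - 1"
  have m: "m \<ge> 1" "p = Suc m" "Suc m \<le> n" using p by (auto simp: m_def)
  have n1: "n \<ge> 1" and n2: "n \<ge> 2" using p by auto
  obtain C where C: "C > 0" and est: "\<forall>T lam t0 w c \<gamma> s0. centered_curve n m T lam t0 w c \<gamma> s0 \<longrightarrow>
    (\<forall>\<^sub>F t in nhds t0. \<bar>lam t - lam t0\<bar> \<le> C * c * \<bar>t - t0\<bar>)"
    using speed_estimate[OF m(1,3)] by (elim exE conjE) (rule that)
  have main: "\<forall>\<^sub>F t in nhds t0. \<bar>lam t - lam t0\<bar> \<le> (2 * C) * c * \<bar>t - t0\<bar>"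
    if H: "open_interval I \<and> open_interval I1 \<and> I1 \<Subset> I \<and> hyperbolic_curve (p - 1) n I a \<and>
    continuous_root I (tschirnhausen n a) lam \<and> {t0 - \<delta><..<t0 + \<delta>} \<subseteq> I1 \<and>
    \<delta> > 0 \<and> c > 0 \<and> \<gamma> > 0 \<and> tcoeff n a 2 t0 \<noteq> 0 \<and> sqrt \<bar>tcoeff n a 2 t0\<bar> \<le> c * \<delta> \<and>
    Lip I1 (deriv (tcoeff n a 2)) \<le> c\<^sup>2 \<and>
    (\<forall>i\<in>{2..n}. Lip I1 ((deriv ^^ (p - 1)) (tcoeff n a i)) * sqrt \<bar>tcoeff n a 2 t0\<bar> ^ (n - i) \<le> c ^ p * \<gamma> ^ (n - p)) \<and>
    tschirnhausen n a t0 = lin_prod zs \<and> length zs = n \<and> sorted zs \<and>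
    (\<forall>i. i + p < n \<longrightarrow> \<gamma> \<le> zs ! (i + p) - zs ! i)" for I I1 a lam t0 \<delta> c \<gamma> zs
  proof -
    have I: "open_interval I" and I1: "open_interval I1" "I1 \<Subset> I" and hc: "hyperbolic_curve m n I a"
      and cr: "continuous_root I (tschirnhausen n a) lam" and sub: "{t0 - \<delta><..<t0 + \<delta>} \<subseteq> I1"
      and \<delta>: "\<delta> > 0" and c: "c > 0" and \<gamma>: "\<gamma> > 0" and b2: "tcoeff n a 2 t0 \<noteq> 0"
      and s0\<delta>: "sqrt \<bar>tcoeff n a 2 t0\<bar> \<le> c * \<delta>" and L2: "Lip I1 (deriv (tcoeff n a 2)) \<le> c\<^sup>2"
      and M: "\<And>i. i \<in> {2..n} \<Longrightarrow> Lip I1 ((deriv ^^ m) (tcoeff n a i)) * sqrt \<bar>tcoeff n a 2 t0\<bar> ^ (n - i) \<le> c ^ Suc m * \<gamma> ^ (n - Suc m)"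
      and zs: "tschirnhausen n a t0 = lin_prod zs" "length zs = n" "sorted zs"
      and gap: "\<And>i. i + Suc m < n \<Longrightarrow> \<gamma> \<le> zs ! (i + Suc m) - zs ! i"
      using H m(2) unfolding m_def[symmetric] by auto
    let ?K = "closure I1"
    note K = compactly_contained_interval[OF I1]
    obtain x0 y0 where xy: "x0 \<in> I1" "y0 \<in> I1" "x0 \<noteq> y0" by (rule open_interval_two_points[OF I1(1)])
    obtain L where L: "L \<ge> 0" "\<And>j. j \<le> n \<Longrightarrow> smooth_bound m L I ?K (tcoeff n a j)"
      by (rule tcoeff_regular[OF n1 I hc I1]) blast
    \<comment> \<open>The closed window has to lie inside the open one of radius \<delta>. Halving
      it is made up for by the doubled speed 2 c.\<close>
    define w where "w = \<delta> / 2"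
    let ?W = "{t0-w..t0+w}"
    have W: "?W \<subseteq> I1" using sub \<delta> by (force simp: w_def)
    then have WI: "?W \<subseteq> I" using K(5) by blast
    have t0: "t0 \<in> I" "t0 \<in> ?W" using WI \<delta> by (auto simp: w_def)
    define s0 where "s0 = sqrt \<bar>tcoeff n a 2 t0\<bar>"
    have s0: "s0 > 0" using b2 by (simp add: s0_def)
    have co: "coeff (tschirnhausen n a t) k = tcoeff n a (n - k) t" if "k \<le> n" for k t
      using that by (simp add: tcoeff_def)
    have roots: "\<exists>zs. length zs = n \<and> tschirnhausen n a t = lin_prod zs" "coeff (tschirnhausen n a t) (n - 1) = 0" if "t \<in> I" for t
    proof -
      have "hyperbolic (poly_curve n a t)" using hc that by (simp add: hyperbolic_curve_def)
      from tschirnhausen_roots[OF n1 this]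
      show "\<exists>zs. length zs = n \<and> tschirnhausen n a t = lin_prod zs" "coeff (tschirnhausen n a t) (n - 1) = 0"
        by blast+
    qed
    have lipI1: "(Lip I1 ((deriv ^^ m') (tcoeff n a j)))-lipschitz_on I1 ((deriv ^^ m') (tcoeff n a j))"
      if "m' \<le> m" "j \<le> n" for m' j
    proof -
      have "smooth_bound m' L I ?K (tcoeff n a j)"
        by (rule smooth_bound_order_mono[OF K(3,2) L(1) L(2)[OF that(2)] that(1)])
      then have "L-lipschitz_on ?K ((deriv ^^ m') (tcoeff n a j))" unfolding smooth_bound_iff by blast
      then have "L-lipschitz_on I1 ((deriv ^^ m') (tcoeff n a j))" using K(4) by (rule lipschitz_on_subset)
      then show ?thesis using xy by (rule Lip_lipschitz)
    qed
    have "centered_curve n m (tschirnhausen n a) lam t0 w (2 * c) \<gamma> s0"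
      unfolding centered_curve_def
    proof (intro conjI ballI allI impI)
      show "\<exists>zs. length zs = n \<and> tschirnhausen n a t = lin_prod zs" "coeff (tschirnhausen n a t) (n - 1) = 0"
        if "t \<in> ?W" for t using roots[of t] that WI by blast+
      show "\<exists>g. (\<forall>t\<in>?W. ((\<lambda>t. coeff (tschirnhausen n a t) (n - 2)) has_real_derivative g t) (at t within ?W)) \<and>
       ((2 * c)\<^sup>2)-lipschitz_on ?W g"
      proof (rule exI[of _ "deriv (tcoeff n a 2)"], intro conjI ballI)
        have eq: "(\<lambda>t. coeff (tschirnhausen n a t) (n - 2)) = tcoeff n a 2"
          using co[of "n - 2"] n2 by auto
        have "smooth_bound 1 L I ?K (tcoeff n a 2)"
          by (rule smooth_bound_order_mono[OF K(3,2) L(1) L(2)[OF n2] m(1)])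
        then have "tcoeff n a 2 field_differentiable at t" if "t \<in> I" for t using that by simp
        then show "((\<lambda>t. coeff (tschirnhausen n a t) (n - 2)) has_real_derivative deriv (tcoeff n a 2) t) (at t within ?W)"
          if "t \<in> ?W" for t unfolding eq using that WI field_differentiable_derivI has_field_derivative_at_within by blast
        have "(Lip I1 (deriv (tcoeff n a 2)))-lipschitz_on I1 (deriv (tcoeff n a 2))"
          using lipI1[of 1 2] m n2 by simp
        then have "(Lip I1 (deriv (tcoeff n a 2)))-lipschitz_on ?W (deriv (tcoeff n a 2))" using W by (rule lipschitz_on_subset)
        then show "((2 * c)\<^sup>2)-lipschitz_on ?W (deriv (tcoeff n a 2))"
        proof (rule lipschitz_on_le)
          show "Lip I1 (deriv (tcoeff n a 2)) \<le> (2 * c)\<^sup>2"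
          proof -
            have "(2 * c)\<^sup>2 = 4 * c\<^sup>2" by (simp add: power_mult_distrib)
            then show ?thesis using L2 zero_le_power2[of c] by linarith
          qed
        qed
      qed
      show "s0\<^sup>2 = \<bar>coeff (tschirnhausen n a t0) (n - 2)\<bar>" using co[of "n - 2" t0] n2 by (simp add: s0_def)
      show "s0 \<le> 2 * c * w" using s0\<delta> by (simp add: s0_def w_def)
      show "\<exists>M\<ge>0. lip_deriv m ?W M (\<lambda>t. coeff (tschirnhausen n a t) k) \<and>
           M * s0 ^ k \<le> (2 * c) ^ Suc m * \<gamma> ^ (n - Suc m)" if k: "k \<le> n - 2" for k
      proof (intro exI conjI)
        let ?M = "Lip I1 ((deriv ^^ m) (tcoeff n a (n - k)))"
        have i: "n - k \<in> {2..n}" "k \<le> n" "n - (n - k) = k" using k n2 by auto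
        have lp: "?M-lipschitz_on I1 ((deriv ^^ m) (tcoeff n a (n - k)))" by (rule lipI1) auto
        show "0 \<le> ?M" by (rule lipschitz_on_nonneg[OF lp])
        have "lip_deriv m ?W ?M (tcoeff n a (n - k))"
          by (rule smooth_bound_lip_deriv[OF L(2) WI lipschitz_on_subset[OF lp W]]) simp
        then show "lip_deriv m ?W ?M (\<lambda>t. coeff (tschirnhausen n a t) k)" using co[OF i(2)] by simp
        have "?M * s0 ^ k \<le> c ^ Suc m * \<gamma> ^ (n - Suc m)" using M[OF i(1)] i(3) by (simp add: s0_def)
        also have "\<dots> \<le> (2 * c) ^ Suc m * \<gamma> ^ (n - Suc m)"
          using c \<gamma> by (intro mult_right_mono power_mono) auto
        finally show "?M * s0 ^ k \<le> (2 * c) ^ Suc m * \<gamma> ^ (n - Suc m)" .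
      qed
      show "\<exists>zs. tschirnhausen n a t0 = lin_prod zs \<and> length zs = n \<and> sorted zs \<and>
          (\<forall>i. i + Suc m < n \<longrightarrow> \<gamma> \<le> zs ! (i + Suc m) - zs ! i)" using zs gap by blast
      show "isCont lam t0" using cr I t0(1) by (auto simp: continuous_root_def open_interval_def continuous_on_eq_continuous_at)
      show "poly (tschirnhausen n a t) (lam t) = 0" if "t \<in> ?W" for t using cr WI that by (auto simp: continuous_root_def)
    qed (use \<delta> c \<gamma> s0 in \<open>auto simp: w_def\<close>)
    from est[rule_format, OF this] show ?thesis by (simp add: mult_ac)
  qed
  have "2 * C > 0" using C by simp
  then show ?thesis
    by (intro exI[of _ "2 * C"] conjI) (assumption, intro allI impI, rule main)
qed

subsection \<open>The case of maximal multiplicity \<open>n\<close>\<close>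

text \<open>Boundedness makes \<open>Inf\<close> and \<open>Sup\<close> the true endpoints. As I1 is
  open and contains the closure of I0, the endpoints of I0 lie strictly inside, so all distances are
  positive.\<close>

lemma endpoint_dist_window:
  assumes I0: "open_interval I0" and I1: "open_interval I1" and sub: "I0 \<Subset> I1" and bnd: "bounded I1"
  shows "endpoint_dist I0 I1 > 0" "\<And>t. t \<in> I0 \<Longrightarrow> {t - endpoint_dist I0 I1<..<t + endpoint_dist I0 I1} \<subseteq> I1"
proof -
  let ?d = "endpoint_dist I0 I1"
  note K = compactly_contained_interval[OF I0 sub]
  have ne: "I0 \<noteq> {}" "I1 \<noteq> {}" using I0 I1 by (auto simp: open_interval_def)
  have bd1: "bdd_below I1" "bdd_above I1"
    using bnd by (simp_all add: bounded_imp_bdd_below bounded_imp_bdd_above)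
  have bd0: "bdd_below I0" "bdd_above I0"
    using bd1 K(5) by (meson bdd_below_mono bdd_above_mono)+
  have strict: "Inf I1 < x" "x < Sup I1" if x: "x \<in> I1" for x
  proof -
    obtain e where e: "e > 0" "ball x e \<subseteq> I1" using I1 x by (auto simp: open_interval_def open_contains_ball)
    have "x - e / 2 \<in> I1" "x + e / 2 \<in> I1" using e by (auto simp: subset_iff dist_real_def)
    then have "Inf I1 \<le> x - e / 2" "x + e / 2 \<le> Sup I1" using bd1 by (auto intro: cInf_lower cSup_upper)
    then show "Inf I1 < x" "x < Sup I1" using e(1) by linarith+
  qed
  have "Inf I0 \<in> closure I0" "Sup I0 \<in> closure I0"
    using ne(1) bd0 by (simp_all add: closure_contains_Inf closure_contains_Sup)
  then have ends: "Inf I0 \<in> I1" "Sup I0 \<in> I1" using K(2) by auto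
  have "{Inf I0, Sup I0} \<inter> {Inf I1, Sup I1} = {}" using strict[OF ends(1)] strict[OF ends(2)] by auto
  then show "?d > 0" unfolding endpoint_dist_def by (subst setdist_gt_0_compact_closed) auto
  have d: "?d \<le> dist (Inf I0) (Inf I1)" "?d \<le> dist (Sup I0) (Sup I1)"
    unfolding endpoint_dist_def by (auto intro: setdist_le_dist)
  fix t assume t: "t \<in> I0"
  then have "Inf I0 \<le> t" "t \<le> Sup I0" using bd0 by (auto intro: cInf_lower cSup_upper)
  show "{t - ?d<..<t + ?d} \<subseteq> I1"
  proof
    fix x assume x: "x \<in> {t - ?d<..<t + ?d}"
    have "Inf I1 < x" "x < Sup I1"
      using x d \<open>Inf I0 \<le> t\<close> \<open>t \<le> Sup I0\<close> strict[OF ends(1)] strict[OF ends(2)] by (auto simp: dist_real_def)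
    then obtain u v where "u \<in> I1" "u < x" "v \<in> I1" "x < v"
      using cInf_less_iff[OF ne(2) bd1(1)] less_cSup_iff[OF ne(2) bd1(2)] by auto
    then show "x \<in> I1" using I1 unfolding open_interval_def is_interval_1 by (meson less_imp_le)
  qed
qed

section \<open>The Tschirnhausen coefficients along the curve\<close>

lemma tcoeff_continuous:
  assumes "hyperbolic_curve m n I a" "n \<ge> 1"
  shows "continuous_on I (tcoeff n a j)"
proof -
  have a: "continuous_on I (a i)" if "i \<in> {1..n}" for i
    using CLip_on_deriv_continuous[of m I "a i" 0] assms(1) that by (auto simp: hyperbolic_curve_def)
  have "continuous_on I (\<lambda>t. \<Sum>k\<le>n. (if k = n then 1 else a (n - k) t) *
     (real (k choose (n - j)) * (- (a 1 t / real n)) ^ (k - (n - j))))"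
  proof (intro continuous_on_sum continuous_on_mult continuous_on_power continuous_on_minus continuous_on_divide continuous_on_const)
    show "continuous_on I (\<lambda>t. if k = n then 1 else a (n - k) t)" if "k \<in> {..n}" for k
    proof (cases "k = n")
      case False
      then have "n - k \<in> {1..n}" using that by auto
      then show ?thesis using False a by simp
    qed simp
  qed (use assms(2) in \<open>auto intro: a\<close>)
  then show ?thesis unfolding tcoeff_eq[abs_def] .
qed

lemma coeff_tschirnhausen: "k \<le> n \<Longrightarrow> coeff (tschirnhausen n a t) k = tcoeff n a (n - k) t"
  by (simp add: tcoeff_def)

lemma tschirnhausen_root_square_le:
  assumes n: "n \<ge> 2" and hyp: "hyperbolic (poly_curve n a t)" and z: "poly (tschirnhausen n a t) z = 0"
  shows "z\<^sup>2 \<le> - (2 * tcoeff n a 2 t)"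
proof -
  have n1: "n \<ge> 1" using n by simp
  obtain zs where zs: "length zs = n" "tschirnhausen n a t = lin_prod zs" "coeff (tschirnhausen n a t) (n - 1) = 0"
    by (rule tschirnhausen_roots[OF n1 hyp])
  have "z \<in> set zs" using z zs by (auto simp: poly_lin_prod prod_list_zero_iff)
  then have "z\<^sup>2 \<le> - (2 * coeff (lin_prod zs) (n - 2))" using zs n by (intro root_square_le) auto
  then show ?thesis using coeff_tschirnhausen[of "n - 2" n a t] zs(2) n by simp
qed

lemma tcoeff_2_nonpos:
  assumes n: "n \<ge> 2" and hyp: "hyperbolic (poly_curve n a t)"
  shows "tcoeff n a 2 t \<le> 0"
proof -
  have n1: "n \<ge> 1" using n by simp
  obtain zs where zs: "length zs = n" "tschirnhausen n a t = lin_prod zs"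
    by (rule tschirnhausen_roots[OF n1 hyp])
  then have "poly (tschirnhausen n a t) (zs ! 0) = 0" using n by (auto simp: poly_lin_prod prod_list_zero_iff)
  from tschirnhausen_root_square_le[OF n hyp this] show ?thesis using zero_le_power2[of "zs ! 0"] by linarith
qed

lemma tcoeff_Lip:
  assumes n: "n \<ge> 1" and I: "open_interval I" and hc: "hyperbolic_curve m n I a"
    and I1: "open_interval I1" "I1 \<Subset> I" and m': "m' \<le> m" and j: "j \<le> n"
  shows "(Lip I1 ((deriv ^^ m') (tcoeff n a j)))-lipschitz_on I1 ((deriv ^^ m') (tcoeff n a j))"
    "0 \<le> Lip I1 ((deriv ^^ m') (tcoeff n a j))"
    "t \<in> I1 \<Longrightarrow> \<bar>tcoeff n a j t\<bar> \<le> sup_norm I1 (tcoeff n a j)"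
    "m' < m \<Longrightarrow> t \<in> I \<Longrightarrow> (deriv ^^ m') (tcoeff n a j) field_differentiable at t"
proof -
  note K = compactly_contained_interval[OF I1]
  obtain x0 y0 where xy: "x0 \<in> I1" "y0 \<in> I1" "x0 \<noteq> y0" by (rule open_interval_two_points[OF I1(1)])
  obtain L where L: "L \<ge> 0" "\<And>j. j \<le> n \<Longrightarrow> smooth_bound m L I (closure I1) (tcoeff n a j)"
    by (rule tcoeff_regular[OF n I hc I1]) blast
  have "smooth_bound m' L I (closure I1) (tcoeff n a j)"
    by (rule smooth_bound_order_mono[OF K(3,2) L(1) L(2)[OF j] m'])
  then have "L-lipschitz_on (closure I1) ((deriv ^^ m') (tcoeff n a j))" unfolding smooth_bound_iff by blast
  then have "L-lipschitz_on I1 ((deriv ^^ m') (tcoeff n a j))" using K(4) by (rule lipschitz_on_subset)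
  then show 1: "(Lip I1 ((deriv ^^ m') (tcoeff n a j)))-lipschitz_on I1 ((deriv ^^ m') (tcoeff n a j))"
    using xy by (rule Lip_lipschitz)
  then show "0 \<le> Lip I1 ((deriv ^^ m') (tcoeff n a j))" by (rule lipschitz_on_nonneg)
  show "\<bar>tcoeff n a j t\<bar> \<le> sup_norm I1 (tcoeff n a j)" if t: "t \<in> I1"
  proof (rule sup_norm_upper[OF _ t])
    show "\<bar>tcoeff n a j x\<bar> \<le> L" if "x \<in> I1" for x
      using smooth_bound_le[OF L(2)[OF j]] that K(4) by blast
  qed
  show "(deriv ^^ m') (tcoeff n a j) field_differentiable at t" if "m' < m" "t \<in> I"
    using L(2)[OF j] that unfolding smooth_bound_iff by blast
qed

text \<open>At a point where all roots coincide, the second coefficient has a maximum, so it is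
  quadratically small nearby.\<close>

lemma coinciding_roots_speed:
  assumes n: "n \<ge> 2" and I: "open_interval I" and hc: "hyperbolic_curve m n I a" and m: "m \<ge> 1"
    and I1: "open_interval I1" "I1 \<Subset> I"
    and cr: "continuous_root I (tschirnhausen n a) lam" and sub: "{t0 - \<delta><..<t0 + \<delta>} \<subseteq> I1" and \<delta>: "\<delta> > 0"
    and z: "tcoeff n a 2 t0 = 0" and B: "Lip I1 (deriv (tcoeff n a 2)) \<le> B\<^sup>2" "B \<ge> 0"
  shows "\<forall>\<^sub>F t in nhds t0. \<bar>lam t - lam t0\<bar> \<le> 2 * B * \<bar>t - t0\<bar>"
proof -
  have n1: "n \<ge> 1" using n by simp
  note K = compactly_contained_interval[OF I1]
  let ?f = "tcoeff n a 2" and ?L = "Lip I1 (deriv (tcoeff n a 2))"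
  have hyp: "hyperbolic (poly_curve n a t)" if "t \<in> I1" for t
    using hc that K(5) by (auto simp: hyperbolic_curve_def)
  have lip: "?L-lipschitz_on I1 (deriv ?f)" "0 \<le> ?L"
    using tcoeff_Lip(1,2)[OF n1 I hc I1 m n] by simp_all
  have diff: "(?f has_real_derivative deriv ?f t) (at t)" if "t \<in> I1" for t
    using tcoeff_Lip(4)[OF n1 I hc I1 _ n, of 0 t] m that K(5) by (auto simp: field_differentiable_derivI)
  have t0: "t0 \<in> I1" using sub \<delta> by (simp add: subset_iff)
  have d0: "deriv ?f t0 = 0"
  proof (rule DERIV_local_max[OF diff[OF t0] \<delta>], intro allI impI)
    fix y assume "\<bar>t0 - y\<bar> < \<delta>"
    then have "y \<in> I1" using sub by (simp add: subset_iff abs_less_iff)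
    then show "?f y \<le> ?f t0" using tcoeff_2_nonpos[OF n hyp] z by simp
  qed
  have root: "(lam t)\<^sup>2 \<le> 2 * \<bar>?f t\<bar>" if t: "t \<in> I1" for t
  proof -
    have "poly (tschirnhausen n a t) (lam t) = 0" using cr t K(5) by (auto simp: continuous_root_def)
    then have "(lam t)\<^sup>2 \<le> - (2 * ?f t)" by (rule tschirnhausen_root_square_le[OF n hyp[OF t]])
    then show ?thesis by linarith
  qed
  have l0: "lam t0 = 0" using root[OF t0] z by simp
  have "\<bar>lam t - lam t0\<bar> \<le> 2 * B * \<bar>t - t0\<bar>" if t: "\<bar>t - t0\<bar> < \<delta>" for t
  proof -
    define r where "r = \<bar>t - t0\<bar>"
    have S: "{t0 - r..t0 + r} \<subseteq> I1" using sub t unfolding r_def by (force simp: subset_iff)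
    have tS: "t \<in> {t0 - r..t0 + r}" "t0 \<in> {t0 - r..t0 + r}" by (auto simp: r_def)
    \<comment> \<open>The derivative vanishes at t0, so it is at most L r on the interval of radius
      r, and the function at most L r^2.\<close>
    have "norm (?f t - ?f t0) \<le> (?L * r) * norm (t - t0)"
    proof (rule field_differentiable_bound[of "{t0 - r..t0 + r}" _ "deriv ?f"])
      show "(?f has_field_derivative deriv ?f x) (at x within {t0 - r..t0 + r})" if "x \<in> {t0 - r..t0 + r}" for x
        using diff S that has_field_derivative_at_within by blast
      show "norm (deriv ?f x) \<le> ?L * r" if x: "x \<in> {t0 - r..t0 + r}" for x
      proof -
        have "\<bar>deriv ?f x - deriv ?f t0\<bar> \<le> ?L * \<bar>x - t0\<bar>"
          using lipschitz_onD[OF lip(1), of x t0] S x t0 by (auto simp: dist_real_def)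
        also have "\<dots> \<le> ?L * r" using x lip(2) by (intro mult_left_mono) auto
        finally show ?thesis using d0 by simp
      qed
    qed (use tS in auto)
    then have "\<bar>?f t\<bar> \<le> ?L * r\<^sup>2" using z by (simp add: r_def power2_eq_square mult.assoc)
    also have "\<dots> \<le> B\<^sup>2 * r\<^sup>2" using B by (intro mult_right_mono) auto
    finally have ft: "\<bar>?f t\<bar> \<le> B\<^sup>2 * r\<^sup>2" .
    have "t \<in> I1" using S tS by blast
    then have "\<bar>lam t\<bar>\<^sup>2 \<le> 2 * (B\<^sup>2 * r\<^sup>2)" using root ft by fastforce
    also have "\<dots> \<le> 4 * (B\<^sup>2 * r\<^sup>2)" by simp
    also have "\<dots> = (2 * B * r)\<^sup>2" by (simp add: power_mult_distrib)
    finally have "\<bar>lam t\<bar> \<le> 2 * B * r" by (rule power2_le_imp_le) (use B in \<open>auto simp: r_def\<close>)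
    then show ?thesis using l0 by (simp add: r_def)
  qed
  then show ?thesis unfolding eventually_nhds_metric using \<delta> by (auto simp: dist_real_def)
qed

lemma lipschitz_on_eventually:
  fixes f :: "real \<Rightarrow> real"
  assumes "is_interval S" "C \<ge> 0" "\<And>x. x \<in> S \<Longrightarrow> \<forall>\<^sub>F y in nhds x. \<bar>f y - f x\<bar> \<le> C * \<bar>y - x\<bar>"
  shows "C-lipschitz_on S f"
proof (rule lipschitz_on_pointwise[OF assms(1,2)])
  fix x assume "x \<in> S"
  from assms(3)[OF this] show "\<exists>d>0. \<forall>y\<in>S. \<bar>y - x\<bar> < d \<longrightarrow> \<bar>f y - f x\<bar> \<le> C * \<bar>y - x\<bar>"
    unfolding eventually_nhds_metric dist_real_def by blast
qed

lemma root_le_imp_le_power: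
  assumes "root p x \<le> B" "0 \<le> x" "p > 0"
  shows "x \<le> B ^ p"
proof -
  have "x = root p x ^ p" using assms by (simp add: real_root_pow_pos2)
  also have "\<dots> \<le> B ^ p" using assms by (intro power_mono) auto
  finally show ?thesis .
qed

lemma sqrt_le_imp_le_power2:
  assumes "sqrt x \<le> B" "0 \<le> x"
  shows "x \<le> B\<^sup>2"
  using assms real_sqrt_le_iff sqrt_le_D by blast

lemma bound_full_ge:
  "sqrt (sup_norm I1 (tcoeff n a 2)) / endpoint_dist I0 I1 \<le> bound_full n a I0 I1"
  "sqrt (Lip I1 (deriv (tcoeff n a 2))) \<le> bound_full n a I0 I1"
  "i \<in> {2..n} \<Longrightarrow> root n (Lip I1 ((deriv ^^ (n - 1)) (tcoeff n a i)) * sqrt (sup_norm I1 (tcoeff n a 2)) ^ (n - i))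
     \<le> bound_full n a I0 I1"
proof -
  let ?r = "\<lambda>i. root n (Lip I1 ((deriv ^^ (n - 1)) (tcoeff n a i)) * sqrt (sup_norm I1 (tcoeff n a 2)) ^ (n - i))"
  have B: "bound_full n a I0 I1 = Max {sqrt (sup_norm I1 (tcoeff n a 2)) / endpoint_dist I0 I1,
     sqrt (Lip I1 (deriv (tcoeff n a 2))), MAX i\<in>{2..n}. ?r i}"
    by (simp add: bound_full_def Let_def)
  show "sqrt (sup_norm I1 (tcoeff n a 2)) / endpoint_dist I0 I1 \<le> bound_full n a I0 I1"
    "sqrt (Lip I1 (deriv (tcoeff n a 2))) \<le> bound_full n a I0 I1"
    unfolding B by (rule Max_ge; simp)+
  assume "i \<in> {2..n}"
  then have "?r i \<le> (MAX i\<in>{2..n}. ?r i)" by (intro Max_ge) auto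
  also have "\<dots> \<le> bound_full n a I0 I1" unfolding B by (rule Max_ge) simp_all
  finally show "?r i \<le> bound_full n a I0 I1" .
qed

text \<open>The bound itself serves as the speed at every point of I0. Points where all roots
  coincide are left to \<open>coinciding_roots_speed\<close>.\<close>

lemma full_lipschitz:
  assumes n: "n \<ge> 2"
  shows "\<exists>C>0. \<forall>I0 I1 I a lam. open_interval I0 \<and> open_interval I1 \<and> open_interval I \<and> I0 \<Subset> I1 \<and> I1 \<Subset> I \<and>
    hyperbolic_curve (n - 1) n I a \<and> continuous_root I (tschirnhausen n a) lam \<longrightarrow>
    (C * bound_full n a I0 I1)-lipschitz_on I0 lam"
proof -
  have n1: "n \<ge> 1" using n by simp
  obtain C where C: "C > 0" and sp: "\<forall>I I1 a lam t0 \<delta> c \<gamma> zs.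
    open_interval I \<and> open_interval I1 \<and> I1 \<Subset> I \<and> hyperbolic_curve (n - 1) n I a \<and>
    continuous_root I (tschirnhausen n a) lam \<and> {t0 - \<delta><..<t0 + \<delta>} \<subseteq> I1 \<and>
    \<delta> > 0 \<and> c > 0 \<and> \<gamma> > 0 \<and> tcoeff n a 2 t0 \<noteq> 0 \<and> sqrt \<bar>tcoeff n a 2 t0\<bar> \<le> c * \<delta> \<and>
    Lip I1 (deriv (tcoeff n a 2)) \<le> c\<^sup>2 \<and>
    (\<forall>i\<in>{2..n}. Lip I1 ((deriv ^^ (n - 1)) (tcoeff n a i)) * sqrt \<bar>tcoeff n a 2 t0\<bar> ^ (n - i) \<le> c ^ n * \<gamma> ^ (n - n)) \<and>
    tschirnhausen n a t0 = lin_prod zs \<and> length zs = n \<and> sorted zs \<and>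
    (\<forall>i. i + n < n \<longrightarrow> \<gamma> \<le> zs ! (i + n) - zs ! i)
    \<longrightarrow> (\<forall>\<^sub>F t in nhds t0. \<bar>lam t - lam t0\<bar> \<le> C * c * \<bar>t - t0\<bar>)"
    using tschirnhausen_speed[OF n order_refl] by (elim exE conjE) (rule that)
  \<comment> \<open>C is needed at points with distinct roots, 2 where all roots coincide.\<close>
  have main: "((C + 2) * bound_full n a I0 I1)-lipschitz_on I0 lam"
    if H: "open_interval I0 \<and> open_interval I1 \<and> open_interval I \<and> I0 \<Subset> I1 \<and> I1 \<Subset> I \<and>
    hyperbolic_curve (n - 1) n I a \<and> continuous_root I (tschirnhausen n a) lam" for I0 I1 I a lam
  proof -
    have I0: "open_interval I0" "I0 \<Subset> I1" and I1: "open_interval I1" "I1 \<Subset> I" and I: "open_interval I"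
      and hc: "hyperbolic_curve (n - 1) n I a" and cr: "continuous_root I (tschirnhausen n a) lam"
      using H by auto
    note K0 = compactly_contained_interval[OF I0] and K1 = compactly_contained_interval[OF I1]
    have bnd: "bounded I1" using K1(1,4) compact_imp_bounded bounded_subset by blast
    define \<delta> where "\<delta> = endpoint_dist I0 I1"
    have \<delta>: "\<delta> > 0" and win: "\<And>t. t \<in> I0 \<Longrightarrow> {t - \<delta><..<t + \<delta>} \<subseteq> I1"
      using endpoint_dist_window[OF I0(1) I1(1) I0(2) bnd] by (auto simp: \<delta>_def)
    define B where "B = bound_full n a I0 I1"
    define A where "A = sup_norm I1 (tcoeff n a 2)"
    have n11: "1 \<le> n - 1" using n by simp
    have L2: "0 \<le> Lip I1 (deriv (tcoeff n a 2))" using tcoeff_Lip(2)[OF n1 I hc I1 n11 n] by simp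
    have B0: "B \<ge> 0" using bound_full_ge(2)[of I1 n a I0] L2 unfolding B_def by (meson order_trans real_sqrt_ge_zero)
    have BL: "Lip I1 (deriv (tcoeff n a 2)) \<le> B\<^sup>2"
      unfolding B_def by (rule sqrt_le_imp_le_power2[OF bound_full_ge(2) L2])
    have pt: "\<forall>\<^sub>F y in nhds t. \<bar>lam y - lam t\<bar> \<le> (C + 2) * B * \<bar>y - t\<bar>" if t: "t \<in> I0" for t
    proof (cases "tcoeff n a 2 t = 0")
      case True
      have "\<forall>\<^sub>F y in nhds t. \<bar>lam y - lam t\<bar> \<le> 2 * B * \<bar>y - t\<bar>"
        by (rule coinciding_roots_speed[OF n I hc n11 I1 cr win[OF t] \<delta> True BL B0])
      then show ?thesis
      proof eventually_elim
        case (elim y)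
        have "2 * B * \<bar>y - t\<bar> \<le> (C + 2) * B * \<bar>y - t\<bar>" using C B0 by (intro mult_right_mono) auto
        then show ?case using elim by linarith
      qed
    next
      case False
      have tI1: "t \<in> I1" using t K0(5) by auto
      have tI: "t \<in> I" using tI1 K1(5) by auto
      have "hyperbolic (poly_curve n a t)" using hc tI by (auto simp: hyperbolic_curve_def)
      then obtain zs where zs: "length zs = n" "sorted zs" "tschirnhausen n a t = lin_prod zs"
        by (rule tschirnhausen_roots[OF n1])
      have bA: "\<bar>tcoeff n a 2 t\<bar> \<le> A" unfolding A_def by (rule tcoeff_Lip(3)[OF n1 I hc I1 n11 n tI1])
      have A0: "A > 0" using bA False by linarith
      have "sqrt A / \<delta> \<le> B" unfolding A_def \<delta>_def B_def by (rule bound_full_ge(1))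
      then have AB: "sqrt A \<le> B * \<delta>" using \<delta> by (simp add: pos_divide_le_eq)
      have sA: "sqrt \<bar>tcoeff n a 2 t\<bar> \<le> sqrt A" using bA by simp
      have sAB: "sqrt \<bar>tcoeff n a 2 t\<bar> \<le> B * \<delta>" using sA AB by (rule order_trans)
      have "0 < sqrt A" using A0 by simp
      then have "0 < B * \<delta>" using AB by linarith
      then have Bp: "B > 0" using \<delta> by (simp add: zero_less_mult_iff)
      have M: "Lip I1 ((deriv ^^ (n - 1)) (tcoeff n a i)) * sqrt \<bar>tcoeff n a 2 t\<bar> ^ (n - i) \<le> B ^ n * 1 ^ (n - n)"
        if i: "i \<in> {2..n}" for i
      proof -
        have M0: "0 \<le> Lip I1 ((deriv ^^ (n - 1)) (tcoeff n a i))"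
          using i by (intro tcoeff_Lip(2)[OF n1 I hc I1 order_refl]) auto
        have "Lip I1 ((deriv ^^ (n - 1)) (tcoeff n a i)) * sqrt \<bar>tcoeff n a 2 t\<bar> ^ (n - i)
          \<le> Lip I1 ((deriv ^^ (n - 1)) (tcoeff n a i)) * sqrt A ^ (n - i)"
          using sA M0 by (intro mult_left_mono power_mono) auto
        also have "\<dots> \<le> B ^ n"
          unfolding A_def B_def using M0 n1 A0 by (intro root_le_imp_le_power[OF bound_full_ge(3)[OF i]]) (auto simp: A_def)
        finally show ?thesis by simp
      qed
      \<comment> \<open>No index satisfies \<open>i + n < n\<close> and the exponent of \<gamma> is
        \<open>n - n\<close>, so \<gamma> = 1 is taken.\<close>
      have "\<forall>\<^sub>F y in nhds t. \<bar>lam y - lam t\<bar> \<le> C * B * \<bar>y - t\<bar>"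
        by (rule sp[rule_format, of I I1 a lam t \<delta> B 1 zs])
          (use I I1 hc cr win[OF t] \<delta> Bp False sAB BL M zs in auto)
      then show ?thesis
      proof eventually_elim
        case (elim y)
        have "C * B * \<bar>y - t\<bar> \<le> (C + 2) * B * \<bar>y - t\<bar>" using C B0 by (intro mult_right_mono) auto
        then show ?case using elim by linarith
      qed
    qed
    show ?thesis unfolding B_def[symmetric]
      by (rule lipschitz_on_eventually[OF _ _ pt]) (use I0 C B0 in \<open>auto simp: open_interval_def\<close>)
  qed
  have "C + 2 > 0" using C by simp
  then show ?thesis
    by (intro exI[of _ "C + 2"] conjI) (assumption, intro allI impI, rule main)
qed

subsection \<open>The case of maximal multiplicity \<open>p < n\<close>\<close>

lemma Max_four:
  fixes a b c d :: real
  shows "a \<le> Max {a, b, c, d}" "b \<le> Max {a, b, c, d}" "c \<le> Max {a, b, c, d}" "d \<le> Max {a, b, c, d}"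
    "\<lbrakk>a \<le> B; b \<le> B; c \<le> B; d \<le> B\<rbrakk> \<Longrightarrow> Max {a, b, c, d} \<le> B"
  by auto

lemma bound_partial_ge:
  assumes "2 \<le> p" "p < n"
  shows "sqrt (sup_norm I1 (tcoeff n a 2)) / endpoint_dist I0 I1 \<le> bound_partial n p a I0 I1"
  "sqrt (Lip I1 (deriv (tcoeff n a 2))) \<le> bound_partial n p a I0 I1"
  "i \<in> {2..p} \<Longrightarrow> root p (Lip I1 ((deriv ^^ (p - 1)) (tcoeff n a i)) * sqrt (sup_norm I1 (tcoeff n a 2)) ^ (p - i))
     \<le> bound_partial n p a I0 I1"
  "i \<in> {p<..n} \<Longrightarrow> root p (Lip I1 ((deriv ^^ (p - 1)) (tcoeff n a i)) * m2 n a I0 powr ((real p - real i) / 2))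
     \<le> bound_partial n p a I0 I1"
proof -
  let ?r = "\<lambda>i. root p (Lip I1 ((deriv ^^ (p - 1)) (tcoeff n a i)) * sqrt (sup_norm I1 (tcoeff n a 2)) ^ (p - i))"
  let ?q = "\<lambda>i. root p (Lip I1 ((deriv ^^ (p - 1)) (tcoeff n a i)) * m2 n a I0 powr ((real p - real i) / 2))"
  have B: "bound_partial n p a I0 I1 = Max {sqrt (sup_norm I1 (tcoeff n a 2)) / endpoint_dist I0 I1,
     sqrt (Lip I1 (deriv (tcoeff n a 2))), MAX i\<in>{2..p}. ?r i, MAX i\<in>{p<..n}. ?q i}"
    unfolding bound_partial_def Let_def ..
  show "sqrt (sup_norm I1 (tcoeff n a 2)) / endpoint_dist I0 I1 \<le> bound_partial n p a I0 I1"
    "sqrt (Lip I1 (deriv (tcoeff n a 2))) \<le> bound_partial n p a I0 I1"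
    unfolding B by (rule Max_four)+
  show "?r i \<le> bound_partial n p a I0 I1" if "i \<in> {2..p}"
  proof -
    have "?r i \<le> (MAX i\<in>{2..p}. ?r i)" using that by (intro Max_ge finite_imageI imageI finite_atLeastAtMost)
    also have "\<dots> \<le> bound_partial n p a I0 I1" unfolding B by (rule Max_four)
    finally show ?thesis .
  qed
  show "?q i \<le> bound_partial n p a I0 I1" if "i \<in> {p<..n}"
  proof -
    have "?q i \<le> (MAX i\<in>{p<..n}. ?q i)" using that by (intro Max_ge finite_imageI imageI finite_greaterThanAtMost)
    also have "\<dots> \<le> bound_partial n p a I0 I1" unfolding B by (rule Max_four)
    finally show ?thesis .
  qed
qed

lemma bound_partial_le:
  assumes "2 \<le> p" "p < n"
    and "sqrt (sup_norm I1 (tcoeff n a 2)) / endpoint_dist I0 I1 \<le> B"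
    and "sqrt (Lip I1 (deriv (tcoeff n a 2))) \<le> B"
    and "\<And>i. i \<in> {2..p} \<Longrightarrow> root p (Lip I1 ((deriv ^^ (p - 1)) (tcoeff n a i)) * sqrt (sup_norm I1 (tcoeff n a 2)) ^ (p - i)) \<le> B"
    and "\<And>i. i \<in> {p<..n} \<Longrightarrow> root p (Lip I1 ((deriv ^^ (p - 1)) (tcoeff n a i)) * m2 n a I0 powr ((real p - real i) / 2)) \<le> B"
  shows "bound_partial n p a I0 I1 \<le> B"
proof -
  have "(MAX i\<in>{2..p}. root p (Lip I1 ((deriv ^^ (p - 1)) (tcoeff n a i)) * sqrt (sup_norm I1 (tcoeff n a 2)) ^ (p - i))) \<le> B"
    using assms(1,5) by (intro Max.boundedI) auto
  moreover have "(MAX i\<in>{p<..n}. root p (Lip I1 ((deriv ^^ (p - 1)) (tcoeff n a i)) * m2 n a I0 powr ((real p - real i) / 2))) \<le> B"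
    using assms(2,6) by (intro Max.boundedI) auto
  ultimately show ?thesis unfolding bound_partial_def Let_def using assms(3,4) by (intro Max_four)
qed

text \<open>The list behind \<open>ordered_root\<close>. It is indexed from 0, so the i-th ordered
  root is the entry \<open>i - 1\<close>.\<close>

definition sorted_roots :: "real poly \<Rightarrow> real list" where
  "sorted_roots q = sorted_list_of_multiset (proots q)"

lemma sorted_roots_lin_prod: "sorted zs \<Longrightarrow> sorted_roots (lin_prod zs) = zs"
  by (simp add: sorted_roots_def proots_lin_prod sorted_sort_id)

lemma alpha_eq:
  "alpha n p a t = (let zs = sorted_roots (tschirnhausen n a t) in
     \<bar>zs ! (n - 1) - zs ! 0\<bar> / (MIN i\<in>{1..n - p}. \<bar>zs ! (i + p - 1) - zs ! (i - 1)\<bar>))"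
  by (simp add: alpha_def ordered_root_def sorted_roots_def Let_def)

lemma sorted_roots_tschirnhausen:
  assumes n: "n \<ge> 1" and hyp: "hyperbolic (poly_curve n a t)"
  shows "length (sorted_roots (tschirnhausen n a t)) = n" "sorted (sorted_roots (tschirnhausen n a t))"
    "tschirnhausen n a t = lin_prod (sorted_roots (tschirnhausen n a t))"
    "count (mset (sorted_roots (tschirnhausen n a t))) x = order (x - a 1 t / real n) (poly_curve n a t)"
proof -
  obtain zs where zs: "length zs = n" "sorted zs" "tschirnhausen n a t = lin_prod zs"
    "\<And>x. count (mset zs) (x + a 1 t / real n) = order x (poly_curve n a t)"
    by (rule tschirnhausen_roots[OF n hyp]) (rule that)
  have s: "sorted_roots (tschirnhausen n a t) = zs" unfolding zs(3) by (rule sorted_roots_lin_prod[OF zs(2)])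
  show "length (sorted_roots (tschirnhausen n a t)) = n" "sorted (sorted_roots (tschirnhausen n a t))"
    "tschirnhausen n a t = lin_prod (sorted_roots (tschirnhausen n a t))"
    unfolding s by (fact zs)+
  show "count (mset (sorted_roots (tschirnhausen n a t))) x = order (x - a 1 t / real n) (poly_curve n a t)"
    unfolding s using zs(4)[of "x - a 1 t / real n"] by simp
qed

text \<open>If the coefficient vanished, \<open>tschirnhausen_root_square_le\<close> would make all
  roots 0, a root of multiplicity n > p.\<close>

lemma tcoeff_2_nonzero:
  assumes n: "n \<ge> 2" and hyp: "hyperbolic (poly_curve n a t)"
    and mult: "\<And>x. order x (poly_curve n a t) \<le> p" and p: "p < n"
  shows "tcoeff n a 2 t \<noteq> 0"
proof
  assume z: "tcoeff n a 2 t = 0"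
  have n1: "n \<ge> 1" using n by simp
  obtain zs where zs: "length zs = n" "tschirnhausen n a t = lin_prod zs"
    "\<And>x. count (mset zs) (x + a 1 t / real n) = order x (poly_curve n a t)"
    by (rule tschirnhausen_roots[OF n1 hyp]) (rule that)
  have "y = 0" if "y \<in> set zs" for y
  proof -
    have "poly (tschirnhausen n a t) y = 0" using that zs(2) by (auto simp: poly_lin_prod prod_list_zero_iff)
    from tschirnhausen_root_square_le[OF n hyp this] show ?thesis using z by simp
  qed
  then have "zs = replicate n 0" using zs(1) by (simp add: replicate_eqI)
  then have "count (mset zs) 0 = n" by simp
  then show False using zs(3)[of "- (a 1 t / real n)"] mult[of "- (a 1 t / real n)"] p by simp
qed

text \<open>The roots have sum 0, so 0 lies between the smallest and the largest one, and every root
  is bounded by the spread.\<close>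

lemma spread_ge:
  assumes n: "n \<ge> 2" and hyp: "hyperbolic (poly_curve n a t)"
  shows "sqrt \<bar>tcoeff n a 2 t\<bar> \<le> 2 ^ n * (sorted_roots (tschirnhausen n a t) ! (n - 1) - sorted_roots (tschirnhausen n a t) ! 0)"
proof -
  have n1: "n \<ge> 1" using n by simp
  define zs where "zs = sorted_roots (tschirnhausen n a t)"
  have zs: "length zs = n" "sorted zs" "tschirnhausen n a t = lin_prod zs"
    unfolding zs_def by (rule sorted_roots_tschirnhausen[OF n1 hyp])+
  have "coeff (tschirnhausen n a t) (n - 1) = 0" by (rule tschirnhausen_roots[OF n1 hyp])
  then have sum0: "sum_list zs = 0" using coeff_lin_prod_sum[of zs] zs n by force
  define D where "D = zs ! (n - 1) - zs ! 0"
  have le: "zs ! 0 \<le> zs ! i" "zs ! i \<le> zs ! (n - 1)" if "i < n" for i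
    using zs that by (auto intro!: sorted_nth_mono)
  have s: "sum_list zs = (\<Sum>i<n. zs ! i)" by (simp add: sum_list_sum_nth zs(1) atLeast0LessThan)
  have "(\<Sum>i<n. zs ! 0) \<le> (\<Sum>i<n. zs ! i)" "(\<Sum>i<n. zs ! i) \<le> (\<Sum>i<n. zs ! (n - 1))"
    using le by (intro sum_mono; simp)+
  then have "real n * zs ! 0 \<le> 0" "0 \<le> real n * zs ! (n - 1)" using s sum0 by simp_all
  then have ends: "zs ! 0 \<le> 0" "0 \<le> zs ! (n - 1)" using n by (auto simp: mult_le_0_iff zero_le_mult_iff)
  have "\<bar>y\<bar> \<le> D" if y: "y \<in> set zs" for y
  proof -
    obtain i where "i < n" "y = zs ! i" using y zs(1) by (auto simp: in_set_conv_nth)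
    then show ?thesis using le[of i] ends unfolding D_def by linarith
  qed
  then have "\<bar>coeff (lin_prod zs) (n - 2)\<bar> \<le> 2 ^ n * D\<^sup>2" by (rule abs_coeff_le_root_square[OF zs(1) n])
  then have "\<bar>tcoeff n a 2 t\<bar> \<le> 2 ^ n * D\<^sup>2" using coeff_tschirnhausen[of "n - 2" n a t] zs(3) n by simp
  also have "\<dots> \<le> (2 ^ n)\<^sup>2 * D\<^sup>2"
  proof (rule mult_right_mono)
    have "(2::real) ^ n * 1 \<le> 2 ^ n * 2 ^ n" by (intro mult_left_mono one_le_power) auto
    then show "(2::real) ^ n \<le> (2 ^ n)\<^sup>2" by (simp add: power2_eq_square)
  qed simp
  also have "\<dots> = (2 ^ n * D)\<^sup>2" by (simp only: power_mult_distrib)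
  finally have "sqrt \<bar>tcoeff n a 2 t\<bar> \<le> \<bar>2 ^ n * D\<bar>" unfolding real_sqrt_abs[symmetric] by (rule real_sqrt_le_mono)
  moreover have "D \<ge> 0" using ends by (simp add: D_def)
  ultimately show ?thesis unfolding D_def zs_def by simp
qed

text \<open>The second coefficient bounds the roots on the compact closure of I1, and multiplicities
  are at most p, so \<open>root_gaps_bounded_below\<close> applies. Both constants are
  qualitative.\<close>

lemma tschirnhausen_gaps:
  assumes I: "open_interval I" and hc: "hyperbolic_curve m n I a" and pm: "p = max_multiplicity I (poly_curve n a)"
    and p: "1 \<le> p" "p < n" and I1: "open_interval I1" "I1 \<Subset> I"
  obtains \<rho> \<gamma> where "\<gamma> > 0"
    "\<And>t y. t \<in> closure I1 \<Longrightarrow> y \<in> set (sorted_roots (tschirnhausen n a t)) \<Longrightarrow> \<bar>y\<bar> \<le> \<rho>"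
    "\<And>t i. t \<in> closure I1 \<Longrightarrow> i + p < n \<Longrightarrow>
       \<gamma> \<le> sorted_roots (tschirnhausen n a t) ! (i + p) - sorted_roots (tschirnhausen n a t) ! i"
proof -
  have n: "n \<ge> 2" and n1: "n \<ge> 1" using p by auto
  note K = compactly_contained_interval[OF I1]
  let ?K = "closure I1"
  define zs where "zs t = sorted_roots (tschirnhausen n a t)" for t
  have hyp: "hyperbolic (poly_curve n a t)" if "t \<in> I" for t using hc that by (auto simp: hyperbolic_curve_def)
  have zs: "length (zs t) = n" "sorted (zs t)" "tschirnhausen n a t = lin_prod (zs t)" if "t \<in> I" for t
    unfolding zs_def by (rule sorted_roots_tschirnhausen[OF n1 hyp[OF that]])+
  have cnt: "count (mset (zs t)) x \<le> p" if "t \<in> I" for t x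
    unfolding zs_def sorted_roots_tschirnhausen(4)[OF n1 hyp[OF that]] pm
    by (rule order_le_max_multiplicity(1)[OF n1 hyp that])
  have "continuous_on ?K (tcoeff n a 2)" by (rule continuous_on_subset[OF tcoeff_continuous[OF hc n1] K(2)])
  then have "bounded (tcoeff n a 2 ` ?K)" using K(1) compact_continuous_image compact_imp_bounded by blast
  then obtain b where b: "\<And>t. t \<in> ?K \<Longrightarrow> \<bar>tcoeff n a 2 t\<bar> \<le> b" by (auto simp: bounded_iff)
  define \<rho> where "\<rho> = sqrt (2 * b)"
  have \<rho>: "\<bar>y\<bar> \<le> \<rho>" if t: "t \<in> ?K" and y: "y \<in> set (zs t)" for t y
  proof -
    have tI: "t \<in> I" using t K(2) by auto
    have "poly (lin_prod (zs t)) y = 0" using y by (auto simp: poly_lin_prod prod_list_zero_iff)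
    then have "poly (tschirnhausen n a t) y = 0" using zs(3)[OF tI] by simp
    from tschirnhausen_root_square_le[OF n hyp[OF tI] this] have "y\<^sup>2 \<le> 2 * b" using b[OF t] by linarith
    then show ?thesis unfolding \<rho>_def by (rule real_le_rsqrt[of "\<bar>y\<bar>", simplified])
  qed
  have "\<exists>\<gamma>>0. \<forall>t\<in>?K. \<forall>i. i + p < n \<longrightarrow> \<gamma> \<le> zs t ! (i + p) - zs t ! i"
  proof (rule root_gaps_bounded_below[OF K(1) p(2), where T="tschirnhausen n a" and \<rho>=\<rho>])
    show "continuous_on ?K (\<lambda>t. coeff (tschirnhausen n a t) k)" for k
    proof (cases "k \<le> n")
      case True
      then show ?thesis unfolding coeff_tschirnhausen[OF True]
        by (intro continuous_on_subset[OF tcoeff_continuous[OF hc n1] K(2)])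
    next
      case False
      have "coeff (tschirnhausen n a t) k = 0" if "t \<in> ?K" for t
        using zs[of t] that K(2) False by (simp add: coeff_lin_prod_gt subset_iff)
      then show ?thesis using continuous_on_cong[of ?K ?K "\<lambda>t. coeff (tschirnhausen n a t) k" "\<lambda>t. 0"] by simp
    qed
  qed (use zs cnt \<rho> K(2) in auto)
  then obtain g0 where g0: "g0 > 0" "\<And>t i. t \<in> ?K \<Longrightarrow> i + p < n \<Longrightarrow> g0 \<le> zs t ! (i + p) - zs t ! i" by blast
  show ?thesis by (rule that[OF g0(1), of \<rho>]) (use \<rho> g0(2) in \<open>auto simp: zs_def\<close>)
qed

text \<open>Bounded roots and uniform gaps make the supremum \<open>alpha_sup\<close> finite. The
  ratio is at least 1, because the span of p + 1 consecutive roots is at most the total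
  spread.\<close>

lemma alpha_props:
  assumes I: "open_interval I" and hc: "hyperbolic_curve m n I a" and pm: "p = max_multiplicity I (poly_curve n a)"
    and p: "1 \<le> p" "p < n" and I1: "open_interval I1" "I1 \<Subset> I" and t: "t \<in> I1"
  shows "alpha n p a t \<le> alpha_sup n p a I1" "1 \<le> alpha n p a t"
    "\<exists>\<gamma>>0. (\<forall>i. i + p < n \<longrightarrow> \<gamma> \<le> sorted_roots (tschirnhausen n a t) ! (i + p) - sorted_roots (tschirnhausen n a t) ! i) \<and>
      sorted_roots (tschirnhausen n a t) ! (n - 1) - sorted_roots (tschirnhausen n a t) ! 0 = alpha n p a t * \<gamma>"
proof -
  have n: "n \<ge> 2" and n1: "n \<ge> 1" using p by auto
  note K = compactly_contained_interval[OF I1]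
  let ?K = "closure I1"
  define zs where "zs t = sorted_roots (tschirnhausen n a t)" for t
  have hyp: "hyperbolic (poly_curve n a t)" if "t \<in> I" for t using hc that by (auto simp: hyperbolic_curve_def)
  have zs: "length (zs t) = n" "sorted (zs t)" "tschirnhausen n a t = lin_prod (zs t)" if "t \<in> I" for t
    unfolding zs_def by (rule sorted_roots_tschirnhausen[OF n1 hyp[OF that]])+
  obtain \<rho> g0 where gaps: "g0 > 0"
    "\<And>t y. t \<in> ?K \<Longrightarrow> y \<in> set (sorted_roots (tschirnhausen n a t)) \<Longrightarrow> \<bar>y\<bar> \<le> \<rho>"
    "\<And>t i. t \<in> ?K \<Longrightarrow> i + p < n \<Longrightarrow>
       g0 \<le> sorted_roots (tschirnhausen n a t) ! (i + p) - sorted_roots (tschirnhausen n a t) ! i"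
    by (rule tschirnhausen_gaps[OF I hc pm p I1]) (rule that)
  note g0 = gaps(1) gaps(3)[folded zs_def] and \<rho> = gaps(2)[folded zs_def]
  define G where "G t = (MIN i\<in>{1..n - p}. \<bar>zs t ! (i + p - 1) - zs t ! (i - 1)\<bar>)" for t
  have fin: "finite ((\<lambda>i. \<bar>zs t ! (i + p - 1) - zs t ! (i - 1)\<bar>) ` {1..n - p})"
    "(\<lambda>i. \<bar>zs t ! (i + p - 1) - zs t ! (i - 1)\<bar>) ` {1..n - p} \<noteq> {}" for t using p by auto
  have Gge: "g0 \<le> G t" if "t \<in> ?K" for t
    unfolding G_def
  proof (rule Min.boundedI[OF fin])
    fix x assume "x \<in> (\<lambda>i. \<bar>zs t ! (i + p - 1) - zs t ! (i - 1)\<bar>) ` {1..n - p}"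
    then obtain i where i: "i \<in> {1..n - p}" "x = \<bar>zs t ! (i + p - 1) - zs t ! (i - 1)\<bar>" by auto
    have "g0 \<le> zs t ! (i - 1 + p) - zs t ! (i - 1)" using i(1) by (intro g0(2)[OF that]) auto
    moreover have "i - 1 + p = i + p - 1" using i(1) by auto
    ultimately show "g0 \<le> x" unfolding i(2) by simp
  qed
  have Gle: "G t \<le> zs t ! (i + p) - zs t ! i" if tK: "t \<in> ?K" and i: "i + p < n" for t i
  proof -
    have "G t \<le> \<bar>zs t ! (Suc i + p - 1) - zs t ! (Suc i - 1)\<bar>"
      unfolding G_def by (rule Min_le[OF fin(1)], rule imageI) (use i in auto)
    also have "\<dots> = zs t ! (i + p) - zs t ! i" using g0(2)[OF tK i] g0(1) by simp
    finally show ?thesis .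
  qed
  have al: "alpha n p a t = \<bar>zs t ! (n - 1) - zs t ! 0\<bar> / G t" for t
    by (simp add: alpha_eq G_def zs_def Let_def)
  have D: "0 \<le> zs t ! (n - 1) - zs t ! 0" "zs t ! (n - 1) - zs t ! 0 \<le> 2 * \<rho>" "G t \<le> zs t ! (n - 1) - zs t ! 0" if tK: "t \<in> ?K" for t
  proof -
    have z: "length (zs t) = n" "sorted (zs t)" using zs that K(2) by auto
    have "zs t ! (n - 1) \<in> set (zs t)" "zs t ! 0 \<in> set (zs t)" using z n by auto
    then have "\<bar>zs t ! (n - 1)\<bar> \<le> \<rho>" "\<bar>zs t ! 0\<bar> \<le> \<rho>" using \<rho>[OF tK] by blast+
    then show "zs t ! (n - 1) - zs t ! 0 \<le> 2 * \<rho>" by linarith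
    have "zs t ! (0 + p) \<le> zs t ! (n - 1)" using z p by (intro sorted_nth_mono) auto
    moreover have "G t \<le> zs t ! (0 + p) - zs t ! 0" using p by (intro Gle[OF tK]) auto
    ultimately show "G t \<le> zs t ! (n - 1) - zs t ! 0" by linarith
    then show "0 \<le> zs t ! (n - 1) - zs t ! 0" using Gge[OF tK] g0(1) by linarith
  qed
  have tK: "t \<in> ?K" using t K(4) by auto
  have Gp: "G t > 0" using Gge[OF tK] g0(1) by linarith
  show "alpha n p a t \<le> alpha_sup n p a I1"
    unfolding alpha_sup_def
  proof (rule cSUP_upper[OF t], rule bdd_aboveI2)
    fix x assume "x \<in> I1"
    then have xK: "x \<in> ?K" using K(4) by auto
    have "alpha n p a x = (zs x ! (n - 1) - zs x ! 0) / G x" using al[of x] D(1)[OF xK] by simp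
    also have "\<dots> \<le> 2 * \<rho> / g0" using D[OF xK] Gge[OF xK] g0(1) by (intro frac_le) auto
    finally show "alpha n p a x \<le> 2 * \<rho> / g0" .
  qed
  have a1: "alpha n p a t = (zs t ! (n - 1) - zs t ! 0) / G t" using al[of t] D(1)[OF tK] by simp
  show "1 \<le> alpha n p a t" unfolding a1 using D(3)[OF tK] Gp by simp
  show "\<exists>\<gamma>>0. (\<forall>i. i + p < n \<longrightarrow> \<gamma> \<le> sorted_roots (tschirnhausen n a t) ! (i + p) - sorted_roots (tschirnhausen n a t) ! i) \<and>
      sorted_roots (tschirnhausen n a t) ! (n - 1) - sorted_roots (tschirnhausen n a t) ! 0 = alpha n p a t * \<gamma>"
    \<comment> \<open>The witness is the smallest gap at t, the denominator of
      \<open>alpha\<close>.\<close>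
    using Gp Gle[OF tK] a1 unfolding zs_def[symmetric] by (intro exI[of _ "G t"]) auto
qed

lemma m2_props:
  assumes n: "n \<ge> 2" and hc: "hyperbolic_curve m n I a" and pm: "p = max_multiplicity I (poly_curve n a)" and p: "p < n"
    and I0: "open_interval I0" "closure I0 \<subseteq> I" "compact (closure I0)"
  shows "0 < m2 n a I0" "\<And>t. t \<in> I0 \<Longrightarrow> m2 n a I0 \<le> \<bar>tcoeff n a 2 t\<bar>"
proof -
  have n1: "n \<ge> 1" using n by simp
  have hyp: "hyperbolic (poly_curve n a t)" if "t \<in> I" for t using hc that by (auto simp: hyperbolic_curve_def)
  have nz: "tcoeff n a 2 t \<noteq> 0" if "t \<in> closure I0" for t
  proof (rule tcoeff_2_nonzero[OF n _ _ p])
    have tI: "t \<in> I" using that I0(2) by auto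
    show "hyperbolic (poly_curve n a t)" by (rule hyp[OF tI])
    show "order x (poly_curve n a t) \<le> p" for x unfolding pm by (rule order_le_max_multiplicity(1)[OF n1 hyp tI])
  qed
  have ne: "closure I0 \<noteq> {}" using I0(1) by (auto simp: open_interval_def)
  have "continuous_on (closure I0) (\<lambda>t. \<bar>tcoeff n a 2 t\<bar>)"
    by (intro continuous_on_rabs continuous_on_subset[OF tcoeff_continuous[OF hc n1] I0(2)])
  from continuous_attains_inf[OF I0(3) ne this]
  obtain t1 where t1: "t1 \<in> closure I0" "\<And>t. t \<in> closure I0 \<Longrightarrow> \<bar>tcoeff n a 2 t1\<bar> \<le> \<bar>tcoeff n a 2 t\<bar>" by blast
  have "\<bar>tcoeff n a 2 t1\<bar> \<le> m2 n a I0" unfolding m2_def by (rule cINF_greatest[OF ne t1(2)])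
  then show "0 < m2 n a I0" using nz[OF t1(1)] by linarith
  show "m2 n a I0 \<le> \<bar>tcoeff n a 2 t\<bar>" if "t \<in> I0" for t
    unfolding m2_def by (rule cINF_lower[OF bdd_belowI2[of _ 0]]) (use that closure_subset[of I0] in auto)
qed

text \<open>Split s0^(n-i) into s0^(p-i) and s0^(n-p). The exponent p - i changes sign at i = p: up
  to there the upper bound \<open>A\<close> for s0^2 is used, beyond it the lower bound
  \<open>mm\<close>. This is the origin of the two maxima over i in
  \<open>bound_partial\<close>.\<close>

lemma partial_weight:
  fixes M A s0 mm B :: real and i p n :: nat
  assumes M: "0 \<le> M" and s0: "0 < s0" and A: "s0\<^sup>2 \<le> A" and mm: "0 < mm" "mm \<le> s0\<^sup>2" and p: "0 < p" "p < n"
    and le: "i \<le> p \<Longrightarrow> root p (M * sqrt A ^ (p - i)) \<le> B"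
    and gt: "p < i \<Longrightarrow> root p (M * mm powr ((real p - real i) / 2)) \<le> B" and i: "i \<le> n"
  shows "M * s0 ^ (n - i) \<le> B ^ p * s0 ^ (n - p)"
proof (cases "i \<le> p")
  case True
  have sA: "s0 \<le> sqrt A" using A by (rule real_le_rsqrt)
  then have sA0: "0 \<le> sqrt A" using s0 by linarith
  have "M * s0 ^ (p - i) \<le> M * sqrt A ^ (p - i)" using M s0 sA by (intro mult_left_mono power_mono) auto
  also have "\<dots> \<le> B ^ p" using M sA0 p by (intro root_le_imp_le_power[OF le[OF True]] mult_nonneg_nonneg zero_le_power)
  finally have "M * s0 ^ (p - i) * s0 ^ (n - p) \<le> B ^ p * s0 ^ (n - p)" using s0 by (intro mult_right_mono) auto
  moreover have "s0 ^ (n - i) = s0 ^ (p - i) * s0 ^ (n - p)"   proof -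
    have "n - i = (p - i) + (n - p)" using True p by simp
    then show ?thesis by (simp only: power_add)
  qed
  ultimately show ?thesis by (simp add: mult.assoc)
next
  case False
  then have pi: "p < i" by simp
  have 1: "s0 powr (real p - real i) \<le> mm powr ((real p - real i) / 2)"
  proof -
    have "s0\<^sup>2 = s0 powr 2" using s0 by simp
    moreover have "2 * ((real p - real i) / 2) = real p - real i" by simp
    ultimately have "s0 powr (real p - real i) = (s0\<^sup>2) powr ((real p - real i) / 2)"
      by (simp only: powr_powr)
    also have "\<dots> \<le> mm powr ((real p - real i) / 2)" using mm pi by (intro powr_mono2') auto
    finally show ?thesis .
  qed
  have "M * s0 powr (real p - real i) \<le> M * mm powr ((real p - real i) / 2)" using M 1 by (rule mult_left_mono[rotated])
  also have "\<dots> \<le> B ^ p" using M p by (intro root_le_imp_le_power[OF gt[OF pi]]) auto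
  finally have "M * s0 powr (real p - real i) * s0 ^ (n - p) \<le> B ^ p * s0 ^ (n - p)" using s0 by (intro mult_right_mono) auto
  moreover have "s0 powr (real p - real i) * s0 ^ (n - p) = s0 ^ (n - i)"
  proof -
    have "s0 powr (real p - real i) * s0 powr real (n - p) = s0 powr real (n - i)"
      unfolding powr_add[symmetric] using p i by (simp add: of_nat_diff)
    then show ?thesis using s0 by (simp add: powr_realpow)
  qed
  ultimately show ?thesis by (simp add: mult.assoc)
qed

text \<open>The top derivatives are controlled by B^p s0^(n-p), but the speed estimate wants c^p
  \<gamma>^(n-p). Since s0 is at most a multiple of the spread, hence of alpha times \<gamma>, the
  factor alpha^((n-p)/p) in c is what converts one into the other.\<close>

lemma partial_lipschitz:
  assumes p: "2 \<le> p" "p < n"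
  shows "\<exists>C>0. \<forall>I0 I1 I a lam. open_interval I0 \<and> open_interval I1 \<and> open_interval I \<and> I0 \<Subset> I1 \<and> I1 \<Subset> I \<and>
    hyperbolic_curve (p - 1) n I a \<and> p = max_multiplicity I (poly_curve n a) \<and> continuous_root I (tschirnhausen n a) lam \<longrightarrow>
    0 \<le> bound_partial n p a I0 I1 \<and>
    (C * alpha_sup n p a I1 powr ((real n - real p) / real p) * bound_partial n p a I0 I1)-lipschitz_on I0 lam"
proof -
  have n: "n \<ge> 2" and n1: "n \<ge> 1" and pn: "p \<le> n" and p1: "1 \<le> p" "p < n" using p by auto
  obtain C where C: "C > 0" and sp: "\<forall>I I1 a lam t0 \<delta> c \<gamma> zs.
    open_interval I \<and> open_interval I1 \<and> I1 \<Subset> I \<and> hyperbolic_curve (p - 1) n I a \<and>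
    continuous_root I (tschirnhausen n a) lam \<and> {t0 - \<delta><..<t0 + \<delta>} \<subseteq> I1 \<and>
    \<delta> > 0 \<and> c > 0 \<and> \<gamma> > 0 \<and> tcoeff n a 2 t0 \<noteq> 0 \<and> sqrt \<bar>tcoeff n a 2 t0\<bar> \<le> c * \<delta> \<and>
    Lip I1 (deriv (tcoeff n a 2)) \<le> c\<^sup>2 \<and>
    (\<forall>i\<in>{2..n}. Lip I1 ((deriv ^^ (p - 1)) (tcoeff n a i)) * sqrt \<bar>tcoeff n a 2 t0\<bar> ^ (n - i) \<le> c ^ p * \<gamma> ^ (n - p)) \<and>
    tschirnhausen n a t0 = lin_prod zs \<and> length zs = n \<and> sorted zs \<and>
    (\<forall>i. i + p < n \<longrightarrow> \<gamma> \<le> zs ! (i + p) - zs ! i)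
    \<longrightarrow> (\<forall>\<^sub>F t in nhds t0. \<bar>lam t - lam t0\<bar> \<le> C * c * \<bar>t - t0\<bar>)"
    using tschirnhausen_speed[OF p(1) pn] by (elim exE conjE) (rule that)
  \<comment> \<open>This dominates (2^n)^(n-p), where 2^n is the constant of
    \<open>spread_ge\<close>.\<close>
  define Kc :: real where "Kc = 2 ^ (n * n)"
  have Kc: "Kc \<ge> 1" unfolding Kc_def by (rule one_le_power) simp
  have main: "0 \<le> bound_partial n p a I0 I1 \<and>
      (C * Kc * alpha_sup n p a I1 powr ((real n - real p) / real p) * bound_partial n p a I0 I1)-lipschitz_on I0 lam"
    if H: "open_interval I0 \<and> open_interval I1 \<and> open_interval I \<and> I0 \<Subset> I1 \<and> I1 \<Subset> I \<and>
    hyperbolic_curve (p - 1) n I a \<and> p = max_multiplicity I (poly_curve n a) \<and> continuous_root I (tschirnhausen n a) lam"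
    for I0 I1 I a lam
  proof -
    have I0: "open_interval I0" "I0 \<Subset> I1" and I1: "open_interval I1" "I1 \<Subset> I" and I: "open_interval I"
      and hc: "hyperbolic_curve (p - 1) n I a" and cr: "continuous_root I (tschirnhausen n a) lam"
      and pm: "p = max_multiplicity I (poly_curve n a)"
      using H by blast+
    note K0 = compactly_contained_interval[OF I0] and K1 = compactly_contained_interval[OF I1]
    have bnd: "bounded I1" using K1(1,4) compact_imp_bounded bounded_subset by blast
    define \<delta> where "\<delta> = endpoint_dist I0 I1"
    have \<delta>: "\<delta> > 0" and win: "\<And>t. t \<in> I0 \<Longrightarrow> {t - \<delta><..<t + \<delta>} \<subseteq> I1"
      using endpoint_dist_window[OF I0(1) I1(1) I0(2) bnd] by (auto simp: \<delta>_def)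
    define B where "B = bound_partial n p a I0 I1"
    define A where "A = sup_norm I1 (tcoeff n a 2)"
    define al where "al = alpha_sup n p a I1"
    define e where "e = (real n - real p) / real p"
    have p11: "1 \<le> p - 1" using p by simp
    have L2: "0 \<le> Lip I1 (deriv (tcoeff n a 2))" using tcoeff_Lip(2)[OF n1 I hc I1 p11 n] by simp
    have B0: "B \<ge> 0" using bound_partial_ge(2)[OF p, of I1 a I0] L2 unfolding B_def by (meson order_trans real_sqrt_ge_zero)
    have BL: "Lip I1 (deriv (tcoeff n a 2)) \<le> B\<^sup>2"
      unfolding B_def by (rule sqrt_le_imp_le_power2[OF bound_partial_ge(2)[OF p] L2])
    have cI0: "closure I0 \<subseteq> I" using K0(2) K1(5) by blast
    note mm = m2_props[OF n hc pm p(2) I0(1) cI0 K0(1)]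
    obtain t1 where t1: "t1 \<in> I1" using I1(1) by (auto simp: open_interval_def)
    have al1: "al \<ge> 1"
      unfolding al_def by (rule order_trans[OF alpha_props(2,1)[OF I hc pm p1 I1 t1]])
    have e0: "e \<ge> 0" using p by (simp add: e_def)
    have ale1: "al powr e \<ge> 1" using al1 e0 by (rule ge_one_powr_ge_zero)
    \<comment> \<open>The exponent e is chosen for this identity.\<close>
    have alep: "(al powr e) ^ p = al ^ (n - p)"
    proof -
      have "(al powr e) ^ p = (al powr e) powr real p" using al1 by (simp add: powr_realpow)
      also have "\<dots> = al powr (e * real p)" by (rule powr_powr)
      also have "e * real p = real (n - p)" using p by (simp add: e_def of_nat_diff)
      also have "al powr real (n - p) = al ^ (n - p)" using al1 by (intro powr_realpow) simp
      finally show ?thesis .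
    qed
    define c where "c = Kc * al powr e * B"
    have cB: "B \<le> c"
    proof -
      have "1 * 1 * B \<le> Kc * al powr e * B" using Kc ale1 B0 by (intro mult_right_mono mult_mono) auto
      then show ?thesis by (simp add: c_def)
    qed
    have pt: "\<forall>\<^sub>F y in nhds t. \<bar>lam y - lam t\<bar> \<le> C * c * \<bar>y - t\<bar>" if t: "t \<in> I0" for t
    proof -
      have tI1: "t \<in> I1" using t K0(5) by auto
      have tI: "t \<in> I" using tI1 K1(5) by auto
      have hyp: "hyperbolic (poly_curve n a t)" using hc tI by (auto simp: hyperbolic_curve_def)
      define zs where "zs = sorted_roots (tschirnhausen n a t)"
      have zs: "length zs = n" "sorted zs" "tschirnhausen n a t = lin_prod zs"
        unfolding zs_def by (rule sorted_roots_tschirnhausen[OF n1 hyp])+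
      obtain \<gamma> where \<gamma>: "\<gamma> > 0" "\<And>i. i + p < n \<Longrightarrow> \<gamma> \<le> zs ! (i + p) - zs ! i"
        "zs ! (n - 1) - zs ! 0 = alpha n p a t * \<gamma>"
        using alpha_props(3)[OF I hc pm p1 I1 tI1] unfolding zs_def by blast
      define s0 where "s0 = sqrt \<bar>tcoeff n a 2 t\<bar>"
      have s0sq: "s0\<^sup>2 = \<bar>tcoeff n a 2 t\<bar>" by (simp add: s0_def)
      have nz: "tcoeff n a 2 t \<noteq> 0" using mm(1) mm(2)[OF t] by auto
      have s0: "s0 > 0" using nz by (simp add: s0_def)
      have bA: "s0\<^sup>2 \<le> A" unfolding A_def s0sq by (rule tcoeff_Lip(3)[OF n1 I hc I1 p11 n tI1])
      have "sqrt A / \<delta> \<le> B" unfolding A_def \<delta>_def B_def by (rule bound_partial_ge(1)[OF p])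
      then have "sqrt A \<le> B * \<delta>" using \<delta> by (simp add: pos_divide_le_eq)
      moreover have "s0 \<le> sqrt A" using bA by (rule real_le_rsqrt)
      ultimately have sB: "s0 \<le> B * \<delta>" by linarith
      then have "0 < B * \<delta>" using s0 by linarith
      then have Bp: "B > 0" using \<delta> by (simp add: zero_less_mult_iff)
      have cp: "c > 0" using Bp cB by linarith
      have sc: "sqrt \<bar>tcoeff n a 2 t\<bar> \<le> c * \<delta>"
        using sB mult_right_mono[OF cB, of \<delta>] \<delta> unfolding s0_def by linarith
      have cL: "Lip I1 (deriv (tcoeff n a 2)) \<le> c\<^sup>2"
        using BL power_mono[OF cB B0, of 2] by linarith
      have s0n: "s0 ^ (n - p) \<le> Kc * (al ^ (n - p) * \<gamma> ^ (n - p))"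
      proof -
        have "s0 \<le> 2 ^ n * (zs ! (n - 1) - zs ! 0)" unfolding s0_def zs_def by (rule spread_ge[OF n hyp])
        also have "\<dots> \<le> 2 ^ n * (al * \<gamma>)"
          unfolding \<gamma>(3) al_def using \<gamma>(1) alpha_props(1)[OF I hc pm p1 I1 tI1] by (intro mult_left_mono mult_right_mono) auto
        finally have "s0 ^ (n - p) \<le> (2 ^ n * (al * \<gamma>)) ^ (n - p)" using s0 by (intro power_mono) auto
        also have "\<dots> = (2 ^ n) ^ (n - p) * (al ^ (n - p) * \<gamma> ^ (n - p))" by (simp only: power_mult_distrib)
        also have "\<dots> \<le> Kc * (al ^ (n - p) * \<gamma> ^ (n - p))"
        proof (rule mult_right_mono)
          have "((2::real) ^ n) ^ (n - p) \<le> (2 ^ n) ^ n" by (intro power_increasing one_le_power) auto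
          then show "((2::real) ^ n) ^ (n - p) \<le> Kc" by (simp add: Kc_def power_mult)
          show "0 \<le> al ^ (n - p) * \<gamma> ^ (n - p)" using al1 \<gamma>(1) by simp
        qed
        finally show ?thesis .
      qed
      have M: "Lip I1 ((deriv ^^ (p - 1)) (tcoeff n a i)) * sqrt \<bar>tcoeff n a 2 t\<bar> ^ (n - i) \<le> c ^ p * \<gamma> ^ (n - p)"
        if i: "i \<in> {2..n}" for i
      proof -
        have M0: "0 \<le> Lip I1 ((deriv ^^ (p - 1)) (tcoeff n a i))"
          using i by (intro tcoeff_Lip(2)[OF n1 I hc I1 order_refl]) auto
        have "Lip I1 ((deriv ^^ (p - 1)) (tcoeff n a i)) * s0 ^ (n - i) \<le> B ^ p * s0 ^ (n - p)"
        proof (rule partial_weight[OF M0 s0 bA mm(1)])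
          show "m2 n a I0 \<le> s0\<^sup>2" unfolding s0sq by (rule mm(2)[OF t])
          show "root p (Lip I1 ((deriv ^^ (p - 1)) (tcoeff n a i)) * sqrt A ^ (p - i)) \<le> B" if "i \<le> p"
            unfolding A_def B_def using i that by (intro bound_partial_ge(3)[OF p]) auto
          show "root p (Lip I1 ((deriv ^^ (p - 1)) (tcoeff n a i)) * m2 n a I0 powr ((real p - real i) / 2)) \<le> B" if "p < i"
            unfolding B_def using i that by (intro bound_partial_ge(4)[OF p]) auto
        qed (use p i in auto)
        also have "\<dots> \<le> B ^ p * (Kc * (al ^ (n - p) * \<gamma> ^ (n - p)))" using s0n B0 by (intro mult_left_mono) auto
        also have "\<dots> \<le> B ^ p * (Kc ^ p * (al ^ (n - p) * \<gamma> ^ (n - p)))"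
        proof -
          \<comment> \<open>The speed c carries the factor Kc itself, so c^p contains Kc^p.\<close>
          have "Kc \<le> Kc ^ p" using Kc p by (intro self_le_power) auto
          then show ?thesis using B0 al1 \<gamma>(1) by (intro mult_left_mono mult_right_mono) auto
        qed
        also have "\<dots> = c ^ p * \<gamma> ^ (n - p)"
          unfolding c_def power_mult_distrib alep by (simp only: mult_ac)
        finally show ?thesis unfolding s0_def .
      qed
      show ?thesis
        by (rule sp[rule_format, of I I1 a lam t \<delta> c \<gamma> zs], intro conjI ballI allI impI)
          (fact I I1 hc cr win[OF t] \<delta> cp \<gamma>(1) nz sc cL zs | rule M, assumption | rule \<gamma>(2), assumption)+
    qed
    have "(C * c)-lipschitz_on I0 lam"
      by (rule lipschitz_on_eventually[OF _ _ pt]) (use I0(1) C B0 cB in \<open>auto simp: open_interval_def\<close>)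
    moreover have "C * c = C * Kc * al powr e * B" by (simp add: c_def mult.assoc)
    ultimately show ?thesis using B0 unfolding B_def al_def e_def by simp
  qed
  have "C * Kc > 0" using C Kc by simp
  then show ?thesis
    by (intro exI[of _ "C * Kc"] conjI) (assumption, intro allI impI, rule main)
qed

subsection \<open>Bounds in terms of the coefficients\<close>

lemma root_le_one_plus:
  assumes "0 \<le> x" "0 < i"
  shows "root i x \<le> 1 + x"
proof -
  have "x \<le> (1 + x) ^ 1" by simp
  also have "\<dots> \<le> (1 + x) ^ i" using assms by (intro power_increasing) auto
  finally have "root i x \<le> root i ((1 + x) ^ i)" using assms by simp
  then show ?thesis using assms by (simp add: real_root_power_cancel)
qed

lemma root_le_of_le_power:
  assumes "x \<le> B ^ p" "0 \<le> B" "0 < p"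
  shows "root p x \<le> B"
proof -
  have "root p x \<le> root p (B ^ p)" using assms by simp
  then show ?thesis using assms by (simp add: real_root_power_cancel)
qed

lemma sup_norm_le:
  assumes "K \<noteq> {}" "\<And>x. x \<in> K \<Longrightarrow> \<bar>f x\<bar> \<le> B"
  shows "sup_norm K f \<le> B"
  unfolding sup_norm_def using assms by (rule cSUP_least)

lemma bound_full_le:
  assumes "n \<ge> 2"
    and "sqrt (sup_norm I1 (tcoeff n a 2)) / endpoint_dist I0 I1 \<le> B"
    and "sqrt (Lip I1 (deriv (tcoeff n a 2))) \<le> B"
    and "\<And>i. i \<in> {2..n} \<Longrightarrow> root n (Lip I1 ((deriv ^^ (n - 1)) (tcoeff n a i)) * sqrt (sup_norm I1 (tcoeff n a 2)) ^ (n - i)) \<le> B"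
  shows "bound_full n a I0 I1 \<le> B"
proof -
  have "(MAX i\<in>{2..n}. root n (Lip I1 ((deriv ^^ (n - 1)) (tcoeff n a i)) * sqrt (sup_norm I1 (tcoeff n a 2)) ^ (n - i))) \<le> B"
    using assms(1,4) by (intro Max.boundedI) auto
  then show ?thesis unfolding bound_full_def Let_def using assms(2,3) by (auto intro!: Max.boundedI)
qed

lemma smooth_bound_Lip_le:
  assumes sb: "smooth_bound m L U K f" and K: "convex K" "K \<subseteq> U" and L: "0 \<le> L" and J: "J \<subseteq> K"
    and xy: "x0 \<in> J" "y0 \<in> J" "x0 \<noteq> y0" and k: "k \<le> m"
  shows "Lip J ((deriv ^^ k) f) \<le> L"
proof -
  have "smooth_bound k L U K f" by (rule smooth_bound_order_mono[OF K L sb k])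
  then have "L-lipschitz_on K ((deriv ^^ k) f)" unfolding smooth_bound_iff by blast
  then have "L-lipschitz_on J ((deriv ^^ k) f)" using J by (rule lipschitz_on_subset)
  then show ?thesis using xy by (rule Lip_le)
qed

lemma continuous_root_tschirnhausen:
  assumes cr: "continuous_root I (poly_curve n a) lam" and a: "continuous_on I (a 1)"
  shows "continuous_root I (tschirnhausen n a) (\<lambda>t. lam t + a 1 t / real n)"
proof -
  have "continuous_on I (\<lambda>t. lam t + a 1 t * inverse (real n))"
    using cr a by (auto simp: continuous_root_def intro!: continuous_on_add continuous_on_mult continuous_on_const)
  then show ?thesis using cr
    by (simp add: continuous_root_def tschirnhausen_def poly_pcompose divide_inverse)
qed

text \<open>Undoes the shift of the roots by a_1 / n.\<close>

lemma lipschitz_on_untranslate: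
  fixes f g :: "real \<Rightarrow> real"
  assumes "L-lipschitz_on S (\<lambda>t. f t + g t / d)" "M-lipschitz_on S g" "d \<ge> 1"
  shows "(L + M)-lipschitz_on S f"
proof -
  have M: "M \<ge> 0" using assms(2) by (rule lipschitz_on_nonneg)
  have "(\<bar>1 / d\<bar> * M)-lipschitz_on S (\<lambda>t. 1 / d * g t)"
    by (rule lipschitz_on_cmult_real[OF assms(2)])
  moreover have "\<bar>1 / d\<bar> * M \<le> 1 * M" using assms(3) M by (intro mult_right_mono) auto
  ultimately have "(1 * M)-lipschitz_on S (\<lambda>t. 1 / d * g t)" by (rule lipschitz_on_le)
  then have "M-lipschitz_on S (\<lambda>t. g t / d)" by simp
  from lipschitz_on_diff[OF assms(1) this] show ?thesis by simp
qed

text \<open>With weight i for a_i and \<Theta> the largest i-th root of a norm, the terms of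
  \<open>bound_full\<close> have weight one, so they are at most multiples of \<Theta>. The
  intervals enter by the division by the endpoint distance.\<close>

lemma full_estimate:
  assumes n: "n \<ge> 1"
  shows "\<exists>C>0. \<forall>I a lam. open_interval I0 \<and> open_interval I1 \<and> I0 \<Subset> I1 \<and> open_interval I \<and> I1 \<Subset> I \<and>
    hyperbolic_curve (n - 1) n I a \<and> continuous_root I (poly_curve n a) lam \<longrightarrow>
    (C * (MAX i\<in>{1..n}. root i (CLip_norm (n - 1) (closure I1) (a i))))-lipschitz_on I0 lam \<and>
    (MAX i\<in>{1..n}. root i (CLip_norm (n - 1) (closure I1) (a i))) \<le> 1 + (MAX i\<in>{1..n}. CLip_norm (n - 1) (closure I1) (a i))"
proof -
  define m where "m = n - 1"
  let ?K = "closure I1"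
  let ?N = "\<lambda>a i. CLip_norm m ?K (a i)"
  let ?Th = "\<lambda>a. MAX i\<in>{1..n}. root i (CLip_norm m ?K (a i))"
  have base: "?Th a \<ge> 0 \<and> (\<forall>i\<in>{1..n}. smooth_bound m (?Th a ^ i) I ?K (a i)) \<and> ?Th a \<le> 1 + (MAX i\<in>{1..n}. ?N a i)"
    if I: "open_interval I" and I1: "open_interval I1" "I1 \<Subset> I" and hc: "hyperbolic_curve m n I a" for I a
  proof -
    note K = compactly_contained_interval[OF I1]
    obtain x0 y0 where xy: "x0 \<in> I1" "y0 \<in> I1" "x0 \<noteq> y0" by (rule open_interval_two_points[OF I1(1)])
    then have xyK: "x0 \<in> ?K" "y0 \<in> ?K" using K(4) by auto
    have sb: "smooth_bound m (?N a i) I ?K (a i)" "0 \<le> ?N a i" if i: "i \<in> {1..n}" for i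
    proof -
      have "CLip_on m I (a i)" using hc i by (auto simp: hyperbolic_curve_def)
      then obtain L where "smooth_bound m L I ?K (a i)" using CLip_on_smooth_bound K(1,2) by blast
      from smooth_bound_CLip_norm[OF this xyK xy(3)]
      show "smooth_bound m (?N a i) I ?K (a i)" "0 \<le> ?N a i" .
    qed
    have le: "root i (?N a i) \<le> ?Th a" if "i \<in> {1..n}" for i
      using that by (intro Max_ge finite_imageI imageI finite_atLeastAtMost)
    have "0 \<le> root 1 (?N a 1)" using sb(2)[of 1] n by simp
    then have \<Theta>0: "?Th a \<ge> 0" using le[of 1] n by simp
    have "smooth_bound m (?Th a ^ i) I ?K (a i)" if i: "i \<in> {1..n}" for i
      using i by (intro smooth_bound_mono[OF sb(1)[OF i]] root_le_imp_le_power[OF le[OF i] sb(2)[OF i]]) auto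
    moreover have "?Th a \<le> 1 + (MAX i\<in>{1..n}. ?N a i)"
    proof (rule Max.boundedI)
      fix x assume "x \<in> (\<lambda>i. root i (?N a i)) ` {1..n}"
      then obtain i where i: "i \<in> {1..n}" "x = root i (?N a i)" by auto
      have "x \<le> 1 + ?N a i" unfolding i(2) using i(1) by (intro root_le_one_plus[OF sb(2)[OF i(1)]]) auto
      also have "?N a i \<le> (MAX i\<in>{1..n}. ?N a i)" using i(1) by (intro Max_ge finite_imageI imageI finite_atLeastAtMost)
      finally show "x \<le> 1 + (MAX i\<in>{1..n}. ?N a i)" by simp
    qed (use n in auto)
    ultimately show ?thesis using \<Theta>0 by blast
  qed
  have a1: "(?Th a)-lipschitz_on I0 (a 1)"
    if I: "open_interval I" and I0: "open_interval I0" "I0 \<Subset> I1" and I1: "open_interval I1" "I1 \<Subset> I" and hc: "hyperbolic_curve m n I a" for I a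
  proof -
    note K = compactly_contained_interval[OF I1]
    note st = base[OF I I1 hc]
    have th0: "?Th a \<ge> 0" by (rule conjunct1[OF st])
    have "\<forall>i\<in>{1..n}. smooth_bound m (?Th a ^ i) I ?K (a i)" by (rule conjunct1[OF conjunct2[OF st]])
    then have "smooth_bound m (?Th a ^ 1) I ?K (a 1)" by (rule bspec) (use n in simp)
    then have "smooth_bound m (?Th a) I ?K (a 1)" by (simp only: power_one_right)
    then have "smooth_bound 0 (?Th a) I ?K (a 1)"
      by (rule smooth_bound_order_mono[OF K(3,2) th0 _ le0])
    then have "(?Th a)-lipschitz_on ?K (a 1)" unfolding smooth_bound.simps by blast
    then show ?thesis by (rule lipschitz_on_subset) (use compactly_contained_interval[OF I0] K(4) in auto)
  qed
  show ?thesis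
  \<comment> \<open>For n = 1 the only root is -a_1 and no second coefficient exists.\<close>
  proof (cases "n = 1")
    case True
    have main: "(1 * ?Th a)-lipschitz_on I0 lam \<and> ?Th a \<le> 1 + (MAX i\<in>{1..n}. ?N a i)"
      if H: "open_interval I0 \<and> open_interval I1 \<and> I0 \<Subset> I1 \<and> open_interval I \<and> I1 \<Subset> I \<and>
      hyperbolic_curve m n I a \<and> continuous_root I (poly_curve n a) lam" for I a lam
    proof -
      have I: "open_interval I" and I0: "open_interval I0" "I0 \<Subset> I1" and I1: "open_interval I1" "I1 \<Subset> I"
        and hc: "hyperbolic_curve m n I a" and cr: "continuous_root I (poly_curve n a) lam" using H by blast+
      have "lam t = - a 1 t" if "t \<in> I" for t
      proof -
        have "poly (poly_curve 1 a t) (lam t) = 0" using cr that True by (auto simp: continuous_root_def)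
        then show ?thesis by (simp add: poly_curve_def poly_monom)
      qed
      moreover have "I0 \<subseteq> I"
        using compactly_contained_interval(5)[OF I0] compactly_contained_interval(5)[OF I1] by blast
      ultimately have eq: "\<And>t. t \<in> I0 \<Longrightarrow> lam t = - a 1 t" by blast
      have "(?Th a)-lipschitz_on I0 (\<lambda>t. - a 1 t)" by (rule lipschitz_on_minus[OF a1[OF I I0 I1 hc]])
      then have "(?Th a)-lipschitz_on I0 lam" by (rule lipschitz_on_transform) (rule eq)
      then have "(1 * ?Th a)-lipschitz_on I0 lam" by (simp only: mult_1)
      then show ?thesis using conjunct2[OF conjunct2[OF base[OF I I1 hc]]] by (rule conjI)
    qed
    show ?thesis unfolding m_def[symmetric]
      by (rule exI[of _ 1], rule conjI[OF zero_less_one], intro allI impI, rule main)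
  next
    case False
    then have n2: "n \<ge> 2" using n by simp
    obtain C3 where C3: "C3 > 0" and full: "\<forall>I0 I1 I a lam. open_interval I0 \<and> open_interval I1 \<and> open_interval I \<and> I0 \<Subset> I1 \<and> I1 \<Subset> I \<and>
      hyperbolic_curve (n - 1) n I a \<and> continuous_root I (tschirnhausen n a) lam \<longrightarrow>
      (C3 * bound_full n a I0 I1)-lipschitz_on I0 lam"
      using full_lipschitz[OF n2] by (elim exE conjE) (rule that)
    obtain Ct where Ct: "Ct \<ge> 1" and tc: "\<forall>\<Theta> a U K. 0 \<le> \<Theta> \<longrightarrow> open U \<longrightarrow> K \<subseteq> U \<longrightarrow> convex K \<longrightarrow>
      (\<forall>i\<in>{1..n}. smooth_bound m (\<Theta> ^ i) U K (a i)) \<longrightarrow>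
      (\<forall>j\<le>n. smooth_bound m (Ct * \<Theta> ^ j) U K (tcoeff n a j))"
      using tcoeff_smooth_bound[OF n, of m] by (elim exE conjE) (rule that)
    \<comment> \<open>The constants are fixed before the hypotheses on the intervals. The absolute
      value keeps them positive; under the hypotheses it changes nothing.\<close>
    define \<delta> where "\<delta> = \<bar>endpoint_dist I0 I1\<bar>"
    define D where "D = Ct / \<delta> + Ct"
    \<comment> \<open>The summand 1 pays for the shift by a_1 / n, whose Lipschitz constant is at
      most \<Theta>.\<close>
    define C where "C = C3 * D + 1"
    have D: "D \<ge> 0" using Ct by (simp add: D_def \<delta>_def)
    have C: "C > 0" using C3 D by (simp add: C_def add_nonneg_pos)
    have main: "(C * ?Th a)-lipschitz_on I0 lam \<and> ?Th a \<le> 1 + (MAX i\<in>{1..n}. ?N a i)"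
      if H: "open_interval I0 \<and> open_interval I1 \<and> I0 \<Subset> I1 \<and> open_interval I \<and> I1 \<Subset> I \<and>
      hyperbolic_curve m n I a \<and> continuous_root I (poly_curve n a) lam" for I a lam
    proof -
      have I: "open_interval I" and I0: "open_interval I0" "I0 \<Subset> I1" and I1: "open_interval I1" "I1 \<Subset> I"
        and hc: "hyperbolic_curve m n I a" and cr: "continuous_root I (poly_curve n a) lam" using H by blast+
      note K = compactly_contained_interval[OF I1]
      define \<Theta> where "\<Theta> = ?Th a"
      have \<Theta>: "\<Theta> \<ge> 0" "\<forall>i\<in>{1..n}. smooth_bound m (\<Theta> ^ i) I ?K (a i)" "\<Theta> \<le> 1 + (MAX i\<in>{1..n}. ?N a i)"
        unfolding \<Theta>_def
        by (fact conjunct1[OF base[OF I I1 hc]] conjunct1[OF conjunct2[OF base[OF I I1 hc]]]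
          conjunct2[OF conjunct2[OF base[OF I I1 hc]]])+
      have oI: "open I" using I by (simp add: open_interval_def)
      have b: "smooth_bound m (Ct * \<Theta> ^ j) I ?K (tcoeff n a j)" if "j \<le> n" for j
        using tc[rule_format, OF \<Theta>(1) oI K(2,3) _ that] \<Theta>(2) by blast
      obtain x0 y0 where xy: "x0 \<in> I1" "y0 \<in> I1" "x0 \<noteq> y0" by (rule open_interval_two_points[OF I1(1)])
      have bn: "bounded I1" using K(1,4) compact_imp_bounded bounded_subset by blast
      have \<delta>: "\<delta> > 0" "endpoint_dist I0 I1 = \<delta>"
        using endpoint_dist_window(1)[OF I0(1) I1(1) I0(2) bn] by (auto simp: \<delta>_def)
      have Ctj: "Ct * \<Theta> ^ j \<le> (Ct * \<Theta>) ^ j" if "j \<ge> 1" for j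
      proof -
        have "Ct \<le> Ct ^ j" using Ct that by (intro self_le_power) auto
        then show ?thesis unfolding power_mult_distrib using \<Theta>(1) by (intro mult_right_mono) auto
      qed
      have CtT: "0 \<le> Ct * \<Theta>" using Ct \<Theta>(1) by simp
      have "sup_norm I1 (tcoeff n a 2) \<le> Ct * \<Theta>\<^sup>2"
        using smooth_bound_le[OF b[OF n2]] K(4) xy(1) by (intro sup_norm_le) auto
      also have "\<dots> \<le> (Ct * \<Theta>)\<^sup>2" by (rule Ctj) simp
      finally have sA: "sqrt (sup_norm I1 (tcoeff n a 2)) \<le> Ct * \<Theta>" using CtT by (intro real_le_lsqrt)
      have sA0: "0 \<le> sup_norm I1 (tcoeff n a 2)"
      proof -
        have "\<bar>tcoeff n a 2 x0\<bar> \<le> sup_norm I1 (tcoeff n a 2)"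
          by (rule tcoeff_Lip(3)[OF n I hc I1 le0 n2 xy(1)])
        then show ?thesis by linarith
      qed
      have Lj: "Lip I1 ((deriv ^^ k) (tcoeff n a j)) \<le> (Ct * \<Theta>) ^ j" if "k \<le> m" "j \<le> n" "j \<ge> 1" for k j
        using smooth_bound_Lip_le[OF b[OF that(2)] K(3,2) _ K(4) xy that(1)] Ctj[OF that(3)] Ct \<Theta>(1) by auto
      have DT: "Ct * \<Theta> \<le> D * \<Theta>" "Ct * \<Theta> / \<delta> \<le> D * \<Theta>"
        using Ct \<delta>(1) \<Theta>(1) by (auto simp: D_def distrib_right)
      have "bound_full n a I0 I1 \<le> D * \<Theta>"
      proof (rule bound_full_le[OF n2])
        have "sqrt (sup_norm I1 (tcoeff n a 2)) / \<delta> \<le> Ct * \<Theta> / \<delta>" using sA \<delta>(1) by (intro divide_right_mono) auto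
        then show "sqrt (sup_norm I1 (tcoeff n a 2)) / endpoint_dist I0 I1 \<le> D * \<Theta>" unfolding \<delta>(2) using DT(2) by linarith
        have "Lip I1 ((deriv ^^ 1) (tcoeff n a 2)) \<le> (Ct * \<Theta>)\<^sup>2" using n2 by (intro Lj) (auto simp: m_def)
        then have "sqrt (Lip I1 (deriv (tcoeff n a 2))) \<le> Ct * \<Theta>" using CtT by (intro real_le_lsqrt) auto
        then show "sqrt (Lip I1 (deriv (tcoeff n a 2))) \<le> D * \<Theta>" using DT(1) by linarith
        fix i assume i: "i \<in> {2..n}"
        have "Lip I1 ((deriv ^^ m) (tcoeff n a i)) * sqrt (sup_norm I1 (tcoeff n a 2)) ^ (n - i) \<le> (Ct * \<Theta>) ^ i * (Ct * \<Theta>) ^ (n - i)"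
          using i sA CtT sA0 by (intro mult_mono Lj power_mono) auto
        also have "\<dots> = (Ct * \<Theta>) ^ n"
        proof -
          have "n = i + (n - i)" using i by simp
          then show ?thesis unfolding power_add[symmetric] by simp
        qed
        finally have "root n (Lip I1 ((deriv ^^ m) (tcoeff n a i)) * sqrt (sup_norm I1 (tcoeff n a 2)) ^ (n - i)) \<le> Ct * \<Theta>"
          using CtT n by (intro root_le_of_le_power) auto
        then show "root n (Lip I1 ((deriv ^^ (n - 1)) (tcoeff n a i)) * sqrt (sup_norm I1 (tcoeff n a 2)) ^ (n - i)) \<le> D * \<Theta>"
          unfolding m_def[symmetric] using DT(1) by linarith
      qed
      then have C3le: "C3 * bound_full n a I0 I1 \<le> C3 * (D * \<Theta>)" using C3 by (intro mult_left_mono) auto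
      have cr': "continuous_root I (tschirnhausen n a) (\<lambda>t. lam t + a 1 t / real n)"
      proof (rule continuous_root_tschirnhausen[OF cr])
        have "CLip_on m I (a 1)" using hc n by (auto simp: hyperbolic_curve_def)
        from CLip_on_deriv_continuous[OF this le0] show "continuous_on I (a 1)" by simp
      qed
      have "(C3 * bound_full n a I0 I1)-lipschitz_on I0 (\<lambda>t. lam t + a 1 t / real n)"
        by (rule full[rule_format, of I0 I1 I a], intro conjI)
          (fact I I0 I1 hc[unfolded m_def] cr')+
      then have "(C3 * (D * \<Theta>))-lipschitz_on I0 (\<lambda>t. lam t + a 1 t / real n)" using C3le by (rule lipschitz_on_le)
      moreover have "\<Theta>-lipschitz_on I0 (a 1)" unfolding \<Theta>_def by (rule a1[OF I I0 I1 hc])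
      ultimately have "(C3 * (D * \<Theta>) + \<Theta>)-lipschitz_on I0 lam" by (rule lipschitz_on_untranslate) (use n in simp)
      moreover have "C3 * (D * \<Theta>) + \<Theta> = C * \<Theta>" by (simp add: C_def algebra_simps)
      ultimately have "(C * \<Theta>)-lipschitz_on I0 lam" by (simp only:)
      then show ?thesis using \<Theta>(3) unfolding \<Theta>_def by blast
    qed
    show ?thesis unfolding m_def[symmetric]
      by (rule exI[of _ C], rule conjI[OF C], intro allI impI, rule main)
  qed
qed

text \<open>Every term is at most a power of 1 + X, where X is the largest norm, times the
  contribution of \<open>endpoint_dist\<close> or m2. Taking p-th roots leaves these to the first
  power or less.\<close>

lemma bound_partial_le_norms:
  assumes p: "2 \<le> p" "p < n" and I: "open_interval I" and I1: "open_interval I1" "I1 \<Subset> I" and hc: "hyperbolic_curve (p - 1) n I a"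
    and \<delta>: "endpoint_dist I0 I1 > 0" and m2: "m2 n a I0 > 0"
  shows "bound_partial n p a I0 I1 \<le> (1 / endpoint_dist I0 I1 + 1) * (1 + m2 n a I0 powr ((real p - real n) / (2 * real p))) *
    (1 + (MAX i\<in>{2..n}. CLip_norm (p - 1) (closure I1) (tcoeff n a i)))"
proof -
  have n: "n \<ge> 2" and n1: "n \<ge> 1" using p by auto
  let ?K = "closure I1"
  define X where "X = (MAX i\<in>{2..n}. CLip_norm (p - 1) ?K (tcoeff n a i))"
  define \<mu> where "\<mu> = m2 n a I0 powr ((real p - real n) / (2 * real p))"
  define \<delta> where "\<delta> = endpoint_dist I0 I1"
  have d: "\<delta> > 0" using assms by (simp add: \<delta>_def)
  have \<mu>: "\<mu> \<ge> 0" by (simp add: \<mu>_def)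
  note K = compactly_contained_interval[OF I1]
  obtain x0 y0 where xy: "x0 \<in> I1" "y0 \<in> I1" "x0 \<noteq> y0" by (rule open_interval_two_points[OF I1(1)])
  then have xyK: "x0 \<in> ?K" "y0 \<in> ?K" using K(4) by auto
  obtain L where L: "L \<ge> 0" "\<And>j. j \<le> n \<Longrightarrow> smooth_bound (p - 1) L I ?K (tcoeff n a j)"
    by (rule tcoeff_regular[OF n1 I hc I1]) blast
  have NX: "CLip_norm (p - 1) ?K (tcoeff n a i) \<le> X" if "i \<in> {2..n}" for i
    unfolding X_def using that by (intro Max_ge finite_imageI imageI finite_atLeastAtMost)
  have X0: "X \<ge> 0" using NX[of 2] smooth_bound_CLip_norm(2)[OF L(2)[OF n] xyK xy(3)] n by simp
  have sb: "smooth_bound (p - 1) X I ?K (tcoeff n a i)" if i: "i \<in> {2..n}" for i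
    using i by (intro smooth_bound_mono[OF smooth_bound_CLip_norm(1)[OF L(2) xyK xy(3)] NX[OF i]]) auto
  have LX: "Lip I1 ((deriv ^^ k) (tcoeff n a i)) \<le> X" if "i \<in> {2..n}" "k \<le> p - 1" for i k
    by (rule smooth_bound_Lip_le[OF sb[OF that(1)] K(3,2) X0 K(4) xy that(2)])
  have M0: "0 \<le> Lip I1 ((deriv ^^ (p - 1)) (tcoeff n a i))" if "i \<in> {2..n}" for i
    using that by (intro tcoeff_Lip(2)[OF n1 I hc I1 order_refl]) auto
  have b2: "smooth_bound (p - 1) X I ?K (tcoeff n a 2)" using n by (intro sb) auto
  have AX: "sup_norm I1 (tcoeff n a 2) \<le> X"
    using smooth_bound_le[OF b2] K(4) xy(1) by (intro sup_norm_le) auto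
  have A0: "0 \<le> sup_norm I1 (tcoeff n a 2)"
  proof -
    have "\<bar>tcoeff n a 2 x0\<bar> \<le> sup_norm I1 (tcoeff n a 2)"
      by (rule tcoeff_Lip(3)[OF n1 I hc I1 le0 n xy(1)])
    then show ?thesis by linarith
  qed
  have sq: "sqrt x \<le> 1 + X" if "x \<le> X" for x
  proof (rule real_le_lsqrt)
    have "(1 + X)\<^sup>2 = 1 + 2 * X + X\<^sup>2" by (simp add: power2_eq_square algebra_simps)
    then show "x \<le> (1 + X)\<^sup>2" using that X0 zero_le_power2[of X] by linarith
  qed (use X0 in auto)
  define B where "B = (1 / \<delta> + 1) * (1 + \<mu>) * (1 + X)"
  have B1: "(1 + \<mu>) * (1 + X) \<le> B"
  proof -
    have "1 * ((1 + \<mu>) * (1 + X)) \<le> (1 / \<delta> + 1) * ((1 + \<mu>) * (1 + X))" using d \<mu> X0 by (intro mult_right_mono) auto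
    then show ?thesis by (simp only: B_def mult.assoc mult_1)
  qed
  have B2: "1 + X \<le> B"
  proof -
    have "1 * (1 + X) \<le> (1 + \<mu>) * (1 + X)" using \<mu> X0 by (intro mult_right_mono) auto
    from order_trans[OF this B1] show ?thesis by simp
  qed
  have B3: "(1 + X) / \<delta> \<le> B"
  proof -
    have "(1 / \<delta>) * 1 * (1 + X) \<le> (1 / \<delta> + 1) * (1 + \<mu>) * (1 + X)" using d \<mu> X0 by (intro mult_mono) auto
    then show ?thesis by (simp add: B_def)
  qed
  have "bound_partial n p a I0 I1 \<le> B"
  proof (rule bound_partial_le[OF p])
    have "sqrt (sup_norm I1 (tcoeff n a 2)) / \<delta> \<le> (1 + X) / \<delta>" using sq[OF AX] d by (intro divide_right_mono) auto
    then show "sqrt (sup_norm I1 (tcoeff n a 2)) / endpoint_dist I0 I1 \<le> B" using B3 unfolding \<delta>_def by linarith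
    have "Lip I1 ((deriv ^^ 1) (tcoeff n a 2)) \<le> X" using p n by (intro LX) auto
    then have "sqrt (Lip I1 (deriv (tcoeff n a 2))) \<le> 1 + X" by (intro sq) simp
    then show "sqrt (Lip I1 (deriv (tcoeff n a 2))) \<le> B" using B2 by linarith
  next
    fix i assume i: "i \<in> {2..p}"
    have "Lip I1 ((deriv ^^ (p - 1)) (tcoeff n a i)) \<le> X" using i p by (intro LX) auto
    then have "Lip I1 ((deriv ^^ (p - 1)) (tcoeff n a i)) * sqrt (sup_norm I1 (tcoeff n a 2)) ^ (p - i) \<le> (1 + X) * (1 + X) ^ (p - i)"
      using sq[OF AX] A0 X0 by (intro mult_mono power_mono) auto
    also have "\<dots> = (1 + X) ^ Suc (p - i)" by simp
    also have "\<dots> \<le> (1 + X) ^ p" using i X0 by (intro power_increasing) auto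
    finally have "root p (Lip I1 ((deriv ^^ (p - 1)) (tcoeff n a i)) * sqrt (sup_norm I1 (tcoeff n a 2)) ^ (p - i)) \<le> 1 + X"
      using X0 p by (intro root_le_of_le_power) auto
    then show "root p (Lip I1 ((deriv ^^ (p - 1)) (tcoeff n a i)) * sqrt (sup_norm I1 (tcoeff n a 2)) ^ (p - i)) \<le> B" using B2 by linarith
  next
    fix i assume i: "i \<in> {p<..n}"
    \<comment> \<open>The exponent is negative. For m2 at least 1 the power is at most 1; below 1 it
      is largest for i = n, where it equals \<mu>^p.\<close>
    have 1: "m2 n a I0 powr ((real p - real i) / 2) \<le> (1 + \<mu>) ^ p"
    proof (cases "m2 n a I0 \<ge> 1")
      case True
      have "m2 n a I0 powr ((real p - real i) / 2) \<le> 1 powr ((real p - real i) / 2)"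
        using i True by (intro powr_mono2') auto
      also have "\<dots> \<le> (1 + \<mu>) ^ p" using \<mu> by (simp add: one_le_power)
      finally show ?thesis .
    next
      case False
      have "m2 n a I0 powr ((real p - real i) / 2) \<le> m2 n a I0 powr ((real p - real n) / 2)"
        using i False m2 by (intro powr_mono') auto
      also have "\<dots> = m2 n a I0 powr (((real p - real n) / (2 * real p)) * real p)" using p by simp
      also have "\<dots> = \<mu> powr real p" unfolding \<mu>_def by (rule powr_powr[symmetric])
      also have "\<dots> = \<mu> ^ p" using m2 by (intro powr_realpow) (simp add: \<mu>_def)
      also have "\<dots> \<le> (1 + \<mu>) ^ p" using \<mu> by (intro power_mono) auto
      finally show ?thesis .
    qed
    have "Lip I1 ((deriv ^^ (p - 1)) (tcoeff n a i)) \<le> X" using i p by (intro LX) auto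
    also have "X \<le> (1 + X) ^ 1" by simp
    also have "(1 + X) ^ 1 \<le> (1 + X) ^ p" using X0 p by (intro power_increasing) auto
    finally have "Lip I1 ((deriv ^^ (p - 1)) (tcoeff n a i)) * m2 n a I0 powr ((real p - real i) / 2) \<le> (1 + X) ^ p * (1 + \<mu>) ^ p"
      using 1 X0 by (intro mult_mono) auto
    also have "\<dots> = ((1 + \<mu>) * (1 + X)) ^ p" by (simp only: power_mult_distrib mult.commute)
    finally have "root p (Lip I1 ((deriv ^^ (p - 1)) (tcoeff n a i)) * m2 n a I0 powr ((real p - real i) / 2)) \<le> (1 + \<mu>) * (1 + X)"
      using X0 \<mu> p by (intro root_le_of_le_power) auto
    then show "root p (Lip I1 ((deriv ^^ (p - 1)) (tcoeff n a i)) * m2 n a I0 powr ((real p - real i) / 2)) \<le> B" using B1 by linarith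
  qed
  then show ?thesis unfolding B_def X_def \<mu>_def \<delta>_def .
qed

text \<open>Here the coefficients are merely Lipschitz, but simple roots are uniformly separated on
  compact sets. Insert the root y at time x into the polynomial at time t: the value is of order |x
  - t|, and in its factorization all factors but the one for lam t are bounded below.\<close>

lemma simple_roots_lipschitz:
  assumes n: "n \<ge> 2" and I: "open_interval I" and hc: "hyperbolic_curve 0 n I a"
    and pm: "1 = max_multiplicity I (poly_curve n a)" and I1: "open_interval I1" "I1 \<Subset> I"
    and cr: "continuous_root I (tschirnhausen n a) lam"
  shows "\<exists>L. L-lipschitz_on I1 lam"
proof -
  have n1: "n \<ge> 1" and p: "(1::nat) \<le> 1" "1 < n" using n by auto
  note K = compactly_contained_interval[OF I1]
  let ?T = "tschirnhausen n a"
  obtain \<rho> g where g: "g > 0"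
    and \<rho>: "\<And>t y. t \<in> closure I1 \<Longrightarrow> y \<in> set (sorted_roots (?T t)) \<Longrightarrow> \<bar>y\<bar> \<le> \<rho>"
    and gap: "\<And>t i. t \<in> closure I1 \<Longrightarrow> i + 1 < n \<Longrightarrow> g \<le> sorted_roots (?T t) ! (i + 1) - sorted_roots (?T t) ! i"
    by (rule tschirnhausen_gaps[OF I hc pm p I1]) (rule that)
  obtain L where L: "L \<ge> 0" "\<And>j. j \<le> n \<Longrightarrow> smooth_bound 0 L I (closure I1) (tcoeff n a j)"
    by (rule tcoeff_regular[OF n1 I hc I1]) blast
  define R where "R = 1 + \<bar>\<rho>\<bar>"
  define E where "E = real (Suc n) * L * R ^ n"
  define C where "C = E / (g / 2) ^ (n - 1)"
  have E: "E \<ge> 0" using L by (simp add: E_def R_def)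
  have C: "C \<ge> 0" using E g by (simp add: C_def)
  have zs: "length (sorted_roots (?T t)) = n" "sorted (sorted_roots (?T t))" "?T t = lin_prod (sorted_roots (?T t))"
    if "t \<in> I" for t
    using hc that by (auto simp only: hyperbolic_curve_def intro!: sorted_roots_tschirnhausen[OF n1])
  have root_in: "lam t \<in> set (sorted_roots (?T t))" if t: "t \<in> I" for t
  proof -
    define us where "us = sorted_roots (?T t)"
    have "?T t = lin_prod us" unfolding us_def by (rule zs(3)[OF t])
    moreover have "poly (?T t) (lam t) = 0" using cr t by (auto simp: continuous_root_def)
    ultimately have "lam t \<in> set us" by (auto simp: poly_lin_prod prod_list_zero_iff)
    then show ?thesis by (simp add: us_def)
  qed
  have "C-lipschitz_on I1 lam"
  proof (rule lipschitz_on_eventually[OF _ C])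
    show "is_interval I1" using I1(1) by (simp add: open_interval_def)
    fix t assume t: "t \<in> I1"
    have tK: "t \<in> closure I1" and tI: "t \<in> I" using t K(4,5) by auto
    have "isCont lam t" using cr I tI by (auto simp: continuous_root_def open_interval_def continuous_on_eq_continuous_at)
    then have "((\<lambda>y. \<bar>lam y - lam t\<bar>) \<longlongrightarrow> \<bar>lam t - lam t\<bar>) (nhds t)"
      by (intro tendsto_rabs tendsto_diff tendsto_const) (simp add: isCont_def tendsto_at_iff_tendsto_nhds)
    then have ev1: "\<forall>\<^sub>F y in nhds t. \<bar>lam y - lam t\<bar> < g / 2" by (rule order_tendstoD) (use g in simp)
    have ev2: "\<forall>\<^sub>F y in nhds t. y \<in> I1" using I1(1) t by (intro eventually_nhds_in_open) (auto simp: open_interval_def)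
    show "\<forall>\<^sub>F y in nhds t. \<bar>lam y - lam t\<bar> \<le> C * \<bar>y - t\<bar>"
      using ev1 ev2
    proof eventually_elim
      case (elim x)
      have xK: "x \<in> closure I1" and xI: "x \<in> I" using elim(2) K(4,5) by auto
      define us where "us = sorted_roots (?T t)"
      define vs where "vs = sorted_roots (?T x)"
      have us: "length us = n" "sorted us" "?T t = lin_prod us" unfolding us_def by (fact zs[OF tI])+
      have vs: "length vs = n" "?T x = lin_prod vs" unfolding vs_def by (fact zs[OF xI])+
      define y where "y = lam x"
      have "y \<in> set vs" unfolding y_def vs_def by (rule root_in[OF xI])
      then have yR: "\<bar>y\<bar> \<le> R" using \<rho>[OF xK, folded vs_def, of y] by (simp add: R_def)
      have sum: "poly (?T s) y = (\<Sum>k\<le>n. coeff (?T s) k * y ^ k)" if "degree (?T s) = n" for s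
        using that by (simp add: poly_altdef)
      have "poly (?T x) y = 0" using cr xI by (auto simp: continuous_root_def y_def)
      then have "poly (?T t) y = (\<Sum>k\<le>n. (coeff (?T t) k - coeff (?T x) k) * y ^ k)"
        using sum[of t] sum[of x] us vs by (simp add: left_diff_distrib sum_subtractf)
      then have "\<bar>poly (?T t) y\<bar> \<le> (\<Sum>k\<le>n. \<bar>(coeff (?T t) k - coeff (?T x) k) * y ^ k\<bar>)" by simp
      also have "\<dots> \<le> (\<Sum>k\<le>n. L * R ^ n * \<bar>x - t\<bar>)"
      proof (rule sum_mono)
        fix k assume "k \<in> {..n}"
        then have k: "k \<le> n" by simp
        have "L-lipschitz_on (closure I1) (tcoeff n a (n - k))" using L(2)[of "n - k"] by simp
        from lipschitz_onD[OF this tK xK] have 1: "\<bar>coeff (?T t) k - coeff (?T x) k\<bar> \<le> L * \<bar>x - t\<bar>"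
          unfolding coeff_tschirnhausen[OF k] by (simp add: dist_real_def abs_minus_commute)
        have "\<bar>y\<bar> ^ k \<le> R ^ k" using yR by (intro power_mono) auto
        also have "\<dots> \<le> R ^ n" using k by (intro power_increasing) (auto simp: R_def)
        finally have "\<bar>coeff (?T t) k - coeff (?T x) k\<bar> * \<bar>y\<bar> ^ k \<le> (L * \<bar>x - t\<bar>) * R ^ n"
          using 1 L(1) by (intro mult_mono) auto
        then show "\<bar>(coeff (?T t) k - coeff (?T x) k) * y ^ k\<bar> \<le> L * R ^ n * \<bar>x - t\<bar>"
          by (simp add: abs_mult power_abs mult_ac)
      qed
      also have "\<dots> = E * \<bar>x - t\<bar>" by (simp add: E_def mult_ac)
      finally have up: "\<bar>poly (?T t) y\<bar> \<le> E * \<bar>x - t\<bar>" .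
      have "lam t \<in> set us" unfolding us_def by (rule root_in[OF tI])
      then obtain i0 where i0: "i0 < n" "lam t = us ! i0" using us(1) by (auto simp: in_set_conv_nth)
      \<comment> \<open>Other roots are at least g away from lam t, and by continuity y is within
        g/2 of it.\<close>
      have far: "g / 2 \<le> \<bar>y - us ! i\<bar>" if i: "i < n" "i \<noteq> i0" for i
      proof -
        have "g \<le> \<bar>us ! i - us ! i0\<bar>"
        proof (cases "i < i0")
          case True
          then have "us ! i \<le> us ! (i0 - 1)" using us i0 by (intro sorted_nth_mono) auto
          moreover have "g \<le> us ! (i0 - 1 + 1) - us ! (i0 - 1)"
            unfolding us_def using True i0 by (intro gap[OF tK]) auto
          moreover have "i0 - 1 + 1 = i0" using True by simp
          ultimately show ?thesis by simp
        next
          case False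
          then have "us ! (i0 + 1) \<le> us ! i" using us i by (intro sorted_nth_mono) auto
          moreover have "g \<le> us ! (i0 + 1) - us ! i0"
            unfolding us_def using False i by (intro gap[OF tK]) auto
          ultimately show ?thesis by simp
        qed
        then show ?thesis using elim(1) unfolding i0(2) y_def by linarith
      qed
      have "\<bar>poly (?T t) y\<bar> = (\<Prod>i\<in>{0..<n}. \<bar>y - us ! i\<bar>)"
        unfolding us(3) poly_lin_prod prod.list_conv_set_nth abs_prod using us(1) by simp
      also have "\<dots> = \<bar>y - us ! i0\<bar> * (\<Prod>i\<in>{0..<n} - {i0}. \<bar>y - us ! i\<bar>)"
        using i0(1) by (intro prod.remove) auto
      also have "\<dots> \<ge> \<bar>y - us ! i0\<bar> * (\<Prod>i\<in>{0..<n} - {i0}. g / 2)"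
        using far g by (intro mult_left_mono prod_mono) auto
      also have "(\<Prod>i\<in>{0..<n} - {i0}. g / 2) = (g / 2) ^ (n - 1)" using i0(1) by simp
      finally have "\<bar>lam x - lam t\<bar> * (g / 2) ^ (n - 1) \<le> \<bar>poly (?T t) y\<bar>" unfolding y_def i0(2) .
      then have "\<bar>lam x - lam t\<bar> * (g / 2) ^ (n - 1) \<le> E * \<bar>x - t\<bar>" using up by linarith
      moreover have "(g / 2) ^ (n - 1) > 0" using g by simp
      ultimately show "\<bar>lam x - lam t\<bar> \<le> C * \<bar>x - t\<bar>" by (simp add: C_def pos_le_divide_eq)
    qed
  qed
  then show ?thesis ..
qed

lemma locally_lipschitz_on_intervals:
  assumes I: "open_interval I"
    and lip: "\<And>I0 I1. open_interval I0 \<Longrightarrow> open_interval I1 \<Longrightarrow> I0 \<Subset> I1 \<Longrightarrow> I1 \<Subset> I \<Longrightarrow> \<exists>L. L-lipschitz_on I0 lam"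
  shows "locally_lipschitz_on I lam"
  unfolding locally_lipschitz_on_def
proof (rule local_lipschitzI)
  fix x s :: real assume x: "x \<in> I"
  obtain e where e: "e > 0" "cball x e \<subseteq> I" using I x by (auto simp: open_interval_def open_contains_cball)
  have oi: "open_interval (ball x r)" if "r > 0" for r
    using that unfolding open_interval_def by (auto simp: is_interval_ball_real)
  \<comment> \<open>Concentric balls serve as the two intervals; the second inclusion holds because
    even the closed ball lies in I.\<close>
  have "ball x (e / 2) \<Subset> ball x e" "ball x e \<Subset> I"
    unfolding compactly_contained_def using e by (auto simp: closure_ball compact_cball)
  from lip[OF oi oi this] e obtain L where L: "L-lipschitz_on (ball x (e / 2)) lam" by auto
  have "L-lipschitz_on (cball x (e / 4) \<inter> I) lam"
    using L by (rule lipschitz_on_subset) (use e in auto)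
  then show "\<exists>u>0. \<exists>L. \<forall>t\<in>cball s u \<inter> {0}. L-lipschitz_on (cball x u \<inter> I) lam"
    using e by (intro exI[of _ "e / 4"]) auto
qed

lemma coefficient_lipschitz:
  assumes hc: "hyperbolic_curve m n I a" and n: "n \<ge> 1" and I1: "open_interval I1" "I1 \<Subset> I"
  shows "\<exists>L. L-lipschitz_on I1 (a 1)"
proof -
  note K = compactly_contained_interval[OF I1]
  have "CLip_on m I (a 1)" using hc n by (auto simp: hyperbolic_curve_def)
  from CLip_on_smooth_bound[OF this K(1,2)] obtain L where "smooth_bound m L I (closure I1) (a 1)" ..
  then have "smooth_bound m \<bar>L\<bar> I (closure I1) (a 1)" by (rule smooth_bound_mono) simp
  then have "smooth_bound 0 \<bar>L\<bar> I (closure I1) (a 1)"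
    by (rule smooth_bound_order_mono[OF K(3,2) abs_ge_zero _ le0])
  then have "\<bar>L\<bar>-lipschitz_on (closure I1) (a 1)" by simp
  then have "\<bar>L\<bar>-lipschitz_on I1 (a 1)" using K(4) by (rule lipschitz_on_subset)
  then show ?thesis ..
qed

text \<open>Three sources: \<open>full_estimate\<close> for p = n, the separation of simple roots
  for p = 1 < n, and \<open>partial_lipschitz\<close> in between. The last two concern the
  Tschirnhausen form, so the shift is undone with the Lipschitz constant of a_1.\<close>

lemma root_locally_lipschitz:
  assumes n: "n \<ge> 1" and I: "open_interval I" and hc: "hyperbolic_curve (p - 1) n I a"
    and pm: "p = max_multiplicity I (poly_curve n a)" and cr: "continuous_root I (poly_curve n a) lam"
  shows "locally_lipschitz_on I lam"
proof (rule locally_lipschitz_on_intervals[OF I])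
  fix I0 I1 assume I0: "open_interval I0" and I1: "open_interval I1" and sub: "I0 \<Subset> I1" "I1 \<Subset> I"
  obtain t0 where t0: "t0 \<in> I" using I by (auto simp: open_interval_def)
  have hyp: "hyperbolic (poly_curve n a t)" if "t \<in> I" for t using hc that by (auto simp: hyperbolic_curve_def)
  have "1 \<le> max_multiplicity I (poly_curve n a)" by (rule order_le_max_multiplicity(2)[OF n hyp t0])
  moreover have "max_multiplicity I (poly_curve n a) \<le> n" by (rule order_le_max_multiplicity(3)[OF n hyp t0])
  ultimately have p: "1 \<le> p" "p \<le> n" using pm by simp_all
  have I0I: "I0 \<Subset> I"
    using sub compactly_contained_interval(5)[OF I1 sub(2)] by (auto simp: compactly_contained_def)
  show "\<exists>L. L-lipschitz_on I0 lam"
  proof (cases "p = n")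
    case True
    obtain C where "\<forall>I a lam. open_interval I0 \<and> open_interval I1 \<and> I0 \<Subset> I1 \<and> open_interval I \<and> I1 \<Subset> I \<and>
      hyperbolic_curve (n - 1) n I a \<and> continuous_root I (poly_curve n a) lam \<longrightarrow>
      (C * (MAX i\<in>{1..n}. root i (CLip_norm (n - 1) (closure I1) (a i))))-lipschitz_on I0 lam \<and>
      (MAX i\<in>{1..n}. root i (CLip_norm (n - 1) (closure I1) (a i))) \<le> 1 + (MAX i\<in>{1..n}. CLip_norm (n - 1) (closure I1) (a i))"
      using full_estimate[OF n, of I0 I1] by (elim exE conjE) (rule that)
    then have "(C * (MAX i\<in>{1..n}. root i (CLip_norm (n - 1) (closure I1) (a i))))-lipschitz_on I0 lam"
      using I I0 I1 sub hc[unfolded True] cr by blast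
    then show ?thesis ..
  next
    case False
    then have n2: "n \<ge> 2" and pn: "p < n" using p by auto
    have "continuous_on I (a 1)"
    proof -
      have "CLip_on (p - 1) I (a 1)" using hc n by (auto simp: hyperbolic_curve_def)
      from CLip_on_deriv_continuous[OF this le0] show ?thesis by simp
    qed
    then have cr': "continuous_root I (tschirnhausen n a) (\<lambda>t. lam t + a 1 t / real n)"
      by (rule continuous_root_tschirnhausen[OF cr])
    have "\<exists>L. L-lipschitz_on I0 (\<lambda>t. lam t + a 1 t / real n)"
    proof (cases "p = 1")
      case True
      show ?thesis
        by (rule simple_roots_lipschitz[OF n2 I _ _ I0 I0I cr']) (use hc pm True in auto)
    next
      case False
      then have p2: "2 \<le> p" using p by simp
      obtain C where "\<forall>I0 I1 I a lam. open_interval I0 \<and> open_interval I1 \<and> open_interval I \<and> I0 \<Subset> I1 \<and> I1 \<Subset> I \<and>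
        hyperbolic_curve (p - 1) n I a \<and> p = max_multiplicity I (poly_curve n a) \<and> continuous_root I (tschirnhausen n a) lam \<longrightarrow>
        0 \<le> bound_partial n p a I0 I1 \<and>
        (C * alpha_sup n p a I1 powr ((real n - real p) / real p) * bound_partial n p a I0 I1)-lipschitz_on I0 lam"
        using partial_lipschitz[OF p2 pn] by (elim exE conjE) (rule that)
      then have "(C * alpha_sup n p a I1 powr ((real n - real p) / real p) * bound_partial n p a I0 I1)-lipschitz_on I0 (\<lambda>t. lam t + a 1 t / real n)"
        using I I0 I1 sub hc pm cr' by blast
      then show ?thesis ..
    qed
    moreover have "\<exists>M. M-lipschitz_on I0 (a 1)" by (rule coefficient_lipschitz[OF hc n I0 I0I])
    ultimately obtain L M where "L-lipschitz_on I0 (\<lambda>t. lam t + a 1 t / real n)" "M-lipschitz_on I0 (a 1)" by blast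
    then have "(L + M)-lipschitz_on I0 lam" by (rule lipschitz_on_untranslate) (use n in simp)
    then show ?thesis ..
  qed
qed

text \<open>The first constant must depend on n alone, while \<open>partial_lipschitz\<close>
  supplies one for each p. There are finitely many p between 2 and n, so these can be
  combined.\<close>

lemma partial_estimate:
  "\<exists>C>0. \<forall>I0 I1. open_interval I0 \<and> open_interval I1 \<and> I0 \<Subset> I1 \<longrightarrow>
     (\<exists>C'>0. \<forall>I p a lam.
        open_interval I \<and> I1 \<Subset> I \<and>
        hyperbolic_curve (p - 1) n I a \<and> p = max_multiplicity I (poly_curve n a) \<and> 2 \<le> p \<and> p < n \<and>
        continuous_root I (tschirnhausen n a) lam
        \<longrightarrow> (C * alpha_sup n p a I1 powr ((real n - real p) / real p) * bound_partial n p a I0 I1)-lipschitz_on I0 lam \<and>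
            C * alpha_sup n p a I1 powr ((real n - real p) / real p) * bound_partial n p a I0 I1
              \<le> C' * alpha_sup n p a I1 powr ((real n - real p) / real p)
                  * (1 + m2 n a I0 powr ((real p - real n) / (2 * real p)))
                  * (1 + (MAX i\<in>{2..n}. CLip_norm (p - 1) (closure I1) (tcoeff n a i))))"
proof -
  define P where "P p C \<longleftrightarrow> (\<forall>I0 I1 I a lam. open_interval I0 \<and> open_interval I1 \<and> open_interval I \<and> I0 \<Subset> I1 \<and> I1 \<Subset> I \<and>
    hyperbolic_curve (p - 1) n I a \<and> p = max_multiplicity I (poly_curve n a) \<and> continuous_root I (tschirnhausen n a) lam \<longrightarrow>
    0 \<le> bound_partial n p a I0 I1 \<and>
    (C * alpha_sup n p a I1 powr ((real n - real p) / real p) * bound_partial n p a I0 I1)-lipschitz_on I0 lam)" for p and C :: real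
  have "\<forall>p\<in>{2..<n}. \<exists>C. C > 0 \<and> P p C"
  proof
    fix p assume "p \<in> {2..<n}"
    then have "2 \<le> p" "p < n" by auto
    from partial_lipschitz[OF this] show "\<exists>C. C > 0 \<and> P p C" unfolding P_def .
  qed
  then obtain f where f: "\<forall>p\<in>{2..<n}. f p > 0 \<and> P p (f p)" by (subst (asm) bchoice_iff) blast
  \<comment> \<open>The summand 1 keeps C positive even if no p is in the range.\<close>
  define C where "C = 1 + (\<Sum>p\<in>{2..<n}. f p)"
  have nn: "0 \<le> (\<Sum>p\<in>{2..<n}. f p)" by (intro sum_nonneg) (use f in \<open>auto intro: less_imp_le\<close>)
  have C: "C > 0" using nn by (simp add: C_def)
  have fC: "f p \<le> C" if "p \<in> {2..<n}" for p
  proof -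
    have "f p \<le> (\<Sum>p\<in>{2..<n}. f p)" by (intro member_le_sum) (use f that in \<open>auto intro: less_imp_le\<close>)
    then show ?thesis by (simp add: C_def)
  qed
  have main: "(C * alpha_sup n p a I1 powr ((real n - real p) / real p) * bound_partial n p a I0 I1)-lipschitz_on I0 lam \<and>
     C * alpha_sup n p a I1 powr ((real n - real p) / real p) * bound_partial n p a I0 I1
       \<le> (C * (1 / \<bar>endpoint_dist I0 I1\<bar> + 1)) * alpha_sup n p a I1 powr ((real n - real p) / real p)
           * (1 + m2 n a I0 powr ((real p - real n) / (2 * real p)))
           * (1 + (MAX i\<in>{2..n}. CLip_norm (p - 1) (closure I1) (tcoeff n a i)))"
    if I0: "open_interval I0 \<and> open_interval I1 \<and> I0 \<Subset> I1"
    and H: "open_interval I \<and> I1 \<Subset> I \<and>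
        hyperbolic_curve (p - 1) n I a \<and> p = max_multiplicity I (poly_curve n a) \<and> 2 \<le> p \<and> p < n \<and>
        continuous_root I (tschirnhausen n a) lam" for I0 I1 I p a lam
  proof -
    have o: "open_interval I0" "open_interval I1" "open_interval I" and sub: "I0 \<Subset> I1" "I1 \<Subset> I"
      and hc: "hyperbolic_curve (p - 1) n I a" and pm: "p = max_multiplicity I (poly_curve n a)" and p: "2 \<le> p" "p < n"
      and cr: "continuous_root I (tschirnhausen n a) lam"
      using I0 H by blast+
    note K0 = compactly_contained_interval[OF o(1) sub(1)] and K1 = compactly_contained_interval[OF o(2) sub(2)]
    have pp: "p \<in> {2..<n}" using p by simp
    define al where "al = alpha_sup n p a I1 powr ((real n - real p) / real p)"
    have al: "al \<ge> 0" by (simp add: al_def)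
    have Pp: "P p (f p)" using f pp by blast
    have *: "0 \<le> bound_partial n p a I0 I1 \<and> (f p * al * bound_partial n p a I0 I1)-lipschitz_on I0 lam"
      unfolding al_def by (rule Pp[unfolded P_def, rule_format, of I0 I1 I a lam], intro conjI) (fact o sub hc pm cr)+
    have "f p * al * bound_partial n p a I0 I1 \<le> C * al * bound_partial n p a I0 I1"
      using fC[OF pp] al * by (intro mult_right_mono) auto
    with * have lip: "(C * al * bound_partial n p a I0 I1)-lipschitz_on I0 lam" using lipschitz_on_le by blast
    have bn: "bounded I1" using K1(1,4) compact_imp_bounded bounded_subset by blast
    have \<delta>: "endpoint_dist I0 I1 > 0" by (rule endpoint_dist_window(1)[OF o(1,2) sub(1) bn])
    have n2: "n \<ge> 2" using p by simp
    have cI: "closure I0 \<subseteq> I" using K0(2) K1(5) by blast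
    have m2: "m2 n a I0 > 0" by (rule m2_props(1)[OF n2 hc pm p(2) o(1) cI K0(1)])
    have "C * al * bound_partial n p a I0 I1 \<le> C * al * ((1 / endpoint_dist I0 I1 + 1) * (1 + m2 n a I0 powr ((real p - real n) / (2 * real p))) *
      (1 + (MAX i\<in>{2..n}. CLip_norm (p - 1) (closure I1) (tcoeff n a i))))"
      using C al by (intro mult_left_mono bound_partial_le_norms[OF p o(3,2) sub(2) hc \<delta> m2]) auto
    also have "\<dots> = (C * (1 / \<bar>endpoint_dist I0 I1\<bar> + 1)) * al
           * (1 + m2 n a I0 powr ((real p - real n) / (2 * real p)))
           * (1 + (MAX i\<in>{2..n}. CLip_norm (p - 1) (closure I1) (tcoeff n a i)))"
      unfolding abs_of_pos[OF \<delta>] by (simp only: mult_ac)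
    finally show ?thesis using lip unfolding al_def by blast
  qed
  show ?thesis
  proof (rule exI[of _ C], rule conjI[OF C], intro allI impI)
    fix I0 I1 assume H0: "open_interval I0 \<and> open_interval I1 \<and> I0 \<Subset> I1"
    have pos: "C * (1 / \<bar>endpoint_dist I0 I1\<bar> + 1) > 0"
    proof (rule mult_pos_pos[OF C])
      have "0 \<le> 1 / \<bar>endpoint_dist I0 I1\<bar>" by simp
      then show "0 < 1 / \<bar>endpoint_dist I0 I1\<bar> + 1" by linarith
    qed
    show "\<exists>C'>0. \<forall>I p a lam.
        open_interval I \<and> I1 \<Subset> I \<and>
        hyperbolic_curve (p - 1) n I a \<and> p = max_multiplicity I (poly_curve n a) \<and> 2 \<le> p \<and> p < n \<and>
        continuous_root I (tschirnhausen n a) lam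
        \<longrightarrow> (C * alpha_sup n p a I1 powr ((real n - real p) / real p) * bound_partial n p a I0 I1)-lipschitz_on I0 lam \<and>
            C * alpha_sup n p a I1 powr ((real n - real p) / real p) * bound_partial n p a I0 I1
              \<le> C' * alpha_sup n p a I1 powr ((real n - real p) / real p)
                  * (1 + m2 n a I0 powr ((real p - real n) / (2 * real p)))
                  * (1 + (MAX i\<in>{2..n}. CLip_norm (p - 1) (closure I1) (tcoeff n a i)))"
      by (rule exI, rule conjI[OF pos], intro allI impI, rule main[OF H0])
  qed
qed

lemma Lip_le_of_open_interval:
  assumes "open_interval J" "L-lipschitz_on J f"
  shows "Lip J f \<le> L"
proof -
  obtain x y where "x \<in> J" "y \<in> J" "x \<noteq> y" by (rule open_interval_two_points[OF assms(1)])
  then show ?thesis by (rule Lip_le[OF assms(2)])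
qed

text \<open>Since \<open>Lip\<close> is a real supremum, an inequality for it says little unless the
  quotients are bounded. Each estimate therefore also asserts that some Lipschitz constant
  exists.\<close>

theorem theorem2p1:
  fixes n :: nat
  assumes "n \<ge> 1"
  shows
    "(\<forall>I p a lam.
        open_interval I \<and> hyperbolic_curve (p - 1) n I a \<and> p = max_multiplicity I (poly_curve n a) \<and>
        continuous_root I (poly_curve n a) lam
        \<longrightarrow> locally_lipschitz_on I lam)
   \<and> (\<forall>I0 I1. open_interval I0 \<and> open_interval I1 \<and> I0 \<Subset> I1 \<longrightarrow>
       (\<exists>C>0. \<exists>C'>0. \<forall>I p a lam.
          open_interval I \<and> I1 \<Subset> I \<and>
          hyperbolic_curve (p - 1) n I a \<and> p = max_multiplicity I (poly_curve n a) \<and> p = n \<and>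
          continuous_root I (poly_curve n a) lam
          \<longrightarrow> (\<exists>L. L-lipschitz_on I0 lam) \<and>
              Lip I0 lam
                \<le> C * (MAX i\<in>{1..n}. root i (CLip_norm (n - 1) (closure I1) (a i))) \<and>
              C * (MAX i\<in>{1..n}. root i (CLip_norm (n - 1) (closure I1) (a i)))
                \<le> C' * (1 + (MAX i\<in>{1..n}. CLip_norm (n - 1) (closure I1) (a i)))))
   \<and> (n \<ge> 2 \<longrightarrow>
       (\<exists>C>0. \<forall>I0 I1 I p a lam.
          open_interval I0 \<and> open_interval I1 \<and> open_interval I \<and> I0 \<Subset> I1 \<and> I1 \<Subset> I \<and>
          hyperbolic_curve (p - 1) n I a \<and> p = max_multiplicity I (poly_curve n a) \<and> p = n \<and>
          continuous_root I (tschirnhausen n a) lam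
          \<longrightarrow> (\<exists>L. L-lipschitz_on I0 lam) \<and>
              Lip I0 lam \<le> C * bound_full n a I0 I1))
   \<and> (\<exists>C>0. \<forall>I0 I1. open_interval I0 \<and> open_interval I1 \<and> I0 \<Subset> I1 \<longrightarrow>
       (\<exists>C'>0. \<forall>I p a lam.
          open_interval I \<and> I1 \<Subset> I \<and>
          hyperbolic_curve (p - 1) n I a \<and> p = max_multiplicity I (poly_curve n a) \<and> 2 \<le> p \<and> p < n \<and>
          continuous_root I (tschirnhausen n a) lam
          \<longrightarrow> (\<exists>L. L-lipschitz_on I0 lam) \<and>
              Lip I0 lam
                \<le> C * alpha_sup n p a I1 powr ((real n - real p) / real p)
                    * bound_partial n p a I0 I1 \<and>
              C * alpha_sup n p a I1 powr ((real n - real p) / real p)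
                  * bound_partial n p a I0 I1
                \<le> C' * alpha_sup n p a I1 powr ((real n - real p) / real p)
                    * (1 + m2 n a I0 powr ((real p - real n) / (2 * real p)))
                    * (1 + (MAX i\<in>{2..n}. CLip_norm (p - 1) (closure I1) (tcoeff n a i)))))"
proof (intro conjI)
  show "(\<forall>I p a lam.
        open_interval I \<and> hyperbolic_curve (p - 1) n I a \<and> p = max_multiplicity I (poly_curve n a) \<and>
        continuous_root I (poly_curve n a) lam
        \<longrightarrow> locally_lipschitz_on I lam)"
    using root_locally_lipschitz[OF assms] by blast
next
  show "(\<forall>I0 I1. open_interval I0 \<and> open_interval I1 \<and> I0 \<Subset> I1 \<longrightarrow>
       (\<exists>C>0. \<exists>C'>0. \<forall>I p a lam.
          open_interval I \<and> I1 \<Subset> I \<and>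
          hyperbolic_curve (p - 1) n I a \<and> p = max_multiplicity I (poly_curve n a) \<and> p = n \<and>
          continuous_root I (poly_curve n a) lam
          \<longrightarrow> (\<exists>L. L-lipschitz_on I0 lam) \<and>
              Lip I0 lam
                \<le> C * (MAX i\<in>{1..n}. root i (CLip_norm (n - 1) (closure I1) (a i))) \<and>
              C * (MAX i\<in>{1..n}. root i (CLip_norm (n - 1) (closure I1) (a i)))
                \<le> C' * (1 + (MAX i\<in>{1..n}. CLip_norm (n - 1) (closure I1) (a i)))))"
  proof (intro allI impI)
    fix I0 I1 assume H0: "open_interval I0 \<and> open_interval I1 \<and> I0 \<Subset> I1"
    obtain C where C: "C > 0" and est: "\<forall>I a lam. open_interval I0 \<and> open_interval I1 \<and> I0 \<Subset> I1 \<and> open_interval I \<and> I1 \<Subset> I \<and>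
      hyperbolic_curve (n - 1) n I a \<and> continuous_root I (poly_curve n a) lam \<longrightarrow>
      (C * (MAX i\<in>{1..n}. root i (CLip_norm (n - 1) (closure I1) (a i))))-lipschitz_on I0 lam \<and>
      (MAX i\<in>{1..n}. root i (CLip_norm (n - 1) (closure I1) (a i))) \<le> 1 + (MAX i\<in>{1..n}. CLip_norm (n - 1) (closure I1) (a i))"
      using full_estimate[OF assms, of I0 I1] by (elim exE conjE) (rule that)
    have main: "(\<exists>L. L-lipschitz_on I0 lam) \<and>
        Lip I0 lam \<le> C * (MAX i\<in>{1..n}. root i (CLip_norm (n - 1) (closure I1) (a i))) \<and>
        C * (MAX i\<in>{1..n}. root i (CLip_norm (n - 1) (closure I1) (a i)))
          \<le> C * (1 + (MAX i\<in>{1..n}. CLip_norm (n - 1) (closure I1) (a i)))"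
      if H: "open_interval I \<and> I1 \<Subset> I \<and> hyperbolic_curve (p - 1) n I a \<and>
        p = max_multiplicity I (poly_curve n a) \<and> p = n \<and> continuous_root I (poly_curve n a) lam" for I p a lam
    proof -
      have "open_interval I0 \<and> open_interval I1 \<and> I0 \<Subset> I1 \<and> open_interval I \<and> I1 \<Subset> I \<and>
        hyperbolic_curve (n - 1) n I a \<and> continuous_root I (poly_curve n a) lam"
        using H0 H by auto
      note e = est[rule_format, OF this]
      have "Lip I0 lam \<le> C * (MAX i\<in>{1..n}. root i (CLip_norm (n - 1) (closure I1) (a i)))"
        using H0 by (intro Lip_le_of_open_interval conjunct1[OF e]) blast
      then show ?thesis using e mult_left_mono[OF conjunct2[OF e], of C] C by (intro conjI exI) auto
    qed
    show "\<exists>C>0. \<exists>C'>0. \<forall>I p a lam.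
          open_interval I \<and> I1 \<Subset> I \<and>
          hyperbolic_curve (p - 1) n I a \<and> p = max_multiplicity I (poly_curve n a) \<and> p = n \<and>
          continuous_root I (poly_curve n a) lam
          \<longrightarrow> (\<exists>L. L-lipschitz_on I0 lam) \<and>
              Lip I0 lam
                \<le> C * (MAX i\<in>{1..n}. root i (CLip_norm (n - 1) (closure I1) (a i))) \<and>
              C * (MAX i\<in>{1..n}. root i (CLip_norm (n - 1) (closure I1) (a i)))
                \<le> C' * (1 + (MAX i\<in>{1..n}. CLip_norm (n - 1) (closure I1) (a i)))"
      \<comment> \<open>The same C serves twice, as an i-th root is at most 1 plus its
        argument.\<close>
      by (rule exI[of _ C], rule conjI[OF C], rule exI[of _ C], rule conjI[OF C], intro allI impI, rule main)
  qed
next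
  show "(n \<ge> 2 \<longrightarrow>
       (\<exists>C>0. \<forall>I0 I1 I p a lam.
          open_interval I0 \<and> open_interval I1 \<and> open_interval I \<and> I0 \<Subset> I1 \<and> I1 \<Subset> I \<and>
          hyperbolic_curve (p - 1) n I a \<and> p = max_multiplicity I (poly_curve n a) \<and> p = n \<and>
          continuous_root I (tschirnhausen n a) lam
          \<longrightarrow> (\<exists>L. L-lipschitz_on I0 lam) \<and>
              Lip I0 lam \<le> C * bound_full n a I0 I1))"
  proof
    assume n: "2 \<le> n"
    obtain C where C: "C > 0" and est: "\<forall>I0 I1 I a lam. open_interval I0 \<and> open_interval I1 \<and> open_interval I \<and> I0 \<Subset> I1 \<and> I1 \<Subset> I \<and>
      hyperbolic_curve (n - 1) n I a \<and> continuous_root I (tschirnhausen n a) lam \<longrightarrow>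
      (C * bound_full n a I0 I1)-lipschitz_on I0 lam"
      using full_lipschitz[OF n] by (elim exE conjE) (rule that)
    have main: "(\<exists>L. L-lipschitz_on I0 lam) \<and> Lip I0 lam \<le> C * bound_full n a I0 I1"
      if H: "open_interval I0 \<and> open_interval I1 \<and> open_interval I \<and> I0 \<Subset> I1 \<and> I1 \<Subset> I \<and>
          hyperbolic_curve (p - 1) n I a \<and> p = max_multiplicity I (poly_curve n a) \<and> p = n \<and>
          continuous_root I (tschirnhausen n a) lam" for I0 I1 I p a lam
    proof -
      have "open_interval I0 \<and> open_interval I1 \<and> open_interval I \<and> I0 \<Subset> I1 \<and> I1 \<Subset> I \<and>
        hyperbolic_curve (n - 1) n I a \<and> continuous_root I (tschirnhausen n a) lam"
        using H by auto
      note e = est[rule_format, OF this]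
      show ?thesis using Lip_le_of_open_interval[OF conjunct1[OF H] e] e by blast
    qed
    show "(\<exists>C>0. \<forall>I0 I1 I p a lam.
          open_interval I0 \<and> open_interval I1 \<and> open_interval I \<and> I0 \<Subset> I1 \<and> I1 \<Subset> I \<and>
          hyperbolic_curve (p - 1) n I a \<and> p = max_multiplicity I (poly_curve n a) \<and> p = n \<and>
          continuous_root I (tschirnhausen n a) lam
          \<longrightarrow> (\<exists>L. L-lipschitz_on I0 lam) \<and>
              Lip I0 lam \<le> C * bound_full n a I0 I1)"
      by (rule exI[of _ C], rule conjI[OF C], intro allI impI, rule main)
  qed
next
  show "(\<exists>C>0. \<forall>I0 I1. open_interval I0 \<and> open_interval I1 \<and> I0 \<Subset> I1 \<longrightarrow>
       (\<exists>C'>0. \<forall>I p a lam.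
          open_interval I \<and> I1 \<Subset> I \<and>
          hyperbolic_curve (p - 1) n I a \<and> p = max_multiplicity I (poly_curve n a) \<and> 2 \<le> p \<and> p < n \<and>
          continuous_root I (tschirnhausen n a) lam
          \<longrightarrow> (\<exists>L. L-lipschitz_on I0 lam) \<and>
              Lip I0 lam
                \<le> C * alpha_sup n p a I1 powr ((real n - real p) / real p)
                    * bound_partial n p a I0 I1 \<and>
              C * alpha_sup n p a I1 powr ((real n - real p) / real p)
                  * bound_partial n p a I0 I1
                \<le> C' * alpha_sup n p a I1 powr ((real n - real p) / real p)
                    * (1 + m2 n a I0 powr ((real p - real n) / (2 * real p)))
                    * (1 + (MAX i\<in>{2..n}. CLip_norm (p - 1) (closure I1) (tcoeff n a i)))))"
  proof -
    \<comment> \<open>\<open>R\<close> and \<open>S\<close> stand for the other conjuncts of the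
      hypothesis on the intervals.\<close>
    have weaken: "(\<exists>L. L-lipschitz_on J f) \<and> Lip J f \<le> B \<and> B \<le> B'"
      if "open_interval J \<and> R \<and> S" "B-lipschitz_on J f \<and> B \<le> B'" for J f B B' R S
      using that Lip_le_of_open_interval[of J B f] by blast
    obtain C where C: "C > 0" and est: "\<forall>I0 I1. open_interval I0 \<and> open_interval I1 \<and> I0 \<Subset> I1 \<longrightarrow>
     (\<exists>C'>0. \<forall>I p a lam.
        open_interval I \<and> I1 \<Subset> I \<and>
        hyperbolic_curve (p - 1) n I a \<and> p = max_multiplicity I (poly_curve n a) \<and> 2 \<le> p \<and> p < n \<and>
        continuous_root I (tschirnhausen n a) lam
        \<longrightarrow> (C * alpha_sup n p a I1 powr ((real n - real p) / real p) * bound_partial n p a I0 I1)-lipschitz_on I0 lam \<and>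
            C * alpha_sup n p a I1 powr ((real n - real p) / real p) * bound_partial n p a I0 I1
              \<le> C' * alpha_sup n p a I1 powr ((real n - real p) / real p)
                  * (1 + m2 n a I0 powr ((real p - real n) / (2 * real p)))
                  * (1 + (MAX i\<in>{2..n}. CLip_norm (p - 1) (closure I1) (tcoeff n a i))))"
      using partial_estimate[of n] by (elim exE conjE) (rule that)
    show ?thesis
    proof (rule exI[of _ C], rule conjI[OF C], intro allI impI, goal_cases)
      case H: (1 I0 I1)
      from est[rule_format, OF H] obtain C' where C': "C' > 0"
        and e: "\<forall>I p a lam. open_interval I \<and> I1 \<Subset> I \<and>
        hyperbolic_curve (p - 1) n I a \<and> p = max_multiplicity I (poly_curve n a) \<and> 2 \<le> p \<and> p < n \<and>
        continuous_root I (tschirnhausen n a) lam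
        \<longrightarrow> (C * alpha_sup n p a I1 powr ((real n - real p) / real p) * bound_partial n p a I0 I1)-lipschitz_on I0 lam \<and>
            C * alpha_sup n p a I1 powr ((real n - real p) / real p) * bound_partial n p a I0 I1
              \<le> C' * alpha_sup n p a I1 powr ((real n - real p) / real p)
                  * (1 + m2 n a I0 powr ((real p - real n) / (2 * real p)))
                  * (1 + (MAX i\<in>{2..n}. CLip_norm (p - 1) (closure I1) (tcoeff n a i)))"
        by (elim exE conjE) (rule that)
      show ?case
        by (rule exI[of _ C'], rule conjI[OF C'], intro allI impI, rule weaken[OF H], rule e[rule_format], assumption)
    qed
  qed
qed

end
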